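(* The abelian category $\mathcal{X}/\mathcal{T}$ is equivalent, as a $K$-linear category, to $f\ell\, mod\text{-}\Lambda$, the category of $\Lambda$-modules of finite length.
   Context: Fix a field $K$. All categories are $K$-linear Krull–Schmidt categories: every object is a finite formal direct sum of indecomposable objects with local endomorphism rings. The category $\mathcal{B}$ has indecomposable objects the pairs $(x,y)\in\mathbb{R}^2$, with $\mathrm{Hom}_{\mathcal{B}}((x,y),(x',y'))=K$ if $x\le x'$ and $y\le y'$, and $0$ otherwise; composition is multiplication of scalars; the morphism corresponding to $1\in K$ is the basic morphism. Let $\mathcal{B}_\pi$ be the full additive subcategory generated by all $(x,y)$ with $|y-x|\ge\pi$. The continuous derived category $\mathcal{D}$ is the full additive subcategory of $\mathcal{B}/\mathcal{B}_\pi$ (quotient by the ideal of morphisms factoring through objects of $\mathcal{B}_\pi$) generated by the $(x,y)$ with $|y-x|<\pi$. The doubled category $\mathcal{D}^{(2)}$ is obtained by adding a second copy $(x,y)'$ of every indecomposable $(x,y)$ together with an isomorphism $\eta:(x,y)'\cong(x,y)$; put $(x,y)''=(x,y)$. Let $F$ be the automorphism of $\mathcal{D}^{(2)}$ given on objects by $F(x,y)=(y+\pi,x+\pi)'$, taking basic morphisms to basic morphisms. The continuous cluster category $\mathcal{C}=\mathcal{C}_\pi$ is the orbit category $\mathcal{D}^{(2)}/F$, with $\mathrm{Hom}_{\mathcal{C}}(X,Y)=\bigoplus_{k\in\mathbb{Z}}\mathrm{Hom}_{\mathcal{D}^{(2)}}(X,F^kY)$. The orbit of $(x,y)$ is denoted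 $M(x,y)$ (and that of $(x,y)'$ is $M(x,y)'\cong M(x,y)$), so $M(x,y)=M(y+\pi,x+\pi)'$. The standard cluster $\mathcal{T}$ is the set of objects $M\left(\frac{m\pi}{2^n},\pi+\frac{(m-1)\pi}{2^n}\right)$ for integers $n\ge0$, $0\le m<2^{n+1}$ (omitting $(\pi,\pi)$, which repeats $(0,0)$). The category $\mathcal{X}$ is the additive full subcategory of $\mathcal{C}$ generated by the rational objects, i.e. those obtained from $\mathcal{T}$ by finitely many mutations; equivalently the objects with coordinates $(a\pi/2^n,b\pi/2^n)$ for integers $a,b,n$ with $n\ge0$ and $|a-b|<2^n$. $\mathcal{X}/\mathcal{T}$ is the quotient of $\mathcal{X}$ by the ideal of morphisms which factor through an object of $\mathrm{add}\,\mathcal{T}$ (finite direct sums of objects of $\mathcal{T}$, up to isomorphism). $\Lambda$ is the $K$-algebra without unit consisting of the endomorphisms in $\mathcal{X}$ of $T$, the direct sum of the objects of $\mathcal{T}$ (one from each isomorphism class), which are zero on all but finitely many components of $T$. Equivalently, $\Lambda$ is the Jacobian algebra of the following infinite quiver with potential: take the unique infinite simply connected planar trivalent tree, replace each vertex by a triangle and each edge by a shared vertex of two triangles, orient all triangles clockwise to obtain the quiver $Q$, and take the potential to be the sum of all these 3-cycles; so $\Lambda=KQ/I$, where $I$ is generated by the compositions of any two consecutive arrows in the same triangle. A $\Lambda$-module is a representation $M=(M_v)_{v\in Q_0}$ of $Q$ over $K$ satisfying these relations. *)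

theory Defs
  imports Complex_Main "HOL-Algebra.Module" "HOL-Algebra.AbelCoset" "Jordan_Normal_Form.VS_Connect"
begin

section \<open>Categories enriched over K-vector spaces\<close>

text \<open>
  Hom spaces are modules in the sense of \<open>HOL-Algebra\<close> over \<^term>\<open>class_ring :: 'k::field ring\<close>, the field
  \<open>K = 'k\<close> as a ring record; their \<open>mult\<close> and \<open>one\<close> fields are never used. Hom spaces of
  different pairs of objects need not be disjoint, so composition carries its objects:
  \<open>Comp C X Y Z g f\<close> is \<open>g \<circ> f\<close> for \<open>f : X \<rightarrow> Y\<close> and \<open>g : Y \<rightarrow> Z\<close>.
\<close>

record ('k, 'o, 'm) klin_cat =
  Obj :: "'o set"
  Hom :: "'o \<Rightarrow> 'o \<Rightarrow> ('k, 'm) module"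
  Comp :: "'o \<Rightarrow> 'o \<Rightarrow> 'o \<Rightarrow> 'm \<Rightarrow> 'm \<Rightarrow> 'm"
  Ident :: "'o \<Rightarrow> 'm"

abbreviation mor :: "('k, 'o, 'm) klin_cat \<Rightarrow> 'o \<Rightarrow> 'o \<Rightarrow> 'm set" where
  "mor C X Y \<equiv> carrier (Hom C X Y)"

definition lin_maps :: "('k::field, 'a) module \<Rightarrow> ('k, 'b) module \<Rightarrow> ('a \<Rightarrow> 'b) set" where
  "lin_maps V W = {h \<in> carrier V \<rightarrow> carrier W.
     (\<forall>x \<in> carrier V. \<forall>y \<in> carrier V. h (x \<oplus>\<^bsub>V\<^esub> y) = h x \<oplus>\<^bsub>W\<^esub> h y) \<and>
     (\<forall>c. \<forall>x \<in> carrier V. h (c \<odot>\<^bsub>V\<^esub> x) = c \<odot>\<^bsub>W\<^esub> h x)}"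

locale klin_category =
  fixes C :: "('k::field, 'o, 'm) klin_cat"
  assumes Hom_module: "X \<in> Obj C \<Longrightarrow> Y \<in> Obj C \<Longrightarrow> Module.module class_ring (Hom C X Y)"
    and Comp_linear_left: "X \<in> Obj C \<Longrightarrow> Y \<in> Obj C \<Longrightarrow> Z \<in> Obj C \<Longrightarrow> f \<in> mor C X Y \<Longrightarrow>
      (\<lambda>g. Comp C X Y Z g f) \<in> lin_maps (Hom C Y Z) (Hom C X Z)"
    and Comp_linear_right: "X \<in> Obj C \<Longrightarrow> Y \<in> Obj C \<Longrightarrow> Z \<in> Obj C \<Longrightarrow> g \<in> mor C Y Z \<Longrightarrow>
      (\<lambda>f. Comp C X Y Z g f) \<in> lin_maps (Hom C X Y) (Hom C X Z)"
    and Comp_assoc: "W \<in> Obj C \<Longrightarrow> X \<in> Obj C \<Longrightarrow> Y \<in> Obj C \<Longrightarrow> Z \<in> Obj C \<Longrightarrow>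
      f \<in> mor C W X \<Longrightarrow> g \<in> mor C X Y \<Longrightarrow> h \<in> mor C Y Z \<Longrightarrow>
      Comp C W Y Z h (Comp C W X Y g f) = Comp C W X Z (Comp C X Y Z h g) f"
    and Ident_mor: "X \<in> Obj C \<Longrightarrow> Ident C X \<in> mor C X X"
    and Ident_left: "X \<in> Obj C \<Longrightarrow> Y \<in> Obj C \<Longrightarrow> f \<in> mor C X Y \<Longrightarrow> Comp C X Y Y (Ident C Y) f = f"
    and Ident_right: "X \<in> Obj C \<Longrightarrow> Y \<in> Obj C \<Longrightarrow> f \<in> mor C X Y \<Longrightarrow> Comp C X X Y f (Ident C X) = f"

definition is_iso :: "('k, 'o, 'm) klin_cat \<Rightarrow> 'o \<Rightarrow> 'o \<Rightarrow> 'm \<Rightarrow> bool" where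
  "is_iso C X Y f \<longleftrightarrow> f \<in> mor C X Y \<and>
     (\<exists>g \<in> mor C Y X. Comp C X Y X g f = Ident C X \<and> Comp C Y X Y f g = Ident C Y)"

definition isomorphic_in :: "('k, 'o, 'm) klin_cat \<Rightarrow> 'o \<Rightarrow> 'o \<Rightarrow> bool" where
  "isomorphic_in C X Y \<longleftrightarrow> (\<exists>f. is_iso C X Y f)"

subsection \<open>Abelian categories\<close>

definition is_zero_obj :: "('k, 'o, 'm) klin_cat \<Rightarrow> 'o \<Rightarrow> bool" where
  "is_zero_obj C Z \<longleftrightarrow> Z \<in> Obj C \<and>
     (\<forall>X \<in> Obj C. (\<exists>!f. f \<in> mor C X Z) \<and> (\<exists>!f. f \<in> mor C Z X))"

definition is_biproduct :: "('k, 'o, 'm) klin_cat \<Rightarrow> 'o \<Rightarrow> 'o \<Rightarrow> 'o \<Rightarrow> 'm \<Rightarrow> 'm \<Rightarrow> 'm \<Rightarrow> 'm \<Rightarrow> bool" where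
  "is_biproduct C X Y S i j p q \<longleftrightarrow> S \<in> Obj C \<and>
     i \<in> mor C X S \<and> j \<in> mor C Y S \<and> p \<in> mor C S X \<and> q \<in> mor C S Y \<and>
     Comp C X S X p i = Ident C X \<and> Comp C Y S Y q j = Ident C Y \<and>
     Comp C X S Y q i = \<zero>\<^bsub>Hom C X Y\<^esub> \<and> Comp C Y S X p j = \<zero>\<^bsub>Hom C Y X\<^esub> \<and>
     Comp C S X S i p \<oplus>\<^bsub>Hom C S S\<^esub> Comp C S Y S j q = Ident C S"

definition is_kernel :: "('k, 'o, 'm) klin_cat \<Rightarrow> 'o \<Rightarrow> 'o \<Rightarrow> 'm \<Rightarrow> 'o \<Rightarrow> 'm \<Rightarrow> bool" where
  "is_kernel C X Y f A i \<longleftrightarrow> A \<in> Obj C \<and> i \<in> mor C A X \<and> Comp C A X Y f i = \<zero>\<^bsub>Hom C A Y\<^esub> \<and>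
     (\<forall>W \<in> Obj C. \<forall>h \<in> mor C W X. Comp C W X Y f h = \<zero>\<^bsub>Hom C W Y\<^esub> \<longrightarrow>
        (\<exists>!u. u \<in> mor C W A \<and> Comp C W A X i u = h))"

definition is_cokernel :: "('k, 'o, 'm) klin_cat \<Rightarrow> 'o \<Rightarrow> 'o \<Rightarrow> 'm \<Rightarrow> 'o \<Rightarrow> 'm \<Rightarrow> bool" where
  "is_cokernel C X Y f B p \<longleftrightarrow> B \<in> Obj C \<and> p \<in> mor C Y B \<and> Comp C X Y B p f = \<zero>\<^bsub>Hom C X B\<^esub> \<and>
     (\<forall>W \<in> Obj C. \<forall>h \<in> mor C Y W. Comp C X Y W h f = \<zero>\<^bsub>Hom C X W\<^esub> \<longrightarrow>
        (\<exists>!u. u \<in> mor C B W \<and> Comp C Y B W u p = h))"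

definition is_mono :: "('k, 'o, 'm) klin_cat \<Rightarrow> 'o \<Rightarrow> 'o \<Rightarrow> 'm \<Rightarrow> bool" where
  "is_mono C X Y f \<longleftrightarrow> f \<in> mor C X Y \<and>
     (\<forall>W \<in> Obj C. \<forall>g \<in> mor C W X. \<forall>h \<in> mor C W X. Comp C W X Y f g = Comp C W X Y f h \<longrightarrow> g = h)"

definition is_epi :: "('k, 'o, 'm) klin_cat \<Rightarrow> 'o \<Rightarrow> 'o \<Rightarrow> 'm \<Rightarrow> bool" where
  "is_epi C X Y f \<longleftrightarrow> f \<in> mor C X Y \<and>
     (\<forall>W \<in> Obj C. \<forall>g \<in> mor C Y W. \<forall>h \<in> mor C Y W. Comp C X Y W g f = Comp C X Y W h f \<longrightarrow> g = h)"

locale abelian_category = klin_category C for C :: "('k::field, 'o, 'm) klin_cat" +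
  assumes zero_obj: "\<exists>Z. is_zero_obj C Z"
    and biproducts: "X \<in> Obj C \<Longrightarrow> Y \<in> Obj C \<Longrightarrow> \<exists>S i j p q. is_biproduct C X Y S i j p q"
    and kernels: "X \<in> Obj C \<Longrightarrow> Y \<in> Obj C \<Longrightarrow> f \<in> mor C X Y \<Longrightarrow> \<exists>A i. is_kernel C X Y f A i"
    and cokernels: "X \<in> Obj C \<Longrightarrow> Y \<in> Obj C \<Longrightarrow> f \<in> mor C X Y \<Longrightarrow> \<exists>B p. is_cokernel C X Y f B p"
    and mono_normal: "X \<in> Obj C \<Longrightarrow> Y \<in> Obj C \<Longrightarrow> is_mono C X Y f \<Longrightarrow>
      \<exists>Z \<in> Obj C. \<exists>g \<in> mor C Y Z. is_kernel C Y Z g X f"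
    and epi_normal: "X \<in> Obj C \<Longrightarrow> Y \<in> Obj C \<Longrightarrow> is_epi C X Y f \<Longrightarrow>
      \<exists>Z \<in> Obj C. \<exists>g \<in> mor C Z X. is_cokernel C Z X g Y f"

subsection \<open>Functors and equivalences\<close>

record ('o, 'm, 'p, 'n) cat_functor =
  FObj :: "'o \<Rightarrow> 'p"
  FMap :: "'o \<Rightarrow> 'o \<Rightarrow> 'm \<Rightarrow> 'n"

definition id_functor :: "('o, 'm, 'o, 'm) cat_functor" where
  "id_functor = \<lparr>FObj = (\<lambda>X. X), FMap = (\<lambda>X Y f. f)\<rparr>"

definition comp_functor ::
  "('p, 'n, 'q, 'r) cat_functor \<Rightarrow> ('o, 'm, 'p, 'n) cat_functor \<Rightarrow> ('o, 'm, 'q, 'r) cat_functor" where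
  "comp_functor G F = \<lparr>FObj = (\<lambda>X. FObj G (FObj F X)),
     FMap = (\<lambda>X Y f. FMap G (FObj F X) (FObj F Y) (FMap F X Y f))\<rparr>"

locale klin_functor = S: klin_category C + T: klin_category D
  for C :: "('k::field, 'o, 'm) klin_cat" and D :: "('k, 'p, 'n) klin_cat" +
  fixes F :: "('o, 'm, 'p, 'n) cat_functor"
  assumes FObj_closed: "X \<in> Obj C \<Longrightarrow> FObj F X \<in> Obj D"
    and FMap_linear: "X \<in> Obj C \<Longrightarrow> Y \<in> Obj C \<Longrightarrow>
      FMap F X Y \<in> lin_maps (Hom C X Y) (Hom D (FObj F X) (FObj F Y))"
    and FMap_Ident: "X \<in> Obj C \<Longrightarrow> FMap F X X (Ident C X) = Ident D (FObj F X)"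
    and FMap_Comp: "X \<in> Obj C \<Longrightarrow> Y \<in> Obj C \<Longrightarrow> Z \<in> Obj C \<Longrightarrow> f \<in> mor C X Y \<Longrightarrow> g \<in> mor C Y Z \<Longrightarrow>
      FMap F X Z (Comp C X Y Z g f) =
      Comp D (FObj F X) (FObj F Y) (FObj F Z) (FMap F Y Z g) (FMap F X Y f)"

definition is_nat_iso ::
  "('k, 'o, 'm) klin_cat \<Rightarrow> ('k, 'p, 'n) klin_cat \<Rightarrow> ('o, 'm, 'p, 'n) cat_functor \<Rightarrow>
   ('o, 'm, 'p, 'n) cat_functor \<Rightarrow> ('o \<Rightarrow> 'n) \<Rightarrow> bool" where
  "is_nat_iso C D F G \<eta> \<longleftrightarrow>
     (\<forall>X \<in> Obj C. is_iso D (FObj F X) (FObj G X) (\<eta> X)) \<and>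
     (\<forall>X \<in> Obj C. \<forall>Y \<in> Obj C. \<forall>f \<in> mor C X Y.
        Comp D (FObj F X) (FObj F Y) (FObj G Y) (\<eta> Y) (FMap F X Y f) =
        Comp D (FObj F X) (FObj G X) (FObj G Y) (FMap G X Y f) (\<eta> X))"

definition klin_equivalent :: "('k::field, 'o, 'm) klin_cat \<Rightarrow> ('k, 'p, 'n) klin_cat \<Rightarrow> bool" where
  "klin_equivalent C D \<longleftrightarrow> (\<exists>F G \<eta> \<epsilon>. klin_functor C D F \<and> klin_functor D C G \<and>
     is_nat_iso C C id_functor (comp_functor G F) \<eta> \<and>
     is_nat_iso D D (comp_functor F G) id_functor \<epsilon>)"

subsection \<open>Full subcategories, quotients and orbit categories\<close>

definition full_subcat :: "('k, 'o, 'm) klin_cat \<Rightarrow> 'o set \<Rightarrow> ('k, 'o, 'm) klin_cat" where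
  "full_subcat C S = C\<lparr>Obj := Obj C \<inter> S\<rparr>"

definition factoring :: "('k, 'o, 'm) klin_cat \<Rightarrow> 'o set \<Rightarrow> 'o \<Rightarrow> 'o \<Rightarrow> 'm set" where
  "factoring C S X Y = {Comp C X Z Y g f | Z f g. Z \<in> Obj C \<inter> S \<and> f \<in> mor C X Z \<and> g \<in> mor C Z Y}"

text \<open>
  The morphisms of the quotient category are cosets. \<^term>\<open>factoring C S\<close> is an ideal only if \<open>S\<close>
  is closed under finite direct sums (including the zero object), which holds in both uses below.
\<close>

definition quotient_cat :: "('k::field, 'o, 'm) klin_cat \<Rightarrow> 'o set \<Rightarrow> ('k, 'o, 'm set) klin_cat" where
  "quotient_cat C S = \<lparr>
     Obj = Obj C,
     Hom = (\<lambda>X Y. \<lparr>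
       carrier = a_rcosets\<^bsub>Hom C X Y\<^esub> (factoring C S X Y),
       mult = undefined,
       one = undefined,
       zero = factoring C S X Y,
       add = set_add (Hom C X Y),
       smult = (\<lambda>c A. \<Union>f\<in>A. factoring C S X Y +>\<^bsub>Hom C X Y\<^esub> (c \<odot>\<^bsub>Hom C X Y\<^esub> f))\<rparr>),
     Comp = (\<lambda>X Y Z B A. \<Union>g\<in>B. \<Union>f\<in>A. factoring C S X Z +>\<^bsub>Hom C X Z\<^esub> Comp C X Y Z g f),
     Ident = (\<lambda>X. factoring C S X X +>\<^bsub>Hom C X X\<^esub> Ident C X)\<rparr>"

text \<open>Integer powers of an automorphism \<open>F\<close> whose inverse is \<open>G\<close>.\<close>

definition zpow_functor ::
  "('o, 'm, 'o, 'm) cat_functor \<Rightarrow> ('o, 'm, 'o, 'm) cat_functor \<Rightarrow> int \<Rightarrow> ('o, 'm, 'o, 'm) cat_functor" where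
  "zpow_functor F G k = (if k \<ge> 0 then (comp_functor F ^^ nat k) id_functor
     else (comp_functor G ^^ nat (- k)) id_functor)"

text \<open>
  For a family \<open>P k = F\<^sup>k\<close> of powers of an automorphism, a morphism \<open>X \<rightarrow> Y\<close> of the orbit category
  is a finitely supported family of components \<open>f k : X \<rightarrow> F\<^sup>k Y\<close>, and
  \<open>(g \<circ> f) k = \<Sum>i. F\<^sup>i (g (k - i)) \<circ> f i\<close>. An object of the category represents its own orbit:
  objects of the same orbit are isomorphic, not equal, in the orbit category.
\<close>

definition orbit_cat ::
  "('k, 'o, 'm) klin_cat \<Rightarrow> (int \<Rightarrow> ('o, 'm, 'o, 'm) cat_functor) \<Rightarrow> ('k, 'o, int \<Rightarrow> 'm) klin_cat" where
  "orbit_cat C P = \<lparr>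
     Obj = Obj C,
     Hom = (\<lambda>X Y. \<lparr>
       carrier = {f. (\<forall>k. f k \<in> mor C X (FObj (P k) Y)) \<and>
                     finite {k. f k \<noteq> \<zero>\<^bsub>Hom C X (FObj (P k) Y)\<^esub>}},
       mult = undefined,
       one = undefined,
       zero = (\<lambda>k. \<zero>\<^bsub>Hom C X (FObj (P k) Y)\<^esub>),
       add = (\<lambda>f g k. f k \<oplus>\<^bsub>Hom C X (FObj (P k) Y)\<^esub> g k),
       smult = (\<lambda>c f k. c \<odot>\<^bsub>Hom C X (FObj (P k) Y)\<^esub> f k)\<rparr>),
     Comp = (\<lambda>X Y Z g f k.
       finsum (Hom C X (FObj (P k) Z))
         (\<lambda>i. Comp C X (FObj (P i) Y) (FObj (P k) Z)
                (FMap (P i) Y (FObj (P (k - i)) Z) (g (k - i))) (f i))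
         {i. f i \<noteq> \<zero>\<^bsub>Hom C X (FObj (P i) Y)\<^esub>}),
     Ident = (\<lambda>X k. if k = 0 then Ident C X else \<zero>\<^bsub>Hom C X (FObj (P k) X)\<^esub>)\<rparr>"

section \<open>The continuous cluster category\<close>

text \<open>
  A formal direct sum of indecomposables is the list of its summands, and a morphism from \<open>X\<close> to
  \<open>Y\<close> is a \<open>length Y \<times> length X\<close> matrix of scalars; the entry at \<open>(j, i)\<close> is the coefficient of
  the basic morphism from \<open>X ! i\<close> to \<open>Y ! j\<close>, and must be zero if there is none.
\<close>

type_synonym point = "real \<times> real"

definition cat_B :: "('k::field, point list, 'k mat) klin_cat" where
  "cat_B = \<lparr>
     Obj = UNIV,
     Hom = (\<lambda>X Y. (module_mat TYPE('k) (length Y) (length X))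
       \<lparr>carrier := {A \<in> carrier_mat (length Y) (length X).
          \<forall>j < length Y. \<forall>i < length X. A $$ (j, i) \<noteq> 0 \<longrightarrow>
            fst (X ! i) \<le> fst (Y ! j) \<and> snd (X ! i) \<le> snd (Y ! j)}\<rparr>),
     Comp = (\<lambda>X Y Z g f. g * f),
     Ident = (\<lambda>X. 1\<^sub>m (length X))\<rparr>"

definition B_pi :: "point list set" where
  "B_pi = {X. \<forall>(x, y) \<in> set X. \<bar>y - x\<bar> \<ge> pi}"

definition cat_D :: "('k::field, point list, 'k mat set) klin_cat" where
  "cat_D = full_subcat (quotient_cat cat_B B_pi) {X. \<forall>(x, y) \<in> set X. \<bar>y - x\<bar> < pi}"

text \<open>
  The doubled category: \<open>((x, y), False)\<close> is the object \<open>(x, y)\<close> and \<open>((x, y), True)\<close> is its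
  copy \<open>(x, y)'\<close>. Identifying the copies by \<open>\<eta>\<close>, the morphisms are those between the underlying
  objects, with \<open>\<eta>\<close> itself being the identity morphism of \<open>(x, y)\<close>.
\<close>

type_synonym dpoint = "point \<times> bool"

definition cat_D2 :: "('k::field, dpoint list, 'k mat set) klin_cat" where
  "cat_D2 = \<lparr>
     Obj = {X. map fst X \<in> Obj (cat_D :: ('k, point list, 'k mat set) klin_cat)},
     Hom = (\<lambda>X Y. Hom cat_D (map fst X) (map fst Y)),
     Comp = (\<lambda>X Y Z. Comp cat_D (map fst X) (map fst Y) (map fst Z)),
     Ident = (\<lambda>X. Ident cat_D (map fst X))\<rparr>"

text \<open>
  On morphisms \<open>F\<close> takes basic morphisms to basic morphisms, i.e. it keeps the matrix of scalars.
  Since \<open>x \<le> x'\<close> and \<open>y \<le> y'\<close> iff \<open>y + pi \<le> y' + pi\<close> and \<open>x + pi \<le> x' + pi\<close>, and \<open>B_pi\<close> is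
  invariant, a coset of matrices from \<open>X\<close> to \<open>Y\<close> is, as a set of matrices, also a coset from
  \<open>F X\<close> to \<open>F Y\<close>.
\<close>

definition F_aut :: "(dpoint list, 'k mat set, dpoint list, 'k mat set) cat_functor" where
  "F_aut = \<lparr>FObj = map (\<lambda>((x, y), s). ((y + pi, x + pi), \<not> s)), FMap = (\<lambda>X Y A. A)\<rparr>"

definition F_aut_inv :: "(dpoint list, 'k mat set, dpoint list, 'k mat set) cat_functor" where
  "F_aut_inv = \<lparr>FObj = map (\<lambda>((x, y), s). ((y - pi, x - pi), \<not> s)), FMap = (\<lambda>X Y A. A)\<rparr>"

definition cat_C :: "('k::field, dpoint list, int \<Rightarrow> 'k mat set) klin_cat" where
  "cat_C = orbit_cat cat_D2 (zpow_functor F_aut F_aut_inv)"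

definition std_cluster :: "dpoint set" where
  "std_cluster = {((of_int m * pi / 2 ^ n, pi + (of_int m - 1) * pi / 2 ^ n), False) | (m :: int) (n :: nat).
     0 \<le> m \<and> m < 2 ^ (n + 1)} - {((pi, pi), False)}"

definition rational_pts :: "dpoint set" where
  "rational_pts = {((of_int a * pi / 2 ^ n, of_int b * pi / 2 ^ n), s) | (a :: int) (b :: int) (n :: nat) s.
     \<bar>a - b\<bar> < 2 ^ n}"

definition cat_X :: "('k::field, dpoint list, int \<Rightarrow> 'k mat set) klin_cat" where
  "cat_X = full_subcat cat_C {X. set X \<subseteq> rational_pts}"

definition add_T :: "'k::field itself \<Rightarrow> dpoint list set" where
  "add_T (_ :: 'k itself) = {Y \<in> Obj (cat_X :: ('k, dpoint list, int \<Rightarrow> 'k mat set) klin_cat).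
     \<exists>Z. set Z \<subseteq> std_cluster \<and>
       isomorphic_in (cat_X :: ('k, dpoint list, int \<Rightarrow> 'k mat set) klin_cat) Y Z}"

definition cat_X_mod_T :: "('k::field, dpoint list, (int \<Rightarrow> 'k mat set) set) klin_cat" where
  "cat_X_mod_T = quotient_cat cat_X (add_T TYPE('k))"

section \<open>Modules over the infinite Jacobian algebra\<close>

text \<open>
  The planar trivalent tree: two rooted binary trees, distinguished by a Boolean, with their roots
  joined by an edge. A vertex is given by its path from the root, last step first. Drawn with the
  tree growing downwards, the neighbours of a vertex in clockwise order are the one above, the
  right child and the left child; for a root, the one above is the other root.
\<close>

type_synonym tvertex = "bool \<times> bool list"

datatype dir = Up | Right_Child | Left_Child

fun clockwise :: "dir \<Rightarrow> dir" where
  "clockwise Up = Right_Child"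
| "clockwise Right_Child = Left_Child"
| "clockwise Left_Child = Up"

fun nbr :: "tvertex \<Rightarrow> dir \<Rightarrow> tvertex" where
  "nbr (s, []) Up = (\<not> s, [])"
| "nbr (s, b # p) Up = (s, p)"
| "nbr (s, p) Right_Child = (s, True # p)"
| "nbr (s, p) Left_Child = (s, False # p)"

text \<open>
  The triangle placed at the tree vertex \<open>v\<close> has the three edges at \<open>v\<close> as its vertices and
  the three arrows \<open>(v, d)\<close>, each from the edge in direction \<open>d\<close> to the clockwise next one. Hence
  the quiver has the tree edges as vertices.
\<close>

definition tedge :: "tvertex \<Rightarrow> dir \<Rightarrow> tvertex set" where
  "tedge v d = {v, nbr v d}"

type_synonym qvertex = "tvertex set"
type_synonym qarrow = "tvertex \<times> dir"

definition Q0 :: "qvertex set" where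
  "Q0 = {tedge v d | v d. True}"

fun src :: "qarrow \<Rightarrow> qvertex" where
  "src (v, d) = tedge v d"

fun tgt :: "qarrow \<Rightarrow> qvertex" where
  "tgt (v, d) = tedge v (clockwise d)"

text \<open>
  The elements of the spaces of a module are drawn from the type \<open>'u\<close>, and the carriers and
  operations are otherwise arbitrary. For every finite-dimensional space to have a copy, \<open>'u\<close>
  needs to be at least as large as \<^typ>\<open>'k list\<close>.
\<close>

record ('k, 'u) quiver_rep =
  space :: "qvertex \<Rightarrow> ('k, 'u) module"
  amap :: "qarrow \<Rightarrow> 'u \<Rightarrow> 'u"

definition is_Lambda_module :: "('k::field, 'u) quiver_rep \<Rightarrow> bool" where
  "is_Lambda_module M \<longleftrightarrow>
     (\<forall>e \<in> Q0. Module.module class_ring (space M e)) \<and>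
     (\<forall>a. amap M a \<in> lin_maps (space M (src a)) (space M (tgt a))) \<and>
     (\<forall>v d. \<forall>x \<in> carrier (space M (tedge v d)).
        amap M (v, clockwise d) (amap M (v, d) x) = \<zero>\<^bsub>space M (tedge v (clockwise (clockwise d)))\<^esub>)"

text \<open>Submodules are taken to be empty outside \<^const>\<open>Q0\<close>, so that they are ordered pointwise by inclusion.\<close>

definition is_Lambda_submodule :: "('k::field, 'u) quiver_rep \<Rightarrow> (qvertex \<Rightarrow> 'u set) \<Rightarrow> bool" where
  "is_Lambda_submodule M U \<longleftrightarrow>
     (\<forall>e \<in> Q0. Module.submodule (U e) class_ring (space M e)) \<and>
     (\<forall>e. e \<notin> Q0 \<longrightarrow> U e = {}) \<and>
     (\<forall>a. amap M a ` U (src a) \<subseteq> U (tgt a))"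

definition composition_series ::
  "('k::field, 'u) quiver_rep \<Rightarrow> nat \<Rightarrow> (nat \<Rightarrow> qvertex \<Rightarrow> 'u set) \<Rightarrow> bool" where
  "composition_series M n U \<longleftrightarrow>
     (\<forall>i \<le> n. is_Lambda_submodule M (U i)) \<and>
     (\<forall>e \<in> Q0. U 0 e = {\<zero>\<^bsub>space M e\<^esub>} \<and> U n e = carrier (space M e)) \<and>
     (\<forall>i < n. U i < U (Suc i) \<and> \<not> (\<exists>W. is_Lambda_submodule M W \<and> U i < W \<and> W < U (Suc i)))"

definition finite_length :: "('k::field, 'u) quiver_rep \<Rightarrow> bool" where
  "finite_length M \<longleftrightarrow> (\<exists>n U. composition_series M n U)"

definition fl_mod_Lambda :: "('k::field, ('k, 'u) quiver_rep, qvertex \<Rightarrow> 'u \<Rightarrow> 'u) klin_cat" where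
  "fl_mod_Lambda = \<lparr>
     Obj = {M. is_Lambda_module M \<and> finite_length M},
     Hom = (\<lambda>M N. \<lparr>
       carrier = {f \<in> (\<Pi>\<^sub>E e\<in>Q0. lin_maps (space M e) (space N e) \<inter> extensional (carrier (space M e))).
          \<forall>a. \<forall>x \<in> carrier (space M (src a)). f (tgt a) (amap M a x) = amap N a (f (src a) x)},
       mult = undefined,
       one = undefined,
       zero = (\<lambda>e\<in>Q0. \<lambda>x\<in>carrier (space M e). \<zero>\<^bsub>space N e\<^esub>),
       add = (\<lambda>f g. \<lambda>e\<in>Q0. \<lambda>x\<in>carrier (space M e). f e x \<oplus>\<^bsub>space N e\<^esub> g e x),
       smult = (\<lambda>c f. \<lambda>e\<in>Q0. \<lambda>x\<in>carrier (space M e). c \<odot>\<^bsub>space N e\<^esub> f e x)\<rparr>),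
     Comp = (\<lambda>L M N g f. \<lambda>e\<in>Q0. compose (carrier (space L e)) (g e) (f e)),
     Ident = (\<lambda>M. \<lambda>e\<in>Q0. \<lambda>x\<in>carrier (space M e). x)\<rparr>"

end

theory Submission
  imports Defs
begin

text \<open>
  A point \<open>(x, y)\<close> with \<open>|y - x| < \<pi>\<close> is read as the chord with ends \<open>a = x / \<pi>\<close> and
  \<open>b = y / \<pi> + 1\<close> of the circle \<open>\<real> / 2\<int>\<close>, where \<open>a < b < a + 2\<close>. The automorphism \<open>F\<close> sends the
  lift \<open>(a, b)\<close> to \<open>(b, a + 2)\<close>, so isomorphism classes of indecomposables are chords, and the basic
  morphism \<open>(a, b) \<rightarrow> (c, d)\<close> survives in \<open>\<D>\<close> iff \<open>a \<le> c < b \<le> d < a + 2\<close>. At most one lift of the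
  target satisfies this, so morphism spaces between indecomposables of \<open>\<C>\<close> are \<open>K\<close> or zero, and
  \<open>\<C>\<close> becomes a category of matrices (\<open>ff_cat_C\<close>).

  The objects of \<open>\<T>\<close> are the sides of the dyadic triangulation. Its triangles are those of the quiver
  \<open>Q\<close>, and its sides the vertices of \<open>Q\<close>. A chord \<open>X\<close> with dyadic ends crosses finitely many sides
  \<open>cr X\<close>, consecutively, and so defines a string module: one basis vector for every crossed side, with
  the arrows between consecutive sides acting as identities. This is the functor of the equivalence.

  It is full, with kernel the ideal of \<open>\<T>\<close>. A homomorphism between two string modules is constant along the
  part where both strings run together, and the arrows at the two ends of this part force one chord
  to arise from the other by a counterclockwise rotation of its ends, that is by a basic morphism
  (\<open>classification\<close>). A basic morphism is sent to zero iff no side is crossed by both chords during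
  the rotation; then a combinatorial form of the Hex theorem gives a side of the triangulation
  through which the rotation can be interrupted (\<open>lift_hom_factor_or_common\<close>), and the morphism
  factors through \<open>\<T>\<close> (\<open>cluster_factoring\<close>).

  The functor is dense. A module of finite length has finite total dimension because nonzero paths in
  \<open>Q\<close> never return, so that simple modules are one-dimensional (\<open>cover_one_dim\<close>). Its support is a finite
  set of sides, hence a finite forest, and one dimension is peeled off at a leaf. The strings of the remaining module
  that end next to the leaf are totally ordered by basic morphisms, so a triangular change of
  basis leaves at most one of them attached to the leaf, and this one is lengthened
  (\<open>ex_string_basis\<close>). Finally a fully faithful dense functor is an equivalence and
  transports kernels, cokernels and their universal properties from modules.
\<close>

text \<open>Vector space operations and module spaces are frequent enough to deserve short notation.\<close>

abbreviation (input) vadd ("_ +[_] _" [65, 0, 66] 65) where "x +[V] y == x \<oplus>\<^bsub>V\<^esub> y"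

abbreviation (input) vsmult ("_ *[_] _" [70, 0, 71] 70) where "c *[V] x == c \<odot>\<^bsub>V\<^esub> x"

abbreviation sp :: "('k, 'u) quiver_rep => qvertex => 'u set" where "sp M e == carrier (space M e)"

section \<open>Linear maps and charts\<close>

lemma lin_mapsI:
 assumes "!!x. x : carrier V ==> h x : carrier W"
  and "!!x y. x : carrier V ==> y : carrier V ==> h (x +[V] y) = h x +[W] h y"
  and "!!c x. x : carrier V ==> h (c *[V] x) = c *[W] h x"
 shows "h : lin_maps V W" using assms by (auto simp: lin_maps_def)

lemma lin_maps_closed: "h : lin_maps V W ==> x : carrier V ==> h x : carrier W" by (auto simp: lin_maps_def)

lemma lin_maps_add:
 "h : lin_maps V W ==> x : carrier V ==> y : carrier V ==> h (x +[V] y) = h x +[W] h y" by (auto simp: lin_maps_def)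

lemma lin_maps_smult:
 "h : lin_maps V W ==> x : carrier V ==> h (c *[V] x) = c *[W] h x" by (auto simp: lin_maps_def)

lemma vs_closed:
 fixes V :: "('k::field, 'a) module"
 assumes "Module.module class_ring V"
 shows vs_add: "x : carrier V ==> y : carrier V ==> x +[V] y : carrier V"
  and vs_zero: "(zero V) : carrier V"
  and vs_smult: "x : carrier V ==> c *[V] x : carrier V"
  and vs_smult_zero: "x : carrier V ==> 0 *[V] x = (zero V)"
  and vs_smult_one: "x : carrier V ==> 1 *[V] x = x"
  and vs_r_zero: "x : carrier V ==> x +[V] (zero V) = x"
  and vs_l_zero: "x : carrier V ==> (zero V) +[V] x = x"
  and vs_smult_null: "c *[V] (zero V) = (zero V)"
  and vs_comm: "x : carrier V ==> y : carrier V ==> x +[V] y = y +[V] x"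
  and vs_assoc: "x : carrier V ==> y : carrier V ==> z : carrier V ==>
   (x +[V] y) +[V] z = x +[V] (y +[V] z)"
  and vs_l_distr: "x : carrier V ==> (c + d) *[V] x = c *[V] x +[V] d *[V] x"
  and vs_r_distr: "x : carrier V ==> y : carrier V ==>
   c *[V] (x +[V] y) = c *[V] x +[V] c *[V] y"
  and vs_smult_smult: "x : carrier V ==> c *[V] (d *[V] x) = (c * d) *[V] x"
proof -
 interpret Module.module "class_ring :: 'k ring" V by fact
 show "x : carrier V ==> y : carrier V ==> x +[V] y : carrier V" by simp
 show "(zero V) : carrier V" by simp
 show "x : carrier V ==> c *[V] x : carrier V" by simp
 show "x : carrier V ==> 0 *[V] x = (zero V)" using smult_l_null by simp
 show "x : carrier V ==> 1 *[V] x = x" using smult_one by simp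
 show "x : carrier V ==> x +[V] (zero V) = x" by simp
 show "x : carrier V ==> (zero V) +[V] x = x" by simp
 show "c *[V] (zero V) = (zero V)" using smult_r_null by simp
 show "x : carrier V ==> y : carrier V ==> x +[V] y = y +[V] x" by (rule M.a_comm)
 show "x : carrier V ==> y : carrier V ==> z : carrier V ==>
   (x +[V] y) +[V] z = x +[V] (y +[V] z)" by (rule M.a_assoc)
 show "x : carrier V ==> (c + d) *[V] x = c *[V] x +[V] d *[V] x" using smult_l_distr by simp
 show "x : carrier V ==> y : carrier V ==>
   c *[V] (x +[V] y) = c *[V] x +[V] c *[V] y" using smult_r_distr by simp
 show "x : carrier V ==> c *[V] (d *[V] x) = (c * d) *[V] x" using smult_assoc1 by simp
qed

lemma vs_lcomm:
 fixes V :: "('k::field, 'a) module"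
 assumes V: "Module.module class_ring V" and "x : carrier V" "y : carrier V" "z : carrier V"
 shows "x +[V] (y +[V] z) = y +[V] (x +[V] z)" using assms vs_assoc[OF V] vs_comm[OF V] by metis

lemma vs_neg:
 fixes V :: "('k::field, 'a) module"
 assumes V: "Module.module class_ring V" and x: "x : carrier V"
 shows "x +[V] (-1) *[V] x = (zero V)" using vs_l_distr[OF V x, of 1 "-1"] vs_smult_zero[OF V x] vs_smult_one[OF V x] by simp

lemma vs_diff_add:
 fixes V :: "('k::field, 'a) module"
 assumes V: "Module.module class_ring V" and x: "x : carrier V" and y: "y : carrier V"
 shows "(x +[V] (-1) *[V] y) +[V] y = x" using vs_assoc[OF V x vs_smult[OF V y] y, of "-1"] vs_comm[OF V vs_smult[OF V y] y, of "-1"]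
  vs_neg[OF V y] vs_r_zero[OF V x] by simp

lemma vs_eq_iff_diff:
 fixes V :: "('k::field, 'a) module"
 assumes V: "Module.module class_ring V" and x: "x : carrier V" and y: "y : carrier V"
 shows "x +[V] (-1) *[V] y = (zero V) \<longleftrightarrow> x = y" using vs_diff_add[OF assms] vs_l_zero[OF V y] vs_neg[OF V x] by metis

lemma lin_maps_zero:
 fixes V :: "('k::field, 'a) module" and W :: "('k, 'b) module"
 assumes V: "Module.module class_ring V" and W: "Module.module class_ring W"
  and h: "h : lin_maps V W"
 shows "h (zero V) = (zero W)" using lin_maps_smult[OF h vs_zero[OF V], of 0] vs_smult_zero[OF W lin_maps_closed[OF h vs_zero[OF V]]]
  vs_smult_zero[OF V vs_zero[OF V]] by simp

lemma vs_intro: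
 fixes V :: "('k::field, 'a) module"
 assumes add: "!!x y. x : carrier V ==> y : carrier V ==> x +[V] y : carrier V"
  and zero: "(zero V) : carrier V"
  and smult: "!!c x. x : carrier V ==> c *[V] x : carrier V"
  and l_zero: "!!x. x : carrier V ==> (zero V) +[V] x = x"
  and neg: "!!x. x : carrier V ==> (-1) *[V] x +[V] x = (zero V)"
  and comm: "!!x y. x : carrier V ==> y : carrier V ==> x +[V] y = y +[V] x"
  and assoc: "!!x y z. x : carrier V ==> y : carrier V ==> z : carrier V ==>
   (x +[V] y) +[V] z = x +[V] (y +[V] z)"
  and l_distr: "!!c d x. x : carrier V ==> (c + d) *[V] x = c *[V] x +[V] d *[V] x"
  and r_distr: "!!c x y. x : carrier V ==> y : carrier V ==>
   c *[V] (x +[V] y) = c *[V] x +[V] c *[V] y"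
  and mult: "!!c d x. x : carrier V ==> c *[V] (d *[V] x) = (c * d) *[V] x"
  and one: "!!x. x : carrier V ==> 1 *[V] x = x"
 shows "Module.module class_ring V"
proof (rule Module.moduleI)
 show "cring (class_ring :: 'k ring)" by (rule class_cring.is_cring)
 show "abelian_group V"
 proof (rule abelian_groupI)
  fix x assume "x : carrier V"
  thus "\<exists>y\<in>carrier V. y +[V] x = (zero V)" using neg smult by blast
 qed (simp_all add: add zero l_zero assoc, rule comm)
qed (simp_all add: smult l_distr r_distr mult one)

text \<open>
 A space that embeds linearly into another one satisfies all the laws of vector spaces that
 hold there; only the closure of its carrier is left to check.
\<close>

lemma vs_via_embedding:
 fixes V :: "('k::field, 'a) module" and W :: "('k, 'b) module"
 assumes W: "Module.module class_ring W"
  and inj: "inj_on ph (carrier V)"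
  and into: "!!x. x : carrier V ==> ph x : carrier W"
  and add: "!!x y. x : carrier V ==> y : carrier V ==> x +[V] y : carrier V"
  and zero: "(zero V) : carrier V"
  and smult: "!!c x. x : carrier V ==> c *[V] x : carrier V"
  and ph: "!!x y. x : carrier V ==> y : carrier V ==> ph (x +[V] y) = ph x +[W] ph y"
   "ph (zero V) = (zero W)" "!!c x. x : carrier V ==> ph (c *[V] x) = c *[W] ph x"
 shows "Module.module class_ring V" by (rule vs_intro; (intro add zero smult)?;
   (rule inj_onD[OF inj]; (intro add zero smult)?; (assumption)?)?;
   simp add: ph add zero smult into vs_l_zero[OF W] vs_assoc[OF W] vs_l_distr[OF W]
    vs_r_distr[OF W] vs_smult_smult[OF W] vs_smult_one[OF W] vs_add[OF W] vs_smult[OF W]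
    vs_comm[OF W, of "(-1) *[W] z" "z" for z] vs_neg[OF W] vs_comm[OF W] vs_lcomm[OF W])

definition fun_space :: "('i => 'k::field) set => ('k, 'i => 'k) module" where
 "fun_space S = \<lparr>carrier = S, mult = undefined, one = undefined, zero = (%i. 0),
   add = (%f g i. f i + g i), smult = (%c f i. c * f i)\<rparr>"

lemma fun_space_simps [simp]:
 "carrier (fun_space S) = S" "(zero (fun_space S)) = (%i. 0)"
 "f +[fun_space S] g = (%i. f i + g i)" "c *[fun_space S] f = (%i. c * f i)" by (simp_all add: fun_space_def)

lemma vs_fun_space:
 assumes "(%i. 0) : S" "!!f g. f : S ==> g : S ==> (%i. f i + g i) : S"
  "!!c f. f : S ==> (%i. c * f i) : S"
 shows "Module.module class_ring (fun_space S)" by (rule vs_intro) (use assms in \<open>auto simp: algebra_simps\<close>)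

lemma vs_chart:
 fixes V :: "('k::field, 'a) module" and ph :: "'a => 'i => 'k"
 assumes inj: "inj_on ph (carrier V)"
  and add: "!!x y. x : carrier V ==> y : carrier V ==> x +[V] y : carrier V"
  and zero: "(zero V) : carrier V"
  and smult: "!!c x. x : carrier V ==> c *[V] x : carrier V"
  and ph: "!!x y. x : carrier V ==> y : carrier V ==> ph (x +[V] y) = (%i. ph x i + ph y i)"
   "ph (zero V) = (%i. 0)" "!!c x. x : carrier V ==> ph (c *[V] x) = (%i. c * ph x i)"
 shows "Module.module class_ring V" by (rule vs_via_embedding[OF vs_fun_space[of UNIV] inj]) (use assms in auto)

section \<open>Functors\<close>

context klin_category
begin

lemma comp_mor:
 assumes "X : Obj C" "Y : Obj C" "Z : Obj C" "f : mor C X Y" "g : mor C Y Z"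
 shows "Comp C X Y Z g f : mor C X Z" using lin_maps_closed[OF Comp_linear_left] assms by fast

lemma zero_mor: "X : Obj C ==> Y : Obj C ==> (zero (Hom C X Y)) : mor C X Y" using Hom_module vs_zero by blast

lemma comp_zero_right:
 assumes "X : Obj C" "Y : Obj C" "Z : Obj C" "g : mor C Y Z"
 shows "Comp C X Y Z g (zero (Hom C X Y)) = (zero (Hom C X Z))" using lin_maps_zero[OF Hom_module Hom_module Comp_linear_right] assms by fast

lemma comp_zero_left:
 assumes "X : Obj C" "Y : Obj C" "Z : Obj C" "f : mor C X Y"
 shows "Comp C X Y Z (zero (Hom C Y Z)) f = (zero (Hom C X Z))" using lin_maps_zero[OF Hom_module Hom_module Comp_linear_left] assms by fast

end

definition ff_functor :: "('k::field, 'o, 'm) klin_cat => ('k, 'p, 'n) klin_cat => ('o, 'm, 'p, 'n) cat_functor => bool" where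
 "ff_functor C D F \<longleftrightarrow> klin_functor C D F &
   (\<forall>X \<in> Obj C. \<forall>Y \<in> Obj C. bij_betw (FMap F X Y) (mor C X Y) (mor D (FObj F X) (FObj F Y)))"

definition ess_surj :: "('k::field, 'o, 'm) klin_cat => ('k, 'p, 'n) klin_cat => ('o, 'm, 'p, 'n) cat_functor => bool" where
 "ess_surj C D F \<longleftrightarrow> (\<forall>Y \<in> Obj D. \<exists>X \<in> Obj C. isomorphic_in D (FObj F X) Y)"

context klin_functor
begin

lemma FMap_mor: "X : Obj C ==> Y : Obj C ==> f : mor C X Y ==> FMap F X Y f : mor D (FObj F X) (FObj F Y)"
 using lin_maps_closed[OF FMap_linear] by blast

lemma FMap_zero: "X : Obj C ==> Y : Obj C ==> FMap F X Y (zero (Hom C X Y)) = (zero (Hom D (FObj F X) (FObj F Y)))"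
 using lin_maps_zero[OF S.Hom_module T.Hom_module FMap_linear] FObj_closed by blast

lemma FMap_add: "X : Obj C ==> Y : Obj C ==> f : mor C X Y ==> g : mor C X Y ==>
  FMap F X Y (f +[Hom C X Y] g) = FMap F X Y f +[Hom D (FObj F X) (FObj F Y)] FMap F X Y g" using lin_maps_add[OF FMap_linear] by blast

lemma FMap_smult: "X : Obj C ==> Y : Obj C ==> f : mor C X Y ==>
  FMap F X Y (c *[Hom C X Y] f) = c *[Hom D (FObj F X) (FObj F Y)] FMap F X Y f" using lin_maps_smult[OF FMap_linear] by blast

end

text \<open>
 The axioms of a linear category are equations between morphisms, so they can be checked after
 a map that is injective on morphisms and compatible with all operations.
\<close>

lemma klin_category_via_bijection:
 fixes C :: "('k::field, 'o, 'm) klin_cat" and D :: "('k, 'p, 'n) klin_cat"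
 assumes D: "klin_category D"
  and obj: "!!X. X : Obj C ==> FO X : Obj D"
  and bij: "!!X Y. X : Obj C ==> Y : Obj C ==> bij_betw (Ph X Y) (mor C X Y) (mor D (FO X) (FO Y))"
  and zero: "!!X Y. X : Obj C ==> Y : Obj C ==>
   (zero (Hom C X Y)) : mor C X Y & Ph X Y (zero (Hom C X Y)) = (zero (Hom D (FO X) (FO Y)))"
  and add: "!!X Y f g. X : Obj C ==> Y : Obj C ==> f : mor C X Y ==> g : mor C X Y ==>
   f +[Hom C X Y] g : mor C X Y &
   Ph X Y (f +[Hom C X Y] g) = Ph X Y f +[Hom D (FO X) (FO Y)] Ph X Y g"
  and smult: "!!X Y c f. X : Obj C ==> Y : Obj C ==> f : mor C X Y ==>
   c *[Hom C X Y] f : mor C X Y &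
   Ph X Y (c *[Hom C X Y] f) = c *[Hom D (FO X) (FO Y)] Ph X Y f"
  and comp: "!!X Y Z f g. X : Obj C ==> Y : Obj C ==> Z : Obj C ==> f : mor C X Y ==> g : mor C Y Z ==>
   Comp C X Y Z g f : mor C X Z &
   Ph X Z (Comp C X Y Z g f) = Comp D (FO X) (FO Y) (FO Z) (Ph Y Z g) (Ph X Y f)"
  and ident: "!!X. X : Obj C ==> Ident C X : mor C X X & Ph X X (Ident C X) = Ident D (FO X)"
 shows "ff_functor C D \<lparr>FObj = FO, FMap = Ph\<rparr>"
proof -
 interpret D: klin_category D by fact
 have inj: "f = g" if "Ph X Y f = Ph X Y g" "X : Obj C" "Y : Obj C" "f : mor C X Y" "g : mor C X Y" for X Y f g
  using bij[OF that(2,3)] that by (auto simp: bij_betw_def dest: inj_onD)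
 have into: "Ph X Y f : mor D (FO X) (FO Y)" if "X : Obj C" "Y : Obj C" "f : mor C X Y" for X Y f
  using bij[OF that(1,2)] that by (auto simp: bij_betw_def)
 have mod: "Module.module class_ring (Hom C X Y)" if X: "X : Obj C" and Y: "Y : Obj C" for X Y
 proof (rule vs_via_embedding[OF D.Hom_module[OF obj[OF X] obj[OF Y]], where ph = "Ph X Y"])
  show "inj_on (Ph X Y) (mor C X Y)" using bij[OF X Y] by (simp add: bij_betw_def)
 qed (use into[OF X Y] zero[OF X Y] add[OF X Y] smult[OF X Y] in auto)
 have cat: "klin_category C"
 proof (rule klin_category.intro)
  fix X Y Z f assume *: "X : Obj C" "Y : Obj C" "Z : Obj C" "f : mor C X Y"
  show "(%g. Comp C X Y Z g f) : lin_maps (Hom C Y Z) (Hom C X Z)"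
  proof (rule lin_mapsI)
   fix g h assume gh: "g : mor C Y Z" "h : mor C Y Z"
   show "Comp C X Y Z (g +[Hom C Y Z] h) f = Comp C X Y Z g f +[Hom C X Z] Comp C X Y Z h f"
    by (rule inj[OF _ *(1,3)]) (simp_all add: * gh comp add obj into lin_maps_add[OF D.Comp_linear_left])
  next
   fix c g assume g: "g : mor C Y Z"
   show "Comp C X Y Z (c *[Hom C Y Z] g) f = c *[Hom C X Z] Comp C X Y Z g f"
    by (rule inj[OF _ *(1,3)]) (simp_all add: * g comp smult obj into lin_maps_smult[OF D.Comp_linear_left])
  qed (simp add: * comp)
 next
  fix X Y Z g assume *: "X : Obj C" "Y : Obj C" "Z : Obj C" "g : mor C Y Z"
  show "(%f. Comp C X Y Z g f) : lin_maps (Hom C X Y) (Hom C X Z)"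
  proof (rule lin_mapsI)
   fix f h assume gh: "f : mor C X Y" "h : mor C X Y"
   show "Comp C X Y Z g (f +[Hom C X Y] h) = Comp C X Y Z g f +[Hom C X Z] Comp C X Y Z g h"
    by (rule inj[OF _ *(1,3)]) (simp_all add: * gh comp add obj into lin_maps_add[OF D.Comp_linear_right])
  next
   fix c f assume g: "f : mor C X Y"
   show "Comp C X Y Z g (c *[Hom C X Y] f) = c *[Hom C X Z] Comp C X Y Z g f"
    by (rule inj[OF _ *(1,3)]) (simp_all add: * g comp smult obj into lin_maps_smult[OF D.Comp_linear_right])
  qed (simp add: * comp)
 next
  fix W X Y Z f g h
  assume *: "W : Obj C" "X : Obj C" "Y : Obj C" "Z : Obj C"
   "f : mor C W X" "g : mor C X Y" "h : mor C Y Z"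
  show "Comp C W Y Z h (Comp C W X Y g f) = Comp C W X Z (Comp C X Y Z h g) f"
   by (rule inj[OF _ *(1,4)]) (simp_all add: * comp obj into D.Comp_assoc)
 next
  fix X Y f assume *: "X : Obj C" "Y : Obj C" "f : mor C X Y"
  show "Comp C X Y Y (Ident C Y) f = f" by (rule inj[OF _ *(1,2)]) (simp_all add: * comp obj into ident D.Ident_left)
  show "Comp C X X Y f (Ident C X) = f" by (rule inj[OF _ *(1,2)]) (simp_all add: * comp obj into ident D.Ident_right)
 qed (simp_all add: mod ident)
 have "klin_functor C D \<lparr>FObj = FO, FMap = Ph\<rparr>"
 proof (intro klin_functor.intro klin_functor_axioms.intro cat D)
  fix X Y assume "X : Obj C" "Y : Obj C"
  thus "FMap \<lparr>FObj = FO, FMap = Ph\<rparr> X Y : lin_maps (Hom C X Y)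
   (Hom D (FObj \<lparr>FObj = FO, FMap = Ph\<rparr> X) (FObj \<lparr>FObj = FO, FMap = Ph\<rparr> Y))"
   by (intro lin_mapsI) (auto simp: into add smult)
 qed (auto simp: obj ident comp)
 thus ?thesis using bij by (auto simp: ff_functor_def)
qed

subsection \<open>Quotients by an ideal\<close>

text \<open>
 The first isomorphism theorem for categories: a full functor whose kernel consists of the
 morphisms that factor through \<open>S\<close> induces a fully faithful functor on the quotient, whose
 morphisms are the fibres of the given functor.
\<close>

lemma ff_functor_quotient:
 fixes C :: "('k::field, 'o, 'm) klin_cat" and D :: "('k, 'p, 'n) klin_cat"
 assumes F: "klin_functor C D F"
  and full: "!!X Y. X : Obj C ==> Y : Obj C ==>
   mor D (FObj F X) (FObj F Y) \<subseteq> FMap F X Y ` mor C X Y"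
  and ker: "!!X Y. X : Obj C ==> Y : Obj C ==>
   factoring C S X Y = {f : mor C X Y. FMap F X Y f = (zero (Hom D (FObj F X) (FObj F Y)))}"
 shows "!!X Y. X : Obj C ==> Y : Obj C ==> mor (quotient_cat C S) X Y =
   {{g : mor C X Y. FMap F X Y g = v} | v. v : mor D (FObj F X) (FObj F Y)}"
  and "ff_functor (quotient_cat C S) D \<lparr>FObj = FObj F, FMap = (%X Y A. FMap F X Y (SOME f. f : A))\<rparr>"
proof -
 interpret klin_functor C D F by fact
 let ?Q = "quotient_cat C S"
 define fib where "fib X Y v = {g : mor C X Y. FMap F X Y g = v}" for X Y v
 have fib_eq: "factoring C S X Y +>\<^bsub>Hom C X Y\<^esub> f = fib X Y (FMap F X Y f)"
  if X: "X : Obj C" and Y: "Y : Obj C" and f: "f : mor C X Y" for X Y f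
 proof -
  note V = S.Hom_module[OF X Y] and W = T.Hom_module[OF FObj_closed[OF X] FObj_closed[OF Y]]
  show ?thesis
  proof (intro equalityI subsetI)
   fix g assume "g : factoring C S X Y +>\<^bsub>Hom C X Y\<^esub> f"
   then obtain i where "i : factoring C S X Y" "g = i +[Hom C X Y] f" by (auto simp: a_r_coset_def')
   thus "g : fib X Y (FMap F X Y f)" using ker[OF X Y] f vs_add[OF V] vs_l_zero[OF W] FMap_mor[OF X Y f] by (auto simp: fib_def FMap_add[OF X Y])
  next
   fix g assume "g : fib X Y (FMap F X Y f)"
   hence g: "g : mor C X Y" and eq: "FMap F X Y g = FMap F X Y f" by (auto simp: fib_def)
   define i where "i = g +[Hom C X Y] (-1) *[Hom C X Y] f"
   have i: "i : mor C X Y" unfolding i_def by (intro vs_add[OF V] vs_smult[OF V] g f)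
   have "FMap F X Y i = (zero (Hom D (FObj F X) (FObj F Y)))"
    unfolding i_def using FMap_mor[OF X Y f] by (simp add: FMap_add[OF X Y] FMap_smult[OF X Y] g f vs_smult[OF V] eq vs_neg[OF W])
   hence "i : factoring C S X Y" using i ker[OF X Y] by auto
   moreover have "g = i +[Hom C X Y] f" unfolding i_def using vs_diff_add[OF V g f] by simp
   ultimately show "g : factoring C S X Y +>\<^bsub>Hom C X Y\<^esub> f" by (auto simp: a_r_coset_def')
  qed
 qed
 have fib_ne: "\<exists>f. f : mor C X Y & FMap F X Y f = v"
  if "X : Obj C" "Y : Obj C" "v : mor D (FObj F X) (FObj F Y)" for X Y v using full[OF that(1,2)] that(3) by auto
 have carr: "mor ?Q X Y = fib X Y ` mor D (FObj F X) (FObj F Y)"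
  if X: "X : Obj C" and Y: "Y : Obj C" for X Y
 proof -
  have "mor ?Q X Y = (%f. factoring C S X Y +>\<^bsub>Hom C X Y\<^esub> f) ` mor C X Y" by (auto simp: quotient_cat_def A_RCOSETS_def' )
  also have "\<dots> = (%f. fib X Y (FMap F X Y f)) ` mor C X Y" by (rule image_cong) (simp_all add: fib_eq[OF X Y])
  also have "\<dots> = fib X Y ` mor D (FObj F X) (FObj F Y)" using full[OF X Y] FMap_mor[OF X Y] by auto
  finally show ?thesis .
 qed
 show "!!X Y. X : Obj C ==> Y : Obj C ==> mor ?Q X Y =
   {{g : mor C X Y. FMap F X Y g = v} | v. v : mor D (FObj F X) (FObj F Y)}" using carr by (auto simp: fib_def)
 define Ph where "Ph = (%X Y A. FMap F X Y (SOME f. f : A))"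
 have Ph_fib: "Ph X Y (fib X Y v) = v"
  if "X : Obj C" "Y : Obj C" "v : mor D (FObj F X) (FObj F Y)" for X Y v
 proof -
  have "\<exists>f. f : fib X Y v" using fib_ne[OF that] by (auto simp: fib_def)
  hence "(SOME f. f : fib X Y v) : fib X Y v" by (rule someI_ex)
  thus ?thesis by (simp add: Ph_def fib_def)
 qed
 have "ff_functor ?Q D \<lparr>FObj = FObj F, FMap = Ph\<rparr>"
 proof (rule klin_category_via_bijection)
  show "klin_category D" by (rule T.klin_category_axioms)
 next
  fix X assume "X : Obj ?Q"
  thus "FObj F X : Obj D" by (simp add: quotient_cat_def FObj_closed)
 next
  fix X Y assume "X : Obj ?Q" "Y : Obj ?Q"
  hence X: "X : Obj C" and Y: "Y : Obj C" by (simp_all add: quotient_cat_def)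
  show "bij_betw (Ph X Y) (mor ?Q X Y) (mor D (FObj F X) (FObj F Y))"
   unfolding carr[OF X Y] by (rule bij_betw_byWitness[where f' = "fib X Y"]) (auto simp: Ph_fib X Y)
 next
  fix X Y assume "X : Obj ?Q" "Y : Obj ?Q"
  hence X: "X : Obj C" and Y: "Y : Obj C" by (simp_all add: quotient_cat_def)
  have "(zero (Hom ?Q X Y)) = fib X Y (zero (Hom D (FObj F X) (FObj F Y)))" using ker[OF X Y] by (simp add: quotient_cat_def fib_def)
  thus "(zero (Hom ?Q X Y)) : mor ?Q X Y & Ph X Y (zero (Hom ?Q X Y)) = (zero (Hom D (FObj F X) (FObj F Y)))"
   using T.zero_mor[OF FObj_closed[OF X] FObj_closed[OF Y]] by (simp add: carr[OF X Y] Ph_fib X Y)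
 next
  fix X Y A B assume "X : Obj ?Q" "Y : Obj ?Q" and AB: "A : mor ?Q X Y" "B : mor ?Q X Y"
  hence X: "X : Obj C" and Y: "Y : Obj C" by (simp_all add: quotient_cat_def)
  note V = S.Hom_module[OF X Y] and W = T.Hom_module[OF FObj_closed[OF X] FObj_closed[OF Y]]
  obtain v w where v: "v : mor D (FObj F X) (FObj F Y)" "A = fib X Y v"
   and w: "w : mor D (FObj F X) (FObj F Y)" "B = fib X Y w" using AB carr[OF X Y] by auto
  have "A +[Hom ?Q X Y] B = fib X Y (v +[Hom D (FObj F X) (FObj F Y)] w)"
  proof (intro equalityI subsetI)
   fix h assume "h : A +[Hom ?Q X Y] B"
   then obtain f g where "f : A" "g : B" "h = f +[Hom C X Y] g" by (auto simp: quotient_cat_def set_add_def')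
   thus "h : fib X Y (v +[Hom D (FObj F X) (FObj F Y)] w)" by (auto simp: v w fib_def vs_add[OF V] FMap_add[OF X Y])
  next
   fix h assume "h : fib X Y (v +[Hom D (FObj F X) (FObj F Y)] w)"
   hence h: "h : mor C X Y" "FMap F X Y h = v +[Hom D (FObj F X) (FObj F Y)] w" by (auto simp: fib_def)
   obtain g where g: "g : mor C X Y" "FMap F X Y g = w" using fib_ne[OF X Y w(1)] by blast
   define f where "f = h +[Hom C X Y] (-1) *[Hom C X Y] g"
   have f: "f : mor C X Y" unfolding f_def by (intro vs_add[OF V] vs_smult[OF V] g h)
   have "FMap F X Y f = (v +[Hom D (FObj F X) (FObj F Y)] w) +[Hom D (FObj F X) (FObj F Y)]
     (-1) *[Hom D (FObj F X) (FObj F Y)] w"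
    unfolding f_def by (simp add: FMap_add[OF X Y] FMap_smult[OF X Y] g h vs_smult[OF V])
   also have "\<dots> = v" using vs_assoc[OF W v(1) w(1) vs_smult[OF W w(1)]] vs_neg[OF W w(1)] vs_r_zero[OF W v(1)] by simp
   finally have "f : A" using f v by (simp add: fib_def)
   moreover have "h = f +[Hom C X Y] g" unfolding f_def using vs_diff_add[OF V h(1) g(1)] by simp
   moreover have "g : B" using g w by (simp add: fib_def)
   ultimately show "h : A +[Hom ?Q X Y] B" by (auto simp: quotient_cat_def set_add_def')
  qed
  thus "A +[Hom ?Q X Y] B : mor ?Q X Y &
   Ph X Y (A +[Hom ?Q X Y] B) = Ph X Y A +[Hom D (FObj F X) (FObj F Y)] Ph X Y B"
   using vs_add[OF W v(1) w(1)] v w by (simp add: carr[OF X Y] Ph_fib X Y)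
 next
  fix X Y c A assume "X : Obj ?Q" "Y : Obj ?Q" and A: "A : mor ?Q X Y"
  hence X: "X : Obj C" and Y: "Y : Obj C" by (simp_all add: quotient_cat_def)
  note V = S.Hom_module[OF X Y] and W = T.Hom_module[OF FObj_closed[OF X] FObj_closed[OF Y]]
  obtain v where v: "v : mor D (FObj F X) (FObj F Y)" "A = fib X Y v" using A carr[OF X Y] by auto
  have "c *[Hom ?Q X Y] A = (\<Union>f\<in>A. factoring C S X Y +>\<^bsub>Hom C X Y\<^esub> (c *[Hom C X Y] f))" by (simp add: quotient_cat_def)
  also have "\<dots> = (\<Union>f\<in>A. fib X Y (c *[Hom D (FObj F X) (FObj F Y)] v))"
   by (rule SUP_cong) (auto simp: v fib_def[of X Y v] fib_eq[OF X Y] vs_smult[OF V] FMap_smult[OF X Y])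
  also have "\<dots> = fib X Y (c *[Hom D (FObj F X) (FObj F Y)] v)" using fib_ne[OF X Y v(1)] by (auto simp: v fib_def)
  finally show "c *[Hom ?Q X Y] A : mor ?Q X Y &
   Ph X Y (c *[Hom ?Q X Y] A) = c *[Hom D (FObj F X) (FObj F Y)] Ph X Y A" using vs_smult[OF W v(1)] v by (simp add: carr[OF X Y] Ph_fib X Y)
 next
  fix X Y Z A B assume "X : Obj ?Q" "Y : Obj ?Q" "Z : Obj ?Q"
   and AB: "A : mor ?Q X Y" "B : mor ?Q Y Z"
  hence X: "X : Obj C" and Y: "Y : Obj C" and Z: "Z : Obj C" by (simp_all add: quotient_cat_def)
  obtain v w where v: "v : mor D (FObj F X) (FObj F Y)" "A = fib X Y v"
   and w: "w : mor D (FObj F Y) (FObj F Z)" "B = fib Y Z w" using AB carr[OF X Y] carr[OF Y Z] by auto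
  let ?u = "Comp D (FObj F X) (FObj F Y) (FObj F Z) w v"
  have "Comp ?Q X Y Z B A = (\<Union>g\<in>B. \<Union>f\<in>A. factoring C S X Z +>\<^bsub>Hom C X Z\<^esub> Comp C X Y Z g f)"
   by (simp add: quotient_cat_def)
  also have "\<dots> = (\<Union>g\<in>B. \<Union>f\<in>A. fib X Z ?u)" by (intro SUP_cong refl)
    (auto simp: v w fib_def[of X Y v] fib_def[of Y Z w] fib_eq[OF X Z] S.comp_mor[OF X Y Z] FMap_Comp[OF X Y Z])
  also have "\<dots> = fib X Z ?u" using fib_ne[OF X Y v(1)] fib_ne[OF Y Z w(1)] by (auto simp: v w fib_def)
  finally show "Comp ?Q X Y Z B A : mor ?Q X Z &
    Ph X Z (Comp ?Q X Y Z B A) = Comp D (FObj F X) (FObj F Y) (FObj F Z) (Ph Y Z B) (Ph X Y A)"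
   using v w T.comp_mor[of "FObj F X" "FObj F Y" "FObj F Z" v w] by (simp add: carr[OF X Z] Ph_fib X Y Z FObj_closed)
 next
  fix X assume "X : Obj ?Q"
  hence X: "X : Obj C" by (simp add: quotient_cat_def)
  have "Ident ?Q X = fib X X (Ident D (FObj F X))" using fib_eq[OF X X S.Ident_mor[OF X]] by (simp add: quotient_cat_def FMap_Ident[OF X])
  thus "Ident ?Q X : mor ?Q X X & Ph X X (Ident ?Q X) = Ident D (FObj F X)"
   using T.Ident_mor[OF FObj_closed[OF X]] by (simp add: carr[OF X X] Ph_fib X)
 qed
 thus "ff_functor ?Q D \<lparr>FObj = FObj F, FMap = (%X Y A. FMap F X Y (SOME f. f : A))\<rparr>" by (simp add: Ph_def)
qed

section \<open>Transport along fully faithful, essentially surjective functors\<close>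

context klin_category
begin

lemma iso_inverse:
 assumes "is_iso C X Y f"
 obtains g where "f : mor C X Y" "g : mor C Y X"
  "Comp C X Y X g f = Ident C X" "Comp C Y X Y f g = Ident C Y" using assms by (auto simp: is_iso_def)

lemma is_iso_sym: "is_iso C X Y f ==> \<exists>g. is_iso C Y X g" by (auto simp: is_iso_def)

lemma iso_cancel_left:
 assumes "X : Obj C" "Y : Obj C" "W : Obj C" "f : mor C X Y" "g : mor C Y X" "Comp C X Y X g f = Ident C X"
  "u : mor C W X"
 shows "Comp C W Y X g (Comp C W X Y f u) = u" using assms by (simp add: Comp_assoc[OF _ _ _ _ assms(7,4,5)] Ident_left)

lemma iso_cancel_right:
 assumes "X : Obj C" "Y : Obj C" "W : Obj C" "f : mor C X Y" "g : mor C Y X" "Comp C X Y X g f = Ident C X"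
  "u : mor C X W"
 shows "Comp C X Y W (Comp C Y X W u g) f = u" using assms by (simp add: Comp_assoc[OF _ _ _ _ assms(4,5,7), symmetric] Ident_right)

lemma kernel_iso:
 assumes ker: "is_kernel C X Y f A i" and iso: "is_iso C A' A th" and f: "f : mor C X Y"
  and obj: "X : Obj C" "Y : Obj C" "A' : Obj C"
 shows "is_kernel C X Y f A' (Comp C A' A X i th)"
proof -
 from iso obtain th' where t: "th : mor C A' A" "th' : mor C A A'"
  "Comp C A' A A' th' th = Ident C A'" "Comp C A A' A th th' = Ident C A" by (rule iso_inverse)
 from ker have A: "A : Obj C" and i: "i : mor C A X" and fi: "Comp C A X Y f i = (zero (Hom C A Y))" by (auto simp: is_kernel_def)
 show ?thesis unfolding is_kernel_def
 proof (intro conjI ballI impI)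
  show "A' : Obj C" by fact
  show "Comp C A' A X i th : mor C A' X" using comp_mor[OF _ _ _ t(1) i] obj A by simp
  show "Comp C A' X Y f (Comp C A' A X i th) = (zero (Hom C A' Y))"
   using Comp_assoc[OF obj(3) A obj(1,2) t(1) i f] fi comp_zero_left[OF obj(3) A obj(2) t(1)] by simp
  fix W h assume W: "W : Obj C" and h: "h : mor C W X" "Comp C W X Y f h = (zero (Hom C W Y))"
  then obtain u where u: "u : mor C W A" "Comp C W A X i u = h"
   and uniq: "!!v. v : mor C W A ==> Comp C W A X i v = h ==> v = u" using ker unfolding is_kernel_def by metis
  show "\<exists>!u. u : mor C W A' & Comp C W A' X (Comp C A' A X i th) u = h"
  proof (intro ex1I conjI)
   show m: "Comp C W A A' th' u : mor C W A'" by (rule comp_mor[OF W A obj(3) u(1) t(2)])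
   show "Comp C W A' X (Comp C A' A X i th) (Comp C W A A' th' u) = h"
    using Comp_assoc[OF W obj(3) A obj(1) m t(1) i] iso_cancel_left[OF A obj(3) W t(2,1,4) u(1)] u by simp
   fix v assume v: "v : mor C W A' & Comp C W A' X (Comp C A' A X i th) v = h"
   hence "Comp C W A X i (Comp C W A' A th v) = h" using Comp_assoc[OF W obj(3) A obj(1) _ t(1) i] by simp
   hence "Comp C W A' A th v = u" using uniq comp_mor[OF W obj(3) A _ t(1)] v by blast
   thus "v = Comp C W A A' th' u" using iso_cancel_left[OF obj(3) A W t(1,2,3)] v by metis
  qed
 qed
qed

lemma kernel_of_iso_comp:
 assumes ker: "is_kernel C X Y f A i" and iso: "is_iso C Y Y' th" and f: "f : mor C X Y"
  and obj: "X : Obj C" "Y : Obj C" "Y' : Obj C"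
 shows "is_kernel C X Y' (Comp C X Y Y' th f) A i"
proof -
 from iso obtain th' where t: "th : mor C Y Y'" "th' : mor C Y' Y" "Comp C Y Y' Y th' th = Ident C Y" by (rule iso_inverse)
 have "Comp C W X Y' (Comp C X Y Y' th f) h = (zero (Hom C W Y')) \<longleftrightarrow> Comp C W X Y f h = (zero (Hom C W Y))"
  if W: "W : Obj C" and h: "h : mor C W X" for W h
 proof -
  have "Comp C W X Y' (Comp C X Y Y' th f) h = Comp C W Y Y' th (Comp C W X Y f h)" using Comp_assoc[OF W obj h f t(1)] by simp
  thus ?thesis using iso_cancel_left[OF obj(2,3) W t comp_mor[OF W obj(1,2) h f]]
    comp_zero_right[OF W obj(3,2) t(2)] comp_zero_right[OF W obj(2,3) t(1)] by metis
 qed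
 thus ?thesis using ker unfolding is_kernel_def by metis
qed

end

text \<open>
 Cokernels are kernels in the opposite category, so that transporting kernels is enough.
\<close>

definition op_cat :: "('k::field, 'o, 'm) klin_cat => ('k, 'o, 'm) klin_cat" where
 "op_cat C = \<lparr>Obj = Obj C, Hom = (%X Y. Hom C Y X), Comp = (%X Y Z g f. Comp C Z Y X f g), Ident = Ident C\<rparr>"

lemma op_cat_simps [simp]: "Obj (op_cat C) = Obj C" "Hom (op_cat C) X Y = Hom C Y X"
 "Comp (op_cat C) X Y Z g f = Comp C Z Y X f g" "Ident (op_cat C) = Ident C" by (simp_all add: op_cat_def)

lemma (in klin_category) klin_category_op: "klin_category (op_cat C)" by (rule klin_category.intro)
  (simp_all add: Hom_module Comp_linear_left Comp_linear_right Comp_assoc Ident_mor Ident_left Ident_right)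

lemma cokernel_op: "is_cokernel C X Y f B p \<longleftrightarrow> is_kernel (op_cat C) Y X f B p" by (simp add: is_kernel_def is_cokernel_def)

lemma epi_op: "is_epi C X Y f \<longleftrightarrow> is_mono (op_cat C) Y X f" by (simp add: is_mono_def is_epi_def)

lemma iso_op: "is_iso (op_cat C) X Y f \<longleftrightarrow> is_iso C Y X f" by (auto simp: is_iso_def)

locale equivalence_functor = klin_functor C D F
 for C :: "('k::field, 'o, 'm) klin_cat" and D :: "('k, 'p, 'n) klin_cat"
  and F :: "('o, 'm, 'p, 'n) cat_functor" +
 assumes bij: "X : Obj C ==> Y : Obj C ==>
   bij_betw (FMap F X Y) (mor C X Y) (mor D (FObj F X) (FObj F Y))"
  and dense: "Z : Obj D ==> \<exists>X \<in> Obj C. isomorphic_in D (FObj F X) Z"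
begin

lemma FMap_inj:
 "FMap F X Y f = FMap F X Y g ==> X : Obj C ==> Y : Obj C ==> f : mor C X Y ==> g : mor C X Y ==> f = g"
 using bij[of X Y] by (auto simp: bij_betw_def dest: inj_onD)

lemma FMap_lift:
 assumes "X : Obj C" "Y : Obj C" "v : mor D (FObj F X) (FObj F Y)"
 obtains f where "f : mor C X Y" "FMap F X Y f = v" using bij[OF assms(1,2)] assms(3) by (metis bij_betw_def imageE)

lemma dense_iso:
 assumes "Y : Obj D"
 obtains X th th' where "X : Obj C" "is_iso D (FObj F X) Y th"
  "th : mor D (FObj F X) Y" "th' : mor D Y (FObj F X)"
  "Comp D (FObj F X) Y (FObj F X) th' th = Ident D (FObj F X)"
  "Comp D Y (FObj F X) Y th th' = Ident D Y" "is_iso D Y (FObj F X) th'" using dense[OF assms] unfolding isomorphic_in_def is_iso_def by blast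

lemma kernel_reflect:
 assumes ker: "is_kernel D (FObj F X) (FObj F Y) (FMap F X Y f) (FObj F A) (FMap F A X i)"
  and m: "X : Obj C" "Y : Obj C" "A : Obj C" "f : mor C X Y" "i : mor C A X"
 shows "is_kernel C X Y f A i"
 unfolding is_kernel_def
proof (intro conjI ballI impI)
 show "Comp C A X Y f i = (zero (Hom C A Y))" using ker m by (intro FMap_inj[of A Y])
   (simp_all add: FMap_Comp FMap_zero is_kernel_def S.comp_mor S.zero_mor)
 fix W h assume W: "W : Obj C" and h: "h : mor C W X" "Comp C W X Y f h = (zero (Hom C W Y))"
 have "Comp D (FObj F W) (FObj F X) (FObj F Y) (FMap F X Y f) (FMap F W X h) = (zero (Hom D (FObj F W) (FObj F Y)))"
  using FMap_Comp[OF W m(1,2) h(1) m(4)] h(2) FMap_zero[OF W m(2)] by simp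
 then obtain v where v: "v : mor D (FObj F W) (FObj F A)"
   "Comp D (FObj F W) (FObj F A) (FObj F X) (FMap F A X i) v = FMap F W X h"
  and uniq: "!!v'. v' : mor D (FObj F W) (FObj F A) ==>
   Comp D (FObj F W) (FObj F A) (FObj F X) (FMap F A X i) v' = FMap F W X h ==> v' = v"
  using ker FObj_closed[OF W] FMap_mor[OF W m(1) h(1)] unfolding is_kernel_def by metis
 obtain u where u: "u : mor C W A" "FMap F W A u = v" using FMap_lift[OF W m(3) v(1)] .
 show "\<exists>!u. u : mor C W A & Comp C W A X i u = h"
 proof (intro ex1I conjI)
  show "u : mor C W A" by fact
  show "Comp C W A X i u = h" by (rule FMap_inj[of W X]) (simp_all add: W m u h FMap_Comp v S.comp_mor[of W A X])
  fix w assume w: "w : mor C W A & Comp C W A X i w = h"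
  hence "FMap F W A w = v" using uniq[OF FMap_mor[OF W m(3)]] FMap_Comp[OF W m(3,1) _ m(5)] by auto
  thus "w = u" using FMap_inj[OF _ W m(3)] u w by auto
 qed
qed (use m in auto)

lemma mono_preserve:
 assumes mono: "is_mono C X Y f" and X: "X : Obj C" and Y: "Y : Obj C"
 shows "is_mono D (FObj F X) (FObj F Y) (FMap F X Y f)"
 unfolding is_mono_def
proof (intro conjI ballI impI)
 have f: "f : mor C X Y" using mono by (simp add: is_mono_def)
 thus Ff: "FMap F X Y f : mor D (FObj F X) (FObj F Y)" by (rule FMap_mor[OF X Y])
 note FX = FObj_closed[OF X] and FY = FObj_closed[OF Y]
 fix W g h assume W: "W : Obj D" and g: "g : mor D W (FObj F X)" and h: "h : mor D W (FObj F X)"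
  and eq: "Comp D W (FObj F X) (FObj F Y) (FMap F X Y f) g = Comp D W (FObj F X) (FObj F Y) (FMap F X Y f) h"
 obtain V t t' where V: "V : Obj C" and t: "t : mor D (FObj F V) W" "t' : mor D W (FObj F V)"
  "Comp D W (FObj F V) W t t' = Ident D W" using dense_iso[OF W] by metis
 note FV = FObj_closed[OF V]
 obtain g' where g': "g' : mor C V X" "FMap F V X g' = Comp D (FObj F V) W (FObj F X) g t" using FMap_lift[OF V X T.comp_mor[OF FV W FX t(1) g]] .
 obtain h' where h': "h' : mor C V X" "FMap F V X h' = Comp D (FObj F V) W (FObj F X) h t" using FMap_lift[OF V X T.comp_mor[OF FV W FX t(1) h]] .
 have "Comp C V X Y f g' = Comp C V X Y f h'" by (rule FMap_inj[of V Y])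
   (simp_all add: S.comp_mor X Y V f g' h' FMap_Comp T.Comp_assoc[OF FV W FX FY t(1) _ Ff] g h eq)
 hence "g' = h'" using mono V g' h' by (auto simp: is_mono_def)
 hence "Comp D (FObj F V) W (FObj F X) g t = Comp D (FObj F V) W (FObj F X) h t" using g' h' by simp
 thus "g = h" using T.iso_cancel_right[OF W FV FX t(2,1,3) g] T.iso_cancel_right[OF W FV FX t(2,1,3) h] by metis
qed

lemma kernel_transport:
 assumes kernels: "!!M N f. M : Obj D ==> N : Obj D ==> f : mor D M N ==> \<exists>A i. is_kernel D M N f A i"
  and X: "X : Obj C" and Y: "Y : Obj C" and f: "f : mor C X Y"
 shows "\<exists>A i. is_kernel C X Y f A i"
proof -
 note FX = FObj_closed[OF X] and FY = FObj_closed[OF Y] and Ff = FMap_mor[OF X Y f]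
 obtain A i where ker: "is_kernel D (FObj F X) (FObj F Y) (FMap F X Y f) A i" using kernels[OF FX FY Ff] by blast
 hence A: "A : Obj D" by (simp add: is_kernel_def)
 obtain V t where V: "V : Obj C" and t: "is_iso D (FObj F V) A t" using dense_iso[OF A] by metis
 have k: "is_kernel D (FObj F X) (FObj F Y) (FMap F X Y f) (FObj F V) (Comp D (FObj F V) A (FObj F X) i t)"
  by (rule T.kernel_iso[OF ker t Ff FX FY FObj_closed[OF V]])
 then obtain i' where i': "i' : mor C V X" "FMap F V X i' = Comp D (FObj F V) A (FObj F X) i t"
  using FMap_lift[OF V X] unfolding is_kernel_def by metis
 thus ?thesis using kernel_reflect[of X Y f V i'] k X Y V f by auto
qed

lemma mono_normal_transport:
 assumes normal: "!!M N f. M : Obj D ==> N : Obj D ==> is_mono D M N f ==> \<exists>Z \<in> Obj D. \<exists>g \<in> mor D N Z. is_kernel D N Z g M f"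
  and X: "X : Obj C" and Y: "Y : Obj C" and mono: "is_mono C X Y f"
 shows "\<exists>Z \<in> Obj C. \<exists>g \<in> mor C Y Z. is_kernel C Y Z g X f"
proof -
 note FX = FObj_closed[OF X] and FY = FObj_closed[OF Y]
 from mono have f: "f : mor C X Y" by (simp add: is_mono_def)
 obtain Z g where Z: "Z : Obj D" and g: "g : mor D (FObj F Y) Z"
  and ker: "is_kernel D (FObj F Y) Z g (FObj F X) (FMap F X Y f)" using normal[OF FX FY mono_preserve[OF mono X Y]] by blast
 obtain V t where V: "V : Obj C" and t: "is_iso D Z (FObj F V) t" using dense_iso[OF Z] by metis
 have k: "is_kernel D (FObj F Y) (FObj F V) (Comp D (FObj F Y) Z (FObj F V) t g) (FObj F X) (FMap F X Y f)"
  by (rule T.kernel_of_iso_comp[OF ker t g FY Z FObj_closed[OF V]])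
 have "Comp D (FObj F Y) Z (FObj F V) t g : mor D (FObj F Y) (FObj F V)" using T.comp_mor[OF FY Z FObj_closed[OF V] g] t by (simp add: is_iso_def)
 then obtain g' where g': "g' : mor C Y V" "FMap F Y V g' = Comp D (FObj F Y) Z (FObj F V) t g" using FMap_lift[OF Y V] by metis
 thus ?thesis using kernel_reflect[of Y V g' X f] k X Y V f by auto
qed

theorem equivalence: "klin_equivalent C D"
proof -
 have "\<exists>X th th'. X : Obj C & th : mor D (FObj F X) Y & th' : mor D Y (FObj F X) &
  Comp D (FObj F X) Y (FObj F X) th' th = Ident D (FObj F X) &
  Comp D Y (FObj F X) Y th th' = Ident D Y" if "Y : Obj D" for Y using dense_iso[OF that] by metis
 then obtain GO e e' where "!!Y. Y : Obj D ==> GO Y : Obj C & e Y : mor D (FObj F (GO Y)) Y &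
   e' Y : mor D Y (FObj F (GO Y)) &
   Comp D (FObj F (GO Y)) Y (FObj F (GO Y)) (e' Y) (e Y) = Ident D (FObj F (GO Y)) &
   Comp D Y (FObj F (GO Y)) Y (e Y) (e' Y) = Ident D Y" by metis
 hence GO: "!!Y. Y : Obj D ==> GO Y : Obj C"
  and e: "!!Y. Y : Obj D ==> e Y : mor D (FObj F (GO Y)) Y"
  and e': "!!Y. Y : Obj D ==> e' Y : mor D Y (FObj F (GO Y))"
  and e'e: "!!Y. Y : Obj D ==> Comp D (FObj F (GO Y)) Y (FObj F (GO Y)) (e' Y) (e Y) = Ident D (FObj F (GO Y))"
  and ee': "!!Y. Y : Obj D ==> Comp D Y (FObj F (GO Y)) Y (e Y) (e' Y) = Ident D Y" by blast+
 note FGO = FObj_closed[OF GO]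
 define conj where "conj Y Z v = Comp D (FObj F (GO Y)) Z (FObj F (GO Z)) (e' Z) (Comp D (FObj F (GO Y)) Y Z v (e Y))" for Y Z v
 have conj_mor: "conj Y Z v : mor D (FObj F (GO Y)) (FObj F (GO Z))"
  if "Y : Obj D" "Z : Obj D" "v : mor D Y Z" for Y Z v
  unfolding conj_def using that by (intro T.comp_mor e e' FGO)
 define GM where "GM Y Z v = (SOME f. f : mor C (GO Y) (GO Z) & FMap F (GO Y) (GO Z) f = conj Y Z v)" for Y Z v
 have GM: "GM Y Z v : mor C (GO Y) (GO Z) & FMap F (GO Y) (GO Z) (GM Y Z v) = conj Y Z v"
  if "Y : Obj D" "Z : Obj D" "v : mor D Y Z" for Y Z v
  unfolding GM_def by (rule someI_ex) (use FMap_lift[OF GO GO conj_mor] that in metis)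
 have e_nat: "Comp D (FObj F (GO Y)) (FObj F (GO Z)) Z (e Z) (conj Y Z v) = Comp D (FObj F (GO Y)) Y Z v (e Y)"
  if "Y : Obj D" "Z : Obj D" "v : mor D Y Z" for Y Z v
  unfolding conj_def using that T.iso_cancel_left[OF that(2) FGO[OF that(2)] FGO[OF that(1)] e' e ee'] by (simp add: T.comp_mor e FGO)
 let ?G = "\<lparr>FObj = GO, FMap = GM\<rparr>"
 have G: "klin_functor D C ?G"
 proof (intro klin_functor.intro klin_functor_axioms.intro T.klin_category_axioms S.klin_category_axioms)
  fix Y Z assume Y: "Y : Obj D" and Z: "Z : Obj D"
  have "GM Y Z : lin_maps (Hom D Y Z) (Hom C (GO Y) (GO Z))"
  proof (rule lin_mapsI)
   fix v w assume v: "v : mor D Y Z" and w: "w : mor D Y Z"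
   have "conj Y Z (v +[Hom D Y Z] w) = conj Y Z v +[Hom D (FObj F (GO Y)) (FObj F (GO Z))] conj Y Z w"
    unfolding conj_def using lin_maps_add[OF T.Comp_linear_left[OF FGO[OF Y] Y Z e[OF Y]] v w]
     lin_maps_add[OF T.Comp_linear_right[OF FGO[OF Y] Z FGO[OF Z] e'[OF Z]]
     T.comp_mor[OF FGO[OF Y] Y Z e[OF Y] v] T.comp_mor[OF FGO[OF Y] Y Z e[OF Y] w]] by simp
   thus "GM Y Z (v +[Hom D Y Z] w) = GM Y Z v +[Hom C (GO Y) (GO Z)] GM Y Z w" using GM[OF Y Z] v w
    by (intro FMap_inj[of "GO Y" "GO Z"]) (simp_all add: GO Y Z FMap_add vs_add[OF T.Hom_module] vs_add[OF S.Hom_module])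
  next
   fix c v assume v: "v : mor D Y Z"
   have "conj Y Z (c *[Hom D Y Z] v) = c *[Hom D (FObj F (GO Y)) (FObj F (GO Z))] conj Y Z v"
    unfolding conj_def using lin_maps_smult[OF T.Comp_linear_left[OF FGO[OF Y] Y Z e[OF Y]] v]
     lin_maps_smult[OF T.Comp_linear_right[OF FGO[OF Y] Z FGO[OF Z] e'[OF Z]]
     T.comp_mor[OF FGO[OF Y] Y Z e[OF Y] v]] by simp
   thus "GM Y Z (c *[Hom D Y Z] v) = c *[Hom C (GO Y) (GO Z)] GM Y Z v" using GM[OF Y Z] v
    by (intro FMap_inj[of "GO Y" "GO Z"]) (simp_all add: GO Y Z FMap_smult vs_smult[OF T.Hom_module] vs_smult[OF S.Hom_module])
  qed (use GM[OF Y Z] in simp)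
  thus "FMap ?G Y Z : lin_maps (Hom D Y Z) (Hom C (FObj ?G Y) (FObj ?G Z))" by simp
 next
  fix Y assume Y: "Y : Obj D"
  have "conj Y Y (Ident D Y) = Ident D (FObj F (GO Y))"
   unfolding conj_def by (simp add: T.Ident_left[OF FGO[OF Y] Y e[OF Y]] e'e[OF Y])
  thus "FMap ?G Y Y (Ident D Y) = Ident C (FObj ?G Y)" using GM[OF Y Y T.Ident_mor[OF Y]]
   by (simp, intro FMap_inj[of "GO Y" "GO Y"]) (simp_all add: GO Y FMap_Ident S.Ident_mor)
 next
  fix X Y Z f g assume X: "X : Obj D" and Y: "Y : Obj D" and Z: "Z : Obj D"
   and f: "f : mor D X Y" and g: "g : mor D Y Z"
  note gf = T.comp_mor[OF X Y Z f g]
  have "Comp D (FObj F (GO X)) (FObj F (GO Y)) (FObj F (GO Z)) (conj Y Z g) (conj X Y f) =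
   Comp D (FObj F (GO X)) Z (FObj F (GO Z)) (e' Z) (Comp D (FObj F (GO X)) (FObj F (GO Y)) Z (Comp D (FObj F (GO Y)) Y Z g (e Y)) (conj X Y f))"
   unfolding conj_def[of Y Z g]
   using T.Comp_assoc[OF FGO[OF X] FGO[OF Y] Z FGO[OF Z] conj_mor[OF X Y f] T.comp_mor[OF FGO[OF Y] Y Z e[OF Y] g] e'[OF Z]] by simp
  also have "Comp D (FObj F (GO X)) (FObj F (GO Y)) Z (Comp D (FObj F (GO Y)) Y Z g (e Y)) (conj X Y f) =
    Comp D (FObj F (GO X)) Y Z g (Comp D (FObj F (GO X)) X Y f (e X))"
   using T.Comp_assoc[OF FGO[OF X] FGO[OF Y] Y Z conj_mor[OF X Y f] e[OF Y] g] e_nat[OF X Y f] by simp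
  also have "\<dots> = Comp D (FObj F (GO X)) X Z (Comp D X Y Z g f) (e X)" by (rule T.Comp_assoc[OF FGO[OF X] X Y Z e[OF X] f g])
  finally have "Comp D (FObj F (GO X)) (FObj F (GO Y)) (FObj F (GO Z)) (conj Y Z g) (conj X Y f) = conj X Z (Comp D X Y Z g f)"
   by (simp add: conj_def)
  thus "FMap ?G X Z (Comp D X Y Z g f) = Comp C (FObj ?G X) (FObj ?G Y) (FObj ?G Z) (FMap ?G Y Z g) (FMap ?G X Y f)"
   using GM[OF X Y f] GM[OF Y Z g] GM[OF X Z gf]
   by (simp, intro FMap_inj[of "GO X" "GO Z"]) (simp_all add: GO X Y Z FMap_Comp[of _ "GO Y"] S.comp_mor[of _ "GO Y"])
 qed (simp add: GO)
 define n where "n X = (SOME f. f : mor C X (GO (FObj F X)) & FMap F X (GO (FObj F X)) f = e' (FObj F X))" for X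
 have n: "n X : mor C X (GO (FObj F X)) & FMap F X (GO (FObj F X)) (n X) = e' (FObj F X)" if X: "X : Obj C" for X
  unfolding n_def by (rule someI_ex) (use FMap_lift[OF X GO[OF FObj_closed[OF X]] e'[OF FObj_closed[OF X]]] in metis)
 have iso_n: "is_iso C X (GO (FObj F X)) (n X)" if X: "X : Obj C" for X
 proof -
  note FX = FObj_closed[OF X] and GX = GO[OF FObj_closed[OF X]]
  obtain m where m: "m : mor C (GO (FObj F X)) X" "FMap F (GO (FObj F X)) X m = e (FObj F X)" using FMap_lift[OF GX X e[OF FX]] .
  have "Comp C X (GO (FObj F X)) X m (n X) = Ident C X"
   using n[OF X] by (intro FMap_inj[of X X]) (simp_all add: X GX FMap_Comp m FMap_Ident ee' FX S.comp_mor S.Ident_mor)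
  moreover have "Comp C (GO (FObj F X)) X (GO (FObj F X)) (n X) m = Ident C (GO (FObj F X))"
   using n[OF X] by (intro FMap_inj[of "GO (FObj F X)" "GO (FObj F X)"])
    (simp_all add: X GX FMap_Comp m FMap_Ident e'e FX S.comp_mor S.Ident_mor)
  ultimately show ?thesis using n[OF X] m by (auto simp: is_iso_def)
 qed
 have "is_nat_iso C C id_functor (comp_functor ?G F) n"
  unfolding is_nat_iso_def
 proof (intro conjI ballI)
  fix X assume "X : Obj C"
  thus "is_iso C (FObj id_functor X) (FObj (comp_functor ?G F) X) (n X)" by (simp add: id_functor_def comp_functor_def iso_n)
 next
  fix X Y f assume X: "X : Obj C" and Y: "Y : Obj C" and f: "f : mor C X Y"
  note FX = FObj_closed[OF X] and FY = FObj_closed[OF Y] and Ff = FMap_mor[OF X Y f]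
  note GX = GO[OF FX] and GY = GO[OF FY]
  have "Comp D (FObj F X) (FObj F (GO (FObj F X))) (FObj F (GO (FObj F Y))) (conj (FObj F X) (FObj F Y) (FMap F X Y f)) (e' (FObj F X)) =
   Comp D (FObj F X) (FObj F Y) (FObj F (GO (FObj F Y))) (e' (FObj F Y)) (FMap F X Y f)"
  proof -
   have "Comp D (FObj F X) (FObj F (GO (FObj F X))) (FObj F (GO (FObj F Y))) (conj (FObj F X) (FObj F Y) (FMap F X Y f)) (e' (FObj F X))
    = Comp D (FObj F X) (FObj F Y) (FObj F (GO (FObj F Y))) (e' (FObj F Y))
     (Comp D (FObj F X) (FObj F (GO (FObj F X))) (FObj F Y) (Comp D (FObj F (GO (FObj F X))) (FObj F X) (FObj F Y) (FMap F X Y f) (e (FObj F X))) (e' (FObj F X)))"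
    unfolding conj_def using T.Comp_assoc[OF FX FGO[OF FX] FY FGO[OF FY] e'[OF FX] T.comp_mor[OF FGO[OF FX] FX FY e[OF FX] Ff] e'[OF FY]] by simp
   thus ?thesis using T.iso_cancel_right[OF FX FGO[OF FX] FY e'[OF FX] e[OF FX] ee'[OF FX] Ff] by simp
  qed
  hence "Comp C X Y (GO (FObj F Y)) (n Y) f = Comp C X (GO (FObj F X)) (GO (FObj F Y)) (GM (FObj F X) (FObj F Y) (FMap F X Y f)) (n X)"
   using n[OF X] n[OF Y] GM[OF FX FY Ff] by (intro FMap_inj[of X "GO (FObj F Y)"])
    (simp_all add: X Y GX GY FMap_Comp[OF X Y GY f] FMap_Comp[OF X GX GY] f S.comp_mor[OF X Y GY] S.comp_mor[OF X GX GY])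
  thus "Comp C (FObj id_functor X) (FObj id_functor Y) (FObj (comp_functor ?G F) Y) (n Y) (FMap id_functor X Y f) =
    Comp C (FObj id_functor X) (FObj (comp_functor ?G F) X) (FObj (comp_functor ?G F) Y) (FMap (comp_functor ?G F) X Y f) (n X)"
   by (simp add: id_functor_def comp_functor_def)
 qed
 moreover have "is_nat_iso D D (comp_functor F ?G) id_functor e"
  unfolding is_nat_iso_def
 proof (intro conjI ballI)
  fix Y assume Y: "Y : Obj D"
  thus "is_iso D (FObj (comp_functor F ?G) Y) (FObj id_functor Y) (e Y)"
   using e[OF Y] e'[OF Y] e'e[OF Y] ee'[OF Y] by (auto simp: id_functor_def comp_functor_def is_iso_def)
 next
  fix X Y f assume X: "X : Obj D" and Y: "Y : Obj D" and f: "f : mor D X Y"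
  show "Comp D (FObj (comp_functor F ?G) X) (FObj (comp_functor F ?G) Y) (FObj id_functor Y) (e Y) (FMap (comp_functor F ?G) X Y f) =
    Comp D (FObj (comp_functor F ?G) X) (FObj id_functor X) (FObj id_functor Y) (FMap id_functor X Y f) (e X)"
   using e_nat[OF X Y f] GM[OF X Y f] by (simp add: id_functor_def comp_functor_def)
 qed
 ultimately show ?thesis
  unfolding klin_equivalent_def using G klin_functor_axioms by blast
qed

end

context equivalence_functor
begin

lemma equivalence_functor_op: "equivalence_functor (op_cat C) (op_cat D) \<lparr>FObj = FObj F, FMap = (%X Y. FMap F Y X)\<rparr>"
proof (intro equivalence_functor.intro klin_functor.intro klin_functor_axioms.intro equivalence_functor_axioms.intro
  S.klin_category_op T.klin_category_op)
 fix Z assume "Z : Obj (op_cat D)"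
 then obtain X where X: "X : Obj C" "isomorphic_in D (FObj F X) Z" using dense by auto
 then obtain g where "is_iso D Z (FObj F X) g" using T.is_iso_sym unfolding isomorphic_in_def by blast
 thus "\<exists>X\<in>Obj (op_cat C). isomorphic_in (op_cat D) (FObj \<lparr>FObj = FObj F, FMap = (%X Y. FMap F Y X)\<rparr> X) Z"
  using X(1) by (auto simp: isomorphic_in_def iso_op)
qed (simp_all add: FObj_closed FMap_linear FMap_Ident FMap_Comp bij)

theorem abelian_transport:
 assumes Z: "Z : Obj C" "is_zero_obj D (FObj F Z)"
  and bip: "!!X Y. X : Obj C ==> Y : Obj C ==> \<exists>V\<in>Obj C. \<exists>i j p q. is_biproduct D (FObj F X) (FObj F Y) (FObj F V) i j p q"
  and ker: "!!M N f. M : Obj D ==> N : Obj D ==> f : mor D M N ==> \<exists>A i. is_kernel D M N f A i"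
  and cok: "!!M N f. M : Obj D ==> N : Obj D ==> f : mor D M N ==> \<exists>B p. is_cokernel D M N f B p"
  and mono: "!!M N f. M : Obj D ==> N : Obj D ==> is_mono D M N f ==> \<exists>Z \<in> Obj D. \<exists>g \<in> mor D N Z. is_kernel D N Z g M f"
  and epi: "!!M N f. M : Obj D ==> N : Obj D ==> is_epi D M N f ==> \<exists>Z \<in> Obj D. \<exists>g \<in> mor D Z M. is_cokernel D Z M g N f"
 shows "abelian_category C"
proof (intro abelian_category.intro abelian_category_axioms.intro S.klin_category_axioms)
 note FZ = FObj_closed[OF Z(1)]
 have "f = (zero (Hom C X Z))" if X: "X : Obj C" and f: "f : mor C X Z" for X f by (rule FMap_inj[OF _ X Z(1) f S.zero_mor[OF X Z(1)]])
   (use Z(2) FMap_mor[OF X Z(1) f] FMap_mor[OF X Z(1) S.zero_mor[OF X Z(1)]] FObj_closed[OF X] in \<open>metis is_zero_obj_def\<close>)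
 moreover have "f = (zero (Hom C Z X))" if X: "X : Obj C" and f: "f : mor C Z X" for X f by (rule FMap_inj[OF _ Z(1) X f S.zero_mor[OF Z(1) X]])
   (use Z(2) FMap_mor[OF Z(1) X f] FMap_mor[OF Z(1) X S.zero_mor[OF Z(1) X]] FObj_closed[OF X] in \<open>metis is_zero_obj_def\<close>)
 ultimately have "is_zero_obj C Z" using Z(1) S.zero_mor unfolding is_zero_obj_def by metis
 thus "\<exists>Z. is_zero_obj C Z" by blast
next
 fix X Y assume X: "X : Obj C" and Y: "Y : Obj C"
 obtain V i j p q where V: "V : Obj C" and bp: "is_biproduct D (FObj F X) (FObj F Y) (FObj F V) i j p q" using bip[OF X Y] by blast
 hence i: "i : mor D (FObj F X) (FObj F V)" and j: "j : mor D (FObj F Y) (FObj F V)"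
  and p: "p : mor D (FObj F V) (FObj F X)" and q: "q : mor D (FObj F V) (FObj F Y)" by (simp_all add: is_biproduct_def)
 obtain i' where i': "i' : mor C X V" "FMap F X V i' = i" using FMap_lift[OF X V i] .
 obtain j' where j': "j' : mor C Y V" "FMap F Y V j' = j" using FMap_lift[OF Y V j] .
 obtain p' where p': "p' : mor C V X" "FMap F V X p' = p" using FMap_lift[OF V X p] .
 obtain q' where q': "q' : mor C V Y" "FMap F V Y q' = q" using FMap_lift[OF V Y q] .
 have "is_biproduct C X Y V i' j' p' q'" unfolding is_biproduct_def
 proof (intro conjI V i' j' p' q')
  show "Comp C X V X p' i' = Ident C X" using bp by (intro FMap_inj[of X X])
    (simp_all add: X V FMap_Comp i' p' FMap_Ident S.comp_mor S.Ident_mor is_biproduct_def)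
  show "Comp C Y V Y q' j' = Ident C Y" using bp by (intro FMap_inj[of Y Y])
    (simp_all add: Y V FMap_Comp j' q' FMap_Ident S.comp_mor S.Ident_mor is_biproduct_def)
  show "Comp C X V Y q' i' = (zero (Hom C X Y))" using bp by (intro FMap_inj[of X Y])
    (simp_all add: X Y V FMap_Comp i' q' FMap_zero S.comp_mor S.zero_mor is_biproduct_def)
  show "Comp C Y V X p' j' = (zero (Hom C Y X))" using bp by (intro FMap_inj[of Y X])
    (simp_all add: X Y V FMap_Comp j' p' FMap_zero S.comp_mor S.zero_mor is_biproduct_def)
  show "Comp C V X V i' p' +[Hom C V V] Comp C V Y V j' q' = Ident C V" using bp by (intro FMap_inj[of V V])
    (simp_all add: X Y V FMap_Comp FMap_add i' p' j' q' FMap_Ident S.comp_mor S.Ident_mor vs_add[OF S.Hom_module] is_biproduct_def)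
 qed
 thus "\<exists>S i j p q. is_biproduct C X Y S i j p q" by blast
next
 fix X Y f assume X: "X : Obj C" and Y: "Y : Obj C"
 interpret op: equivalence_functor "op_cat C" "op_cat D" "\<lparr>FObj = FObj F, FMap = (%X Y. FMap F Y X)\<rparr>" by (rule equivalence_functor_op)
 show "\<exists>A i. is_kernel C X Y f A i" if "f : mor C X Y" by (rule kernel_transport[OF ker X Y that])
 show "\<exists>B p. is_cokernel C X Y f B p" if "f : mor C X Y"
  unfolding cokernel_op by (rule op.kernel_transport) (use cok X Y that in \<open>simp_all add: cokernel_op\<close>)
 show "\<exists>Z \<in> Obj C. \<exists>g \<in> mor C Y Z. is_kernel C Y Z g X f" if "is_mono C X Y f"
  by (rule mono_normal_transport[OF mono X Y that])
 show "\<exists>Z \<in> Obj C. \<exists>g \<in> mor C Z X. is_cokernel C Z X g Y f" if "is_epi C X Y f"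
  using op.mono_normal_transport[of Y X f] epi X Y that by (simp add: cokernel_op epi_op)
qed

end

lemma equivalence_functorI: "ff_functor C D F ==> ess_surj C D F ==> equivalence_functor C D F"
 by (auto simp: ff_functor_def ess_surj_def equivalence_functor_def equivalence_functor_axioms_def)

section \<open>Chords of the circle\<close>

type_synonym lift = "real \<times> real"

text \<open>
 The action of \<open>F\<^sup>k\<close> on lifts of chords; an odd power exchanges the two ends.
\<close>

definition turn :: "int => lift => lift" where
 "turn k x = (if even k then (fst x + of_int k, snd x + of_int k)
   else (snd x + of_int k - 1, fst x + of_int k + 1))"

definition chord :: "lift => bool" where
 "chord x \<longleftrightarrow> fst x < snd x & snd x < fst x + 2"

definition crosses :: "lift => lift => bool" where
 "crosses x l \<longleftrightarrow> fst x < fst l & fst l < snd x & snd x < snd l & snd l < fst x + 2"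

definition lift_hom :: "lift => lift => bool" where
 "lift_hom x y \<longleftrightarrow> fst x <= fst y & fst y < snd x & snd x <= snd y & snd y < fst x + 2"

lemma turn_0 [simp]: "turn 0 x = x" by (simp add: turn_def)

lemma turn_turn [simp]: "turn j (turn k x) = turn (j + k) x" by (auto simp: turn_def)

lemma turn_1: "turn 1 x = (snd x, fst x + 2)" by (simp add: turn_def)

lemma turn_m1: "turn (-1) x = (snd x - 2, fst x)" by (simp add: turn_def)

lemma chord_turn [simp]: "chord (turn k x) = chord x" by (auto simp: turn_def chord_def)

lemma crosses_turn [simp]: "crosses (turn k x) (turn k l) = crosses x l" by (auto simp: turn_def crosses_def)

lemma lift_hom_turn [simp]: "lift_hom (turn k x) (turn k l) = lift_hom x l" by (auto simp: turn_def lift_hom_def)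

lemma crosses_swap: "crosses x l \<longleftrightarrow> crosses l (turn 1 x)" by (auto simp: turn_def crosses_def)

lemma turn_inj: "turn k x = turn k y \<longleftrightarrow> x = y" by (metis turn_turn turn_0 ab_left_minus)

lemma crosses_turn_left: "crosses (turn k x) l \<longleftrightarrow> crosses x (turn (- k) l)" using crosses_turn[of k x "turn (- k) l"] by simp

lemma crosses_unique_0:
 assumes "crosses x l" "crosses x (turn k l)"
 shows "k = 0"
proof (cases "even k")
 case True
 then obtain n where n: "k = 2 * n" by blast
 from assms have "-1 < real_of_int n" "real_of_int n < 1" by (auto simp: crosses_def turn_def n)
 thus ?thesis using n by simp
next
 case False
 then obtain n where n: "k = 2 * n + 1" by (metis oddE)
 from assms have "-1 < real_of_int n" "real_of_int n < 0" by (auto simp: crosses_def turn_def n)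
 hence "-1 < n" "n < 0" by simp_all
 thus ?thesis by simp
qed

lemma lift_hom_unique_0:
 assumes "lift_hom x l" "lift_hom x (turn k l)"
 shows "k = 0"
proof (cases "even k")
 case True
 then obtain n where n: "k = 2 * n" by blast
 from assms have "-1 < real_of_int n" "real_of_int n < 1" by (auto simp: lift_hom_def turn_def n)
 thus ?thesis using n by simp
next
 case False
 then obtain n where n: "k = 2 * n + 1" by (metis oddE)
 from assms have "-1 < real_of_int n" "real_of_int n < 0" by (auto simp: lift_hom_def turn_def n)
 hence "-1 < n" "n < 0" by simp_all
 thus ?thesis by simp
qed

lemma lift_hom_unique: "lift_hom x (turn j l) ==> lift_hom x (turn k l) ==> j = k" using lift_hom_unique_0[of x "turn j l" "k - j"] by simp

lemma lift_hom_refl: "chord x ==> lift_hom x x" by (auto simp: lift_hom_def chord_def)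

section \<open>The dyadic triangulation\<close>

fun iv :: "tvertex => lift" where
 "iv (s, []) = (if s then (1, 2) else (0, 1))"
| "iv (s, b # p) = (if b then (fst (iv (s, p)), (fst (iv (s, p)) + snd (iv (s, p))) / 2)
   else ((fst (iv (s, p)) + snd (iv (s, p))) / 2, snd (iv (s, p))))"

text \<open>
 Every tree edge is the edge above a vertex \<open>v\<close>, which carries a dyadic interval; its lifts are the
 lifts of the chord spanned by this interval.
\<close>

definition lifts :: "qvertex => lift set" where
 "lifts e = {turn k (iv v) | k v. tedge v Up = e}"

definition dyadic :: "real => bool" where
 "dyadic r \<longleftrightarrow> (\<exists>(m::int) (n::nat). r = of_int m / 2 ^ n)"

lemma iv_dyadic:
 "\<exists>m::int. 0 <= m & m < 2 ^ Suc (length p) &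
   iv (s, p) = (of_int m / 2 ^ length p, (of_int m + 1) / 2 ^ length p)"
proof (induction p)
 case Nil
 show ?case by (cases s) (auto intro: exI[of _ 1] exI[of _ 0])
next
 case (Cons b p)
 then obtain m :: int where m: "0 <= m" "m < 2 ^ Suc (length p)"
  "iv (s, p) = (of_int m / 2 ^ length p, (of_int m + 1) / 2 ^ length p)" by blast
 have mid: "(of_int m / 2 ^ length p + (of_int m + 1) / 2 ^ length p) / 2 = (2 * of_int m + 1 :: real) / 2 ^ Suc (length p)"
  by (simp add: field_simps)
 show ?case
 proof (cases b)
  case True
  with m mid show ?thesis by (intro exI[of _ "2 * m"]) (simp add: field_simps)
 next
  case False
  with m mid show ?thesis by (intro exI[of _ "2 * m + 1"]) (simp add: field_simps)
 qed
qed

lemma iv_onto: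
 assumes "0 <= m" "m < 2 ^ Suc n"
 shows "\<exists>v. length (snd v) = n & iv v = (of_int m / 2 ^ n, (of_int m + 1) / 2 ^ n)" using assms
proof (induction n arbitrary: m)
 case 0
 hence "m = 0 | m = 1" by auto
 thus ?case by (auto intro: exI[of _ "(False, [])"] exI[of _ "(True, [])"])
next
 case (Suc n)
 have "0 <= m div 2" "m div 2 < 2 ^ Suc n" using Suc.prems by auto
 from Suc.IH[OF this] obtain s p where v: "length p = n"
  "iv (s, p) = (of_int (m div 2) / 2 ^ n, (of_int (m div 2) + 1) / 2 ^ n)" by auto
 have mid: "(of_int (m div 2) / 2 ^ n + (of_int (m div 2) + 1) / 2 ^ n) / 2 = (2 * of_int (m div 2) + 1 :: real) / 2 ^ Suc n"
  by (simp add: field_simps)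
 show ?case
 proof (cases "even m")
  case True
  hence "real_of_int m = 2 * of_int (m div 2)" by (metis dvd_mult_div_cancel of_int_mult of_int_numeral)
  thus ?thesis using v mid by (intro exI[of _ "(s, True # p)"]) (simp add: field_simps)
 next
  case False
  hence "real_of_int m = 2 * of_int (m div 2) + 1" by (metis odd_two_times_div_two_succ of_int_add of_int_mult of_int_numeral of_int_1)
  thus ?thesis using v mid by (intro exI[of _ "(s, False # p)"]) (simp add: field_simps)
 qed
qed

lemma iv_less: "fst (iv v) < snd (iv v)" "snd (iv v) <= fst (iv v) + 1"
proof -
 obtain s p where v: "v = (s, p)" by (cases v)
 obtain m :: int where m: "iv v = (of_int m / 2 ^ length p, (of_int m + 1) / 2 ^ length p)" using iv_dyadic[of p s] v by auto
 show "fst (iv v) < snd (iv v)" by (simp add: m field_simps)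
 show "snd (iv v) <= fst (iv v) + 1" by (simp add: m field_simps)
qed

lemma dyadic_interval_no_inner:
 fixes m m' :: int
 assumes "n' <= n" "of_int m / 2 ^ n < (of_int m' / 2 ^ n' :: real)"
  "of_int m' / 2 ^ n' < (of_int m + 1) / (2 ^ n :: real)"
 shows False
proof -
 have "(of_int m' / 2 ^ n' :: real) = of_int (m' * 2 ^ (n - n')) / 2 ^ n" using assms(1) by (simp add: field_simps power_add[symmetric])
 hence "real_of_int m < of_int (m' * 2 ^ (n - n'))" "real_of_int (m' * 2 ^ (n - n')) < of_int (m + 1)"
  using assms(2,3) by (simp_all add: divide_less_cancel)
 hence "m < m' * 2 ^ (n - n')" "m' * 2 ^ (n - n') < m + 1" by (simp_all only: of_int_less_iff)
 thus False by simp
qed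

lemma pow2_eq_1: "(2::real) ^ length p = 1 ==> p = []" using power_inject_exp[of "2::real" "length p" 0] by simp

lemma iv_inj: "iv v = iv w ==> v = w"
proof (induction "snd v" arbitrary: v w)
 case Nil
 then obtain s where v: "v = (s, [])" by (metis prod.collapse)
 note 1 = Nil.prems[unfolded v]
 obtain s' p' where w: "w = (s', p')" by (cases w)
 obtain m :: int where m: "iv w = (of_int m / 2 ^ length p', (of_int m + 1) / 2 ^ length p')" using iv_dyadic[of p' s'] w by auto
 have "snd (iv w) - fst (iv w) = 1" using 1 by (auto split: if_splits simp: prod_eq_iff)
 hence "(2::real) ^ length p' = 1" by (simp add: m field_simps)
 hence "p' = []" using pow2_eq_1 by blast
 thus ?case using 1 w v by (auto split: if_splits)
next
 case (Cons b p)
 then obtain s where v: "v = (s, b # p)" by (metis prod.collapse)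
 note 2 = Cons.hyps(1) Cons.prems[unfolded v]
 obtain s' q where w: "w = (s', q)" by (cases w)
 have len: "snd (iv (s, b # p)) - fst (iv (s, b # p)) = 1 / 2 ^ Suc (length p)" for s b p
  using iv_dyadic[of "b # p" s] by (auto simp: field_simps simp del: iv.simps)
 have half: "snd (iv (s, p)) - fst (iv (s, p)) = 1 / 2 ^ length p" for s p using iv_dyadic[of p s] by (auto simp: field_simps simp del: iv.simps)
 have "1 / 2 ^ Suc (length p) = (1 / 2 ^ length q :: real)" using 2(2) len[of s b p] half[of s' q] w by metis
 hence "(2::real) ^ length q = 2 ^ Suc (length p)" by (metis div_by_1 divide_divide_eq_right mult_1)
 hence lq: "length q = Suc (length p)" using power_inject_exp[of "2::real" "length q" "Suc (length p)"] by (simp del: power_Suc)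
 then obtain b' p' where q: "q = b' # p'" "length p' = length p" by (cases q) auto
 obtain m :: int where m: "iv (s, p) = (of_int m / 2 ^ length p, (of_int m + 1) / 2 ^ length p)" using iv_dyadic[of p s] by auto
 obtain m' :: int where m': "iv (s', p') = (of_int m' / 2 ^ length p, (of_int m' + 1) / 2 ^ length p)" using iv_dyadic[of p' s'] q by auto
 have mid: "(of_int m / 2 ^ length p + (of_int m + 1) / 2 ^ length p) / 2 = (of_int (2 * m + 1) :: real) / 2 ^ Suc (length p)" for m :: int
  by (simp add: field_simps)
 have lo: "of_int m / 2 ^ length p = (of_int (2 * m) :: real) / 2 ^ Suc (length p)" for m :: int by (simp add: field_simps)
 have cancel: "of_int i / 2 ^ Suc (length p) = (of_int j :: real) / 2 ^ Suc (length p) \<longleftrightarrow> i = j" for i j :: int by simp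
 have "fst (iv (s, b # p)) = of_int (if b then 2 * m else 2 * m + 1) / 2 ^ Suc (length p)"
  by (cases b, simp_all only: iv.simps if_True if_False fst_conv snd_conv m mid, simp add: field_simps)
 moreover have "fst (iv (s', b' # p')) = of_int (if b' then 2 * m' else 2 * m' + 1) / 2 ^ Suc (length p)"
  by (cases b', simp_all only: iv.simps if_True if_False fst_conv snd_conv m' mid, simp add: field_simps)
 moreover have "fst (iv (s, b # p)) = fst (iv (s', b' # p'))" using 2(2) by (simp only: w q)
 ultimately have "(if b then 2 * m else 2 * m + 1) = (if b' then 2 * m' else 2 * m' + 1)" by (simp only: cancel)
 hence mm: "m' = m" and bb: "b' = b" by (cases b; cases b'; simp; presburger)+
 have "iv (s, p) = iv (s', p')" by (simp only: m m' mm)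
 hence "(s, p) = (s', p')" using 2(1)[of "(s, p)" "(s', p')"] by simp
 thus ?case by (simp add: v w q bb)
qed

lemma tedge_Up_eq: "tedge v Up = tedge w Up \<longleftrightarrow> v = w | (snd v = [] & snd w = [])"
proof -
 obtain s p where v: "v = (s, p)" by (cases v)
 obtain s' p' where w: "w = (s', p')" by (cases w)
 show ?thesis by (cases p; cases p') (auto simp: v w tedge_def doubleton_eq_iff dest: arg_cong[of _ _ length])
qed

lemma tedge_child:
 "tedge (s, p) Right_Child = tedge (s, True # p) Up" "tedge (s, p) Left_Child = tedge (s, False # p) Up" by (auto simp: tedge_def)

lemma Q0_Up: "e : Q0 ==> \<exists>v. e = tedge v Up"
proof -
 assume "e : Q0"
 then obtain s p d where "e = tedge (s, p) d" by (auto simp: Q0_def)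
 thus ?thesis using tedge_child[of s p] by (cases d) auto
qed

lemma tedge_Q0 [simp]: "tedge v d : Q0"
 unfolding Q0_def by blast

lemma src_tgt_Q0 [simp]: "src a : Q0" "tgt a : Q0" by (cases a; simp)+

lemma lifts_turn: "l : lifts e ==> turn k l : lifts e" by (auto simp: lifts_def) (metis turn_turn)

lemma iv_lifts: "iv v : lifts (tedge v Up)"
 unfolding lifts_def using turn_0[of "iv v", symmetric] by blast

lemma iv_root: "iv (True, []) = turn 1 (iv (False, []))" "iv (False, []) = turn (-1) (iv (True, []))" by (simp_all add: turn_def)

lemma lifts_orbit: "l : lifts e ==> l' : lifts e ==> \<exists>k. l' = turn k l"
proof -
 assume "l : lifts e" "l' : lifts e"
 then obtain j v k w where l: "l = turn j (iv v)" "l' = turn k (iv w)" and "tedge v Up = tedge w Up" by (auto simp: lifts_def)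
 then consider "v = w" | "snd v = []" "snd w = []" "v ~= w" by (auto simp: tedge_Up_eq)
 hence "\<exists>i. iv w = turn i (iv v)"
 proof cases
  case 1
  thus ?thesis by (metis turn_0)
 next
  case 2
  obtain s s' where vw: "v = (s, [])" "w = (s', [])" using 2 by (metis prod.collapse)
  hence "s' = (\<not> s)" using 2(3) by auto
  thus ?thesis using vw iv_root by (cases s) metis+
 qed
 then obtain i where "iv w = turn i (iv v)" by blast
 hence "l' = turn (k + i - j) l" by (simp add: l)
 thus ?thesis by blast
qed

lemma lifts_Q0: "l : lifts e ==> e : Q0" by (auto simp: lifts_def)

lemma iv_bounds: "0 <= fst (iv v)" "snd (iv v) <= 2"
proof -
 obtain s p where v: "v = (s, p)" by (cases v)
 obtain m :: int where m: "0 <= m" "m < 2 ^ Suc (length p)" "iv v = (of_int m / 2 ^ length p, (of_int m + 1) / 2 ^ length p)"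
  using iv_dyadic[of p s] v by auto
 show "0 <= fst (iv v)" using m by simp
 have "m + 1 <= 2 * 2 ^ length p" using m by simp
 hence "real_of_int (m + 1) <= of_int (2 * 2 ^ length p)" by (rule of_int_le_iff[THEN iffD2])
 thus "snd (iv v) <= 2" using m by (simp add: field_simps)
qed

lemma lifts_inj:
 assumes "l : lifts e" "l : lifts e'"
 shows "e = e'"
proof -
 obtain j v k w where l: "l = turn j (iv v)" "l = turn k (iv w)" and e: "tedge v Up = e" "tedge w Up = e'" using assms unfolding lifts_def by blast
 hence eq: "iv w = turn (j - k) (iv v)" by (metis (no_types, opaque_lifting) turn_turn turn_inj add.commute diff_add_cancel)
 show ?thesis
 proof (cases "even (j - k)")
  case True
  then obtain n where n: "j - k = 2 * n" by blast
  have "fst (iv w) = fst (iv v) + 2 * of_int n" "snd (iv w) = snd (iv v) + 2 * of_int n" using eq by (simp_all add: turn_def n)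
  hence "-1 < real_of_int n" "real_of_int n < 1" using iv_bounds[of v] iv_bounds[of w] iv_less[of v] iv_less[of w] by linarith+
  hence "n = 0" by simp
  hence "v = w" using eq n iv_inj[of v w] by simp
  thus ?thesis using e by simp
 next
  case False
  hence f: "fst (iv w) = snd (iv v) + of_int (j - k) - 1" "snd (iv w) = fst (iv v) + of_int (j - k) + 1" using eq by (simp_all add: turn_def)
  hence len: "snd (iv w) - fst (iv w) = 1" "snd (iv v) - fst (iv v) = 1" using iv_less(2)[of v] iv_less(2)[of w] by linarith+
  have root: "snd v = []" if "snd (iv v) - fst (iv v) = 1" for v
  proof -
   obtain s p where v: "v = (s, p)" by (cases v)
   obtain m :: int where m: "iv v = (of_int m / 2 ^ length p, (of_int m + 1) / 2 ^ length p)" using iv_dyadic[of p s] v by auto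
   have "(2::real) ^ length p = 1" using that by (simp add: m field_simps)
   thus ?thesis using v pow2_eq_1 by simp
  qed
  show ?thesis using root[OF len(1)] root[OF len(2)] e tedge_Up_eq by metis
 qed
qed

lemma lifts_chord: "l : lifts e ==> chord l"
proof -
 have "chord (iv v)" for v using iv_less[of v] by (auto simp: chord_def)
 thus "l : lifts e ==> chord l" by (auto simp: lifts_def)
qed

lemma dyadic_intervals_noncrossing:
 fixes m m' :: int
 shows "\<not> crosses (of_int m / 2 ^ n, (of_int m + 1) / 2 ^ n) (of_int m' / 2 ^ n', (of_int m' + 1) / 2 ^ n')"
proof
 assume c: "crosses (of_int m / 2 ^ n, (of_int m + 1) / 2 ^ n) (of_int m' / 2 ^ n', (of_int m' + 1) / 2 ^ n')"
 show False
 proof (cases "n' <= n")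
  case True
  thus False using dyadic_interval_no_inner[of n' n m m'] c by (auto simp: crosses_def)
 next
  case False
  thus False using dyadic_interval_no_inner[of n n' m' "m + 1"] c by (auto simp: crosses_def)
 qed
qed

lemma noncrossing:
 assumes "l : lifts e" "l' : lifts e'"
 shows "\<not> crosses l l'"
proof
 assume c: "crosses l l'"
 obtain j v k w where l: "l = turn j (iv v)" "l' = turn k (iv w)" using assms by (auto simp: lifts_def)
 have *: "\<not> crosses (iv v) (turn (2 * n) (iv w))" for n v w
 proof -
  obtain s p where v: "v = (s, p)" by (cases v)
  obtain s' p' where w: "w = (s', p')" by (cases w)
  obtain m :: int where m: "iv v = (of_int m / 2 ^ length p, (of_int m + 1) / 2 ^ length p)" using iv_dyadic[of p s] v by auto
  obtain m' :: int where m': "iv w = (of_int m' / 2 ^ length p', (of_int m' + 1) / 2 ^ length p')" using iv_dyadic[of p' s'] w by auto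
  have "turn (2 * n) (iv w) = (of_int (m' + 2 * n * 2 ^ length p') / 2 ^ length p', (of_int (m' + 2 * n * 2 ^ length p') + 1) / 2 ^ length p')"
   by (simp add: m' turn_def field_simps)
  thus ?thesis using m dyadic_intervals_noncrossing by metis
 qed
 have c': "crosses (iv v) (turn (k - j) (iv w))" using c crosses_turn[of "- j" l l'] by (simp add: l)
 show False
 proof (cases "even (k - j)")
  case True
  then obtain n where "k - j = 2 * n" by blast
  thus False using * c' by metis
 next
  case False
  then obtain n where n: "k - j = 2 * n + 1" by (metis oddE)
  have "crosses (turn (2 * n + 1) (iv w)) (turn 1 (iv v))" using c' crosses_swap n by metis
  hence "crosses (iv w) (turn (2 * (- n)) (iv v))" using crosses_turn[of "- (2 * n + 1)" "turn (2 * n + 1) (iv w)" "turn 1 (iv v)"] by simp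
  thus False using * by metis
 qed
qed

subsection \<open>Triangles and arrows\<close>

definition arrow_lift :: "qarrow => real => real => real => bool" where
 "arrow_lift a p q r \<longleftrightarrow> p < q & q < r & r < p + 2 & (q, r) : lifts (src a) & (p, r) : lifts (tgt a) &
   (p, q) : lifts (tgt (fst a, clockwise (snd a)))"

lemma clockwise3 [simp]: "clockwise (clockwise (clockwise d)) = d" by (cases d) auto

lemma arrow_lift_next: "arrow_lift a p q r ==> arrow_lift (fst a, clockwise (snd a)) q r (p + 2)"
 using lifts_turn[of "(p, r)" _ 1] lifts_turn[of "(p, q)" _ 1] by (cases a) (auto simp: arrow_lift_def turn_1)

lemma arrow_lift_shift: "arrow_lift a p q r ==> arrow_lift a (p + 2 * of_int n) (q + 2 * of_int n) (r + 2 * of_int n)"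
 using lifts_turn[of "(p, r)" _ "2 * n"] lifts_turn[of "(p, q)" _ "2 * n"] lifts_turn[of "(q, r)" _ "2 * n"] by (auto simp: arrow_lift_def turn_def)

lemma arrow_lift_Left:
 "arrow_lift (v, Left_Child) (fst (iv v)) ((fst (iv v) + snd (iv v)) / 2) (snd (iv v))"
proof -
 obtain s p where v: "v = (s, p)" by (cases v)
 show ?thesis using iv_less[of v] iv_lifts[of v] iv_lifts[of "(s, True # p)"] iv_lifts[of "(s, False # p)"]
  by (simp add: arrow_lift_def v tedge_child)
qed

lemma arrow_lift_ex: "\<exists>p q r. arrow_lift a p q r"
proof -
 obtain v d where a: "a = (v, d)" by (cases a)
 note 1 = arrow_lift_Left[of v]
 note 2 = arrow_lift_next[OF 1]
 note 3 = arrow_lift_next[OF 2]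
 show ?thesis using 1 2 3 by (cases d) (auto simp: a)
qed

text \<open>Every side of every chord of the triangulation carries a triangle.\<close>

lemma apex:
 assumes "(s, t) : lifts e"
 obtains v d w where "arrow_lift (v, d) s w t" "e = tgt (v, d)"
proof -
 obtain k v where k: "(s, t) = turn k (iv v)" and e: "tedge v Up = e" using assms by (auto simp: lifts_def)
 have even: "\<exists>a w. arrow_lift a s w t & tedge v Up = tgt a" if "even k" "(s, t) = turn k (iv v)" for k v s t
 proof -
  from that obtain n where n: "k = 2 * n" by blast
  have "arrow_lift (v, Left_Child) s ((fst (iv v) + snd (iv v)) / 2 + 2 * of_int n) t"
   using arrow_lift_shift[OF arrow_lift_Left[of v], of n] that by (simp add: turn_def n)
  moreover have "tedge v Up = tgt (v, Left_Child)" by simp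
  ultimately show ?thesis by blast
 qed
 have "\<exists>a w. arrow_lift a s w t & tedge v Up = tgt a"
 proof (cases "even k")
  case True
  thus ?thesis using even k by blast
 next
  case False
  then obtain n where n: "k = 2 * n + 1" by (metis oddE)
  have st: "s = snd (iv v) + 2 * of_int n" "t = fst (iv v) + 2 * of_int n + 2" using k n by (auto simp: turn_def)
  obtain r p where v: "v = (r, p)" by (cases v)
  show ?thesis
  proof (cases p)
   case Nil
   hence "\<exists>k' v'. even k' & (s, t) = turn k' (iv v') & tedge v' Up = tedge v Up"
   proof (cases r)
    case True
    thus ?thesis using st v Nil by (intro exI[of _ "2 * n + 2"] exI[of _ "(False, [])"]) (simp add: turn_def tedge_Up_eq)
   next
    case False
    thus ?thesis using st v Nil by (intro exI[of _ "2 * n"] exI[of _ "(True, [])"]) (simp add: turn_def tedge_Up_eq)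
   qed
   thus ?thesis using even by metis
  next
   case (Cons b q)
   let ?u = "(r, q)"
   note 1 = arrow_lift_Left[of ?u]
   note 2 = arrow_lift_next[OF 1, simplified]
   note 3 = arrow_lift_next[OF 2, simplified]
   show ?thesis
   proof (cases b)
    case True
    have "arrow_lift (?u, Up) s (snd (iv ?u) + 2 * of_int n) t" using arrow_lift_shift[OF 2, of n] st v Cons True by (simp add: add_ac)
    thus ?thesis using v Cons True tedge_child by (intro exI[of _ "(?u, Up)"]) auto
   next
    case False
    have "arrow_lift (?u, Right_Child) s (fst (iv ?u) + 2 + 2 * of_int n) t"
     using arrow_lift_shift[OF 3, of n] st v Cons False by (simp add: add_ac)
    thus ?thesis using v Cons False tedge_child by (intro exI[of _ "(?u, Right_Child)"]) auto
   qed
  qed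
 qed
 thus thesis using that e by (metis prod.collapse)
qed

subsection \<open>Supports of chords\<close>

definition cr :: "lift => qvertex set" where
 "cr x = {e. \<exists>l \<in> lifts e. crosses x l}"

definition common :: "lift => lift => qvertex set" where
 "common x y = {e. \<exists>l \<in> lifts e. crosses x l & crosses y l}"

lemma cr_turn [simp]: "cr (turn k x) = cr x"
proof -
 have "cr (turn k x) \<subseteq> cr x" for k x using lifts_turn[of _ _ "-k"] by (auto simp: cr_def crosses_turn_left)
 from this[of k x] this[of "-k" "turn k x"] show ?thesis by auto
qed

lemma cr_Q0: "cr x \<subseteq> Q0" using lifts_Q0 by (auto simp: cr_def)

lemma common_subset: "common x y \<subseteq> cr x" "common x y \<subseteq> cr y" by (auto simp: common_def cr_def)

lemma crI: "l : lifts e ==> crosses x l ==> e : cr x" by (auto simp: cr_def)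

lemma commonI: "l : lifts e ==> crosses x l ==> crosses y l ==> e : common x y" by (auto simp: common_def)

lemma cr_lift_unique: "l : lifts e ==> l' : lifts e ==> crosses x l ==> crosses x l' ==> l = l'"
 using lifts_orbit[of l e l'] crosses_unique_0[of x l] turn_0 by metis

lemma common_iff: "l : lifts e ==> crosses x l ==> e : common x y \<longleftrightarrow> crosses y l"
 unfolding common_def using cr_lift_unique[of l e _ x] by blast

lemma common_turn [simp]: "common (turn k x) (turn k y) = common x y"
proof -
 have "common (turn k x) (turn k y) \<subseteq> common x y" for k x y using lifts_turn[of _ _ "-k"] by (auto simp: common_def crosses_turn_left)
 from this[of k x y] this[of "-k" "turn k x" "turn k y"] show ?thesis by auto
qed

lemma crosses_tgt_upper:
 assumes "crosses y (q, r)" "p < q" "r < p + 2" "crosses y (turn k (p, r))"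
 shows "k = 0"
proof (cases "even k")
 case True
 then obtain n where n: "k = 2 * n" by blast
 from assms have "-1 < real_of_int n" "real_of_int n < 1" by (auto simp: crosses_def turn_def n)
 thus ?thesis using n by simp
next
 case False
 then obtain n where n: "k = 2 * n + 1" by (metis oddE)
 from assms have "-1 < real_of_int n" "real_of_int n < 0" by (auto simp: crosses_def turn_def n)
 hence "-1 < n" "n < 0" by simp_all
 thus ?thesis by simp
qed

lemma crosses_tgt_lower:
 assumes "crosses y (r - 2, q)" "p < q" "r < p + 2" "crosses y (turn k (p, r))"
 shows "k = -1"
proof -
 have "crosses (turn 1 y) (q, r)" using assms(1) by (auto simp: crosses_def turn_1)
 moreover have "crosses (turn 1 y) (turn (k + 1) (p, r))" using assms(4) crosses_turn[of 1 y "turn k (p, r)"] by (simp add: add_ac)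
 ultimately show ?thesis using crosses_tgt_upper[of "turn 1 y" q r p "k + 1"] assms(2,3) by simp
qed

lemma src_lift_cases:
 assumes "src a : cr x"
 obtains p q r where "arrow_lift a p q r" "crosses x (q, r)"
 | p q r where "arrow_lift a p q r" "crosses x (r - 2, q)"
proof -
 obtain p q r where a: "arrow_lift a p q r" using arrow_lift_ex by blast
 obtain l where l: "l : lifts (src a)" "crosses x l" using assms by (auto simp: cr_def)
 obtain k where k: "l = turn k (q, r)" using lifts_orbit[OF _ l(1), of "(q, r)"] a by (auto simp: arrow_lift_def)
 show thesis
 proof (cases "even k")
  case True
  then obtain n where n: "k = 2 * n" by blast
  thus thesis using that(1)[OF arrow_lift_shift[OF a, of n]] l k by (simp add: turn_def)
 next
  case False
  then obtain n where n: "k = 2 * n + 1" by (metis oddE)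
  thus thesis using that(2)[OF arrow_lift_shift[OF a, of "n + 1"]] l k by (simp add: turn_def add_ac)
 qed
qed

lemma arrow_lift_tgt_cr:
 assumes a: "arrow_lift a p q r" and l: "l : lifts (tgt a)" "crosses y l"
 shows "crosses y (q, r) ==> l = (p, r)" "crosses y (r - 2, q) ==> l = (r - 2, p)"
proof -
 obtain k where k: "l = turn k (p, r)" using lifts_orbit[OF _ l(1), of "(p, r)"] a by (auto simp: arrow_lift_def)
 show "crosses y (q, r) ==> l = (p, r)" using crosses_tgt_upper[of y q r p k] l k a by (auto simp: arrow_lift_def)
 show "crosses y (r - 2, q) ==> l = (r - 2, p)" using crosses_tgt_lower[of y r q p k] l k a by (auto simp: arrow_lift_def turn_m1)
qed

text \<open>
 Rotating a chord \<open>x\<close> counterclockwise to \<open>y\<close>, the part of the triangulation crossed all along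
 is closed under successors in the support of \<open>y\<close> and under predecessors in the support of \<open>x\<close>.
\<close>

lemma common_arrow:
 assumes hom: "lift_hom x y" and src: "src a : cr x"
 shows "src a : common x y & tgt a : cr y \<longleftrightarrow> tgt a : common x y" using src
proof (cases rule: src_lift_cases)
 case (1 p q r)
 note a = 1(1) and x = 1(2)
 have E: "(q, r) : lifts (src a)" and F: "(p, r) : lifts (tgt a)" and o: "p < q" "q < r" "r < p + 2" using a by (auto simp: arrow_lift_def)
 have Ey: "src a : common x y \<longleftrightarrow> crosses y (q, r)" by (rule common_iff[OF E x])
 show ?thesis
 proof
  assume *: "src a : common x y & tgt a : cr y"
  hence y: "crosses y (q, r)" using Ey by simp
  from * obtain l where "l : lifts (tgt a)" "crosses y l" by (auto simp: cr_def)
  with arrow_lift_tgt_cr(1)[OF a this y] have "crosses y (p, r)" by simp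
  moreover from this have "crosses x (p, r)" using hom x o by (auto simp: crosses_def lift_hom_def)
  ultimately show "tgt a : common x y" using F by (auto simp: common_def)
 next
  assume *: "tgt a : common x y"
  then obtain l where l: "l : lifts (tgt a)" "crosses x l" "crosses y l" by (auto simp: common_def)
  with arrow_lift_tgt_cr(1)[OF a l(1,2) x] have "crosses y (p, r)" by simp
  hence "crosses y (q, r)" using hom x o by (auto simp: crosses_def lift_hom_def)
  thus "src a : common x y & tgt a : cr y" using Ey * common_subset by blast
 qed
next
 case (2 p q r)
 note a = 2(1) and x = 2(2)
 have E: "(r - 2, q) : lifts (src a)" and F: "(r - 2, p) : lifts (tgt a)" and o: "p < q" "q < r" "r < p + 2"
  using a lifts_turn[of "(q, r)" "src a" "-1"] lifts_turn[of "(p, r)" "tgt a" "-1"] by (auto simp: arrow_lift_def turn_m1)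
 have Ey: "src a : common x y \<longleftrightarrow> crosses y (r - 2, q)" by (rule common_iff[OF E x])
 show ?thesis
 proof
  assume *: "src a : common x y & tgt a : cr y"
  hence y: "crosses y (r - 2, q)" using Ey by simp
  from * obtain l where "l : lifts (tgt a)" "crosses y l" by (auto simp: cr_def)
  with arrow_lift_tgt_cr(2)[OF a this y] have "crosses y (r - 2, p)" by simp
  moreover from this have "crosses x (r - 2, p)" using hom x o by (auto simp: crosses_def lift_hom_def)
  ultimately show "tgt a : common x y" using F by (auto simp: common_def)
 next
  assume *: "tgt a : common x y"
  then obtain l where l: "l : lifts (tgt a)" "crosses x l" "crosses y l" by (auto simp: common_def)
  with arrow_lift_tgt_cr(2)[OF a l(1,2) x] have "crosses y (r - 2, p)" by simp
  hence "crosses y (r - 2, q)" using hom x o by (auto simp: crosses_def lift_hom_def)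
  thus "src a : common x y & tgt a : cr y" using Ey * common_subset by blast
 qed
qed

lemma not_three_sides:
 assumes "src a : cr x" "tgt a : cr x" "tgt (fst a, clockwise (snd a)) : cr x"
 shows False using assms(1)
proof (cases rule: src_lift_cases)
 case (1 p q r)
 have "crosses x (p, r)" using assms(2) arrow_lift_tgt_cr(1)[OF 1(1) _ _ 1(2)] by (auto simp: cr_def)
 moreover obtain l where l: "l : lifts (tgt (fst a, clockwise (snd a)))" "crosses x l" using assms(3) by (auto simp: cr_def)
 moreover have n: "arrow_lift (fst a, clockwise (snd a)) q r (p + 2)" by (rule arrow_lift_next[OF 1(1)])
 ultimately have "l = (p, q)" using arrow_lift_tgt_cr(2)[OF n l] by simp
 thus False using l 1(2) by (auto simp: crosses_def)
next
 case (2 p q r)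
 have x: "crosses x (r - 2, p)" using assms(2) arrow_lift_tgt_cr(2)[OF 2(1) _ _ 2(2)] by (auto simp: cr_def)
 obtain l where l: "l : lifts (tgt (fst a, clockwise (snd a)))" "crosses x l" using assms(3) by (auto simp: cr_def)
 have n: "arrow_lift (fst a, clockwise (snd a)) (q - 2) (r - 2) p" using arrow_lift_shift[OF arrow_lift_next[OF 2(1)], of "-1"] by simp
 have "l = (q - 2, p)" using arrow_lift_tgt_cr(1)[OF n l x] .
 thus False using l 2(2) by (auto simp: crosses_def)
qed

subsection \<open>Morphisms between chords\<close>

lemma dyadic_multiple:
 assumes "dyadic r"
 shows "\<exists>n. \<forall>N\<ge>n. \<exists>m::int. r = of_int m / 2 ^ N"
proof -
 obtain m :: int and n where r: "r = of_int m / 2 ^ n" using assms by (auto simp: dyadic_def)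
 have "r = of_int (m * 2 ^ (N - n)) / 2 ^ N" if "n <= N" for N using that by (simp add: r field_simps power_add[symmetric])
 thus ?thesis by blast
qed

lemma dyadic_interval_lift: "\<exists>e. (of_int m / 2 ^ n, (of_int m + 1) / 2 ^ n) : lifts e"
proof -
 define P :: int where "P = 2 ^ Suc n"
 have "0 <= m mod P" "m mod P < 2 ^ Suc n" by (simp_all add: P_def)
 then obtain v where v: "iv v = (of_int (m mod P) / 2 ^ n, (of_int (m mod P) + 1) / 2 ^ n)" using iv_onto[of "m mod P" n] by blast
 have "of_int m = of_int (m div P * P + m mod P)" by simp
 also have "\<dots> = 2 * of_int (m div P) * 2 ^ n + (of_int (m mod P) :: real)" by (simp add: P_def)
 finally have "turn (2 * (m div P)) (iv v) = (of_int m / 2 ^ n, (of_int m + 1) / 2 ^ n)" by (simp add: turn_def v field_simps)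
 thus ?thesis using lifts_turn[OF iv_lifts[of v], of "2 * (m div P)"] by auto
qed

lemma div_step:
 fixes z P :: int
 assumes "P > 0"
 shows "(z + 1) div P - z div P = (if P dvd z + 1 then 1 else 0)"
proof -
 have "(z + 1) div P = z div P + (if P dvd z + 1 then 1 else 0)"
 proof (cases "z mod P = P - 1")
  case True
  have "(z div P + 1) * P = (z div P * P + z mod P) + 1" unfolding True by (simp add: algebra_simps)
  hence "z + 1 = (z div P + 1) * P" by simp
  thus ?thesis using assms by simp
 next
  case False
  hence r: "0 <= z mod P + 1" "z mod P + 1 < P" using assms pos_mod_bound[of P z] pos_mod_sign[of P z] by linarith+
  have "z + 1 = (z mod P + 1) + z div P * P" using div_mult_mod_eq[of z P] by simp
  hence *: "(z + 1) div P = z div P" "(z + 1) mod P = z mod P + 1"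
   using r assms by (metis add.commute add_0 div_mult_self1 div_pos_pos_trivial less_irrefl, metis mod_mult_self1 mod_pos_pos_trivial)
  hence "\<not> P dvd z + 1" using pos_mod_sign[of P z] assms by (metis dvd_eq_mod_eq_0 add_nonneg_eq_0_iff zero_le_one zero_neq_one)
  thus ?thesis using * by simp
 qed
 thus ?thesis by simp
qed

text \<open>
 A discrete form of the Hex theorem: if the circle is cut into four consecutive arcs, then some
 chord of the triangulation joins two opposite ones. Otherwise the number of cuts between the ends
 of a dyadic interval could not jump from at most one to more while the intervals grow.
\<close>

lemma opposite_arcs_int:
 fixes A B C D :: int and N :: nat
 defines "P \<equiv> 2 * 2 ^ N :: int"
 assumes even: "even A" "even B" "even C" "even D" and N: "N > 0"
  and ord: "A <= C" "C < B" "B <= D" "D < A + P"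
 obtains j i where "j <= N" "\<exists>q. let s = i * 2 ^ j + q * P; t = (i + 1) * 2 ^ j + q * P in
   (A <= s & s <= C & B <= t & t <= D) | (C < s & s < B & D < t & t < A + P) |
   (B <= s & s <= D & A + P <= t & t <= C + P) | (D < s & s < A + P & C + P < t & t < B + P)"
proof -
 define kap where "kap v = (v - A) div P + (v - B) div P - (C - v) div P - (D - v) div P" for v
 have P: "P > 0" by (simp add: P_def)
 have evenP: "even P" by (simp add: P_def)
 have kap_P: "kap (v + q * P) = kap v + 4 * q" for v q
 proof -
  have "(v + q * P - A) div P = (v - A) div P + q" "(v + q * P - B) div P = (v - B) div P + q"
   "(C - (v + q * P)) div P = (C - v) div P - q" "(D - (v + q * P)) div P = (D - v) div P - q"
   using P div_mult_self1[of P "v - A" q] div_mult_self1[of P "v - B" q]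
    div_mult_self1[of P "C - v" "-q"] div_mult_self1[of P "D - v" "-q"] by (simp_all add: algebra_simps)
  thus ?thesis by (simp add: kap_def)
 qed
 have small: "\<not> P dvd z" if "0 < z" "z < P" for z using that zdvd_not_zless by blast
 have step: "kap (v + 1) - kap v <= 1" for v
 proof -
  have "kap (v + 1) - kap v = (if P dvd v + 1 - A then 1 else 0) + (if P dvd v + 1 - B then 1 else 0)
   + (if P dvd C - v then 1 else 0) + (if P dvd D - v then 1 else 0)"
   using div_step[OF P, of "v - A"] div_step[OF P, of "v - B"] div_step[OF P, of "C - v - 1"] div_step[OF P, of "D - v - 1"]
   by (simp add: kap_def algebra_simps)
  moreover have "\<not> (P dvd v + 1 - A & P dvd v + 1 - B)" using small[of "B - A"] ord dvd_diff[of P "v + 1 - A" "v + 1 - B"] by auto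
  moreover have "\<not> (P dvd C - v & P dvd D - v)" using small[of "D - C"] ord dvd_diff[of P "D - v" "C - v"] by auto
  moreover have "odd v" if "P dvd v + 1 - A | P dvd v + 1 - B" using that evenP even by (auto dest: dvd_trans)
  moreover have "even v" if "P dvd C - v | P dvd D - v" using that evenP even by (auto dest: dvd_trans)
  ultimately show ?thesis by (auto split: if_splits)
 qed
 have "\<exists>j i. j <= N & kap ((i + 1) * 2 ^ j) - kap (i * 2 ^ j) = 2"
 proof (rule ccontr)
  assume no: "\<not> ?thesis"
  have "kap ((i + 1) * 2 ^ j) - kap (i * 2 ^ j) <= 1" if "j <= N" for j i using that
  proof (induction j arbitrary: i)
   case 0
   thus ?case using step[of i] by simp
  next
   case (Suc j)
   have "kap ((2 * i + 1) * 2 ^ j) - kap (2 * i * 2 ^ j) <= 1" "kap ((2 * i + 1 + 1) * 2 ^ j) - kap ((2 * i + 1) * 2 ^ j) <= 1"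
    using Suc.IH[of "2 * i"] Suc.IH[of "2 * i + 1"] Suc.prems by simp_all
   hence "kap ((i + 1) * 2 ^ Suc j) - kap (i * 2 ^ Suc j) <= 2" by (simp add: algebra_simps)
   moreover have "kap ((i + 1) * 2 ^ Suc j) - kap (i * 2 ^ Suc j) ~= 2" using no Suc.prems by blast
   ultimately show ?case by linarith
  qed
  from this[of N 0] this[of N 1] have "kap (2 * 2 ^ N) - kap 0 <= 2" by simp
  thus False using kap_P[of 0 1] by (simp add: P_def)
 qed
 then obtain j i where j: "j <= N" and two: "kap ((i + 1) * 2 ^ j) - kap (i * 2 ^ j) = 2" by blast
 define q where "q = - ((i * 2 ^ j - A) div P)"
 define s where "s = i * 2 ^ j + q * P"
 define t where "t = (i + 1) * 2 ^ j + q * P"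
 have s: "A <= s" "s < A + P"
 proof -
  have "s = A + (i * 2 ^ j - A) mod P" using div_mult_mod_eq[of "i * 2 ^ j - A" P] by (simp add: s_def q_def algebra_simps)
  thus "A <= s" "s < A + P" using P by simp_all
 qed
 have "(2::int) ^ j <= 2 ^ N" using j by simp
 moreover have "t - s = 2 ^ j" by (simp add: s_def t_def algebra_simps)
 moreover have "(2::int) ^ j > 0" "(2::int) ^ N > 0" by simp_all
 ultimately have t: "s < t" "t < s + P" unfolding P_def by linarith+
 have kap2: "kap t - kap s = 2" using two by (simp add: s_def t_def kap_P)
 have div0: "z div P = 0" if "0 <= z" "z < P" for z using that by simp
 have divm: "z div P = -1" if "- P <= z" "z < 0" for z
  using that P by (simp add: div_eq_minus1 div_pos_neg_trivial) (smt (verit) div_pos_pos_trivial div_add_self2)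
 have low: "kap v = -1 + (if C < v then 1 else 0) + (if B <= v then 1 else 0) + (if D < v then 1 else 0)"
  if "A <= v" "v < A + P" for v
 proof -
  have "(v - A) div P = 0" using that by simp
  moreover have "(v - B) div P = (if B <= v then 0 else -1)" using that ord div0[of "v - B"] divm[of "v - B"] by auto
  moreover have "(C - v) div P = (if C < v then -1 else 0)" using that ord div0[of "C - v"] divm[of "C - v"] by auto
  moreover have "(D - v) div P = (if D < v then -1 else 0)" using that ord div0[of "D - v"] divm[of "D - v"] by auto
  ultimately show ?thesis by (simp add: kap_def)
 qed
 have high: "kap v = 3 + (if C + P < v then 1 else 0) + (if B + P <= v then 1 else 0) + (if D + P < v then 1 else 0)"
  if "A + P <= v" "v < A + 2 * P" for v using low[of "v - P"] kap_P[of "v - P" 1] that by (simp add: algebra_simps)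
 have "(A <= s & s <= C & B <= t & t <= D) | (C < s & s < B & D < t & t < A + P) |
   (B <= s & s <= D & A + P <= t & t <= C + P) | (D < s & s < A + P & C + P < t & t < B + P)"
 proof (cases "t < A + P")
  case True
  thus ?thesis using low[of s] low[of t] kap2 s t ord by (auto split: if_splits)
 next
  case False
  thus ?thesis using low[of s] high[of t] kap2 s t ord by (auto split: if_splits)
 qed
 thus thesis using that[OF j, of i] by (auto simp: Let_def s_def t_def intro!: exI[of _ q])
qed

lemma lift_hom_factor_or_common:
 assumes hom: "lift_hom (a, b) (c, d)" and dy: "dyadic a" "dyadic b" "dyadic c" "dyadic d"
  and no: "common (a, b) (c, d) = {}"
 obtains s t e where "(s, t) : lifts e" "a <= s" "s <= c" "b <= t" "t <= d"
proof -
 obtain na where na: "!!N. na <= N ==> \<exists>m::int. a = of_int m / 2 ^ N" using dyadic_multiple[OF dy(1)] by blast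
 obtain nb where nb: "!!N. nb <= N ==> \<exists>m::int. b = of_int m / 2 ^ N" using dyadic_multiple[OF dy(2)] by blast
 obtain nc where nc: "!!N. nc <= N ==> \<exists>m::int. c = of_int m / 2 ^ N" using dyadic_multiple[OF dy(3)] by blast
 obtain nd where nd: "!!N. nd <= N ==> \<exists>m::int. d = of_int m / 2 ^ N" using dyadic_multiple[OF dy(4)] by blast
 define M where "M = na + nb + nc + nd"
 obtain A B C D :: int where ABCD: "a = of_int A / 2 ^ M" "b = of_int B / 2 ^ M" "c = of_int C / 2 ^ M" "d = of_int D / 2 ^ M"
  using na[of M] nb[of M] nc[of M] nd[of M] by (auto simp: M_def)
 define N where "N = Suc M"
 have sc: "a = of_int (2 * A) / 2 ^ N" "b = of_int (2 * B) / 2 ^ N" "c = of_int (2 * C) / 2 ^ N" "d = of_int (2 * D) / 2 ^ N"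
  by (simp_all add: ABCD N_def)
 have pow: "(2::real) = of_int (2 * 2 ^ N) / 2 ^ N" by simp
 have le: "of_int x / 2 ^ N <= (of_int y / 2 ^ N :: real) \<longleftrightarrow> x <= y" for x y :: int by (simp add: divide_le_cancel)
 have less: "of_int x / 2 ^ N < (of_int y / 2 ^ N :: real) \<longleftrightarrow> x < y" for x y :: int by (simp add: divide_less_cancel)
 have add: "of_int x / 2 ^ N + 2 = (of_int (x + 2 * 2 ^ N) / 2 ^ N :: real)" for x :: int by (simp add: field_simps)
 have ord: "2 * A <= 2 * C" "2 * C < 2 * B" "2 * B <= 2 * D" "2 * D < 2 * A + 2 * 2 ^ N"
  using hom unfolding lift_hom_def fst_conv snd_conv sc add le less by auto
 obtain j i where j: "j <= N" and "\<exists>q. let s = i * 2 ^ j + q * (2 * 2 ^ N); t = (i + 1) * 2 ^ j + q * (2 * 2 ^ N) in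
   (2*A <= s & s <= 2*C & 2*B <= t & t <= 2*D) | (2*C < s & s < 2*B & 2*D < t & t < 2*A + 2 * 2 ^ N) |
   (2*B <= s & s <= 2*D & 2*A + 2 * 2 ^ N <= t & t <= 2*C + 2 * 2 ^ N) | (2*D < s & s < 2*A + 2 * 2 ^ N & 2*C + 2 * 2 ^ N < t & t < 2*B + 2 * 2 ^ N)"
  by (rule opposite_arcs_int[of "2*A" "2*B" "2*C" "2*D" N]) (use ord in \<open>auto simp: N_def\<close>)
 then obtain q where q: "let s = i * 2 ^ j + q * (2 * 2 ^ N); t = (i + 1) * 2 ^ j + q * (2 * 2 ^ N) in
   (2*A <= s & s <= 2*C & 2*B <= t & t <= 2*D) | (2*C < s & s < 2*B & 2*D < t & t < 2*A + 2 * 2 ^ N) |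
   (2*B <= s & s <= 2*D & 2*A + 2 * 2 ^ N <= t & t <= 2*C + 2 * 2 ^ N) | (2*D < s & s < 2*A + 2 * 2 ^ N & 2*C + 2 * 2 ^ N < t & t < 2*B + 2 * 2 ^ N)"
  by blast
 define S where "S = i * 2 ^ j + q * (2 * 2 ^ N)"
 define T where "T = (i + 1) * 2 ^ j + q * (2 * 2 ^ N)"
 define s :: real where "s = of_int S / 2 ^ N"
 define t :: real where "t = of_int T / 2 ^ N"
 have "\<exists>e. (s, t) : lifts e"
 proof -
  have pw: "(2::real) ^ N = 2 ^ j * 2 ^ (N - j)" using j by (simp add: power_add[symmetric])
  have "s = of_int (i + q * (2 * 2 ^ (N - j))) / 2 ^ (N - j)" "t = (of_int (i + q * (2 * 2 ^ (N - j))) + 1) / 2 ^ (N - j)"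
   by (simp_all add: s_def t_def S_def T_def pw field_simps)
  thus ?thesis using dyadic_interval_lift by metis
 qed
 then obtain e where e: "(s, t) : lifts e" by blast
 have "(a <= s & s <= c & b <= t & t <= d) | (c < s & s < b & d < t & t < a + 2) |
   (b <= s & s <= d & a + 2 <= t & t <= c + 2) | (d < s & s < a + 2 & c + 2 < t & t < b + 2)"
  using q unfolding Let_def S_def[symmetric] T_def[symmetric] s_def t_def sc add le less by simp
 then consider "a <= s & s <= c & b <= t & t <= d" | "c < s & s < b & d < t & t < a + 2"
  | "b <= s & s <= d & a + 2 <= t & t <= c + 2" | "d < s & s < a + 2 & c + 2 < t & t < b + 2" by blast
 thus thesis
 proof cases
  case 1
  thus thesis using that e by blast
 next
  case 2
  hence "crosses (a, b) (s, t)" "crosses (c, d) (s, t)" using hom by (auto simp: crosses_def lift_hom_def)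
  thus thesis using no e by (auto simp: common_def)
 next
  case 3
  moreover have "(t - 2, s) : lifts e" using lifts_turn[OF e, of "-1"] by (simp add: turn_m1)
  ultimately show thesis using that[of "t - 2" s] by auto
 next
  case 4
  moreover have l: "(t - 2, s) : lifts e" using lifts_turn[OF e, of "-1"] by (simp add: turn_m1)
  ultimately have "crosses (a, b) (t - 2, s)" "crosses (c, d) (t - 2, s)" using hom by (auto simp: crosses_def lift_hom_def)
  thus thesis using no l by (auto simp: common_def)
 qed
qed

lemma finite_cr:
 assumes "dyadic a" "dyadic b"
 shows "finite (cr (a, b))"
proof -
 obtain na where na: "!!N. na <= N ==> \<exists>m::int. a = of_int m / 2 ^ N" using dyadic_multiple[OF assms(1)] by blast
 obtain nb where nb: "!!N. nb <= N ==> \<exists>m::int. b = of_int m / 2 ^ N" using dyadic_multiple[OF assms(2)] by blast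
 have inner: "length (snd v) < n" if r: "!!N. n <= N ==> \<exists>m::int. r = of_int m / 2 ^ N"
  and in': "fst (iv v) + 2 * of_int i < r" "r < snd (iv v) + 2 * of_int i" for r n v and i :: int
 proof (rule ccontr)
  assume neg: "\<not> length (snd v) < n"
  obtain s p where v: "v = (s, p)" by (cases v)
  obtain m :: int where m: "iv v = (of_int m / 2 ^ length p, (of_int m + 1) / 2 ^ length p)" using iv_dyadic[of p s] v by auto
  have "n <= length p" using neg v by simp
  from r[OF this] obtain m' :: int where m': "r = of_int m' / 2 ^ length p" by blast
  have sh: "of_int x / 2 ^ length p + 2 * of_int i = (of_int (x + 2 * i * 2 ^ length p) :: real) / 2 ^ length p" for x :: int
   by (simp add: field_simps)
  have "of_int (m + 2 * i * 2 ^ length p) / 2 ^ length p < (of_int m' / 2 ^ length p :: real)"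
   "of_int m' / 2 ^ length p < (of_int (m + 2 * i * 2 ^ length p) + 1) / (2 ^ length p :: real)"
   using in' sh[of m] sh[of "m + 1"] by (simp_all add: m m' add_ac)
  thus False by (rule dyadic_interval_no_inner[OF order_refl])
 qed
 have "cr (a, b) \<subseteq> (%v. tedge v Up) ` {v. length (snd v) < na + nb}"
 proof
  fix e assume "e : cr (a, b)"
  then obtain k v where e: "e = tedge v Up" and c: "crosses (a, b) (turn k (iv v))"
   unfolding cr_def lifts_def by blast
  have "length (snd v) < na + nb"
  proof (cases "even k")
   case True
   then obtain i where i: "k = 2 * i" by blast
   thus ?thesis using inner[where v = v and i = i, OF nb] c by (simp add: crosses_def turn_def)
  next
   case False
   then obtain i where i: "k = 2 * i + 1" by (metis oddE)
   thus ?thesis using inner[where v = v and i = i, OF na] c by (simp add: crosses_def turn_def)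
  qed
  thus "e : (%v. tedge v Up) ` {v. length (snd v) < na + nb}" using e by blast
 qed
 moreover have "finite {v :: tvertex. length (snd v) < na + nb}"
 proof -
  have "{v :: tvertex. length (snd v) < na + nb} \<subseteq> UNIV \<times> {p. set p \<subseteq> UNIV & length p <= na + nb}" by auto
  thus ?thesis by (rule finite_subset) (intro finite_cartesian_product finite_lists_length_le finite)
 qed
 ultimately show ?thesis by (meson finite_imageI finite_subset)
qed

text \<open>
 A family of scalars on the chords crossed by both \<open>x\<close> and \<open>y\<close> that commutes with the arrows:
 where it does not vanish, it can be followed from triangle to triangle until \<open>x\<close> and \<open>y\<close>
 part, and the direction of the arrows there tells which of the two ends comes first.
\<close>

lemma crE:
 assumes "e : cr x"
 obtains l where "l : lifts e" "crosses x l" using assms by (auto simp: cr_def)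

locale string_entry =
 fixes x y :: lift and ph :: "qvertex => 'k::zero"
 assumes fin: "finite (cr x)"
  and supp: "!!e. ph e ~= 0 ==> e : cr x & e : cr y"
  and arrow: "!!a. src a : cr x ==>
   (if tgt a : cr y then ph (src a) else 0) = (if tgt a : cr x then ph (tgt a) else 0)"
begin

lemma min_lift:
 assumes crx: "cr x' = cr x" and Lm: "!!l. l : Lm ==> crosses x' l & (\<exists>e. l : lifts e)" and ne: "l0 : Lm"
 obtains l where "l : Lm" "!!l'. l' : Lm ==> \<not> snd l' - fst l' < snd l - fst l"
proof -
 define edge where "edge l = (THE e. l : lifts e)" for l
 have edge: "l : lifts (edge l)" if "l : Lm" for l
  unfolding edge_def using Lm[OF that] lifts_inj by (metis theI)
 have "inj_on edge Lm" using edge Lm cr_lift_unique[of _ _ _ x'] by (intro inj_onI) metis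
 moreover have "edge ` Lm \<subseteq> cr x"
 proof
  fix e assume "e : edge ` Lm"
  then obtain l where "l : Lm" "e = edge l" by blast
  thus "e : cr x" using crI[OF edge, of l x'] Lm[of l] crx by blast
 qed
 ultimately have "finite Lm" using fin finite_imageD finite_subset by metis
 thus thesis using that ne ex_min_if_finite[of "(%l. snd l - fst l) ` Lm"] by blast
qed

lemma upper_end_le:
 assumes x': "cr x' = cr x" and y': "cr y' = cr y"
  and l: "l : lifts e" "crosses x' l" "crosses y' l" and ne: "ph e ~= 0"
 shows "snd x' <= snd y'"
proof (rule ccontr)
 assume "\<not> ?thesis"
 hence less: "snd y' < snd x'" by simp
 define Lm where "Lm = {l. crosses x' l & crosses y' l & (\<exists>e. l : lifts e & ph e ~= 0)}"
 have "l : Lm" using l ne by (auto simp: Lm_def)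
 moreover have "!!l. l : Lm ==> crosses x' l & (\<exists>e. l : lifts e)" by (auto simp: Lm_def)
 ultimately obtain l where lLm: "l : Lm" and min: "!!l'. l' : Lm ==> \<not> snd l' - fst l' < snd l - fst l" using min_lift[OF x', of Lm] by metis
 obtain p r where pr: "l = (p, r)" by (cases l)
 obtain f where f: "(p, r) : lifts f" "ph f ~= 0" and cx: "crosses x' (p, r)" and cy: "crosses y' (p, r)" using lLm by (auto simp: Lm_def pr)
 obtain v d w where a: "arrow_lift (v, d) p w r" and fe: "f = tgt (v, d)" using apex[OF f(1)] .
 have o: "p < w" "w < r" "r < p + 2" and g: "(w, r) : lifts (src (v, d))"
  and h: "(p, w) : lifts (tgt (v, clockwise d))" using a by (auto simp: arrow_lift_def)
 have fx: "f : cr x" "f : cr y" using supp f by auto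
 show False
 proof (cases "w < snd x'")
  case True
  hence gx: "crosses x' (w, r)" using cx o by (auto simp: crosses_def)
  have "src (v, d) : cr x" using crI[OF g gx] x' by blast
  hence "ph (src (v, d)) = ph f" using arrow[of "(v, d)"] fx fe by simp
  hence nz: "ph (src (v, d)) ~= 0" using f by simp
  hence "src (v, d) : cr y'" using supp y' by simp
  then obtain m where m: "m : lifts (src (v, d))" "crosses y' m" unfolding cr_def by blast
  obtain k where k: "m = turn k (w, r)" using lifts_orbit[OF g m(1)] by blast
  have "w < snd y'"
  proof (rule ccontr)
   assume nw: "\<not> w < snd y'"
   have yb: "fst y' < p" "p < snd y'" "snd y' < r" "r < fst y' + 2" using cy by (auto simp: crosses_def)
   show False
   proof (cases "even k")
    case True
    then obtain n where n: "k = 2 * n" by blast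
    have "fst y' < w + 2 * of_int n" "w + 2 * of_int n < snd y'" "snd y' < r + 2 * of_int n" "r + 2 * of_int n < fst y' + 2"
     using m(2) by (simp_all add: k crosses_def turn_def n)
    hence "-1 < real_of_int n" "real_of_int n < 0" using yb nw o by linarith+
    hence "-1 < n" "n < 0" by simp_all
    thus False by simp
   next
    case False
    then obtain n where n: "k = 2 * n + 1" by (metis oddE)
    have "fst y' < r + 2 * of_int n" "r + 2 * of_int n < snd y'" "snd y' < w + 2 * of_int n + 2" "w + 2 * of_int n + 2 < fst y' + 2"
     using m(2) by (simp_all add: k crosses_def turn_def n)
    hence "-1 < real_of_int n" "real_of_int n < 0" using yb nw o by linarith+
    hence "-1 < n" "n < 0" by simp_all
    thus False by simp
   qed
  qed
  hence "crosses y' (w, r)" using cy o by (auto simp: crosses_def)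
  hence "(w, r) : Lm" using gx g nz by (auto simp: Lm_def)
  thus False using min o pr by fastforce
 next
  case False
  hence hy: "crosses y' (p, w)" using cy o less by (auto simp: crosses_def)
  have "tgt (v, clockwise d) : cr y" using crI[OF h hy] y' by blast
  moreover have "src (v, clockwise d) = f" using fe by simp
  ultimately have "(if tgt (v, clockwise d) : cr x then ph (tgt (v, clockwise d)) else 0) = ph f" using arrow[of "(v, clockwise d)"] fx by simp
  hence nz: "tgt (v, clockwise d) : cr x" "ph (tgt (v, clockwise d)) ~= 0" using f(2) by (auto split: if_splits)
  then obtain m where m: "m : lifts (tgt (v, clockwise d))" "crosses x' m" using crE[of _ x'] x' by metis
  obtain k where k: "m = turn k (p, w)" using lifts_orbit[OF h m(1)] by blast
  have "snd x' < w"
  proof (rule ccontr)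
   assume nw: "\<not> snd x' < w"
   have yb: "fst x' < p" "p < snd x'" "snd x' < r" "r < fst x' + 2" using cx by (auto simp: crosses_def)
   show False
   proof (cases "even k")
    case True
    then obtain n where n: "k = 2 * n" by blast
    have "fst x' < p + 2 * of_int n" "p + 2 * of_int n < snd x'" "snd x' < w + 2 * of_int n" "w + 2 * of_int n < fst x' + 2"
     using m(2) by (simp_all add: k crosses_def turn_def n)
    hence "0 < real_of_int n" "real_of_int n < 1" using yb nw o by linarith+
    hence "0 < n" "n < 1" by simp_all
    thus False by simp
   next
    case False
    then obtain n where n: "k = 2 * n + 1" by (metis oddE)
    have "fst x' < w + 2 * of_int n" "w + 2 * of_int n < snd x'" "snd x' < p + 2 * of_int n + 2" "p + 2 * of_int n + 2 < fst x' + 2"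
     using m(2) by (simp_all add: k crosses_def turn_def n)
    hence "-1 < real_of_int n" "real_of_int n < 0" using yb nw o by linarith+
    hence "-1 < n" "n < 0" by simp_all
    thus False by simp
   qed
  qed
  hence "crosses x' (p, w)" using cx o by (auto simp: crosses_def)
  hence "(p, w) : Lm" using hy h nz by (auto simp: Lm_def)
  thus False using min o pr by fastforce
 qed
qed

lemma nested_eq:
 assumes x': "cr x' = cr x" and y': "cr y' = cr y"
  and f: "(s, t) : lifts f" "crosses x' (s, t)" "crosses y' (s, t)"
  and e: "(s', t') : lifts e" "crosses x' (s', t')" "crosses y' (s', t')"
  and nest: "s' <= s" "t <= t'"
 shows "ph e = ph f"
proof -
 define Lm where "Lm = {l. crosses x' l & crosses y' l & fst l <= s & t <= snd l & (\<exists>g. l : lifts g & ph g = ph e)}"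
 have "(s', t') : Lm" using e nest by (auto simp: Lm_def)
 moreover have "!!l. l : Lm ==> crosses x' l & (\<exists>e. l : lifts e)" by (auto simp: Lm_def)
 ultimately obtain l where lLm: "l : Lm" and min: "!!l'. l' : Lm ==> \<not> snd l' - fst l' < snd l - fst l" using min_lift[OF x', of Lm] by metis
 obtain p r where pr: "l = (p, r)" by (cases l)
 obtain g where g: "(p, r) : lifts g" "ph g = ph e" and cx: "crosses x' (p, r)" and cy: "crosses y' (p, r)"
  and pn: "p <= s" "t <= r" using lLm by (auto simp: Lm_def pr)
 obtain v d w where a: "arrow_lift (v, d) p w r" and ge: "g = tgt (v, d)" using apex[OF g(1)] .
 have o: "p < w" "w < r" "r < p + 2" and g1: "(w, r) : lifts (src (v, d))"
  and h: "(p, w) : lifts (tgt (v, clockwise d))" using a by (auto simp: arrow_lift_def)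
 have gx: "g : cr x" "g : cr y" using crI[OF g(1) cx] crI[OF g(1) cy] x' y' by blast+
 have st: "s < t" "fst x' < s" "s < snd x'" "snd x' < t" "s < snd y'" "snd y' < t" "fst y' < s" using f by (auto simp: crosses_def)
 consider "w <= s" | "t <= w" | "s < w" "w < t" by linarith
 thus ?thesis
 proof cases
  case 1
  hence c: "crosses x' (w, r)" "crosses y' (w, r)" using cx cy st o by (auto simp: crosses_def)
  have "src (v, d) : cr x" "src (v, d) : cr y" using crI[OF g1 c(1)] crI[OF g1 c(2)] x' y' by blast+
  hence "ph (src (v, d)) = ph g" using arrow[of "(v, d)"] gx ge by simp
  hence "(w, r) : Lm" using c g1 g 1 pn by (auto simp: Lm_def)
  thus ?thesis using min o pr by fastforce
 next
  case 2
  hence c: "crosses x' (p, w)" "crosses y' (p, w)" using cx cy st o by (auto simp: crosses_def)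
  have "tgt (v, clockwise d) : cr x" "tgt (v, clockwise d) : cr y" using crI[OF h c(1)] crI[OF h c(2)] x' y' by blast+
  hence "ph (tgt (v, clockwise d)) = ph g" using arrow[of "(v, clockwise d)"] gx ge by simp
  hence "(p, w) : Lm" using c h g 2 pn by (auto simp: Lm_def)
  thus ?thesis using min o pr by fastforce
 next
  case 3
  have "p = s" using noncrossing[OF h f(1)] 3 pn o by (auto simp: crosses_def)
  moreover have "r = t" using noncrossing[OF f(1) g1] 3 pn o by (auto simp: crosses_def)
  ultimately have "g = f" using lifts_inj[OF g(1)] f(1) by simp
  thus ?thesis using g by simp
 qed
qed

theorem classification:
 assumes "ph e ~= 0"
 shows "\<exists>k. lift_hom x (turn k y) & (\<forall>f. ph f = (if f : common x (turn k y) then ph e else 0))"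
proof -
 have ends: "\<exists>l k. l : lifts f & crosses x l & crosses (turn k y) l & lift_hom x (turn k y)" if f: "ph f ~= 0" for f
 proof -
  obtain l where l: "l : lifts f" "crosses x l" using supp[OF f] by (auto simp: cr_def)
  obtain l' where l': "l' : lifts f" "crosses y l'" using supp[OF f] by (auto simp: cr_def)
  obtain k where k: "l = turn k l'" using lifts_orbit[OF l'(1) l(1)] by blast
  have ck: "crosses (turn k y) l" using l' k by simp
  have "snd x <= snd (turn k y)" by (rule upper_end_le[OF _ _ l ck f]) auto
  moreover have "snd (turn (-1) x) <= snd (turn (-1) (turn k y))" by (rule upper_end_le[OF _ _ lifts_turn[OF l(1), of "-1"] _ _ f])
    (use l ck crosses_turn in \<open>auto simp del: turn_turn\<close>)
  hence "fst x <= fst (turn k y)" by (simp add: turn_m1 del: turn_turn)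
  ultimately have "lift_hom x (turn k y)" using l ck by (auto simp: lift_hom_def crosses_def)
  thus ?thesis using l ck by blast
 qed
 obtain l k where l: "l : lifts e" "crosses x l" "crosses (turn k y) l" and hom: "lift_hom x (turn k y)" using ends[OF assms] by blast
 have "ph f = (if f : common x (turn k y) then ph e else 0)" for f
 proof (cases "f : common x (turn k y)")
  case True
  then obtain m where m: "m : lifts f" "crosses x m" "crosses (turn k y) m" by (auto simp: common_def)
  obtain s t where st: "m = (s, t)" by (cases m)
  obtain s' t' where st': "l = (s', t')" by (cases l)
  have "(s' <= s & t <= t') | (s <= s' & t' <= t)" using noncrossing[OF m(1) l(1)] noncrossing[OF l(1) m(1)] l(2) m(2)
   by (auto simp: st st' crosses_def)
  hence "ph f = ph e"
  proof
   assume "s' <= s & t <= t'"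
   thus ?thesis using nested_eq[OF refl cr_turn m[unfolded st] l[unfolded st']] by simp
  next
   assume "s <= s' & t' <= t"
   thus ?thesis using nested_eq[OF refl cr_turn l[unfolded st'] m[unfolded st]] by simp
  qed
  thus ?thesis using True by simp
 next
  case False
  have "ph f = 0"
  proof (rule ccontr)
   assume "ph f ~= 0"
   then obtain m j where m: "m : lifts f" "crosses x m" "crosses (turn j y) m" "lift_hom x (turn j y)" using ends by blast
   hence "j = k" using hom lift_hom_unique by blast
   thus False using False m by (auto simp: common_def)
  qed
  thus ?thesis using False by simp
 qed
 thus ?thesis using hom by blast
qed

end

subsection \<open>Extending a chord across one more triangle\<close>

text \<open>
 Moving the upper end of a chord from \<open>t\<close> to the apex \<open>w'\<close> of the triangle beyond the side
 \<open>(s, t)\<close> makes it cross exactly this additional side.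
\<close>

lemma cr_extend_upper:
 assumes e: "(s, t) : lifts e" and g: "(w, t) : lifts g" and h: "(s, w) : lifts h"
  and f: "(t, w') : lifts f" and f': "(w', s + 2) : lifts f'"
  and o: "s < u" "u < w" "w < t" "t < w'" "w' < s + 2"
 shows "cr (u, w') = insert e (cr (u, t))" "e \<notin> cr (u, t)"
proof -
 have e1: "(t, s + 2) : lifts e" using lifts_turn[OF e, of 1] by (simp add: turn_1)
 have h1: "(s + 2, w + 2) : lifts h" using lifts_turn[OF h, of 2] by (simp add: turn_def)
 show "cr (u, w') = insert e (cr (u, t))"
 proof (intro equalityI subsetI)
  fix c assume "c : cr (u, w')"
  then obtain z where z: "z : lifts c" "crosses (u, w') z" by (auto simp: cr_def)
  obtain z1 z2 where zz: "z = (z1, z2)" by (cases z)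
  have b: "u < z1" "z1 < w'" "w' < z2" "z2 < u + 2" using z by (auto simp: crosses_def zz)
  consider "z1 < t" | "z1 = t" "z2 = s + 2" | "z1 = t" "z2 < s + 2" | "z1 = t" "s + 2 < z2" | "t < z1" by linarith
  thus "c : insert e (cr (u, t))"
  proof cases
   case 1
   hence "crosses (u, t) z" using b o by (simp add: crosses_def zz)
   thus ?thesis using z by (auto simp: cr_def)
  next
   case 2
   thus ?thesis using lifts_inj[OF e1] z zz by auto
  next
   case 3
   hence "crosses (t, z2) (w', s + 2)" using b o by (simp add: crosses_def)
   thus ?thesis using noncrossing[OF z(1) f'] 3 by (simp add: zz)
  next
   case 4
   hence "crosses (t, z2) (s + 2, w + 2)" using b o by (simp add: crosses_def)
   thus ?thesis using noncrossing[OF z(1) h1] 4 by (simp add: zz)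
  next
   case 5
   hence "crosses (t, w') (z1, z2)" using b o by (simp add: crosses_def)
   thus ?thesis using noncrossing[OF f z(1)] by (simp add: zz)
  qed
 next
  fix c assume "c : insert e (cr (u, t))"
  then consider "c = e" | z where "z : lifts c" "crosses (u, t) z" by (auto simp: cr_def)
  thus "c : cr (u, w')"
  proof cases
   case 1
   have "crosses (u, w') (t, s + 2)" using o by (simp add: crosses_def)
   thus ?thesis using e1 1 by (auto simp: cr_def)
  next
   case (2 z)
   obtain z1 z2 where zz: "z = (z1, z2)" by (cases z)
   have b: "u < z1" "z1 < t" "t < z2" "z2 < u + 2" using 2 by (auto simp: crosses_def zz)
   have "w' < z2"
   proof (rule ccontr)
    assume "\<not> w' < z2"
    hence "crosses (s, t) (z1, z2)" using b o by (simp add: crosses_def)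
    thus False using noncrossing[OF e 2(1)] by (simp add: zz)
   qed
   hence "crosses (u, w') z" using b o by (simp add: crosses_def zz)
   thus ?thesis using 2 by (auto simp: cr_def)
  qed
 qed
 show "e \<notin> cr (u, t)"
 proof
  assume "e : cr (u, t)"
  then obtain z where z: "z : lifts e" "crosses (u, t) z" by (auto simp: cr_def)
  moreover have "crosses (u, w') z" using z noncrossing[OF e z(1)] o by (auto simp: crosses_def)
  moreover have "crosses (u, w') (t, s + 2)" using o by (simp add: crosses_def)
  ultimately have "z = (t, s + 2)" using cr_lift_unique e1 by blast
  thus False using z by (simp add: crosses_def)
 qed
qed

lemma cr_extend_lower:
 assumes e: "(s, t) : lifts e" and g: "(w, t) : lifts g" and h: "(s, w) : lifts h"
  and f: "(t, w') : lifts f" and f': "(w', s + 2) : lifts f'"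
  and o: "s < w" "w < u" "u < t" "t < w'" "w' < s + 2"
 shows "cr (u, w') = insert e (cr (u, s + 2))" "e \<notin> cr (u, s + 2)"
proof -
 have e1: "(t, s + 2) : lifts e" using lifts_turn[OF e, of 1] by (simp add: turn_1)
 show "cr (u, w') = insert e (cr (u, s + 2))"
 proof (intro equalityI subsetI)
  fix c assume "c : cr (u, w')"
  then obtain z where z: "z : lifts c" "crosses (u, w') z" by (auto simp: cr_def)
  obtain z1 z2 where zz: "z = (z1, z2)" by (cases z)
  have b: "u < z1" "z1 < w'" "w' < z2" "z2 < u + 2" using z by (auto simp: crosses_def zz)
  consider "s + 2 < z2" | "z2 = s + 2" "z1 = t" | "z2 = s + 2" "z1 < t" | "z2 = s + 2" "t < z1" | "z2 < s + 2" by linarith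
  thus "c : insert e (cr (u, s + 2))"
  proof cases
   case 1
   hence "crosses (u, s + 2) z" using b o by (simp add: crosses_def zz)
   thus ?thesis using z by (auto simp: cr_def)
  next
   case 2
   thus ?thesis using lifts_inj[OF e1] z zz by auto
  next
   case 3
   have "(s, z1) : lifts c" using lifts_turn[OF z(1), of "-1"] 3 by (simp add: turn_m1 zz)
   moreover have "crosses (s, z1) (w, t)" using b o 3 by (simp add: crosses_def)
   ultimately show ?thesis using noncrossing g by blast
  next
   case 4
   hence "crosses (t, w') (z1, z2)" using b o by (simp add: crosses_def)
   thus ?thesis using noncrossing[OF f z(1)] by (simp add: zz)
  next
   case 5
   hence "crosses (z1, z2) (w', s + 2)" using b o by (simp add: crosses_def)
   thus ?thesis using noncrossing[OF z(1) f'] by (simp add: zz)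
  qed
 next
  fix c assume "c : insert e (cr (u, s + 2))"
  then consider "c = e" | z where "z : lifts c" "crosses (u, s + 2) z" by (auto simp: cr_def)
  thus "c : cr (u, w')"
  proof cases
   case 1
   have "crosses (u, w') (t, s + 2)" using o by (simp add: crosses_def)
   thus ?thesis using e1 1 by (auto simp: cr_def)
  next
   case (2 z)
   obtain z1 z2 where zz: "z = (z1, z2)" by (cases z)
   have b: "u < z1" "z1 < s + 2" "s + 2 < z2" "z2 < u + 2" using 2 by (auto simp: crosses_def zz)
   have "z1 < w'"
   proof (rule ccontr)
    assume "\<not> z1 < w'"
    hence "crosses (t, s + 2) (z1, z2)" using b o by (simp add: crosses_def)
    thus False using noncrossing[OF e1 2(1)] by (simp add: zz)
   qed
   hence "crosses (u, w') z" using b o by (simp add: crosses_def zz)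
   thus ?thesis using 2 by (auto simp: cr_def)
  qed
 qed
 show "e \<notin> cr (u, s + 2)"
 proof
  assume "e : cr (u, s + 2)"
  then obtain z where z: "z : lifts e" "crosses (u, s + 2) z" by (auto simp: cr_def)
  moreover have "crosses (u, w') z" using z noncrossing[OF e1 z(1)] o by (auto simp: crosses_def)
  moreover have "crosses (u, w') (t, s + 2)" using o by (simp add: crosses_def)
  ultimately have "z = (t, s + 2)" using cr_lift_unique e1 by blast
  thus False using z by (simp add: crosses_def)
 qed
qed

lemma cr_single:
 assumes e: "(s, t) : lifts e" and g: "(w, t) : lifts g" and h: "(s, w) : lifts h"
  and f: "(t, w') : lifts f" and f': "(w', s + 2) : lifts f'"
  and o: "s < w" "w < t" "t < w'" "w' < s + 2"
 shows "cr (w, w') = {e}"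
proof -
 have e1: "(t, s + 2) : lifts e" using lifts_turn[OF e, of 1] by (simp add: turn_1)
 have h1: "(s + 2, w + 2) : lifts h" using lifts_turn[OF h, of 2] by (simp add: turn_def)
 show ?thesis
 proof (intro equalityI subsetI)
  fix c assume "c : cr (w, w')"
  then obtain z where z: "z : lifts c" "crosses (w, w') z" by (auto simp: cr_def)
  obtain z1 z2 where zz: "z = (z1, z2)" by (cases z)
  have b: "w < z1" "z1 < w'" "w' < z2" "z2 < w + 2" using z by (auto simp: crosses_def zz)
  consider "z1 < t" | "z1 = t" "z2 = s + 2" | "z1 = t" "z2 < s + 2" | "z1 = t" "s + 2 < z2" | "t < z1" by linarith
  thus "c : {e}"
  proof cases
   case 1
   hence "crosses (w, t) (z1, z2)" using b o by (simp add: crosses_def)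
   thus ?thesis using noncrossing[OF g z(1)] by (simp add: zz)
  next
   case 2
   thus ?thesis using lifts_inj[OF e1] z zz by auto
  next
   case 3
   hence "crosses (t, z2) (w', s + 2)" using b o by (simp add: crosses_def)
   thus ?thesis using noncrossing[OF z(1) f'] 3 by (simp add: zz)
  next
   case 4
   hence "crosses (t, z2) (s + 2, w + 2)" using b o by (simp add: crosses_def)
   thus ?thesis using noncrossing[OF z(1) h1] 4 by (simp add: zz)
  next
   case 5
   hence "crosses (t, w') (z1, z2)" using b o by (simp add: crosses_def)
   thus ?thesis using noncrossing[OF f z(1)] by (simp add: zz)
  qed
 next
  fix c assume "c : {e}"
  moreover have "crosses (w, w') (t, s + 2)" using o by (simp add: crosses_def)
  ultimately show "c : cr (w, w')" using e1 by (auto simp: cr_def)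
 qed
qed

text \<open>
 A chord that enters a triangle through one side and crosses neither of the others ends in the opposite corner.
\<close>

lemma half_string:
 assumes a: "arrow_lift (v, d) s w t"
  and h: "tgt (v, clockwise d) : cr x" and g: "src (v, d) \<notin> cr x" and e: "tgt (v, d) \<notin> cr x"
 obtains k u where "turn k x = (u, t)" "s < u" "u < w"
proof -
 have o: "s < w" "w < t" "t < s + 2" and l: "(w, t) : lifts (src (v, d))" "(s, t) : lifts (tgt (v, d))"
  "(s, w) : lifts (tgt (v, clockwise d))" using a by (auto simp: arrow_lift_def)
 obtain z where z: "z : lifts (tgt (v, clockwise d))" "crosses x z" using h by (auto simp: cr_def)
 obtain j where "(s, w) = turn j z" using lifts_orbit[OF z(1) l(3)] by blast
 hence "crosses (s, w) (turn 1 (turn j x))" using z crosses_swap[of "turn j x" "(s, w)"] by simp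
 then obtain k where k: "crosses (s, w) (turn k x)" by auto
 obtain u r where ur: "turn k x = (u, r)" by (cases "turn k x")
 have b: "s < u" "u < w" "w < r" "r < s + 2" using k by (auto simp: ur crosses_def)
 have nl: "\<not> crosses l' (turn i x)" if "l' : lifts c" "c \<notin> cr x" for l' c i
 proof
  assume "crosses l' (turn i x)"
  hence "crosses (turn i x) (turn 1 l')" using crosses_swap[of l' "turn i x"] crosses_swap[of "turn i x" "turn 1 l'"] by (metis crosses_turn)
  thus False using that crI[OF lifts_turn[OF that(1), of 1], of "turn i x"] by simp
 qed
 have "\<not> r < t"
 proof
  assume "r < t"
  moreover have "turn (1 + k) x = (r, u + 2)"
   unfolding turn_turn[symmetric] ur by (simp add: turn_1)
  ultimately have "crosses (w, t) (turn (1 + k) x)" using b o by (simp add: crosses_def)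
  thus False using nl[OF l(1) g] by blast
 qed
 moreover have "\<not> t < r"
 proof
  assume "t < r"
  hence "crosses (s, t) (turn k x)" using b ur o by (simp add: crosses_def)
  thus False using nl[OF l(2) e] by blast
 qed
 ultimately show thesis using that b ur by simp
qed

lemma dyadic_add: "dyadic r ==> dyadic (r + of_int k)"
proof -
 assume "dyadic r"
 then obtain m :: int and n where "r = of_int m / 2 ^ n" by (auto simp: dyadic_def)
 hence "r + of_int k = of_int (m + k * 2 ^ n) / 2 ^ n" by (simp add: field_simps)
 thus ?thesis unfolding dyadic_def by blast
qed

definition dyadic_lift :: "lift => bool" where
 "dyadic_lift x \<longleftrightarrow> dyadic (fst x) & dyadic (snd x)"

lemma dyadic_lift_turn [simp]: "dyadic_lift (turn k x) = dyadic_lift x"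
proof -
 have "dyadic_lift (turn k x)" if "dyadic_lift x" for k x
 proof (cases "even k")
  case True
  have "fst (turn k x) = fst x + of_int k" "snd (turn k x) = snd x + of_int k" using True by (simp_all add: turn_def)
  thus ?thesis using that dyadic_add unfolding dyadic_lift_def by metis
 next
  case False
  have "fst (turn k x) = snd x + of_int (k - 1)" "snd (turn k x) = fst x + of_int (k + 1)" using False by (simp_all add: turn_def)
  thus ?thesis using that dyadic_add unfolding dyadic_lift_def by metis
 qed
 from this[of x k] this[of "turn k x" "-k"] show ?thesis by (metis turn_turn turn_0 ab_left_minus)
qed

lemma lifts_dyadic: "l : lifts e ==> dyadic_lift l"
proof -
 have "dyadic_lift (iv v)" for v
 proof -
  obtain s p where v: "v = (s, p)" by (cases v)
  obtain m :: int where m: "iv v = (of_int m / 2 ^ length p, (of_int m + 1) / 2 ^ length p)" using iv_dyadic[of p s] v by auto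
  have "(of_int m + 1 :: real) = of_int (m + 1)" by simp
  thus ?thesis unfolding dyadic_lift_def m fst_conv snd_conv dyadic_def by metis
 qed
 thus "l : lifts e ==> dyadic_lift l" by (auto simp: lifts_def)
qed

section \<open>Categories of matrices\<close>

text \<open>
 Objects are lists of points, morphisms are matrices supported on the pairs related by \<open>R\<close>, and
 the composite of basic morphisms \<open>p \<rightarrow> q \<rightarrow> r\<close> is the basic morphism or zero, according to \<open>E\<close>.
\<close>

definition supp_mats :: "('p => 'p => bool) => 'p list => 'p list => (nat \<times> nat => 'k::field) set" where
 "supp_mats R X Y = {c. \<forall>j i. c (j, i) ~= 0 --> j < length Y & i < length X & R (X ! i) (Y ! j)}"

definition mat_comp :: "('p => 'p => 'p => bool) => 'p list => 'p list => 'p list =>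
  (nat \<times> nat => 'k::field) => (nat \<times> nat => 'k) => nat \<times> nat => 'k" where
 "mat_comp E X Y Z g f = (%(l, i). if l < length Z & i < length X
   then \<Sum>j<length Y. if E (X ! i) (Y ! j) (Z ! l) then g (l, j) * f (j, i) else 0 else 0)"

definition mat_cat :: "'p list set => ('p => 'p => bool) => ('p => 'p => 'p => bool) =>
  ('k::field, 'p list, nat \<times> nat => 'k) klin_cat" where
 "mat_cat S R E = \<lparr>Obj = S, Hom = (%X Y. fun_space (supp_mats R X Y)), Comp = mat_comp E,
   Ident = (%X (j, i). if i = j & i < length X & R (X ! i) (X ! i) then 1 else 0)\<rparr>"

lemma mat_cat_simps [simp]:
 "Obj (mat_cat S R E) = S" "Hom (mat_cat S R E) X Y = fun_space (supp_mats R X Y)"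
 "Comp (mat_cat S R E) = mat_comp E"
 "Ident (mat_cat S R E) X = (%(j, i). if i = j & i < length X & R (X ! i) (X ! i) then 1 else 0)" by (simp_all add: mat_cat_def)

lemma vs_supp_mats: "Module.module class_ring (fun_space (supp_mats R X Y :: (nat \<times> nat => 'k::field) set))"
proof (rule vs_fun_space)
 fix f g :: "nat \<times> nat => 'k" assume f: "f : supp_mats R X Y" and g: "g : supp_mats R X Y"
 have "f ji ~= 0 | g ji ~= 0" if "f ji + g ji ~= 0" for ji using that by auto
 thus "(%i. f i + g i) : supp_mats R X Y" using f g unfolding supp_mats_def by blast
qed (auto simp: supp_mats_def)

lemma supp_matsD: "c : supp_mats R X Y ==> c (j, i) ~= 0 ==> j < length Y & i < length X & R (X ! i) (Y ! j)" by (auto simp: supp_mats_def)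

lemma mat_comp_linear:
 "mat_comp E X Y Z (%i. g i + h i) f = (%i. mat_comp E X Y Z g f i + mat_comp E X Y Z h f i)"
 "mat_comp E X Y Z g (%i. f i + f' i) = (%i. mat_comp E X Y Z g f i + mat_comp E X Y Z g f' i)"
 "mat_comp E X Y Z (%i. c * g i) f = (%i. c * mat_comp E X Y Z g f i)"
 "mat_comp E X Y Z g (%i. c * f i) = (%i. c * mat_comp E X Y Z g f i)"
 for f f' g h :: "nat \<times> nat => 'k::field"
proof -
 have d: "(\<Sum>j<n. if P j then u j + v j else 0) = (\<Sum>j<n. if P j then u j else 0) + (\<Sum>j<n. if P j then v j else 0)"
  for P and u v :: "nat => 'k" and n :: nat
  unfolding sum.distrib[symmetric] by (rule sum.cong) auto
 have m: "(\<Sum>j<n. if P j then c * u j else 0) = c * (\<Sum>j<n. if P j then u j else 0)"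
  for P and u :: "nat => 'k" and n :: nat
  unfolding sum_distrib_left by (rule sum.cong) auto
 show "mat_comp E X Y Z (%i. g i + h i) f = (%i. mat_comp E X Y Z g f i + mat_comp E X Y Z h f i)"
  by (rule ext) (simp add: mat_comp_def split_def distrib_right d cong: if_cong)
 show "mat_comp E X Y Z g (%i. f i + f' i) = (%i. mat_comp E X Y Z g f i + mat_comp E X Y Z g f' i)"
  by (rule ext) (simp add: mat_comp_def split_def distrib_left d cong: if_cong)
 show "mat_comp E X Y Z (%i. c * g i) f = (%i. c * mat_comp E X Y Z g f i)"
  by (rule ext) (simp add: mat_comp_def split_def mult.assoc m cong: if_cong)
 show "mat_comp E X Y Z g (%i. c * f i) = (%i. c * mat_comp E X Y Z g f i)"
  by (rule ext) (simp add: mat_comp_def split_def mult.left_commute m cong: if_cong)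
qed

locale mat_relation =
 fixes R :: "'p => 'p => bool" and E :: "'p => 'p => 'p => bool"
 assumes R_refl: "R p q ==> R p p" "R p q ==> R q q"
  and E_ident: "R p q ==> E p p q" "R p q ==> E p q q"
  and E_R: "R p q ==> R q r ==> E p q r ==> R p r"
  and E_assoc: "R p q ==> R q r ==> R r s ==> E p q r & E p r s \<longleftrightarrow> E q r s & E p q s"
begin

lemma mat_comp_supp:
 assumes f: "f : supp_mats R X Y" and g: "g : supp_mats R Y Z"
 shows "mat_comp E X Y Z g f : supp_mats R X Z"
 unfolding supp_mats_def
proof (intro CollectI allI impI)
 fix l i assume nz: "mat_comp E X Y Z g f (l, i) ~= 0"
 hence li: "l < length Z" "i < length X" by (auto simp: mat_comp_def split: if_splits)
 obtain j where "(if E (X ! i) (Y ! j) (Z ! l) then g (l, j) * f (j, i) else 0) ~= 0"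
  using nz li sum.not_neutral_contains_not_neutral[of _ "{..<length Y}"] by (auto simp: mat_comp_def)
 hence "E (X ! i) (Y ! j) (Z ! l)" "g (l, j) ~= 0" "f (j, i) ~= 0" by (auto split: if_splits)
 thus "l < length Z & i < length X & R (X ! i) (Z ! l)" using supp_matsD[OF f, of j i] supp_matsD[OF g, of l j] E_R li by blast
qed

lemma mat_comp_assoc:
 assumes f: "f : supp_mats R W X" and g: "g : supp_mats R X Y" and h: "h : supp_mats R Y Z"
 shows "mat_comp E W Y Z h (mat_comp E W X Y g f) = mat_comp E W X Z (mat_comp E X Y Z h g) f"
proof (rule ext)
 fix li :: "nat \<times> nat"
 obtain l i where li: "li = (l, i)" by (cases li)
 show "mat_comp E W Y Z h (mat_comp E W X Y g f) li = mat_comp E W X Z (mat_comp E X Y Z h g) f li"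
 proof (cases "l < length Z & i < length W")
  case True
  have "mat_comp E W Y Z h (mat_comp E W X Y g f) li =
   (\<Sum>k<length Y. \<Sum>j<length X. if E (W ! i) (Y ! k) (Z ! l) & E (W ! i) (X ! j) (Y ! k) then h (l, k) * g (k, j) * f (j, i) else 0)"
   using True by (auto simp: mat_comp_def li sum_distrib_left mult.assoc intro!: sum.cong)
  also have "\<dots> = (\<Sum>k<length Y. \<Sum>j<length X. if E (X ! j) (Y ! k) (Z ! l) & E (W ! i) (X ! j) (Z ! l) then h (l, k) * g (k, j) * f (j, i) else 0)"
  proof (intro sum.cong refl)
   fix k j
   show "(if E (W ! i) (Y ! k) (Z ! l) & E (W ! i) (X ! j) (Y ! k) then h (l, k) * g (k, j) * f (j, i) else 0) =
    (if E (X ! j) (Y ! k) (Z ! l) & E (W ! i) (X ! j) (Z ! l) then h (l, k) * g (k, j) * f (j, i) else 0)"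
   proof (cases "h (l, k) * g (k, j) * f (j, i) = 0")
    case False
    hence "R (Y ! k) (Z ! l)" "R (X ! j) (Y ! k)" "R (W ! i) (X ! j)"
     using supp_matsD[OF f, of j i] supp_matsD[OF g, of k j] supp_matsD[OF h, of l k] by auto
    from E_assoc[OF this(3,2,1)] show ?thesis by auto
   qed auto
  qed
  also have "\<dots> = (\<Sum>j<length X. \<Sum>k<length Y. if E (X ! j) (Y ! k) (Z ! l) & E (W ! i) (X ! j) (Z ! l) then h (l, k) * g (k, j) * f (j, i) else 0)"
   by (rule sum.swap)
  also have "\<dots> = mat_comp E W X Z (mat_comp E X Y Z h g) f li" using True by (auto simp: mat_comp_def li sum_distrib_right intro!: sum.cong)
  finally show ?thesis .
 next
  case False
  thus ?thesis by (auto simp: mat_comp_def li)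
 qed
qed

lemma klin_category_mat_cat: "klin_category (mat_cat S R E :: ('k::field, 'p list, nat \<times> nat => 'k) klin_cat)"
proof (rule klin_category.intro)
 fix X Y Z and f :: "nat \<times> nat => 'k" assume "f : mor (mat_cat S R E) X Y"
 hence f: "f : supp_mats R X Y" by simp
 show "(%g. Comp (mat_cat S R E) X Y Z g f) : lin_maps (Hom (mat_cat S R E) Y Z) (Hom (mat_cat S R E) X Z)"
  by (rule lin_mapsI) (simp_all add: mat_comp_supp[OF f] mat_comp_linear)
next
 fix X Y Z and g :: "nat \<times> nat => 'k" assume "g : mor (mat_cat S R E) Y Z"
 hence g: "g : supp_mats R Y Z" by simp
 show "(%f. Comp (mat_cat S R E) X Y Z g f) : lin_maps (Hom (mat_cat S R E) X Y) (Hom (mat_cat S R E) X Z)"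
  by (rule lin_mapsI) (simp_all add: mat_comp_supp[OF _ g] mat_comp_linear)
next
 fix X Y and f :: "nat \<times> nat => 'k" assume "f : mor (mat_cat S R E) X Y"
 hence f: "f : supp_mats R X Y" by simp
 let ?I = "%X (j :: nat, i :: nat). (if i = j & i < length X & R (X ! i) (X ! i) then 1 else 0) :: 'k"
 have "mat_comp E X Y Y (?I Y) f (l, i) = f (l, i)" for l i
 proof (cases "f (l, i) = 0")
  case True
  hence "(if E (X ! i) (Y ! j) (Y ! l) then ?I Y (l, j) * f (j, i) else 0) = 0" for j by auto
  thus ?thesis using True by (simp add: mat_comp_def)
 next
  case False
  hence *: "l < length Y" "i < length X" "R (X ! i) (Y ! l)" using supp_matsD[OF f, of l i] by auto
  have "(if E (X ! i) (Y ! j) (Y ! l) then (if j = l & j < length Y & R (Y ! j) (Y ! j) then 1 else 0) * f (j, i) else 0) =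
    (if j = l then f (l, i) else 0)" for j using * R_refl(2) E_ident(2) by auto
  note t = this
  show ?thesis unfolding mat_comp_def prod.case t using * by simp
 qed
 thus "Comp (mat_cat S R E) X Y Y (Ident (mat_cat S R E) Y) f = f" by (simp add: fun_eq_iff)
 have "mat_comp E X X Y f (?I X) (l, i) = f (l, i)" for l i
 proof (cases "f (l, i) = 0")
  case True
  hence "(if E (X ! i) (X ! j) (Y ! l) then f (l, j) * ?I X (j, i) else 0) = 0" for j by auto
  thus ?thesis using True by (simp add: mat_comp_def)
 next
  case False
  hence *: "l < length Y" "i < length X" "R (X ! i) (Y ! l)" using supp_matsD[OF f, of l i] by auto
  have "(if E (X ! i) (X ! j) (Y ! l) then f (l, j) * (if i = j & i < length X & R (X ! i) (X ! i) then 1 else 0) else 0) =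
    (if j = i then f (l, i) else 0)" for j using * R_refl(1) E_ident(1) by auto
  note t = this
  show ?thesis unfolding mat_comp_def prod.case t using * by simp
 qed
 thus "Comp (mat_cat S R E) X X Y f (Ident (mat_cat S R E) X) = f" by (simp add: fun_eq_iff)
qed (simp_all add: vs_supp_mats mat_comp_assoc, auto simp: supp_mats_def split: if_splits)

end

section \<open>The continuous derived category as a matrix category\<close>

definition plift :: "point => lift" where
 "plift p = (fst p / pi, snd p / pi + 1)"

definition lift_le :: "lift => lift => bool" where
 "lift_le x y \<longleftrightarrow> fst x <= fst y & snd x <= snd y"

definition homB :: "point => point => bool" where
 "homB p q \<longleftrightarrow> lift_le (plift p) (plift q)"

definition homD :: "point => point => bool" where
 "homD p q \<longleftrightarrow> lift_hom (plift p) (plift q)"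

lemma homB_iff: "homB p q \<longleftrightarrow> fst p <= fst q & snd p <= snd q" by (simp add: homB_def lift_le_def plift_def divide_le_cancel)

lemma homD_iff: "homD p q \<longleftrightarrow> homB p q & fst q < snd p + pi & snd q < fst p + pi"
proof -
 have *: "u / pi < v / pi + 1 \<longleftrightarrow> u < v + pi" for u v :: real
 proof -
  have "v / pi + 1 = (v + pi) / pi" by (simp add: add_divide_distrib)
  thus ?thesis by (simp add: divide_less_cancel)
 qed
 have "fst q / pi < snd p / pi + 1 \<longleftrightarrow> fst q < snd p + pi" "snd q / pi + 1 < fst p / pi + 2 \<longleftrightarrow> snd q < fst p + pi"
  using *[of "fst q" "snd p"] *[of "snd q" "fst p"] by auto
 thus ?thesis by (auto simp: homD_def homB_iff lift_hom_def plift_def divide_le_cancel)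
qed

lemma mat_relation_B: "mat_relation homB (%_ _ _. True)" by standard (auto simp: homB_iff)

lemma mat_relation_D: "mat_relation homD (%p q r. homD p r)" by standard (auto simp: homD_iff homB_iff)

abbreviation catB' :: "('k::field, point list, nat \<times> nat => 'k) klin_cat" where
 "catB' \<equiv> mat_cat UNIV homB (%_ _ _. True)"

abbreviation catD' :: "('k::field, point list, nat \<times> nat => 'k) klin_cat" where
 "catD' \<equiv> mat_cat UNIV homD (%p q r. homD p r)"

definition entries :: "(point => point => bool) => point list => point list => 'k::field mat => nat \<times> nat => 'k" where
 "entries R X Y A = (%(j, i). if j < length Y & i < length X & R (X ! i) (Y ! j) then A $$ (j, i) else 0)"

lemma cat_B_simps:
 "Obj cat_B = UNIV"
 "mor cat_B X Y = {A : carrier_mat (length Y) (length X). \<forall>j < length Y. \<forall>i < length X. A $$ (j, i) ~= 0 --> homB (X ! i) (Y ! j)}"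
 "(zero (Hom cat_B X Y)) = 0\<^sub>m (length Y) (length X)" "A +[Hom cat_B X Y] B = A + B" "c *[Hom cat_B X Y] A = c \<cdot>\<^sub>m A"
 "Comp cat_B X Y Z g f = g * f" "Ident cat_B X = 1\<^sub>m (length X)" by (simp_all add: cat_B_def homB_iff module_mat_def)

lemma cat_B_zero_entry:
 "A : mor cat_B X Y ==> j < length Y ==> i < length X ==> \<not> homB (X ! i) (Y ! j) ==> A $$ (j, i) = 0"
 unfolding cat_B_simps by blast

lemma entries_comp:
 assumes "A : carrier_mat (length Y) (length X)" "B : carrier_mat (length Z) (length Y)"
  "l < length Z" "i < length X"
 shows "(B * A) $$ (l, i) = (\<Sum>j<length Y. B $$ (l, j) * A $$ (j, i))" using assms by (simp add: scalar_prod_def atLeast0LessThan)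

lemma ff_cat_B: "ff_functor (cat_B :: ('k::field, point list, 'k mat) klin_cat) catB' \<lparr>FObj = (%X. X), FMap = entries homB\<rparr>"
proof (rule klin_category_via_bijection)
 show "klin_category catB'" by (rule mat_relation.klin_category_mat_cat[OF mat_relation_B])
next
 fix X Y :: "point list"
 show "bij_betw (entries homB X Y) (mor cat_B X Y) (mor (catB' :: ('k, point list, nat \<times> nat => 'k) klin_cat) X Y)"
 proof (rule bij_betw_byWitness[where f' = "%c. mat (length Y) (length X) c"])
  show "\<forall>A\<in>mor cat_B X Y. mat (length Y) (length X) (entries homB X Y A) = (A :: 'k mat)"
  proof
   fix A :: "'k mat" assume A: "A : mor cat_B X Y"
   show "mat (length Y) (length X) (entries homB X Y A) = A"
   proof (rule eq_matI)
    fix j i assume "j < dim_row A" "i < dim_col A"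
    thus "mat (length Y) (length X) (entries homB X Y A) $$ (j, i) = A $$ (j, i)"
     using A cat_B_zero_entry[OF A] by (auto simp: cat_B_simps entries_def)
   qed (use A in \<open>auto simp: cat_B_simps\<close>)
  qed
  show "\<forall>c\<in>mor catB' X Y. entries homB X Y (mat (length Y) (length X) c) = (c :: nat \<times> nat => 'k)"
   using supp_matsD by (fastforce simp: entries_def fun_eq_iff)
  show "entries homB X Y ` mor cat_B X Y \<subseteq> mor (catB' :: ('k, point list, nat \<times> nat => 'k) klin_cat) X Y"
   by (auto simp: entries_def supp_mats_def split: if_splits)
  show "mat (length Y) (length X) ` mor catB' X Y \<subseteq> mor (cat_B :: ('k, point list, 'k mat) klin_cat) X Y"
   by (auto simp: cat_B_simps supp_mats_def)
 qed
next
 fix X Y Z :: "point list" and f g :: "'k mat"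
 assume f: "f : mor cat_B X Y" and g: "g : mor cat_B Y Z"
 have c: "f : carrier_mat (length Y) (length X)" "g : carrier_mat (length Z) (length Y)" using f g by (simp_all add: cat_B_simps)
 have hom: "homB (X ! i) (Z ! l)" if li: "l < length Z" "i < length X" and nz: "(\<Sum>j<length Y. g $$ (l, j) * f $$ (j, i)) ~= 0" for l i
 proof -
  obtain j where "j < length Y" "g $$ (l, j) * f $$ (j, i) ~= 0" using sum.not_neutral_contains_not_neutral[OF nz] by auto
  hence "homB (X ! i) (Y ! j)" "homB (Y ! j) (Z ! l)" using f g li by (auto simp: cat_B_simps)
  thus ?thesis by (auto simp: homB_iff)
 qed
 have "Comp cat_B X Y Z g f : mor cat_B X Z" using c hom by (auto simp: cat_B_simps entries_comp[OF c] simp del: index_mult_mat)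
 moreover have "entries homB X Z (Comp cat_B X Y Z g f) = Comp catB' X Y Z (entries homB Y Z g) (entries homB X Y f)"
 proof (rule ext)
  fix li :: "nat \<times> nat"
  obtain l i where li: "li = (l, i)" by (cases li)
  show "entries homB X Z (Comp cat_B X Y Z g f) li = Comp catB' X Y Z (entries homB Y Z g) (entries homB X Y f) li"
  proof (cases "l < length Z & i < length X")
   case True
   have "g $$ (l, j) * f $$ (j, i) = entries homB Y Z g (l, j) * entries homB X Y f (j, i)" if "j < length Y" for j
    using cat_B_zero_entry[OF f, of j i] cat_B_zero_entry[OF g, of l j] True that by (auto simp: entries_def)
   hence "(\<Sum>j<length Y. g $$ (l, j) * f $$ (j, i)) = (\<Sum>j<length Y. entries homB Y Z g (l, j) * entries homB X Y f (j, i))"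
    by (intro sum.cong) auto
   moreover have "entries homB X Z (g * f) (l, i) = (\<Sum>j<length Y. g $$ (l, j) * f $$ (j, i))"
    using True hom[of l i] entries_comp[OF c] unfolding entries_def by auto
   ultimately show ?thesis using True by (simp add: li mat_comp_def cat_B_simps)
  next
   case False
   thus ?thesis by (auto simp: li mat_comp_def entries_def)
  qed
 qed
 ultimately show "Comp cat_B X Y Z g f : mor cat_B X Z &
  entries homB X Z (Comp cat_B X Y Z g f) = Comp catB' X Y Z (entries homB Y Z g) (entries homB X Y f)" by blast
next
 fix X Y :: "point list" and f g :: "'k mat"
 assume f: "f : mor cat_B X Y" and g: "g : mor cat_B X Y"
 have c: "f : carrier_mat (length Y) (length X)" "g : carrier_mat (length Y) (length X)" using f g by (simp_all add: cat_B_simps)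
 have "homB (X ! i) (Y ! j)" if "j < length Y" "i < length X" "(f + g) $$ (j, i) ~= 0" for j i
 proof (rule ccontr)
  assume "\<not> homB (X ! i) (Y ! j)"
  thus False using that c cat_B_zero_entry[OF f that(1,2)] cat_B_zero_entry[OF g that(1,2)] by simp
 qed
 hence "f + g : mor cat_B X Y" using c unfolding cat_B_simps by (simp del: index_add_mat)
 moreover have "entries homB X Y (f + g) = (%i. entries homB X Y f i + entries homB X Y g i)" using c by (auto simp: entries_def fun_eq_iff)
 ultimately show "f +[Hom cat_B X Y] g : mor cat_B X Y &
  entries homB X Y (f +[Hom cat_B X Y] g) = entries homB X Y f +[Hom catB' X Y] entries homB X Y g" by (simp add: cat_B_simps(4))
next
 fix X Y :: "point list" and f :: "'k mat" and c
 assume f: "f : mor cat_B X Y"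
 thus "c *[Hom cat_B X Y] f : mor cat_B X Y &
  entries homB X Y (c *[Hom cat_B X Y] f) = c *[Hom catB' X Y] entries homB X Y f" by (auto simp: cat_B_simps entries_def)
qed (auto simp: cat_B_simps entries_def homB_iff split: if_splits)

lemma klin_category_cat_B: "klin_category cat_B" using ff_cat_B by (auto simp: ff_functor_def klin_functor_def)

lemma klin_functor_D: "klin_functor (cat_B :: ('k::field, point list, 'k mat) klin_cat) catD' \<lparr>FObj = (%X. X), FMap = entries homD\<rparr>"
proof (intro klin_functor.intro klin_functor_axioms.intro klin_category_cat_B
  mat_relation.klin_category_mat_cat[OF mat_relation_D])
 fix X Y :: "point list"
 have "entries homD X Y : lin_maps (Hom cat_B X Y) (Hom (catD' :: ('k, point list, nat \<times> nat => 'k) klin_cat) X Y)"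
  by (rule lin_mapsI) (auto simp: entries_def supp_mats_def cat_B_simps split: if_splits)
 thus "FMap \<lparr>FObj = (%X. X), FMap = entries homD\<rparr> X Y : lin_maps (Hom cat_B X Y)
   (Hom (catD' :: ('k, point list, nat \<times> nat => 'k) klin_cat) (FObj \<lparr>FObj = (%X. X), FMap = entries homD\<rparr> X) (FObj \<lparr>FObj = (%X. X), FMap = entries homD\<rparr> Y))" by (simp only: cat_functor.simps)
next
 fix X Y Z :: "point list" and f g :: "'k mat"
 assume f: "f : mor cat_B X Y" and g: "g : mor cat_B Y Z"
 have c: "f : carrier_mat (length Y) (length X)" "g : carrier_mat (length Z) (length Y)" using f g by (simp_all add: cat_B_simps)
 have "entries homD X Z (g * f) = mat_comp (%p q r. homD p r) X Y Z (entries homD Y Z g) (entries homD X Y f)"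
 proof (rule ext)
  fix li :: "nat \<times> nat"
  obtain l i where li: "li = (l, i)" by (cases li)
  show "entries homD X Z (g * f) li = mat_comp (%p q r. homD p r) X Y Z (entries homD Y Z g) (entries homD X Y f) li"
  proof (cases "l < length Z & i < length X & homD (X ! i) (Z ! l)")
   case True
   have "g $$ (l, j) * f $$ (j, i) = entries homD Y Z g (l, j) * entries homD X Y f (j, i)" if j: "j < length Y" for j
   proof (cases "g $$ (l, j) * f $$ (j, i) = 0")
    case False
    hence "homB (X ! i) (Y ! j)" "homB (Y ! j) (Z ! l)" using f g True j by (auto simp: cat_B_simps)
    hence "homD (X ! i) (Y ! j)" "homD (Y ! j) (Z ! l)" using True by (auto simp: homD_iff homB_iff)
    thus ?thesis using True j by (simp add: entries_def)
   qed (auto simp: entries_def)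
   hence "(\<Sum>j<length Y. g $$ (l, j) * f $$ (j, i)) = (\<Sum>j<length Y. entries homD Y Z g (l, j) * entries homD X Y f (j, i))"
    by (intro sum.cong) auto
   moreover have "entries homD X Z (g * f) (l, i) = (\<Sum>j<length Y. g $$ (l, j) * f $$ (j, i))"
    using True entries_comp[OF c] unfolding entries_def by auto
   ultimately show ?thesis using True by (simp add: li mat_comp_def)
  qed (auto simp: li mat_comp_def entries_def)
 qed
 thus "FMap \<lparr>FObj = (%X. X), FMap = entries homD\<rparr> X Z (Comp cat_B X Y Z g f) =
   Comp catD' (FObj \<lparr>FObj = (%X. X), FMap = entries homD\<rparr> X) (FObj \<lparr>FObj = (%X. X), FMap = entries homD\<rparr> Y) (FObj \<lparr>FObj = (%X. X), FMap = entries homD\<rparr> Z)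
    (FMap \<lparr>FObj = (%X. X), FMap = entries homD\<rparr> Y Z g) (FMap \<lparr>FObj = (%X. X), FMap = entries homD\<rparr> X Y f)"
  by (simp add: cat_B_simps)
qed (auto simp: cat_B_simps entries_def)

text \<open>A basic morphism dies in the quotient iff a point of the strip complement lies in between.\<close>

lemma between_B_pi:
 "homB p q & \<not> homD p q \<longleftrightarrow> (\<exists>z. homB p z & homB z q & \<bar>snd z - fst z\<bar> \<ge> pi)"
proof
 assume "homB p q & \<not> homD p q"
 then consider "homB p q" "snd p + pi <= fst q" | "homB p q" "fst p + pi <= snd q" by (auto simp: homD_iff)
 thus "\<exists>z. homB p z & homB z q & \<bar>snd z - fst z\<bar> \<ge> pi"
 proof cases
  case 1
  thus ?thesis by (intro exI[of _ "(fst q, snd p)"]) (auto simp: homB_iff)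
 next
  case 2
  thus ?thesis by (intro exI[of _ "(fst p, snd q)"]) (auto simp: homB_iff)
 qed
next
 assume "\<exists>z. homB p z & homB z q & \<bar>snd z - fst z\<bar> \<ge> pi"
 thus "homB p q & \<not> homD p q" by (auto simp: homD_iff homB_iff)
qed

lemma B_pi_iff: "X : B_pi \<longleftrightarrow> (\<forall>p\<in>set X. pi <= \<bar>snd p - fst p\<bar>)"
 unfolding B_pi_def split_def by simp

lemma factoring_B_pi:
 "factoring (cat_B :: ('k::field, point list, 'k mat) klin_cat) B_pi X Y = {A : mor cat_B X Y. entries homD X Y A = (%_. 0)}"
proof (intro equalityI subsetI)
 fix A :: "'k mat" assume "A : factoring cat_B B_pi X Y"
 then obtain Z f g where A: "A = g * f" and Z: "Z : B_pi" and f: "f : mor cat_B X Z" and g: "g : mor cat_B Z Y"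
  by (auto simp: factoring_def cat_B_simps(6))
 have m: "A : mor cat_B X Y" using klin_category.comp_mor[OF klin_category_cat_B _ _ _ f g] by (simp add: cat_B_simps(1,6) A)
 have c: "f : carrier_mat (length Z) (length X)" "g : carrier_mat (length Y) (length Z)" using f g by (simp_all add: cat_B_simps)
 have "A $$ (j, i) = 0" if ji: "j < length Y" "i < length X" and h: "homD (X ! i) (Y ! j)" for j i
 proof -
  have "g $$ (j, k) * f $$ (k, i) = 0" if k: "k < length Z" for k
  proof (rule ccontr)
   assume "g $$ (j, k) * f $$ (k, i) ~= 0"
   hence "homB (X ! i) (Z ! k)" "homB (Z ! k) (Y ! j)" using f g ji k by (auto simp: cat_B_simps)
   moreover have "\<bar>snd (Z ! k) - fst (Z ! k)\<bar> \<ge> pi" using Z nth_mem[OF k] unfolding B_pi_iff by blast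
   ultimately show False using between_B_pi h by blast
  qed
  thus ?thesis unfolding A entries_comp[OF c ji] by (intro sum.neutral) auto
 qed
 thus "A : {A : mor cat_B X Y. entries homD X Y A = (%_. 0)}" using m by (auto simp: entries_def)
next
 fix A :: "'k mat" assume A: "A : {A : mor cat_B X Y. entries homD X Y A = (%_. 0)}"
 hence cA: "A : carrier_mat (length Y) (length X)" by (simp add: cat_B_simps)
 have A0: "A $$ (j, i) = 0" if "j < length Y" "i < length X" "homD (X ! i) (Y ! j)" for j i
 proof -
  have "entries homD X Y A (j, i) = 0" using A by simp
  thus ?thesis using that by (simp add: entries_def)
 qed
 have ex: "\<exists>z. \<bar>snd z - fst z\<bar> \<ge> pi & (A $$ (j, i) ~= 0 --> homB (X ! i) z & homB z (Y ! j))"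
  if ji: "j < length Y" "i < length X" for j i
 proof (cases "A $$ (j, i) = 0")
  case True
  thus ?thesis using pi_gt_zero by (intro exI[of _ "(0, pi)"]) auto
 next
  case False
  hence "homB (X ! i) (Y ! j) & \<not> homD (X ! i) (Y ! j)" using A A0 ji by (auto simp: cat_B_simps)
  thus ?thesis using between_B_pi by blast
 qed
 define z where "z j i = (SOME z. \<bar>snd z - fst z\<bar> \<ge> pi & (A $$ (j, i) ~= 0 --> homB (X ! i) z & homB z (Y ! j)))" for j i
 have z: "\<bar>snd (z j i) - fst (z j i)\<bar> \<ge> pi" "A $$ (j, i) ~= 0 ==> homB (X ! i) (z j i) & homB (z j i) (Y ! j)"
  if "j < length Y" "i < length X" for j i using someI_ex[OF ex[OF that]] unfolding z_def by blast+
 define n where "n = length X"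
 define L where "L = length Y * n"
 have kdec: "k div n < length Y" "k mod n < n" if "k < L" for k
 proof -
  have "n > 0" using that by (cases n) (auto simp: L_def)
  thus "k div n < length Y" "k mod n < n" using that less_mult_imp_div_less[of k "length Y" n] by (auto simp: L_def)
 qed
 have kenc: "j * n + i < L" "(j * n + i) div n = j" "(j * n + i) mod n = i" if "j < length Y" "i < n" for j i
 proof -
  have "j * n + i < (j + 1) * n" using that by simp
  also have "\<dots> <= L" using that unfolding L_def by (intro mult_le_mono1) simp
  finally show "j * n + i < L" .
 qed (use that in simp_all)
 define Z where "Z = map (%k. z (k div n) (k mod n)) [0..<L]"
 define f where "f = mat L n (%(k, i). if k mod n = i & A $$ (k div n, i) ~= 0 then 1 else 0 :: 'k)"
 define g where "g = mat (length Y) L (%(j, k). if k div n = j then A $$ (j, k mod n) else 0)"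
 have Zk: "length Z = L" "!!k. k < L ==> Z ! k = z (k div n) (k mod n)" by (simp_all add: Z_def)
 have "Z : B_pi" using z(1) kdec unfolding B_pi_iff Z_def n_def by auto
 moreover have f: "f : mor cat_B X Z" using z(2) kdec by (auto simp: cat_B_simps f_def Zk n_def split: if_splits)
 moreover have g: "g : mor cat_B Z Y" using z(2) kdec by (auto simp: cat_B_simps g_def Zk n_def split: if_splits)
 moreover have "g * f = A"
 proof (rule eq_matI)
  show d: "dim_row (g * f) = dim_row A" "dim_col (g * f) = dim_col A" using cA by (simp_all add: f_def g_def n_def)
  fix j i assume "j < dim_row A" "i < dim_col A"
  hence ji: "j < length Y" "i < n" using cA by (auto simp: n_def)
  have c: "f : carrier_mat (length Z) (length X)" "g : carrier_mat (length Y) (length Z)" using f g by (simp_all add: cat_B_simps)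
  have "(g * f) $$ (j, i) = (\<Sum>k<L. g $$ (j, k) * f $$ (k, i))" using entries_comp[OF c ji(1)] ji by (simp add: n_def Zk)
  also have "\<dots> = (\<Sum>k<L. if k = j * n + i then A $$ (j, i) else 0)"
  proof (intro sum.cong refl)
   fix k assume "k : {..<L}"
   hence k: "k < L" by simp
   show "g $$ (j, k) * f $$ (k, i) = (if k = j * n + i then A $$ (j, i) else 0)"
   proof (cases "k = j * n + i")
    case True
    thus ?thesis using kenc[OF ji] ji k by (simp add: f_def g_def)
   next
    case False
    hence "\<not> (k div n = j & k mod n = i)" using div_mult_mod_eq[of k n] by auto
    thus ?thesis using ji k by (auto simp: f_def g_def False)
   qed
  qed
  also have "\<dots> = A $$ (j, i)" using kenc(1)[OF ji] by simp
  finally show "(g * f) $$ (j, i) = A $$ (j, i)" .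
 qed
 ultimately show "A : factoring cat_B B_pi X Y"
  unfolding factoring_def cat_B_simps(1,6) by blast
qed

type_synonym 'k coset_cat = "('k, point list, 'k mat set) klin_cat"
type_synonym 'k cluster_cat = "('k, dpoint list, int => 'k mat set) klin_cat"

abbreviation quotB :: "('k::field, point list, 'k mat set) klin_cat" where
 "quotB \<equiv> quotient_cat cat_B B_pi"

definition coset_entries :: "point list => point list => 'k::field mat set => nat \<times> nat => 'k" where
 "coset_entries X Y A = entries homD X Y (SOME f. f : A)"

definition coset_of :: "point list => point list => (nat \<times> nat => 'k::field) => 'k mat set" where
 "coset_of X Y c = {A : mor cat_B X Y. entries homD X Y A = c}"

lemma quotB_functor:
 shows mor_quotB: "mor quotB X Y = coset_of X Y ` (supp_mats homD X Y :: (nat \<times> nat => 'k::field) set)"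
  and ff_quotB: "ff_functor (quotB :: 'k coset_cat) catD' \<lparr>FObj = (%X. X), FMap = coset_entries\<rparr>"
proof -
 have full: "mor catD' X Y \<subseteq> entries homD X Y ` mor (cat_B :: ('k, point list, 'k mat) klin_cat) X Y" for X Y
 proof
  fix c :: "nat \<times> nat => 'k" assume "c : mor catD' X Y"
  hence c: "c : supp_mats homD X Y" by simp
  have "mat (length Y) (length X) c : mor cat_B X Y" using supp_matsD[OF c] by (auto simp: cat_B_simps homD_iff)
  moreover have "entries homD X Y (mat (length Y) (length X) c) = c" using supp_matsD[OF c] by (fastforce simp: entries_def fun_eq_iff)
  ultimately show "c : entries homD X Y ` mor cat_B X Y" by (metis imageI)
 qed
 have ker: "factoring cat_B B_pi X Y = {f : mor (cat_B :: ('k, point list, 'k mat) klin_cat) X Y. entries homD X Y f = (zero (Hom catD' X Y))}" for X Y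
  unfolding factoring_B_pi by simp
 note Q = ff_functor_quotient[OF klin_functor_D, of B_pi, simplified cat_functor.simps, OF full ker]
 show "mor quotB X Y = coset_of X Y ` (supp_mats homD X Y :: (nat \<times> nat => 'k) set)"
  using Q(1)[of X Y] by (auto simp: coset_of_def cat_B_simps(1))
 show "ff_functor (quotB :: 'k coset_cat) catD' \<lparr>FObj = (%X. X), FMap = coset_entries\<rparr>"
  using Q(2) unfolding coset_entries_def[abs_def] by simp
qed

section \<open>The continuous cluster category as a matrix category\<close>

definition lft :: "dpoint => lift" where
 "lft d = plift (fst d)"

definition shift :: "dpoint => dpoint" where
 "shift = (%((x, y), s). ((y + pi, x + pi), \<not> s))"

definition unshift :: "dpoint => dpoint" where
 "unshift = (%((x, y), s). ((y - pi, x - pi), \<not> s))"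

definition rot :: "int => dpoint => dpoint" where
 "rot k = (if k \<ge> 0 then shift ^^ nat k else unshift ^^ nat (- k))"

lemma lft_shift: "lft (shift d) = turn 1 (lft d)" "lft (unshift d) = turn (-1) (lft d)"
 by (auto simp: lft_def shift_def unshift_def plift_def turn_def add_divide_distrib diff_divide_distrib split: prod.split)

lemma lft_rot [simp]: "lft (rot k d) = turn k (lft d)"
proof -
 have "lft ((shift ^^ n) d) = turn (int n) (lft d)" for n by (induction n) (simp_all add: lft_shift add.commute)
 moreover have "lft ((unshift ^^ n) d) = turn (- int n) (lft d)" for n by (induction n) (simp_all add: lft_shift add.commute)
 ultimately show ?thesis by (simp add: rot_def)
qed

abbreviation Fpow :: "int => (dpoint list, 'k::field mat set, dpoint list, 'k mat set) cat_functor" where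
 "Fpow \<equiv> zpow_functor F_aut F_aut_inv"

lemma Fpow_simps [simp]:
 "FObj (Fpow k :: (dpoint list, 'k::field mat set, dpoint list, 'k mat set) cat_functor) Y = map (rot k) Y"
 "FMap (Fpow k :: (dpoint list, 'k::field mat set, dpoint list, 'k mat set) cat_functor) X Y A = A"
proof -
 have F: "FObj F_aut = map shift" "FObj F_aut_inv = map unshift" by (simp_all add: F_aut_def F_aut_inv_def shift_def unshift_def)
 have FM: "FMap F_aut X Y A = A" "FMap F_aut_inv X Y A = A" for X Y and A :: "'k mat set" by (simp_all add: F_aut_def F_aut_inv_def)
 have "FObj ((comp_functor F_aut ^^ n) id_functor :: (dpoint list, 'k mat set, dpoint list, 'k mat set) cat_functor) = map (shift ^^ n)"
  "FMap ((comp_functor F_aut ^^ n) id_functor :: (dpoint list, 'k mat set, dpoint list, 'k mat set) cat_functor) X Y A = A"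
  "FObj ((comp_functor F_aut_inv ^^ n) id_functor :: (dpoint list, 'k mat set, dpoint list, 'k mat set) cat_functor) = map (unshift ^^ n)"
  "FMap ((comp_functor F_aut_inv ^^ n) id_functor :: (dpoint list, 'k mat set, dpoint list, 'k mat set) cat_functor) X Y A = A" for n X Y A
  by (induction n arbitrary: X Y A) (auto simp: id_functor_def comp_functor_def F FM fun_eq_iff)
 thus "FObj (Fpow k :: (dpoint list, 'k mat set, dpoint list, 'k mat set) cat_functor) Y = map (rot k) Y"
  "FMap (Fpow k :: (dpoint list, 'k mat set, dpoint list, 'k mat set) cat_functor) X Y A = A" by (simp_all add: zpow_functor_def rot_def)
qed

definition homC :: "dpoint => dpoint => bool" where
 "homC p q \<longleftrightarrow> (\<exists>k. lift_hom (lft p) (turn k (lft q)))"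

definition deg :: "dpoint => dpoint => int" where
 "deg p q = (THE k. lift_hom (lft p) (turn k (lft q)))"

definition compC :: "dpoint => dpoint => dpoint => bool" where
 "compC p q r \<longleftrightarrow> lift_hom (lft p) (turn (deg p q + deg q r) (lft r))"

lemma deg_eq: "lift_hom (lft p) (turn k (lft q)) ==> deg p q = k"
 unfolding deg_def using lift_hom_unique by blast

lemma homC_deg: "homC p q ==> lift_hom (lft p) (turn (deg p q) (lft q))" using deg_eq unfolding homC_def by blast

lemma homC_iff: "lift_hom (lft p) (turn k (lft q)) \<longleftrightarrow> homC p q & deg p q = k" using deg_eq homC_deg unfolding homC_def by blast

lemma lift_hom_chord: "lift_hom x y ==> chord x" "lift_hom x y ==> chord y" by (auto simp: lift_hom_def chord_def)

lemma homC_refl: "homC p p \<longleftrightarrow> chord (lft p)"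
 using lift_hom_chord(1)[of "lft p"] lift_hom_refl[of "lft p"] turn_0[of "lft p"] unfolding homC_def by metis

lemma deg_refl: "chord (lft p) ==> deg p p = 0" using deg_eq[of p 0 p] lift_hom_refl by simp

lemma mat_relation_C: "mat_relation homC compC"
proof
 fix p q r s
 {
  assume pq: "homC p q"
  note h = homC_deg[OF pq]
  have c: "chord (lft p)" "chord (lft q)" using lift_hom_chord[OF h] by simp_all
  thus "homC p p" "homC q q" by (simp_all add: homC_refl)
  show "compC p p q" "compC p q q" using h deg_refl c by (simp_all add: compC_def)
  assume qr: "homC q r"
  show "compC p q r ==> homC p r" by (auto simp: compC_def homC_def)
  assume rs: "homC r s"
  define y where "y = turn (deg p q) (lft q)"
  define z where "z = turn (deg p q + deg q r) (lft r)"
  define w where "w = turn (deg p q + deg q r + deg r s) (lft s)"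
  have 1: "lift_hom (lft p) y" using h by (simp add: y_def)
  have 2: "lift_hom y z" using homC_deg[OF qr] lift_hom_turn[of "deg p q" "lft q" "turn (deg q r) (lft r)"] by (simp add: y_def z_def)
  have 3: "lift_hom z w" using homC_deg[OF rs] lift_hom_turn[of "deg p q + deg q r" "lft r" "turn (deg r s) (lft s)"] by (simp add: z_def w_def)
  have L: "compC p q r & compC p r s \<longleftrightarrow> lift_hom (lft p) z & lift_hom (lft p) w"
   using deg_eq[of p "deg p q + deg q r" r] by (auto simp: compC_def z_def w_def)
  have "compC q r s \<longleftrightarrow> lift_hom y w"
   using lift_hom_turn[of "deg p q" "lft q" "turn (deg q r + deg r s) (lft s)"] by (simp add: compC_def y_def w_def add.assoc)
  hence R: "compC q r s & compC p q s \<longleftrightarrow> lift_hom y w & lift_hom (lft p) w"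
   using deg_eq[of q "deg q r + deg r s" s] by (auto simp: compC_def w_def add.assoc)
  have "lift_hom (lft p) w ==> lift_hom (lft p) z & lift_hom y w" using 1 2 3 unfolding lift_hom_def by linarith
  thus "compC p q r & compC p r s \<longleftrightarrow> compC q r s & compC p q s" using L R by blast
 }
qed

abbreviation chord_lists :: "dpoint list set" where
 "chord_lists \<equiv> {X. \<forall>d\<in>set X. chord (lft d)}"

abbreviation catC' :: "dpoint list set => ('k::field, dpoint list, nat \<times> nat => 'k) klin_cat" where
 "catC' S \<equiv> mat_cat S homC compC"

lemma lin_finsum:
 fixes V :: "('k::field, 'a) module" and h :: "'a => 'i => 'k"
 assumes V: "Module.module class_ring V" and h: "h : lin_maps V (fun_space S)"
  and W: "Module.module class_ring (fun_space S)"
  and A: "finite A" and f: "!!a. a : A ==> f a : carrier V"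
 shows "finsum V f A : carrier V & h (finsum V f A) = (%i. \<Sum>a\<in>A. h (f a) i)"
proof -
 interpret Module.module "class_ring :: 'k ring" V by fact
 show ?thesis using A f
 proof (induction A)
  case empty
  thus ?case using lin_maps_zero[OF V W h] by simp
 next
  case (insert a A)
  hence fin: "finsum V f A : carrier V" "h (finsum V f A) = (%i. \<Sum>a\<in>A. h (f a) i)" by auto
  have "finsum V f (insert a A) = f a +[V] finsum V f A" by (rule finsum_insert) (use insert in auto)
  thus ?case using insert fin lin_maps_add[OF h, of "f a" "finsum V f A"] by simp
 qed
qed

abbreviation pts :: "dpoint list => point list" where
 "pts \<equiv> map fst"

abbreviation rots :: "int => dpoint list => dpoint list" where
 "rots k \<equiv> map (rot k)"

lemma hom_pts:
 assumes "j < length Y" "i < length X"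
 shows "homD (pts (rots m X) ! i) (pts (rots k Y) ! j) \<longleftrightarrow> lift_hom (lft (X ! i)) (turn (k - m) (lft (Y ! j)))"
  and "homB (pts (rots m X) ! i) (pts (rots k Y) ! j) \<longleftrightarrow> lift_le (lft (X ! i)) (turn (k - m) (lft (Y ! j)))"
proof -
 have l: "plift (fst (rot m d)) = turn m (lft d)" for m d using lft_rot[of m d] by (simp add: lft_def)
 have le: "lift_le (turn m x) (turn m y) \<longleftrightarrow> lift_le x y" for m x y by (auto simp: lift_le_def turn_def)
 show "homD (pts (rots m X) ! i) (pts (rots k Y) ! j) \<longleftrightarrow> lift_hom (lft (X ! i)) (turn (k - m) (lft (Y ! j)))"
  using assms lift_hom_turn[of m "lft (X ! i)" "turn (k - m) (lft (Y ! j))"] by (simp add: homD_def l)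
 show "homB (pts (rots m X) ! i) (pts (rots k Y) ! j) \<longleftrightarrow> lift_le (lft (X ! i)) (turn (k - m) (lft (Y ! j)))"
  using assms le[of m "lft (X ! i)" "turn (k - m) (lft (Y ! j))"] by (simp add: homB_def l)
qed

lemma rot_0 [simp]: "rot 0 = id" by (simp add: rot_def)

lemma hom_pts0:
 assumes "j < length Y" "i < length X"
 shows "homD (pts X ! i) (pts (rots k Y) ! j) \<longleftrightarrow> lift_hom (lft (X ! i)) (turn k (lft (Y ! j)))"
 using hom_pts(1)[OF assms, of 0 k] by simp

lemma entries_rots: "entries homD (pts (rots m X)) (pts (rots k Y)) = entries homD (pts X) (pts (rots (k - m) Y))"
 using hom_pts(1)[of _ Y _ X m k] hom_pts(1)[of _ Y _ X 0 "k - m"] by (auto simp: entries_def fun_eq_iff simp del: nth_map map_map)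

lemma supp_rots: "supp_mats homD (pts (rots m X)) (pts (rots k Y)) = supp_mats homD (pts X) (pts (rots (k - m) Y))"
proof -
 have "(j < length (pts (rots k Y)) & i < length (pts (rots m X)) & homD (pts (rots m X) ! i) (pts (rots k Y) ! j)) =
  (j < length (pts (rots (k - m) Y)) & i < length (pts X) & homD (pts X ! i) (pts (rots (k - m) Y) ! j))" for i j
  using hom_pts(1)[of j Y i X m k] hom_pts0[of j Y i X "k - m"] by (cases "j < length Y & i < length X") (auto simp del: map_map nth_map)
 thus ?thesis unfolding supp_mats_def by simp
qed

lemma mor_B_rots: "mor cat_B (pts (rots m X)) (pts (rots k Y)) = mor cat_B (pts X) (pts (rots (k - m) Y))"
 using hom_pts(2)[of _ Y _ X m k] hom_pts(2)[of _ Y _ X 0 "k - m"] by (auto simp: cat_B_simps simp del: nth_map map_map)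

lemma coset_rots:
 "coset_of (pts (rots m X)) (pts (rots k Y)) = coset_of (pts X) (pts (rots (k - m) Y))"
 "coset_entries (pts (rots m X)) (pts (rots k Y)) = coset_entries (pts X) (pts (rots (k - m) Y))"
 by (simp_all add: coset_of_def coset_entries_def entries_rots mor_B_rots fun_eq_iff del: map_map)

lemma quotB_props:
 fixes X Y :: "point list"
 defines "V \<equiv> coset_entries X Y :: 'k::field mat set => _"
 shows "V : lin_maps (Hom quotB X Y) (fun_space (supp_mats homD X Y))"
  and "A : mor quotB X Y ==> coset_of X Y (V A) = A"
  and "c : supp_mats homD X Y ==> V (coset_of X Y c) = c & coset_of X Y c : mor quotB X Y"
  and "Module.module class_ring (Hom (quotB :: 'k coset_cat) X Y)"
  and "Z : UNIV ==> A : mor quotB X Y ==> B : mor quotB Y Z ==>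
   Comp quotB X Y Z B A : mor quotB X Z &
   coset_entries X Z (Comp quotB X Y Z B A) = mat_comp (%p q r. homD p r) X Y Z (coset_entries Y Z B) (V A)"
  and "(Ident quotB X :: 'k mat set) : mor quotB X X & coset_entries X X (Ident quotB X :: 'k mat set) = Ident catD' X"
proof -
 let ?F = "\<lparr>FObj = (%X. X), FMap = coset_entries :: _ => _ => 'k mat set => _\<rparr>"
 have F: "klin_functor (quotB :: 'k coset_cat) catD' ?F"
  and bij: "!!X Y. bij_betw (coset_entries X Y) (mor (quotB :: 'k coset_cat) X Y) (supp_mats homD X Y)"
  using ff_quotB by (auto simp: ff_functor_def quotient_cat_def cat_B_simps(1))
 interpret klin_functor "quotB :: ('k, point list, 'k mat set) klin_cat" catD' ?F by fact
 have obj: "X : Obj (quotB :: 'k coset_cat)" for X by (simp add: quotient_cat_def cat_B_simps(1))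
 show "V : lin_maps (Hom quotB X Y) (fun_space (supp_mats homD X Y))" using FMap_linear[OF obj obj] by (simp add: V_def)
 have vc: "V (coset_of X Y c) = c" and cm: "coset_of X Y c : mor quotB X Y" if c: "c : supp_mats homD X Y" for c
 proof -
  show cm: "coset_of X Y c : mor quotB X Y" using c mor_quotB by blast
  have "mat (length Y) (length X) d : coset_of X Y d" if d: "d : supp_mats homD X Y" for d :: "nat \<times> nat => 'k"
  proof -
   have "mat (length Y) (length X) d : mor cat_B X Y" using supp_matsD[OF d] by (auto simp: cat_B_simps homD_iff)
   moreover have "entries homD X Y (mat (length Y) (length X) d) = d" using supp_matsD[OF d] by (fastforce simp: entries_def fun_eq_iff)
   ultimately show ?thesis by (simp add: coset_of_def)
  qed
  hence "(SOME f. f : coset_of X Y d) : coset_of X Y d" if "d : supp_mats homD X Y" for d :: "nat \<times> nat => 'k"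
   using someI[of "%f. f : coset_of X Y d"] that by blast
  from this[OF c] show "V (coset_of X Y c) = c" by (simp add: V_def coset_entries_def coset_of_def)
 qed
 thus "c : supp_mats homD X Y ==> V (coset_of X Y c) = c & coset_of X Y c : mor quotB X Y" by blast
 show "coset_of X Y (V A) = A" if "A : mor quotB X Y"
 proof -
  from that obtain c where c: "A = coset_of X Y c" "c : supp_mats homD X Y"
   unfolding mor_quotB by (rule imageE)
  show ?thesis unfolding c(1) vc[OF c(2)] by (rule refl)
 qed
 show "Module.module class_ring (Hom (quotB :: 'k coset_cat) X Y)" by (rule S.Hom_module[OF obj obj])
 show "Comp quotB X Y Z B A : mor quotB X Z &
   coset_entries X Z (Comp quotB X Y Z B A) = mat_comp (%p q r. homD p r) X Y Z (coset_entries Y Z B) (V A)"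
  if "A : mor quotB X Y" "B : mor quotB Y Z" using FMap_Comp[OF obj obj obj that] S.comp_mor[OF obj obj obj that] by (simp add: V_def)
 show "(Ident quotB X :: 'k mat set) : mor quotB X X & coset_entries X X (Ident quotB X :: 'k mat set) = Ident catD' X"
  using FMap_Ident[OF obj] S.Ident_mor[OF obj] by simp
qed

lemma cat_D2_simps:
 "Obj (cat_D2 :: ('k::field, dpoint list, 'k mat set) klin_cat) = chord_lists"
 "Hom (cat_D2 :: ('k, dpoint list, 'k mat set) klin_cat) X Y = Hom quotB (pts X) (pts Y)"
 "Comp (cat_D2 :: ('k, dpoint list, 'k mat set) klin_cat) X Y Z = Comp quotB (pts X) (pts Y) (pts Z)"
 "Ident (cat_D2 :: ('k, dpoint list, 'k mat set) klin_cat) X = Ident quotB (pts X)"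
proof -
 have "\<bar>snd p - fst p\<bar> < pi \<longleftrightarrow> chord (plift p)" for p
 proof -
  have 1: "u / pi < v / pi + 1 \<longleftrightarrow> u < v + pi" for u v :: real
  proof -
   have "v / pi + 1 = (v + pi) / pi" by (simp add: add_divide_distrib)
   thus ?thesis by (simp add: divide_less_cancel)
  qed
  show ?thesis using 1[of "fst p" "snd p"] 1[of "snd p" "fst p"] by (auto simp: chord_def plift_def)
 qed
 hence "(\<forall>(x, y)\<in>set (pts X). \<bar>y - x\<bar> < pi) \<longleftrightarrow> (\<forall>d\<in>set X. chord (lft d))" for X
  by (simp add: split_def lft_def)
 thus "Obj (cat_D2 :: ('k, dpoint list, 'k mat set) klin_cat) = chord_lists"
  by (simp add: cat_D2_def cat_D_def full_subcat_def quotient_cat_def cat_B_simps(1))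
qed (simp_all add: cat_D2_def cat_D_def full_subcat_def)

definition oentries :: "dpoint list => dpoint list => (int => 'k::field mat set) => nat \<times> nat => 'k" where
 "oentries X Y f = (%(j, i). if j < length Y & i < length X & homC (X ! i) (Y ! j)
   then coset_entries (pts X) (pts (rots (deg (X ! i) (Y ! j)) Y)) (f (deg (X ! i) (Y ! j))) (j, i) else 0)"

definition part :: "dpoint list => dpoint list => int => (nat \<times> nat => 'k::field) => nat \<times> nat => 'k" where
 "part X Y k c = (%(j, i). if j < length Y & i < length X & lift_hom (lft (X ! i)) (turn k (lft (Y ! j))) then c (j, i) else 0)"

lemma part_supp: "part X Y k c : supp_mats homD (pts X) (pts (rots k Y))"
 unfolding supp_mats_def using hom_pts0[of _ Y _ X k] by (auto simp: part_def split: if_splits simp del: map_map nth_map)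

lemma cat_C_simps:
 fixes X Y :: "dpoint list"
 defines "H \<equiv> %k. Hom (quotB :: ('k::field, point list, 'k mat set) klin_cat) (pts X) (pts (rots k Y))"
 shows "mor cat_C X Y = {f. (\<forall>k. f k : carrier (H k)) & finite {k. f k ~= (zero (H k))}}"
  "(zero (Hom cat_C X Y)) = (%k. (zero (H k)))"
  "f +[Hom cat_C X Y] g = (%k. f k +[H k] g k)"
  "c *[Hom cat_C X Y] f = (%k. c *[H k] f k)" by (simp_all add: cat_C_def orbit_cat_def cat_D2_simps H_def del: map_map)

lemma coset_entries_part:
 assumes f: "f : mor (cat_C :: ('k::field, dpoint list, int => 'k mat set) klin_cat) X Y"
 shows "coset_entries (pts X) (pts (rots k Y)) (f k) = part X Y k (oentries X Y f)"
proof (rule ext)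
 fix ji :: "nat \<times> nat"
 obtain j i where ji: "ji = (j, i)" by (cases ji)
 have "f k : mor quotB (pts X) (pts (rots k Y))" using f unfolding cat_C_simps by blast
 hence c: "coset_entries (pts X) (pts (rots k Y)) (f k) : supp_mats homD (pts X) (pts (rots k Y))"
  using lin_maps_closed[OF quotB_props(1)] by fastforce
 show "coset_entries (pts X) (pts (rots k Y)) (f k) ji = part X Y k (oentries X Y f) ji"
 proof (cases "j < length Y & i < length X & lift_hom (lft (X ! i)) (turn k (lft (Y ! j)))")
  case True
  hence "homC (X ! i) (Y ! j)" "deg (X ! i) (Y ! j) = k" using homC_iff by blast+
  thus ?thesis using True by (simp add: ji part_def oentries_def del: map_map)
 next
  case False
  hence "coset_entries (pts X) (pts (rots k Y)) (f k) (j, i) = 0"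
   using supp_matsD[OF c, of j i] hom_pts0[of j Y i X k] by (auto simp del: map_map nth_map)
  thus ?thesis using False by (auto simp add: ji part_def)
 qed
qed

lemma zero_quotB: "(zero (Hom (quotB :: ('k::field, point list, 'k mat set) klin_cat) X Y)) = coset_of X Y (%_. 0)"
proof -
 have v0: "coset_entries X Y (zero (Hom (quotB :: 'k coset_cat) X Y)) = (%_. 0)"
  using lin_maps_zero[OF quotB_props(4) vs_supp_mats quotB_props(1)] by simp
 show ?thesis by (rule trans[OF quotB_props(2)[OF vs_zero[OF quotB_props(4)], symmetric]]) (simp only: v0)
qed

lemma orbit_entries_bij:
 "bij_betw (oentries X Y) (mor (cat_C :: ('k::field, dpoint list, int => 'k mat set) klin_cat) X Y) (supp_mats homC X Y)"
proof (rule bij_betw_byWitness[where f' = "%c k. coset_of (pts X) (pts (rots k Y)) (part X Y k c)"])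
 show "\<forall>f\<in>mor (cat_C :: 'k cluster_cat) X Y.
   (%k. coset_of (pts X) (pts (rots k Y)) (part X Y k (oentries X Y f))) = f"
 proof (intro ballI ext)
  fix f :: "int => 'k mat set" and k assume f: "f : mor cat_C X Y"
  hence "f k : mor quotB (pts X) (pts (rots k Y))" unfolding cat_C_simps by blast
  thus "coset_of (pts X) (pts (rots k Y)) (part X Y k (oentries X Y f)) = f k"
   using coset_entries_part[OF f, of k, symmetric] quotB_props(2) by (simp del: map_map)
 qed
 show "\<forall>c\<in>supp_mats homC X Y. oentries X Y (%k. coset_of (pts X) (pts (rots k Y)) (part X Y k c)) = (c :: nat \<times> nat => 'k)"
 proof (intro ballI ext)
  fix c :: "nat \<times> nat => 'k" and ji :: "nat \<times> nat" assume c: "c : supp_mats homC X Y"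
  obtain j i where ji: "ji = (j, i)" by (cases ji)
  show "oentries X Y (%k. coset_of (pts X) (pts (rots k Y)) (part X Y k c)) ji = c ji"
  proof (cases "j < length Y & i < length X & homC (X ! i) (Y ! j)")
   case True
   hence "oentries X Y (%k. coset_of (pts X) (pts (rots k Y)) (part X Y k c)) ji = part X Y (deg (X ! i) (Y ! j)) c (j, i)"
    by (simp add: ji oentries_def conjunct1[OF quotB_props(3)[OF part_supp]] del: map_map)
   thus ?thesis using True homC_deg by (simp add: part_def ji)
  next
   case False
   thus ?thesis using supp_matsD[OF c, of j i] by (auto simp: oentries_def ji)
  qed
 qed
 show "oentries X Y ` mor (cat_C :: 'k cluster_cat) X Y \<subseteq> supp_mats homC X Y" by (auto simp: oentries_def supp_mats_def split: if_splits)
 show "(%c k. coset_of (pts X) (pts (rots k Y)) (part X Y k c)) ` supp_mats homC X Y \<subseteq>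
   mor (cat_C :: 'k cluster_cat) X Y"
 proof (intro image_subsetI)
  fix c :: "nat \<times> nat => 'k" assume "c : supp_mats homC X Y"
  let ?f = "%k. coset_of (pts X) (pts (rots k Y)) (part X Y k c)"
  have "{k. ?f k ~= (zero (Hom (quotB :: 'k coset_cat) (pts X) (pts (rots k Y))))} \<subseteq>
   (%(j, i). deg (X ! i) (Y ! j)) ` ({..<length Y} \<times> {..<length X})"
  proof
   fix k assume "k : {k. ?f k ~= (zero (Hom (quotB :: 'k coset_cat) (pts X) (pts (rots k Y))))}"
   hence "part X Y k c ~= (%_. 0)" by (auto simp: zero_quotB simp del: map_map)
   then obtain j i where "j < length Y" "i < length X" "lift_hom (lft (X ! i)) (turn k (lft (Y ! j)))"
    by (auto simp: part_def fun_eq_iff split: if_splits)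
   thus "k : (%(j, i). deg (X ! i) (Y ! j)) ` ({..<length Y} \<times> {..<length X})" using deg_eq by (intro image_eqI[of _ _ "(j, i)"]) auto
  qed
  hence "finite {k. ?f k ~= (zero (Hom (quotB :: 'k coset_cat) (pts X) (pts (rots k Y))))}" by (rule finite_subset) simp
  thus "?f : mor cat_C X Y"
   unfolding cat_C_simps by (simp add: conjunct2[OF quotB_props(3)[OF part_supp]] del: map_map)
 qed
qed

text \<open>
 Only one degree contributes to an entry of a morphism in the orbit category, so the finite sum
 in the definition of composition has a single nonzero term.
\<close>

lemma ff_cat_C: "ff_functor (cat_C :: ('k::field, dpoint list, int => 'k mat set) klin_cat)
  (catC' chord_lists) \<lparr>FObj = (%X. X), FMap = oentries\<rparr>"
proof (rule klin_category_via_bijection)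
 show "klin_category (catC' chord_lists :: ('k, dpoint list, nat \<times> nat => 'k) klin_cat)"
  by (rule mat_relation.klin_category_mat_cat[OF mat_relation_C])
next
 fix X assume "X : Obj (cat_C :: 'k cluster_cat)"
 thus "X : Obj (catC' chord_lists :: ('k, dpoint list, nat \<times> nat => 'k) klin_cat)" by (simp add: cat_C_def orbit_cat_def cat_D2_simps)
next
 fix X Y
 show "bij_betw (oentries X Y) (mor (cat_C :: 'k cluster_cat) X Y)
   (mor (catC' chord_lists) X Y)" using orbit_entries_bij by simp
next
 fix X Y
 have V: "coset_entries (pts X) (pts (rots k Y)) (zero (Hom (quotB :: 'k coset_cat) (pts X) (pts (rots k Y)))) = (%_. 0)" for k
  using lin_maps_zero[OF quotB_props(4) vs_supp_mats quotB_props(1)] by simp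
 have "oentries X Y (zero (Hom (cat_C :: 'k cluster_cat) X Y)) = (%_. 0)"
  unfolding cat_C_simps oentries_def using V by (auto simp: fun_eq_iff simp del: map_map)
 moreover have "(zero (Hom (cat_C :: 'k cluster_cat) X Y)) : mor cat_C X Y"
  unfolding cat_C_simps by (simp add: vs_zero[OF quotB_props(4)])
 ultimately show "(zero (Hom cat_C X Y)) : mor (cat_C :: 'k cluster_cat) X Y &
  oentries X Y (zero (Hom (cat_C :: 'k cluster_cat) X Y)) = (zero (Hom (catC' chord_lists) X Y))" by simp
next
 fix X Y and f g :: "int => 'k mat set"
 assume f: "f : mor cat_C X Y" and g: "g : mor cat_C X Y"
 let ?H = "%k. Hom (quotB :: 'k coset_cat) (pts X) (pts (rots k Y))"
 have fk: "f k : carrier (?H k)" "g k : carrier (?H k)" for k using f g unfolding cat_C_simps by blast+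
 have fin: "finite {k. f k ~= (zero (?H k))}" "finite {k. g k ~= (zero (?H k))}" using f g unfolding cat_C_simps by blast+
 have "{k. f k +[?H k] g k ~= (zero (?H k))} \<subseteq> {k. f k ~= (zero (?H k))} \<union> {k. g k ~= (zero (?H k))}"
  by (auto simp: vs_l_zero[OF quotB_props(4) vs_zero[OF quotB_props(4)]] simp del: map_map)
 hence "finite {k. f k +[?H k] g k ~= (zero (?H k))}" using fin finite_subset by blast
 hence m: "f +[Hom cat_C X Y] g : mor cat_C X Y"
  unfolding cat_C_simps by (simp add: vs_add[OF quotB_props(4) fk] del: map_map)
 have "oentries X Y (%k. f k +[?H k] g k) = (%ji. oentries X Y f ji + oentries X Y g ji)"
  by (simp add: oentries_def fun_eq_iff lin_maps_add[OF quotB_props(1) fk] del: map_map)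
 thus "f +[Hom cat_C X Y] g : mor cat_C X Y &
  oentries X Y (f +[Hom cat_C X Y] g) = oentries X Y f +[Hom (catC' chord_lists) X Y] oentries X Y g" using m unfolding cat_C_simps(3) by simp
next
 fix X Y c and f :: "int => 'k mat set"
 assume f: "f : mor cat_C X Y"
 let ?H = "%k. Hom (quotB :: 'k coset_cat) (pts X) (pts (rots k Y))"
 have fk: "f k : carrier (?H k)" for k using f unfolding cat_C_simps by blast
 have fin: "finite {k. f k ~= (zero (?H k))}" using f unfolding cat_C_simps by blast
 have "c *[?H k] f k = (zero (?H k))" if "f k = (zero (?H k))" for k
  unfolding that by (rule vs_smult_null[OF quotB_props(4)])
 hence "{k. c *[?H k] f k ~= (zero (?H k))} \<subseteq> {k. f k ~= (zero (?H k))}" by blast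
 hence "finite {k. c *[?H k] f k ~= (zero (?H k))}" using fin finite_subset by blast
 hence m: "c *[Hom cat_C X Y] f : mor cat_C X Y"
  unfolding cat_C_simps by (simp add: vs_smult[OF quotB_props(4) fk] del: map_map)
 have "oentries X Y (%k. c *[?H k] f k) = (%ji. c * oentries X Y f ji)"
  by (simp add: oentries_def fun_eq_iff lin_maps_smult[OF quotB_props(1) fk] del: map_map)
 thus "c *[Hom cat_C X Y] f : mor cat_C X Y &
  oentries X Y (c *[Hom cat_C X Y] f) = c *[Hom (catC' chord_lists) X Y] oentries X Y f" using m unfolding cat_C_simps(4) by simp
next
 fix X Y Z and f g :: "int => 'k mat set"
 assume f: "f : mor cat_C X Y" and g: "g : mor cat_C Y Z"
 let ?H = "%X Y k. Hom (quotB :: 'k coset_cat) (pts X) (pts (rots k Y))"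
 have fk: "f k : carrier (?H X Y k)" and gk: "g k : carrier (?H Y Z k)" for k using f g unfolding cat_C_simps by blast+
 define S where "S = {k. f k ~= (zero (?H X Y k))}"
 have S: "finite S" using f unfolding S_def cat_C_simps by blast
 define T where "T = {k. g k ~= (zero (?H Y Z k))}"
 have T: "finite T" using g unfolding T_def cat_C_simps by blast
 let ?v = "%k. coset_entries (pts X) (pts (rots k Y)) (f k)"
 let ?w = "%k. coset_entries (pts Y) (pts (rots k Z)) (g k)"
 have gk': "g (k - i) : mor quotB (pts (rots i Y)) (pts (rots k Z))" for i k
 proof -
  obtain c where c: "c : supp_mats homD (pts Y) (pts (rots (k - i) Z))" "g (k - i) = coset_of (pts Y) (pts (rots (k - i) Z)) c"
   using gk[of "k - i"] unfolding mor_quotB by blast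
  show ?thesis unfolding mor_quotB supp_rots coset_rots(1) c(2) using c(1) by (rule imageI)
 qed
 define u where "u k i = Comp quotB (pts X) (pts (rots i Y)) (pts (rots k Z)) (g (k - i)) (f i)" for k i
 have u: "u k i : carrier (?H X Z k)"
  "coset_entries (pts X) (pts (rots k Z)) (u k i) = mat_comp (%p q r. homD p r) (pts X) (pts (rots i Y)) (pts (rots k Z)) (?w (k - i)) (?v i)" for k i
  using quotB_props(5)[OF UNIV_I fk[of i] gk'[of k i]] unfolding u_def coset_rots(2)[of i Y k Z] by blast+
 have C: "Comp cat_C X Y Z g f = (%k. finsum (?H X Z k) (u k) S)"
  by (simp add: cat_C_def orbit_cat_def cat_D2_simps u_def[abs_def] S_def del: map_map)
 have fs: "finsum (?H X Z k) (u k) S : carrier (?H X Z k)"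
  "coset_entries (pts X) (pts (rots k Z)) (finsum (?H X Z k) (u k) S) = (%li. \<Sum>i\<in>S. coset_entries (pts X) (pts (rots k Z)) (u k i) li)" for k
  using lin_finsum[OF quotB_props(4) quotB_props(1) vs_supp_mats S u(1)] by (simp_all del: map_map)
 have w0: "?w k = (%_. 0)" if "k \<notin> T" for k using that by (simp add: T_def lin_maps_zero[OF quotB_props(4) vs_supp_mats quotB_props(1)])
 have v0: "?v k = (%_. 0)" if "k \<notin> S" for k using that by (simp add: S_def lin_maps_zero[OF quotB_props(4) vs_supp_mats quotB_props(1)])
 have "{k. finsum (?H X Z k) (u k) S ~= (zero (?H X Z k))} \<subseteq> (%(i, j). i + j) ` (S \<times> T)"
 proof
  fix k assume k: "k : {k. finsum (?H X Z k) (u k) S ~= (zero (?H X Z k))}"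
  show "k : (%(i, j). i + j) ` (S \<times> T)"
  proof (rule ccontr)
   assume no: "k \<notin> (%(i, j). i + j) ` (S \<times> T)"
   have "coset_entries (pts X) (pts (rots k Z)) (u k i) = (%_. 0)" if "i : S" for i
   proof -
    have "k - i \<notin> T" using no that by force
    thus ?thesis unfolding u(2) w0[OF \<open>k - i \<notin> T\<close>] by (auto simp: mat_comp_def fun_eq_iff cong: if_cong)
   qed
   hence "coset_entries (pts X) (pts (rots k Z)) (finsum (?H X Z k) (u k) S) = (%_. 0)" unfolding fs(2) by simp
   hence "finsum (?H X Z k) (u k) S = coset_of (pts X) (pts (rots k Z)) (%_. 0)" using quotB_props(2)[OF fs(1)[of k]] by simp
   thus False using k zero_quotB by blast
  qed
 qed
 hence "finite {k. finsum (?H X Z k) (u k) S ~= (zero (?H X Z k))}" by (rule finite_subset) (intro finite_imageI finite_cartesian_product S T)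
 hence m: "Comp cat_C X Y Z g f : mor cat_C X Z" unfolding C cat_C_simps using fs(1) by blast
 have "oentries X Z (Comp cat_C X Y Z g f) = mat_comp compC X Y Z (oentries Y Z g) (oentries X Y f)"
 proof (rule ext)
  fix li :: "nat \<times> nat"
  obtain l i where li: "li = (l, i)" by (cases li)
  show "oentries X Z (Comp cat_C X Y Z g f) li = mat_comp compC X Y Z (oentries Y Z g) (oentries X Y f) li"
  proof (cases "l < length Z & i < length X")
   case False
   thus ?thesis by (auto simp: li oentries_def mat_comp_def)
  next
   case True
   hence l: "l < length Z" and i: "i < length X" by auto
   define G where "G j = oentries Y Z g (l, j)" for j
   define F where "F j = oentries X Y f (j, i)" for j
   have GF: "homC (Y ! j) (Z ! l)" "homC (X ! i) (Y ! j)" if "G j * F j ~= 0" for j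
    using that by (auto simp: G_def F_def oentries_def split: if_splits)
   have rhs: "mat_comp compC X Y Z (oentries Y Z g) (oentries X Y f) li =
    (\<Sum>j<length Y. if compC (X ! i) (Y ! j) (Z ! l) then G j * F j else 0)"
    unfolding G_def F_def using True by (simp add: li mat_comp_def)
   show ?thesis
   proof (cases "homC (X ! i) (Z ! l)")
    case False
    hence "(if compC (X ! i) (Y ! j) (Z ! l) then G j * F j else 0) = 0" for j
     using GF[of j] mat_relation.E_R[OF mat_relation_C, of "X ! i" "Y ! j" "Z ! l"] by auto
    thus ?thesis unfolding rhs using False by (simp add: li oentries_def)
   next
    case hC: True
    define k where "k = deg (X ! i) (Z ! l)"
    have hD: "homD (pts X ! i) (pts (rots k Z) ! l)" using hom_pts0[OF l i, of k] homC_deg[OF hC] by (simp add: k_def)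
    have "oentries X Z (Comp cat_C X Y Z g f) li = coset_entries (pts X) (pts (rots k Z)) (finsum (?H X Z k) (u k) S) (l, i)"
     using True hC by (simp add: li oentries_def C k_def del: map_map)
    also have "\<dots> = (\<Sum>m\<in>S. \<Sum>j<length Y. ?w (k - m) (l, j) * ?v m (j, i))"
     unfolding fs(2) u(2) using l i hD by (simp add: mat_comp_def del: map_map nth_map)
    also have "\<dots> = (\<Sum>j<length Y. \<Sum>m\<in>S. ?w (k - m) (l, j) * ?v m (j, i))" by (rule sum.swap)
    also have "\<dots> = (\<Sum>j<length Y. if compC (X ! i) (Y ! j) (Z ! l) then G j * F j else 0)"
    proof (intro sum.cong refl)
     fix j assume "j : {..<length Y}"
     hence j: "j < length Y" by simp
     have v: "?v m (j, i) = (if lift_hom (lft (X ! i)) (turn m (lft (Y ! j))) then F j else 0)" for m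
     using coset_entries_part[OF f, of m] j i by (simp add: part_def F_def del: map_map)
     have w: "?w m (l, j) = (if lift_hom (lft (Y ! j)) (turn m (lft (Z ! l))) then G j else 0)" for m
     using coset_entries_part[OF g, of m] j l by (simp add: part_def G_def del: map_map)
     show "(\<Sum>m\<in>S. ?w (k - m) (l, j) * ?v m (j, i)) = (if compC (X ! i) (Y ! j) (Z ! l) then G j * F j else 0)"
     proof (cases "G j * F j = 0")
     case True
     hence "?w (k - m) (l, j) * ?v m (j, i) = 0" for m unfolding v w by auto
     thus ?thesis using True by simp
     next
     case False
     note h = GF[OF False]
     define m0 where "m0 = deg (X ! i) (Y ! j)"
     have "m0 : S"
     proof (rule ccontr)
     assume "m0 \<notin> S"
     hence "?v m0 (j, i) = 0" using v0 by simp
     thus False using v[of m0] homC_deg[OF h(2)] False by (simp add: m0_def)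
     qed
     have "?w (k - m) (l, j) * ?v m (j, i) = (if m = m0 then (if compC (X ! i) (Y ! j) (Z ! l) then G j * F j else 0) else 0)" for m
     proof (cases "m = m0")
     case False
     hence "\<not> lift_hom (lft (X ! i)) (turn m (lft (Y ! j)))" using deg_eq m0_def by blast
     thus ?thesis using False v by simp
     next
     case True
     have "lift_hom (lft (Y ! j)) (turn (k - m0) (lft (Z ! l))) \<longleftrightarrow> deg (Y ! j) (Z ! l) = k - m0"
     using h(1) homC_iff by blast
     also have "\<dots> \<longleftrightarrow> compC (X ! i) (Y ! j) (Z ! l)"
     using hC homC_iff[of "X ! i" "deg (X ! i) (Y ! j) + deg (Y ! j) (Z ! l)" "Z ! l"]
     unfolding compC_def m0_def k_def by auto
     finally show ?thesis using True v[of m0] w[of "k - m0"] homC_deg[OF h(2)] by (simp add: m0_def)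
     qed
     thus ?thesis using S \<open>m0 : S\<close> by simp
     qed
    qed
    finally show ?thesis unfolding rhs .
   qed
  qed
 qed
 thus "Comp cat_C X Y Z g f : mor cat_C X Z &
  oentries X Z (Comp cat_C X Y Z g f) = Comp (catC' chord_lists) X Y Z (oentries Y Z g) (oentries X Y f)" using m by simp
next
 fix X assume "X : Obj (cat_C :: 'k cluster_cat)"
 let ?H = "%k. Hom (quotB :: 'k coset_cat) (pts X) (pts (rots k X))"
 have I: "Ident (cat_C :: 'k cluster_cat) X = (%k. if k = 0 then Ident quotB (pts X) else (zero (?H k)))"
  by (simp add: cat_C_def orbit_cat_def cat_D2_simps cong: if_cong del: map_map)
 have Iq: "Ident quotB (pts X) : mor quotB (pts X) (pts X)"
  "coset_entries (pts X) (pts X) (Ident quotB (pts X) :: 'k mat set) = Ident catD' (pts X)" using quotB_props(6)[of "pts X"] by blast+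
 have "finite {k. Ident (cat_C :: 'k cluster_cat) X k ~= (zero (?H k))}" by (rule finite_subset[of _ "{0}"]) (auto simp: I)
 hence m: "Ident cat_C X : mor (cat_C :: 'k cluster_cat) X X"
  unfolding cat_C_simps using Iq(1) by (simp add: I vs_zero[OF quotB_props(4)])
 have z: "coset_entries (pts X) (pts (rots k X)) (zero (?H k)) = (%_. 0)" for k
  using lin_maps_zero[OF quotB_props(4) vs_supp_mats quotB_props(1)] by simp
 have "oentries X X (Ident (cat_C :: 'k cluster_cat) X) (j, i) =
  (if i = j & i < length X & homC (X ! i) (X ! i) then 1 else 0)" for j i
 proof (cases "j < length X & i < length X & homC (X ! i) (X ! j)")
  case True
  show ?thesis
  proof (cases "deg (X ! i) (X ! j) = 0")
   case d: True
   hence "homD (pts X ! i) (pts X ! j)" using True homC_deg[of "X ! i" "X ! j"] hom_pts0[of j X i X 0] by simp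
   thus ?thesis using True d Iq(2) by (auto simp: oentries_def I simp del: map_map)
  next
   case False
   moreover have "i ~= j" using False True deg_refl[of "X ! i"] homC_refl[of "X ! i"] by auto
   ultimately show ?thesis using True z[of "deg (X ! i) (X ! j)"] by (simp add: oentries_def I del: map_map)
  qed
 next
  case False
  thus ?thesis by (auto simp: oentries_def)
 qed
 hence "oentries X X (Ident (cat_C :: 'k cluster_cat) X) = Ident (catC' chord_lists) X" by (simp add: fun_eq_iff)
 thus "Ident cat_C X : mor (cat_C :: 'k cluster_cat) X X &
  oentries X X (Ident (cat_C :: 'k cluster_cat) X) = Ident (catC' chord_lists) X" using m by blast
qed

section \<open>Linear algebra with leading positions\<close>

definition coord_space :: "nat => (nat => 'k::field) set => bool" where
 "coord_space n W \<longleftrightarrow> (%i. 0) : W & (\<forall>v\<in>W. \<forall>w\<in>W. (%i. v i + w i) : W) &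
   (\<forall>c. \<forall>w\<in>W. (%i. c * w i) : W) & (\<forall>w\<in>W. \<forall>i\<ge>n. w i = 0)"

lemma coord_spaceD:
 assumes "coord_space n W"
 shows "(%i. 0) : W" "v : W ==> w : W ==> (%i. v i + w i) : W" "w : W ==> (%i. c * w i) : W"
  "w : W ==> n <= i ==> w i = 0" using assms by (auto simp: coord_space_def)

lemma coord_space_diff:
 assumes "coord_space n W" "v : W" "w : W"
 shows "(%i. v i - c * w i) : W" using coord_spaceD(2)[OF assms(1,2) coord_spaceD(3)[OF assms(1,3), of "-c"]] by simp

definition lead_pos :: "(nat => 'k::field) set => nat set" where
 "lead_pos W = {i. \<exists>w\<in>W. w i ~= 0 & (\<forall>j>i. w j = 0)}"

lemma lead_pos_bound: "coord_space n W ==> lead_pos W \<subseteq> {..<n}"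
proof
 fix i assume "coord_space n W" "i : lead_pos W"
 thus "i : {..<n}" unfolding lead_pos_def using coord_spaceD(4)[of n W _ i] not_less[of i n] by blast
qed

lemma nonzero_has_lead:
 assumes W: "coord_space n W" and w: "w : W" and "w ~= (%i. 0)"
 shows "\<exists>i\<in>lead_pos W. w i ~= 0"
proof -
 obtain k where k: "w k ~= 0" using assms by blast
 have fin: "finite {i. w i ~= 0}" by (rule finite_subset[of _ "{..<n}"]) (use coord_spaceD(4)[OF W w] not_less in auto)
 define i where "i = Max {i. w i ~= 0}"
 have "w i ~= 0" using Max_in[OF fin] k by (auto simp: i_def)
 moreover have "w j = 0" if "j > i" for j using Max_ge[OF fin, of j] that by (auto simp: i_def)
 ultimately show ?thesis using w by (auto simp: lead_pos_def)
qed

text \<open>Reduction to the normal form in which all coordinates at leading positions vanish.\<close>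

lemma reduce_lead:
 assumes W: "coord_space n W"
 shows "\<exists>w\<in>W. \<forall>i\<in>lead_pos W. v i = w i"
proof -
 have "\<exists>w\<in>W. \<forall>i\<in>lead_pos W. k <= i --> v i = w i" if "k <= n" for k using that
 proof (induction "n - k" arbitrary: k)
  case 0
  hence "k = n" by simp
  hence "\<not> k <= i" if "i : lead_pos W" for i using lead_pos_bound[OF W] that by auto
  thus ?case using coord_spaceD(1)[OF W] by blast
 next
  case (Suc m)
  then obtain w where w: "w : W" "!!i. i : lead_pos W ==> Suc k <= i ==> v i = w i" using Suc.hyps(1)[of "Suc k"] by fastforce
  show ?case
  proof (cases "k : lead_pos W")
   case True
   then obtain u where u: "u : W" "u k ~= 0" "!!j. j > k ==> u j = 0" by (auto simp: lead_pos_def)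
   have r: "(%i. w i - ((w k - v k) / u k) * u i) : W" by (rule coord_space_diff[OF W w(1) u(1)])
   have "v i = w i - ((w k - v k) / u k) * u i" if "i : lead_pos W" "k <= i" for i using that u w(2)[of i] by (cases "i = k") auto
   thus ?thesis by (intro bexI[OF _ r]) simp
  next
   case False
   thus ?thesis using w by (metis Suc_leI le_neq_implies_less)
  qed
 qed
 from this[of 0] show ?thesis by simp
qed

lemma lead_pos_strict:
 assumes W: "coord_space n W" and W': "coord_space n W'" and sub: "W \<subset> W'"
 shows "card (lead_pos W) < card (lead_pos W')"
proof (rule psubset_card_mono)
 show "finite (lead_pos W')" using lead_pos_bound[OF W'] finite_subset by blast
 have "lead_pos W \<subseteq> lead_pos W'" using sub by (auto simp: lead_pos_def)
 moreover have "lead_pos W ~= lead_pos W'"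
 proof
  assume eq: "lead_pos W = lead_pos W'"
  obtain v where v: "v : W'" "v \<notin> W" using sub by blast
  obtain w where w: "w : W" "!!i. i : lead_pos W ==> v i = w i" using reduce_lead[OF W] by blast
  have d: "(%i. v i - 1 * w i) : W'" by (rule coord_space_diff[OF W' v(1)]) (use w sub in auto)
  have "v = w"
  proof (rule ccontr)
   assume "v ~= w"
   hence "(%i. v i - 1 * w i) ~= (%i. 0)" by (auto simp: fun_eq_iff)
   from nonzero_has_lead[OF W' d this] show False using eq w by auto
  qed
  thus False using v w by simp
 qed
 ultimately show "lead_pos W \<subset> lead_pos W'" by blast
qed

lemma ex_projection:
 assumes W: "coord_space n W"
 shows "\<exists>prj :: (nat => 'k::field) => nat => 'k.
  (\<forall>v w. prj (%i. v i + w i) = (%i. prj v i + prj w i)) & (\<forall>c v. prj (%i. c * v i) = (%i. c * prj v i)) &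
  (\<forall>v. prj v = (%i. 0) \<longleftrightarrow> v : W) & (\<forall>v. (%i. v i - prj v i) : W)"
proof -
 have ex: "\<exists>w. w : W & (\<forall>i\<in>lead_pos W. v i = w i)" for v using reduce_lead[OF W, of v] by blast
 have uniq: "w = w'" if "w : W" "w' : W" "\<forall>i\<in>lead_pos W. w i = w' i" for w w'
 proof (rule ccontr)
  assume "w ~= w'"
  hence "(%i. w i - 1 * w' i) ~= (%i. 0)" by (auto simp: fun_eq_iff)
  from nonzero_has_lead[OF W coord_space_diff[OF W that(1,2)] this] show False using that(3) by auto
 qed
 define r where "r v = (SOME w. w : W & (\<forall>i\<in>lead_pos W. v i = w i))" for v
 have r: "r v : W" "!!i. i : lead_pos W ==> v i = r v i" for v using someI_ex[OF ex[of v]] by (auto simp: r_def)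
 have r_eq: "r v = w" if "w : W" "\<forall>i\<in>lead_pos W. v i = w i" for v w using uniq[OF r(1) that(1)] r(2) that(2) by metis
 have 1: "r (%i. v i + w i) = (%i. r v i + r w i)" for v w by (rule r_eq) (simp_all add: coord_spaceD(2)[OF W r(1) r(1)] r(2)[symmetric])
 have 2: "r (%i. c * v i) = (%i. c * r v i)" for c v by (rule r_eq) (simp_all add: coord_spaceD(3)[OF W r(1)] r(2)[symmetric])
 show ?thesis
 proof (intro exI[of _ "%v i. v i - r v i"] conjI allI)
  fix v show "(%i. v i - r v i) = (%i. 0) \<longleftrightarrow> v : W"
  proof
   assume "(%i. v i - r v i) = (%i. 0)"
   hence "v = r v" by (auto simp: fun_eq_iff)
   thus "v : W" using r(1)[of v] by simp
  next
   assume "v : W"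
   hence "r v = v" by (intro r_eq) auto
   thus "(%i. v i - r v i) = (%i. 0)" by simp
  qed
 qed (simp_all add: 1 2 r(1) algebra_simps)
qed

definition chart :: "('k::field, 'a) module => ('a => nat => 'k) => nat => bool" where
 "chart V ph n \<longleftrightarrow> inj_on ph (carrier V) &
   (\<forall>x\<in>carrier V. \<forall>y\<in>carrier V. ph (x +[V] y) = (%i. ph x i + ph y i)) &
   (\<forall>c. \<forall>x\<in>carrier V. ph (c *[V] x) = (%i. c * ph x i)) & (\<forall>x\<in>carrier V. \<forall>i\<ge>n. ph x i = 0)"

definition linear_subset :: "('k::field, 'a) module => 'a set => bool" where
 "linear_subset V W \<longleftrightarrow> W \<subseteq> carrier V & (zero V) : W & (\<forall>x\<in>W. \<forall>y\<in>W. x +[V] y : W) &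
   (\<forall>c. \<forall>x\<in>W. c *[V] x : W)"

lemma lsubD:
 assumes "linear_subset V W"
 shows "W \<subseteq> carrier V" "(zero V) : W" "x : W ==> y : W ==> x +[V] y : W" "x : W ==> c *[V] x : W"
  "x : W ==> x : carrier V" using assms by (auto simp: linear_subset_def)

lemma submodule_iff:
 fixes V :: "('k::field, 'a) module"
 assumes V: "Module.module class_ring V"
 shows "Module.submodule W class_ring V \<longleftrightarrow> linear_subset V W"
proof
 interpret Module.module "class_ring :: 'k ring" V by fact
 assume "Module.submodule W class_ring V"
 note E = submoduleE[OF this]
 obtain x where "x : W" using E(2) by blast
 hence "0 *[V] x : W" using E(4)[of 0 x] by simp
 hence "(zero V) : W" using vs_smult_zero[OF V, of x] \<open>x : W\<close> E(1) by auto
 thus "linear_subset V W" using E by (auto simp: linear_subset_def)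
next
 interpret Module.module "class_ring :: 'k ring" V by fact
 assume W: "linear_subset V W"
 have "\<ominus>\<^bsub>V\<^esub> x = (-1) *[V] x" if "x : W" for x
  using M.minus_equality[of "(-1) *[V] x" x] vs_neg[OF V, of x] vs_comm[OF V, of x "(-1) *[V] x"]
   vs_smult[OF V, of x "-1"] lsubD[OF W] that by auto
 thus "Module.submodule W class_ring V" by (intro submoduleI) (use lsubD[OF W] in auto)
qed

lemma vs_linear_subset:
 fixes V :: "('k::field, 'a) module"
 assumes V: "Module.module class_ring V" and W: "linear_subset V W"
 shows "Module.module class_ring (V\<lparr>carrier := W\<rparr>)" using Module.submodule.submodule_is_module[OF _ V] submodule_iff[OF V] W by blast

lemma chart_linear_subset: "chart V ph n ==> linear_subset V W ==> chart (V\<lparr>carrier := W\<rparr>) ph n"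
 unfolding chart_def using lsubD(1)[of V W] by (simp add: subset_iff inj_on_def)

lemma chart_zero:
 fixes V :: "('k::field, 'a) module"
 assumes V: "Module.module class_ring V" and c: "chart V ph n"
 shows "ph (zero V) = (%i. 0)"
proof -
 have "ph (0 *[V] (zero V)) = (%i. 0 * ph (zero V) i)" using c vs_zero[OF V] unfolding chart_def by blast
 thus ?thesis using vs_smult_zero[OF V vs_zero[OF V]] by simp
qed

lemma chart_coord_space:
 fixes V :: "('k::field, 'a) module"
 assumes V: "Module.module class_ring V" and c: "chart V ph n" and W: "linear_subset V W"
 shows "coord_space n (ph ` W)"
 unfolding coord_space_def
proof (intro conjI ballI allI impI)
 note L = lsubD[OF W]
 show "(%i. 0) : ph ` W" using chart_zero[OF V c] L(2) by force
 fix v assume v: "v : ph ` W"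
 then obtain x where x: "x : W" "v = ph x" by blast
 hence xV: "x : carrier V" using L by blast
 {
  fix w assume "w : ph ` W"
  then obtain y where y: "y : W" "w = ph y" by blast
  have "ph (x +[V] y) = (%i. v i + w i)" using c x y L(1) xV unfolding chart_def by blast
  thus "(%i. v i + w i) : ph ` W" using L(3)[OF x(1) y(1)] by (metis imageI)
 }
 fix k
 have "ph (k *[V] x) = (%i. k * v i)" using c x xV unfolding chart_def by blast
 thus "(%i. k * v i) : ph ` W" using L(4)[OF x(1)] by (metis imageI)
next
 fix v i assume "v : ph ` W" "n <= i"
 thus "v i = 0" using c lsubD[OF W] unfolding chart_def by blast
qed

lemma carrier_linear_subset:
 fixes V :: "('k::field, 'a) module"
 assumes V: "Module.module class_ring V"
 shows "linear_subset V (carrier V)" "linear_subset V {(zero V)}"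
 using vs_add[OF V] vs_zero[OF V] vs_smult[OF V] vs_smult_null[OF V] vs_r_zero[OF V] by (auto simp: linear_subset_def)

lemma chart_projection:
 fixes V :: "('k::field, 'a) module"
 assumes V: "Module.module class_ring V" and c: "chart V ph n" and W: "linear_subset V W"
 obtains prj where "prj : lin_maps V V" "!!x. x : carrier V ==> prj x = (zero V) \<longleftrightarrow> x : W"
  "!!x. x : carrier V ==> prj (prj x) = prj x"
proof -
 note W' = chart_coord_space[OF V c W]
 have V': "coord_space n (ph ` carrier V)" by (rule chart_coord_space[OF V c carrier_linear_subset(1)[OF V]])
 have inj: "inj_on ph (carrier V)" using c by (simp add: chart_def)
 have add: "ph (x +[V] y) = (%i. ph x i + ph y i)" if "x : carrier V" "y : carrier V" for x y using c that unfolding chart_def by blast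
 have smult: "ph (k *[V] x) = (%i. k * ph x i)" if "x : carrier V" for k x using c that unfolding chart_def by blast
 obtain p :: "(nat => 'k) => nat => 'k" where p0:
  "(\<forall>v w. p (%i. v i + w i) = (%i. p v i + p w i)) & (\<forall>c v. p (%i. c * v i) = (%i. c * p v i)) &
   (\<forall>v. p v = (%i. 0) \<longleftrightarrow> v : ph ` W) & (\<forall>v. (%i. v i - p v i) : ph ` W)" using ex_projection[OF W'] by (rule exE)
 have p: "!!v w. p (%i. v i + w i) = (%i. p v i + p w i)"
  "!!c v. p (%i. c * v i) = (%i. c * p v i)" "!!v. p v = (%i. 0) \<longleftrightarrow> v : ph ` W" "!!v. (%i. v i - p v i) : ph ` W"
  using p0 by blast+
 have pV: "p (ph x) : ph ` carrier V" if x: "x : carrier V" for x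
 proof -
  have "(%i. ph x i - p (ph x) i) : ph ` carrier V" using p(4)[of "ph x"] lsubD(1)[OF W] by blast
  from coord_space_diff[OF V' _ this, of "ph x" 1] x show ?thesis by simp
 qed
 define prj where "prj x = inv_into (carrier V) ph (p (ph x))" for x
 have prjV: "prj x : carrier V" and phprj: "ph (prj x) = p (ph x)" if "x : carrier V" for x
  using pV[OF that] by (auto simp: prj_def intro: inv_into_into f_inv_into_f)
 have eqI: "x = y" if "ph x = ph y" "x : carrier V" "y : carrier V" for x y using inj_onD[OF inj] that by blast
 show thesis
 proof (rule that[of prj])
  show "prj : lin_maps V V" by (intro lin_mapsI eqI) (simp_all add: prjV phprj add smult p vs_add[OF V] vs_smult[OF V])
  fix x assume x: "x : carrier V"
  have "prj x = (zero V) \<longleftrightarrow> p (ph x) = (%i. 0)"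
   using phprj[OF x] eqI[of "prj x" "(zero V)"] chart_zero[OF V c] prjV[OF x] vs_zero[OF V] by metis
  also have "\<dots> \<longleftrightarrow> x : W" using p(3) inj x lsubD(1)[OF W] by (metis inj_on_image_mem_iff)
  finally show "prj x = (zero V) \<longleftrightarrow> x : W" .
  have "p (ph x) = p (%i. p (ph x) i + (ph x i - p (ph x) i))" by simp
  also have "\<dots> = (%i. p (p (ph x)) i + p (%i. ph x i - p (ph x) i) i)" by (rule p(1))
  also have "p (%i. ph x i - p (ph x) i) = (%i. 0)" using p(3,4) by blast
  finally have *: "p (ph x) = (%i. p (p (ph x)) i + 0)" .
  have "(%i. p (p (ph x)) i + 0) = p (p (ph x))" by simp
  hence pp: "p (p (ph x)) = p (ph x)" using * by (rule trans[OF sym sym])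
  have "ph (prj (prj x)) = ph (prj x)" by (simp only: phprj prjV x pp)
  thus "prj (prj x) = prj x" by (rule eqI[OF _ prjV[OF prjV[OF x]] prjV[OF x]])
 qed
qed

section \<open>The category of modules of finite length\<close>

abbreviation FL :: "('k::field, ('k, 'u) quiver_rep, qvertex => 'u => 'u) klin_cat" where
 "FL \<equiv> fl_mod_Lambda"

definition family :: "('k::field, 'u) quiver_rep => (qvertex => 'u => 'w) => qvertex => 'u => 'w" where
 "family M h = (\<lambda>e\<in>Q0. \<lambda>x\<in>sp M e. h e x)"

lemma family_apply [simp]: "e : Q0 ==> x : sp M e ==> family M h e x = h e x" by (simp add: family_def)

lemma FL_simps:
 "(zero (Hom FL M N)) = family M (%e x. (zero (space N e)))"
 "f +[Hom FL M N] g = family M (%e x. f e x +[space N e] g e x)"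
 "c *[Hom FL M N] f = family M (%e x. c *[space N e] f e x)"
 "Ident FL M = family M (%e x. x)"
 "Comp FL L M N g f = family L (%e x. g e (f e x))"
 "Obj FL = {M. is_Lambda_module M & finite_length M}" by (simp_all add: fl_mod_Lambda_def family_def compose_def)

lemma FL_mor_iff: "f : mor FL M N \<longleftrightarrow> f = family M f & (\<forall>e\<in>Q0. f e : lin_maps (space M e) (space N e)) &
  (\<forall>a. \<forall>x\<in>sp M (src a). f (tgt a) (amap M a x) = amap N a (f (src a) x))"
proof -
 have "f = family M f \<longleftrightarrow> f : extensional Q0 & (\<forall>e\<in>Q0. f e : extensional (sp M e))"
  by (auto simp: family_def extensional_def restrict_def fun_eq_iff)
 thus ?thesis by (auto simp: fl_mod_Lambda_def PiE_def Pi_def)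
qed

lemma FL_eq: "f : mor FL M N ==> f = family M f"
 unfolding FL_mor_iff by blast

lemma FL_lin: "f : mor FL M N ==> e : Q0 ==> f e : lin_maps (space M e) (space N e)"
 unfolding FL_mor_iff by blast

lemma FL_nat: "f : mor FL M N ==> x : sp M (src a) ==> f (tgt a) (amap M a x) = amap N a (f (src a) x)"
 unfolding FL_mor_iff by blast

lemma FL_closed: "f : mor FL M N ==> e : Q0 ==> x : sp M e ==> f e x : sp N e" by (rule lin_maps_closed[OF FL_lin])

lemma family_cong: "(!!e x. e : Q0 ==> x : sp M e ==> h e x = h' e x) ==> family M h = family M h'" by (auto simp: family_def restrict_def fun_eq_iff)

lemma FL_ext:
 assumes "f : mor FL M N" "g : mor FL M N'"
  and "!!e x. e : Q0 ==> x : sp M e ==> f e x = g e x"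
 shows "f = g"
proof -
 have f: "f = family M f" and g: "g = family M g" using assms(1,2) unfolding FL_mor_iff by blast+
 show ?thesis by (rule trans[OF f trans[OF family_cong[OF assms(3)] sym[OF g]]])
qed

lemma LmodD:
 assumes "is_Lambda_module M"
 shows "e : Q0 ==> Module.module class_ring (space M e)"
  "amap M a : lin_maps (space M (src a)) (space M (tgt a))"
  "x : carrier (space M (src (v, d))) ==>
    amap M (v, clockwise d) (amap M (v, d) x) = (zero (space M (tgt (v, clockwise d))))"
 using assms unfolding is_Lambda_module_def src.simps tgt.simps by blast+

lemma FL_morI:
 assumes M: "is_Lambda_module M"
  and lin: "!!e. e : Q0 ==> h e : lin_maps (space M e) (space N e)"
  and nat: "!!a x. x : sp M (src a) ==> h (tgt a) (amap M a x) = amap N a (h (src a) x)"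
 shows "family M h : mor FL M N"
proof -
 have "family M h e : lin_maps (space M e) (space N e)" if e: "e : Q0" for e
  using lin[OF e] e vs_add[OF LmodD(1)[OF M e]] vs_smult[OF LmodD(1)[OF M e]] by (auto simp: lin_maps_def family_def)
 moreover have "family M h (tgt a) (amap M a x) = amap N a (family M h (src a) x)"
  if "x : sp M (src a)" for a x using nat[OF that] that lin_maps_closed[OF LmodD(2)[OF M] that] by simp
 moreover have "family M h = family M (family M h)" by (simp add: family_def restrict_def fun_eq_iff)
 ultimately show ?thesis by (simp add: FL_mor_iff)
qed

lemma lin_add_map:
 fixes V :: "('k::field, 'a) module" and W :: "('k, 'b) module"
 assumes W: "Module.module class_ring W" and f: "f : lin_maps V W" and g: "g : lin_maps V W"
 shows "(%x. f x +[W] g x) : lin_maps V W"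
proof (rule lin_mapsI)
 fix x y assume x: "x : carrier V" "y : carrier V"
 note c = lin_maps_closed[OF f x(1)] lin_maps_closed[OF f x(2)] lin_maps_closed[OF g x(1)] lin_maps_closed[OF g x(2)]
 show "f (x +[V] y) +[W] g (x +[V] y) = f x +[W] g x +[W] (f y +[W] g y)"
  using c by (simp add: lin_maps_add[OF f x] lin_maps_add[OF g x] vs_assoc[OF W] vs_add[OF W] vs_lcomm[OF W, of "f y" "g x"])
next
 fix c x assume x: "x : carrier V"
 show "f (c *[V] x) +[W] g (c *[V] x) = c *[W] (f x +[W] g x)"
  using x by (simp add: lin_maps_smult[OF f x] lin_maps_smult[OF g x] vs_r_distr[OF W] lin_maps_closed[OF f] lin_maps_closed[OF g])
qed (simp add: vs_add[OF W] lin_maps_closed[OF f] lin_maps_closed[OF g])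

lemma lin_smult_map:
 fixes V :: "('k::field, 'a) module" and W :: "('k, 'b) module"
 assumes W: "Module.module class_ring W" and f: "f : lin_maps V W"
 shows "(%x. c *[W] f x) : lin_maps V W" using assms by (intro lin_mapsI)
  (simp_all add: lin_maps_add[OF f] lin_maps_smult[OF f] lin_maps_closed[OF f] vs_r_distr[OF W] vs_smult[OF W] vs_smult_smult[OF W] mult.commute)

lemma lin_zero_map:
 fixes V :: "('k::field, 'a) module" and W :: "('k, 'b) module"
 assumes W: "Module.module class_ring W"
 shows "(%x. (zero W)) : lin_maps V W" by (rule lin_mapsI) (simp_all add: vs_zero[OF W] vs_r_zero[OF W] vs_smult_null[OF W])

lemma lin_comp: "f : lin_maps U V ==> g : lin_maps V W ==> (%x. g (f x)) : lin_maps U W" by (auto simp: lin_maps_def Pi_def)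

lemma FL_Obj: "M : Obj FL ==> is_Lambda_module M" by (simp add: FL_simps)

lemma FL_add_mor:
 assumes M: "is_Lambda_module M" and N: "is_Lambda_module N" and f: "f : mor FL M N" and g: "g : mor FL M N"
 shows "family M (%e x. f e x +[space N e] g e x) : mor FL M N"
proof (rule FL_morI[OF M])
 fix a x assume x: "x : sp M (src a)"
 show "f (tgt a) (amap M a x) +[space N (tgt a)] g (tgt a) (amap M a x) =
   amap N a (f (src a) x +[space N (src a)] g (src a) x)" using FL_closed[OF f _ x] FL_closed[OF g _ x]
  by (simp add: FL_nat[OF f x] FL_nat[OF g x] lin_maps_add[OF LmodD(2)[OF N]])
qed (intro lin_add_map LmodD(1)[OF N] FL_lin[OF f] FL_lin[OF g])

lemma FL_smult_mor:
 assumes M: "is_Lambda_module M" and N: "is_Lambda_module N" and f: "f : mor FL M N"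
 shows "family M (%e x. c *[space N e] f e x) : mor FL M N"
proof (rule FL_morI[OF M])
 fix a x assume x: "x : sp M (src a)"
 show "c *[space N (tgt a)] f (tgt a) (amap M a x) = amap N a (c *[space N (src a)] f (src a) x)" using FL_closed[OF f _ x]
  by (simp add: FL_nat[OF f x] lin_maps_smult[OF LmodD(2)[OF N]])
qed (intro lin_smult_map LmodD(1)[OF N] FL_lin[OF f])

lemma FL_zero_mor:
 assumes M: "is_Lambda_module M" and N: "is_Lambda_module N"
 shows "family M (%e x. (zero (space N e))) : mor FL M N" by (rule FL_morI[OF M])
  (simp_all add: lin_zero_map LmodD(1)[OF N]
   lin_maps_zero[OF LmodD(1)[OF N] LmodD(1)[OF N] LmodD(2)[OF N]])

lemma FL_comp_mor:
 assumes L: "is_Lambda_module L" and f: "f : mor FL L M" and g: "g : mor FL M N"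
 shows "family L (%e x. g e (f e x)) : mor FL L N"
 by (rule FL_morI[OF L]) (simp_all add: lin_comp[OF FL_lin[OF f] FL_lin[OF g]] FL_nat[OF f] FL_nat[OF g] FL_closed[OF f])

lemma klin_category_FL: "klin_category (FL :: ('k::field, ('k, 'u) quiver_rep, qvertex => 'u => 'u) klin_cat)"
proof (rule klin_category.intro)
 fix M N :: "('k, 'u) quiver_rep" assume MN: "M : Obj FL" "N : Obj FL"
 note M = FL_Obj[OF MN(1)] and N = FL_Obj[OF MN(2)]
 note VN = LmodD(1)[OF N]
 show "Module.module class_ring (Hom FL M N)"
 proof (rule vs_intro)
  fix f g h assume f: "f : mor FL M N" and g: "g : mor FL M N" and h: "h : mor FL M N"
  note cl = FL_closed[OF f] FL_closed[OF g] FL_closed[OF h]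
  show "(f +[Hom FL M N] g) +[Hom FL M N] h = f +[Hom FL M N] (g +[Hom FL M N] h)"
   unfolding FL_simps by (rule family_cong) (simp add: cl vs_assoc[OF VN])
 next
  fix f g assume f: "f : mor FL M N" and g: "g : mor FL M N"
  note cl = FL_closed[OF f] FL_closed[OF g]
  show "f +[Hom FL M N] g : mor FL M N" unfolding FL_simps by (rule FL_add_mor[OF M N f g])
  show "f +[Hom FL M N] g = g +[Hom FL M N] f"
   unfolding FL_simps by (rule family_cong) (rule vs_comm[OF VN cl])
  fix c
  show "c *[Hom FL M N] (f +[Hom FL M N] g) = c *[Hom FL M N] f +[Hom FL M N] c *[Hom FL M N] g"
   unfolding FL_simps by (rule family_cong) (simp add: cl vs_r_distr[OF VN])
 next
  show "(zero (Hom FL M N)) : mor FL M N" unfolding FL_simps by (rule FL_zero_mor[OF M N])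
 next
  fix f c d assume f: "f : mor FL M N"
  note cl = FL_closed[OF f]
  note eq = FL_eq[OF f]
  show "c *[Hom FL M N] f : mor FL M N" unfolding FL_simps by (rule FL_smult_mor[OF M N f])
  show "(zero (Hom FL M N)) +[Hom FL M N] f = f"
   unfolding FL_simps by (subst (2) eq, rule family_cong) (simp add: cl vs_l_zero[OF VN])
  show "1 *[Hom FL M N] f = f"
   unfolding FL_simps by (subst (2) eq, rule family_cong) (simp add: cl vs_smult_one[OF VN])
  show "(-1) *[Hom FL M N] f +[Hom FL M N] f = (zero (Hom FL M N))"
   unfolding FL_simps using vs_neg[OF VN cl] vs_comm[OF VN _ cl] vs_smult[OF VN cl] by (intro family_cong) simp
  show "c *[Hom FL M N] (d *[Hom FL M N] f) = (c * d) *[Hom FL M N] f"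
   unfolding FL_simps by (rule family_cong) (simp add: cl vs_smult_smult[OF VN])
  show "(c + d) *[Hom FL M N] f = c *[Hom FL M N] f +[Hom FL M N] d *[Hom FL M N] f"
   unfolding FL_simps by (rule family_cong) (simp add: cl vs_l_distr[OF VN])
 qed
next
 fix L M N :: "('k, 'u) quiver_rep" and f
 assume O: "L : Obj FL" "M : Obj FL" "N : Obj FL" and f: "f : mor FL L M"
 note L = FL_Obj[OF O(1)]
 show "(%g. Comp FL L M N g f) : lin_maps (Hom FL M N) (Hom FL L N)"
  by (intro lin_mapsI; unfold FL_simps) (auto intro!: FL_comp_mor[OF L f] family_cong simp: FL_closed[OF f])
next
 fix L M N :: "('k, 'u) quiver_rep" and g
 assume O: "L : Obj FL" "M : Obj FL" "N : Obj FL" and g: "g : mor FL M N"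
 note L = FL_Obj[OF O(1)]
 show "(%f. Comp FL L M N g f) : lin_maps (Hom FL L M) (Hom FL L N)" by (intro lin_mapsI; unfold FL_simps)
   (auto intro!: FL_comp_mor[OF L _ g] family_cong simp: FL_closed lin_maps_add[OF FL_lin[OF g]] lin_maps_smult[OF FL_lin[OF g]])
next
 fix W X Y Z :: "('k, 'u) quiver_rep" and f g h
 assume "f : mor FL W X" "g : mor FL X Y" "h : mor FL Y Z"
 thus "Comp FL W Y Z h (Comp FL W X Y g f) = Comp FL W X Z (Comp FL X Y Z h g) f"
  unfolding FL_simps by (intro family_cong) (simp add: FL_closed)
next
 fix X :: "('k, 'u) quiver_rep" assume "X : Obj FL"
 thus "Ident FL X : mor FL X X"
  unfolding FL_simps(4) by (intro FL_morI FL_Obj) (auto intro: lin_mapsI)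
next
 fix X Y :: "('k, 'u) quiver_rep" and f assume f: "f : mor FL X Y"
 note eq = FL_eq[OF f]
 show "Comp FL X Y Y (Ident FL Y) f = f"
  unfolding FL_simps by (subst (2) eq, rule family_cong) (simp add: FL_closed[OF f])
 show "Comp FL X X Y f (Ident FL X) = f"
  unfolding FL_simps by (subst (2) eq, rule family_cong) simp
qed

subsection \<open>Subrepresentations and finite dimension\<close>

definition fin_dim :: "('k::field, 'u) quiver_rep => bool" where
 "fin_dim M \<longleftrightarrow> (\<exists>S. finite S & (\<forall>e\<in>Q0 - S. sp M e = {(zero (space M e))})) &
   (\<forall>e\<in>Q0. \<exists>ph n. chart (space M e) ph n)"

lemma Lambda_submodule_iff:
 assumes M: "is_Lambda_module M"
 shows "is_Lambda_submodule M U \<longleftrightarrow> (\<forall>e\<in>Q0. linear_subset (space M e) (U e)) & (\<forall>e. e \<notin> Q0 --> U e = {}) &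
   (\<forall>a. amap M a ` U (src a) \<subseteq> U (tgt a))"
 unfolding is_Lambda_submodule_def using submodule_iff[OF LmodD(1)[OF M]] by blast

lemma Lambda_submoduleD:
 assumes M: "is_Lambda_module M" and U: "is_Lambda_submodule M U"
 shows "e : Q0 ==> linear_subset (space M e) (U e)" "e \<notin> Q0 ==> U e = {}"
  "x : U (src a) ==> amap M a x : U (tgt a)" using U unfolding Lambda_submodule_iff[OF M] by blast+

definition subrep :: "('k, 'u) quiver_rep => (qvertex => 'u set) => ('k, 'u) quiver_rep" where
 "subrep M U = M\<lparr>space := (%e. (space M e)\<lparr>carrier := U e\<rparr>)\<rparr>"

lemma subrep_simps [simp]:
 "space (subrep M U) e = (space M e)\<lparr>carrier := U e\<rparr>" "amap (subrep M U) = amap M" by (simp_all add: subrep_def)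

lemma subrep_module:
 assumes M: "is_Lambda_module M" and U: "is_Lambda_submodule M U"
 shows "is_Lambda_module (subrep M U)"
 unfolding is_Lambda_module_def
proof (intro conjI ballI allI)
 note D = Lambda_submoduleD[OF M U]
 show "Module.module class_ring (space (subrep M U) e)" if "e : Q0" for e using vs_linear_subset[OF LmodD(1)[OF M that] D(1)[OF that]] by simp
 show "amap (subrep M U) a : lin_maps (space (subrep M U) (src a)) (space (subrep M U) (tgt a))" for a
 proof (rule lin_mapsI)
  fix x y c assume x: "x : sp (subrep M U) (src a)"
  hence x': "x : sp M (src a)" "x : U (src a)" using lsubD(5)[OF D(1)] by auto
  show "amap (subrep M U) a x : sp (subrep M U) (tgt a)" using D(3)[OF x'(2)] by simp
  show "amap (subrep M U) a (c *[space (subrep M U) (src a)] x) = c *[space (subrep M U) (tgt a)] amap (subrep M U) a x"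
   using lin_maps_smult[OF LmodD(2)[OF M] x'(1)] by simp
  assume y: "y : sp (subrep M U) (src a)"
  hence y': "y : sp M (src a)" using lsubD(5)[OF D(1)] by auto
  show "amap (subrep M U) a (x +[space (subrep M U) (src a)] y) =
    amap (subrep M U) a x +[space (subrep M U) (tgt a)] amap (subrep M U) a y" using lin_maps_add[OF LmodD(2)[OF M] x'(1) y'] by simp
 qed
 fix v d x assume "x : sp (subrep M U) (tedge v d)"
 hence "x : U (tedge v d)" by simp
 hence "x : carrier (space M (src (v, d)))" using lsubD(5)[OF D(1)[OF tedge_Q0]] by simp
 from LmodD(3)[OF M this]
 show "amap (subrep M U) (v, clockwise d) (amap (subrep M U) (v, d) x) =
   (zero (space (subrep M U) (tedge v (clockwise (clockwise d)))))" by simp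
qed

lemma subrep_fin_dim:
 assumes M: "is_Lambda_module M" and U: "is_Lambda_submodule M U" and fd: "fin_dim M"
 shows "fin_dim (subrep M U)"
proof -
 note D = Lambda_submoduleD[OF M U]
 obtain S where S: "finite S" "!!e. e : Q0 - S ==> sp M e = {(zero (space M e))}" using fd unfolding fin_dim_def by blast
 have "U e = {(zero (space M e))}" if "e : Q0 - S" for e using lsubD(1,2)[OF D(1), of e] S(2)[OF that] that by auto
 hence "\<exists>S. finite S & (\<forall>e\<in>Q0 - S. sp (subrep M U) e = {(zero (space (subrep M U) e))})" using S(1) by auto
 moreover have "\<exists>ph n. chart (space (subrep M U) e) ph n" if e: "e : Q0" for e
  using fd chart_linear_subset[OF _ D(1)[OF e]] e unfolding fin_dim_def by fastforce
 ultimately show ?thesis unfolding fin_dim_def by blast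
qed

definition zero_sub :: "('k, 'u) quiver_rep => qvertex => 'u set" where
 "zero_sub M e = (if e : Q0 then {(zero (space M e))} else {})"

definition whole_sub :: "('k, 'u) quiver_rep => qvertex => 'u set" where
 "whole_sub M e = (if e : Q0 then sp M e else {})"

lemma amap_zero:
 assumes M: "is_Lambda_module M"
 shows "amap M a (zero (space M (src a))) = (zero (space M (tgt a)))"
 by (rule lin_maps_zero[OF LmodD(1)[OF M] LmodD(1)[OF M] LmodD(2)[OF M]]) simp_all

lemma zero_whole_sub:
 assumes M: "is_Lambda_module M"
 shows "is_Lambda_submodule M (zero_sub M)" "is_Lambda_submodule M (whole_sub M)"
 unfolding Lambda_submodule_iff[OF M] using carrier_linear_subset[OF LmodD(1)[OF M]] amap_zero[OF M]
  lin_maps_closed[OF LmodD(2)[OF M]] by (simp_all add: zero_sub_def whole_sub_def image_subset_iff del: src.simps tgt.simps split_paired_All)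

lemma fin_dim_finite_length:
 fixes M :: "('k::field, 'u) quiver_rep"
 assumes M: "is_Lambda_module M" and fd: "fin_dim M"
 shows "finite_length M"
proof -
 obtain S where S: "finite S" "!!e. e : Q0 - S ==> sp M e = {(zero (space M e))}" using fd unfolding fin_dim_def by blast
 obtain ph n where c: "!!e. e : Q0 ==> chart (space M e) (ph e) (n e)" using fd unfolding fin_dim_def by metis
 note D = Lambda_submoduleD[OF M]
 define mu where "mu U = (\<Sum>e\<in>S \<inter> Q0. card (lead_pos (ph e ` U e)))" for U
 have fin: "finite (S \<inter> Q0)" using S by simp
 have strict: "mu U < mu W" if U: "is_Lambda_submodule M U" and W: "is_Lambda_submodule M W" and less: "U < W" for U W
 proof -
  have sub: "U e \<subseteq> W e" for e using less by (auto simp: less_fun_def le_fun_def)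
  have str: "card (lead_pos (ph e ` U e)) < card (lead_pos (ph e ` W e))" if e: "e : Q0" and ne: "U e ~= W e" for e
  proof (rule lead_pos_strict)
   note V = LmodD(1)[OF M e]
   show "coord_space (n e) (ph e ` U e)" by (rule chart_coord_space[OF V c[OF e] D(1)[OF U e]])
   show "coord_space (n e) (ph e ` W e)" by (rule chart_coord_space[OF V c[OF e] D(1)[OF W e]])
   have "inj_on (ph e) (sp M e)" using c[OF e] by (simp add: chart_def)
   hence "ph e ` U e ~= ph e ` W e" using ne inj_on_image_eq_iff lsubD(1)[OF D(1)[OF U e]] lsubD(1)[OF D(1)[OF W e]] by blast
   thus "ph e ` U e \<subset> ph e ` W e" using sub[of e] by blast
  qed
  have le: "card (lead_pos (ph e ` U e)) <= card (lead_pos (ph e ` W e))" if e: "e : Q0" for e using str[OF e] by (cases "U e = W e") auto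
  obtain e where ne: "U e ~= W e" using less by (metis less_le ext)
  have "e : Q0" using ne D(2)[OF U, of e] D(2)[OF W, of e] by blast
  moreover have "e : S"
  proof (rule ccontr)
   assume "e \<notin> S"
   hence "sp M e = {(zero (space M e))}" using S(2) \<open>e : Q0\<close> by blast
   thus False using ne lsubD(1,2)[OF D(1)[OF U \<open>e : Q0\<close>]] lsubD(1,2)[OF D(1)[OF W \<open>e : Q0\<close>]] by auto
  qed
  ultimately show ?thesis unfolding mu_def by (intro sum_strict_mono_ex1[OF fin]) (use le str[OF _ ne] in auto)
 qed
 define cover where "cover U W \<longleftrightarrow> U < W & \<not> (\<exists>V. is_Lambda_submodule M V & U < V & V < W)" for U W
 have "\<exists>m Us. (\<forall>i\<le>m. is_Lambda_submodule M (Us i)) & Us 0 = zero_sub M & Us m = U & (\<forall>i<m. cover (Us i) (Us (Suc i)))"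
  if "is_Lambda_submodule M U" for U using that
 proof (induction "mu U" arbitrary: U rule: less_induct)
  case less
  show ?case
  proof (cases "U = zero_sub M")
   case True
   thus ?thesis using less.prems by (intro exI[of _ 0] exI[of _ "%_. U"]) simp
  next
   case False
   have "zero_sub M < U" using False lsubD(2)[OF D(1)[OF less.prems]] by (auto simp: less_le le_fun_def zero_sub_def)
   hence P: "is_Lambda_submodule M (zero_sub M) & zero_sub M < U" using zero_whole_sub[OF M] by blast
   have "\<forall>W. is_Lambda_submodule M W & W < U --> mu W < mu U" using strict less.prems by blast
   from ex_has_greatest_nat[of "%W. is_Lambda_submodule M W & W < U", OF P this]
   obtain W where W: "is_Lambda_submodule M W" "W < U"
    and max: "!!V. is_Lambda_submodule M V ==> V < U ==> mu V <= mu W" by blast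
   have cov: "cover W U" unfolding cover_def using W max strict[OF W(1)] not_less by blast
   obtain m Us where Us: "\<forall>i\<le>m. is_Lambda_submodule M (Us i)" "Us 0 = zero_sub M" "Us m = W"
    "\<forall>i<m. cover (Us i) (Us (Suc i))" using less.hyps[OF strict[OF W(1) less.prems W(2)] W(1)] by blast
   show ?thesis using Us cov less.prems by (intro exI[of _ "Suc m"] exI[of _ "%i. if i <= m then Us i else U"])
     (auto simp: le_Suc_eq less_Suc_eq)
  qed
 qed
 from this[OF zero_whole_sub(2)[OF M]] obtain m Us where Us: "\<forall>i\<le>m. is_Lambda_submodule M (Us i)"
  "Us 0 = zero_sub M" "Us m = whole_sub M" "\<forall>i<m. cover (Us i) (Us (Suc i))" by blast
 have "composition_series M m Us"
  unfolding composition_series_def using Us unfolding cover_def by (simp add: zero_sub_def whole_sub_def)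
 thus ?thesis unfolding finite_length_def by blast
qed

subsection \<open>Simple modules are one-dimensional\<close>

lemma nbr_inj: "nbr v d = nbr v d' ==> d = d'"
proof -
 obtain s p where v: "v = (s, p)" by (cases v)
 have "p ~= b # p" "p ~= b # b' # p" for b b' using arg_cong[of p _ length] by force+
 thus "nbr v d = nbr v d' ==> d = d'" by (cases p; cases d; cases d'; simp add: v; metis)
qed

lemma nbr_neq: "nbr v d ~= v"
proof -
 obtain s p where v: "v = (s, p)" by (cases v)
 have "length (snd (nbr v d)) ~= length p | fst (nbr v d) ~= s" by (cases p; cases d; simp add: v)
 thus ?thesis using v by auto
qed

lemma src_tgt_inj:
 assumes "src a = src b" "tgt a = tgt b"
 shows "a = b"
proof -
 obtain v d where a: "a = (v, d)" by (cases a)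
 obtain v' d' where b: "b = (v', d')" by (cases b)
 have e: "{v, nbr v d} = {v', nbr v' d'}" "{v, nbr v (clockwise d)} = {v', nbr v' (clockwise d')}" using assms by (simp_all add: a b tedge_def)
 have "v = v'"
 proof (rule ccontr)
  assume "v ~= v'"
  hence "v' = nbr v d" "v' = nbr v (clockwise d)" using e by (auto simp: doubleton_eq_iff)
  hence "d = clockwise d" using nbr_inj by metis
  thus False by (cases d) auto
 qed
 moreover from this have "nbr v d = nbr v d'" using e(1) nbr_neq by (auto simp: doubleton_eq_iff)
 ultimately show ?thesis using nbr_inj by (auto simp: a b)
qed

lemma arrow_lift_unique:
 assumes a: "arrow_lift a p q r" and b: "arrow_lift b p' q r"
 shows "a = b"
proof -
 have o: "p < q" "q < r" "r < p + 2" "p' < q" "r < p' + 2"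
  and la: "(q, r) : lifts (src a)" "(p, r) : lifts (tgt a)" "(p, q) : lifts (tgt (fst a, clockwise (snd a)))"
  and lb: "(q, r) : lifts (src b)" "(p', r) : lifts (tgt b)" "(p', q) : lifts (tgt (fst b, clockwise (snd b)))"
  using a b by (simp_all add: arrow_lift_def del: src.simps tgt.simps)
 have "\<not> p < p'" using noncrossing[OF la(3) lb(2)] o by (simp add: crosses_def)
 moreover have "\<not> p' < p" using noncrossing[OF lb(3) la(2)] o by (simp add: crosses_def)
 ultimately have "p = p'" by simp
 thus ?thesis using lifts_inj[OF la(1) lb(1)] lifts_inj[OF la(2)] lb(2) src_tgt_inj by metis
qed

lemma lifts_same_end:
 assumes "(p, r) : lifts e" "(s, r) : lifts e"
 shows "p = s"
proof -
 obtain k where k: "(p, r) = turn k (s, r)" using lifts_orbit[OF assms(2,1)] by blast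
 show ?thesis
 proof (cases "even k")
  case True
  thus ?thesis using k by (simp add: turn_def)
 next
  case False
  then obtain n where n: "k = 2 * n + 1" by (metis oddE)
  hence "r - s = 2 * of_int n + 2" using k by (simp add: turn_def)
  hence "-1 < real_of_int n" "real_of_int n < 0" using lifts_chord[OF assms(2)] by (simp_all add: chord_def)
  hence "-1 < n" "n < 0" by simp_all
  thus ?thesis by simp
 qed
qed

text \<open>
 The nonzero paths starting at a vertex turn around one of the two ends of its chord, in the
 clockwise direction. They never come back.
\<close>

inductive fan :: "(qarrow => 'u => 'u) => qvertex => 'u => lift => 'u => bool" for A e0 x where
 start: "arrow_lift a p q r ==> (q, r) : lifts e0 ==> fan A e0 x (p, r) (A a x)"
| step: "fan A e0 x (q, r) y ==> arrow_lift a p q r ==> fan A e0 x (p, r) (A a y)"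

inductive fan_span :: "('k, 'u) quiver_rep => (qvertex => 'u set) => qvertex => 'u => qvertex => 'u => bool"
 for M U e0 x where
 base: "u : U e ==> fan_span M U e0 x e u"
| path: "fan (amap M) e0 x l y ==> l : lifts e ==> fan_span M U e0 x e y"
| add: "fan_span M U e0 x e y ==> fan_span M U e0 x e z ==> fan_span M U e0 x e (y +[space M e] z)"
| smult: "fan_span M U e0 x e y ==> fan_span M U e0 x e (c *[space M e] y)"

lemma fan_last:
 assumes M: "is_Lambda_module M" and U: "is_Lambda_submodule M U" and x: "x : U e0"
  and f: "fan (amap M) e0 x l y"
 shows "\<exists>a p q r y0. l = (p, r) & arrow_lift a p q r & y = amap M a y0 & y0 : U (src a) &
  (\<exists>s. (s, r) : lifts e0 & p < s)" using f
proof (induction rule: fan.induct)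
 case (start a p q r)
 hence "src a = e0" "p < q" using lifts_inj by (auto simp: arrow_lift_def simp del: src.simps)
 thus ?case using start x by blast
next
 case (step q r y a p)
 from step.IH obtain b p' q' r' y0 s where IH: "(q, r) = (p', r')" "arrow_lift b p' q' r'" "y = amap M b y0" "y0 : U (src b)"
  "(s, r') : lifts e0" "p' < s" by blast
 hence "tgt b = src a" using step.hyps lifts_inj[of "(q, r)" "tgt b" "src a"] by (simp add: arrow_lift_def del: src.simps tgt.simps)
 hence "y : U (src a)" using Lambda_submoduleD(3)[OF M U IH(4)] IH(3) by simp
 moreover have "p < s" using IH step.hyps by (simp add: arrow_lift_def del: src.simps tgt.simps)
 ultimately show ?case using step.hyps IH by blast
qed

text \<open>
 A vector \<open>x\<close> outside \<open>U\<close> generates \<open>U'\<close> together with \<open>U\<close>. If some arrow moved \<open>x\<close> out of \<open>U\<close>, then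
 the images of \<open>x\<close> under paths of positive length would generate a proper intermediate submodule,
 since no such path returns to the vertex of \<open>x\<close>.
\<close>

lemma cover_one_dim:
 fixes M :: "('k::field, 'u) quiver_rep"
 assumes M: "is_Lambda_module M" and U: "is_Lambda_submodule M U" and U': "is_Lambda_submodule M U'"
  and less: "U < U'" and cov: "!!W. is_Lambda_submodule M W ==> U < W ==> \<not> W < U'"
 shows "\<exists>e0 x. e0 : Q0 & x : U' e0 & x \<notin> U e0 &
  U' = U(e0 := {u +[space M e0] c *[space M e0] x | u c. u : U e0})"
proof -
 note D = Lambda_submoduleD[OF M U] and D' = Lambda_submoduleD[OF M U'] and V = LmodD(1)[OF M]
 have sub: "U e \<subseteq> U' e" for e using less by (auto simp: less_fun_def le_fun_def)
 obtain e0 x where x: "x : U' e0" "x \<notin> U e0" using less by (auto simp: less_fun_def le_fun_def)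
 have e0: "e0 : Q0" using x D'(2) by blast
 define W where "W e = {y. fan_span M U e0 x e y}" for e
 have Q: "e : Q0" if "fan_span M U e0 x e y" for e y using that by induction (use D(2) lifts_Q0 in blast)+
 have WU': "W e \<subseteq> U' e" for e
 proof
  fix y assume "y : W e"
  hence "fan_span M U e0 x e y" by (simp add: W_def)
  thus "y : U' e"
  proof induction
   case (path l y e)
   from fan_last[OF M U' x(1) path(1)] obtain a p q r y0 where
    "l = (p, r)" "arrow_lift a p q r" "y = amap M a y0" "y0 : U' (src a)" by blast
   thus ?case using path(2) lifts_inj[of l e "tgt a"] D'(3) by (simp add: arrow_lift_def del: src.simps tgt.simps)
  next
   case (add e y z)
   thus ?case using lsubD(3)[OF D'(1)] Q by blast
  next
   case (smult e y c)
   thus ?case using lsubD(4)[OF D'(1)] Q by blast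
  qed (use sub in blast)
 qed
 have W: "is_Lambda_submodule M W"
  unfolding Lambda_submodule_iff[OF M]
 proof (intro conjI ballI allI impI)
  fix e assume e: "e : Q0"
  show "linear_subset (space M e) (W e)"
   unfolding linear_subset_def using WU'[of e] lsubD(1)[OF D'(1)[OF e]] lsubD(2)[OF D(1)[OF e]] by (auto simp: W_def intro: fan_span.intros)
 next
  fix e :: qvertex assume "e \<notin> Q0"
  thus "W e = {}" using Q by (auto simp: W_def)
 next
  fix b :: qarrow
  have "fan_span M U e0 x (tgt b) (amap M b y)" if "fan_span M U e0 x e y" "e = src b" for e y using that
  proof induction
   case (base u e)
   thus ?case using D(3) by (simp add: fan_span.base del: src.simps tgt.simps)
  next
   case (path l y e)
   from fan_last[OF M U' x(1) path(1)] obtain a p q r y0 where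
    a: "l = (p, r)" "arrow_lift a p q r" "y = amap M a y0" "y0 : U' (src a)" by blast
   obtain p' q' r' where b: "arrow_lift b p' q' r'" using arrow_lift_ex by blast
   hence "(q', r') : lifts e" using path(3) by (simp add: arrow_lift_def del: src.simps tgt.simps)
   then obtain k where k: "(p, r) = turn k (q', r')" using lifts_orbit path(2) a(1) by blast
   show ?case
   proof (cases "even k")
    case True
    then obtain n where n: "k = 2 * n" by blast
    have "arrow_lift b (p' + 2 * of_int n) p r" using arrow_lift_shift[OF b, of n] k n by (simp add: turn_def)
    moreover from this have "(p' + 2 * of_int n, r) : lifts (tgt b)" by (simp add: arrow_lift_def del: src.simps tgt.simps)
    moreover have "fan (amap M) e0 x (p, r) y" using path(1) a(1) by simp
    ultimately show ?thesis using fan_span.path[OF fan.step] by metis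
   next
    case False
    then obtain n where n: "k = 2 * n + 1" by (metis oddE)
    have "arrow_lift b (p' + 2 * of_int (n + 1)) r (p + 2)" using arrow_lift_shift[OF b, of "n + 1"] k n by (simp add: turn_def add_ac)
    hence "b = (fst a, clockwise (snd a))" using arrow_lift_unique[OF _ arrow_lift_next[OF a(2)]] by blast
    moreover have "y0 : carrier (space M (src (fst a, snd a)))" using a(4) lsubD(5)[OF D'(1)] by simp
    ultimately have "amap M b y = (zero (space M (tgt b)))" using LmodD(3)[OF M, of y0 "fst a" "snd a"] a(3) by simp
    thus ?thesis using lsubD(2)[OF D(1)[of "tgt b"]] by (simp add: fan_span.base del: tgt.simps)
   qed
  next
   case (add e y z)
   have "y : sp M (src b)" "z : sp M (src b)" using add WU'[of e] lsubD(5)[OF D'(1)] Q by (auto simp: W_def)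
   thus ?case using add lin_maps_add[OF LmodD(2)[OF M]] by (simp add: fan_span.add del: src.simps tgt.simps)
  next
   case (smult e y c)
   have "y : sp M (src b)" using smult WU'[of e] lsubD(5)[OF D'(1)] Q by (auto simp: W_def)
   thus ?case using smult lin_maps_smult[OF LmodD(2)[OF M]] by (simp add: fan_span.smult del: src.simps tgt.simps)
  qed
  thus "amap M b ` W (src b) \<subseteq> W (tgt b)" by (auto simp: W_def simp del: src.simps tgt.simps)
 qed
 have "y : U e" if "fan_span M U e0 x e y" "e = e0" for e y using that
 proof induction
  case (path l y e)
  from fan_last[OF M U' x(1) path(1)] obtain p r s where "l = (p, r)" "(s, r) : lifts e0" "p < s" by blast
  thus ?case using lifts_same_end[of p r e0 s] path by simp
 next
  case (add e y z)
  thus ?case using lsubD(3)[OF D(1)[OF e0]] by blast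
 next
  case (smult e y c)
  thus ?case using lsubD(4)[OF D(1)[OF e0]] by blast
 qed
 hence xW: "x \<notin> W e0" using x by (auto simp: W_def)
 have "U <= W" by (auto simp: le_fun_def W_def intro: fan_span.base)
 moreover have "W < U'" using WU' xW x(1) by (auto simp: less_fun_def le_fun_def)
 ultimately have WU: "W = U" using cov[OF W] by (metis order.not_eq_order_implies_strict)
 have out: "amap M a x : U (tgt a)" if "src a = e0" for a
 proof -
  obtain p q r where a: "arrow_lift a p q r" using arrow_lift_ex by blast
  hence "fan (amap M) e0 x (p, r) (amap M a x)"
   by (intro fan.start[of a p q r]) (use that in \<open>simp_all add: arrow_lift_def del: src.simps tgt.simps\<close>)
  moreover have "(p, r) : lifts (tgt a)" using a by (simp add: arrow_lift_def del: src.simps tgt.simps)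
  ultimately show ?thesis using fan_span.path WU by (metis W_def mem_Collect_eq)
 qed
 note V0 = V[OF e0] and L0 = D(1)[OF e0]
 have xV: "x : sp M e0" using lsubD(5)[OF D'(1)[OF e0] x(1)] .
 define X where "X = {u +[space M e0] c *[space M e0] x | u c. u : U e0}"
 have UX: "U e0 \<subseteq> X"
 proof
  fix u assume u: "u : U e0"
  hence "u = u +[space M e0] 0 *[space M e0] x" using vs_smult_zero[OF V0 xV] vs_r_zero[OF V0 lsubD(5)[OF L0 u]] by simp
  thus "u : X" unfolding X_def using u by blast
 qed
 have xX: "x : X"
 proof -
  have "x = (zero (space M e0)) +[space M e0] 1 *[space M e0] x" using vs_smult_one[OF V0 xV] vs_l_zero[OF V0 xV] by simp
  thus ?thesis unfolding X_def using lsubD(2)[OF L0] by blast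
 qed
 have XU': "X \<subseteq> U' e0"
  unfolding X_def using sub[of e0] x(1) lsubD(3,4)[OF D'(1)[OF e0]] by blast
 have "is_Lambda_submodule M (U(e0 := X))"
  unfolding Lambda_submodule_iff[OF M]
 proof (intro conjI ballI allI impI)
  fix e assume e: "e : Q0"
  have "linear_subset (space M e0) X"
   unfolding linear_subset_def
  proof (intro conjI ballI allI)
   show "X \<subseteq> sp M e0" using XU' lsubD(1)[OF D'(1)[OF e0]] by blast
   show "(zero (space M e0)) : X" using UX lsubD(2)[OF L0] by blast
   fix y assume "y : X"
   then obtain u c where y: "y = u +[space M e0] c *[space M e0] x" "u : U e0" unfolding X_def by blast
   note uV = lsubD(5)[OF L0 y(2)]
   have "k *[space M e0] y = k *[space M e0] u +[space M e0] (k * c) *[space M e0] x" for k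
    using vs_r_distr[OF V0 uV vs_smult[OF V0 xV]] vs_smult_smult[OF V0 xV] y(1) by simp
   thus "k *[space M e0] y : X" for k unfolding X_def using lsubD(4)[OF L0 y(2)] by blast
   fix z assume "z : X"
   then obtain w d where z: "z = w +[space M e0] d *[space M e0] x" "w : U e0" unfolding X_def by blast
   note wV = lsubD(5)[OF L0 z(2)]
   have "y +[space M e0] z = (u +[space M e0] w) +[space M e0] (c + d) *[space M e0] x"
    unfolding y z using uV wV xV by (simp add: vs_assoc[OF V0] vs_l_distr[OF V0] vs_add[OF V0] vs_smult[OF V0]
     vs_lcomm[OF V0, of "c *[space M e0] x" w])
   thus "y +[space M e0] z : X" unfolding X_def using lsubD(3)[OF L0 y(2) z(2)] by blast
  qed
  thus "linear_subset (space M e) ((U(e0 := X)) e)" using D(1)[OF e] by simp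
 next
  fix e :: qvertex assume "e \<notin> Q0"
  thus "(U(e0 := X)) e = {}" using D(2) e0 by auto
 next
  fix a :: qarrow
  have "amap M a y : U (tgt a)" if y: "y : (U(e0 := X)) (src a)" for y
  proof (cases "src a = e0")
   case True
   then obtain u c where y: "y = u +[space M (src a)] c *[space M (src a)] x" "u : U (src a)" using y unfolding X_def by auto
   have xs: "x : sp M (src a)" using xV True by simp
   have us: "u : sp M (src a)" using lsubD(5)[OF D(1) y(2)] by simp
   have "amap M a y = amap M a u +[space M (tgt a)] c *[space M (tgt a)] amap M a x"
    unfolding y(1) using lin_maps_add[OF LmodD(2)[OF M] us vs_smult[OF V xs]]
     lin_maps_smult[OF LmodD(2)[OF M] xs] by simp
   thus ?thesis using lsubD(3,4)[OF D(1)[of "tgt a"]] D(3)[OF y(2)] out[OF True] by simp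
  next
   case False
   thus ?thesis using D(3) y by simp
  qed
  thus "amap M a ` (U(e0 := X)) (src a) \<subseteq> (U(e0 := X)) (tgt a)" using UX by (force simp del: src.simps tgt.simps)
 qed
 moreover have "U < U(e0 := X)" using UX xX x(2) by (auto simp: less_fun_def le_fun_def)
 moreover have "U(e0 := X) <= U'" using XU' sub by (auto simp: le_fun_def)
 ultimately have "U' = U(e0 := X)" using cov by (metis order.not_eq_order_implies_strict)
 thus ?thesis using e0 x unfolding X_def by blast
qed

lemma finite_length_fin_dim:
 fixes M :: "('k::field, 'u) quiver_rep"
 assumes M: "is_Lambda_module M" and fl: "finite_length M"
 shows "fin_dim M"
proof -
 obtain n U where cs: "composition_series M n U" using fl unfolding finite_length_def by blast
 note D = Lambda_submoduleD[OF M]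
 have U: "is_Lambda_submodule M (U i)" if "i <= n" for i using cs that by (simp add: composition_series_def)
 have "(\<exists>S. finite S & (\<forall>e\<in>Q0 - S. U i e = {(zero (space M e))})) & (\<forall>e\<in>Q0. \<exists>ph n. chart ((space M e)\<lparr>carrier := U i e\<rparr>) ph n)"
  if "i <= n" for i using that
 proof (induction i)
  case 0
  have U0: "U 0 e = {(zero (space M e))}" if "e : Q0" for e using cs that by (simp add: composition_series_def)
  have "chart ((space M e)\<lparr>carrier := U 0 e\<rparr>) (%x i. 0) 0" if e: "e : Q0" for e
   using vs_l_zero[OF LmodD(1)[OF M e] vs_zero[OF LmodD(1)[OF M e]]] by (simp add: chart_def U0[OF e])
  thus ?case using U0 by blast
 next
  case (Suc i)
  then obtain S where S: "finite S" "!!e. e : Q0 - S ==> U i e = {(zero (space M e))}"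
   and ch: "!!e. e : Q0 ==> \<exists>ph n. chart ((space M e)\<lparr>carrier := U i e\<rparr>) ph n" by auto
  have i: "i < n" "i <= n" using Suc.prems by auto
  have "U i < U (Suc i)" "!!W. is_Lambda_submodule M W ==> U i < W ==> \<not> W < U (Suc i)" using cs i unfolding composition_series_def by blast+
  from cover_one_dim[OF M U[OF i(2)] U[OF Suc.prems] this]
  obtain e0 x where e0: "e0 : Q0" and x: "x : U (Suc i) e0" "x \<notin> U i e0"
   and eq: "U (Suc i) = (U i)(e0 := {u +[space M e0] c *[space M e0] x | u c. u : U i e0})" by blast
  have "finite (insert e0 S)" "!!e. e : Q0 - insert e0 S ==> U (Suc i) e = {(zero (space M e))}" using S by (simp_all add: eq)
  moreover have "\<exists>ph n. chart ((space M e)\<lparr>carrier := U (Suc i) e\<rparr>) ph n" if e: "e : Q0" for e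
  proof (cases "e = e0")
   case False
   thus ?thesis using ch[OF e] by (simp add: eq)
  next
   case True
   note V = LmodD(1)[OF M e0] and L = D(1)[OF U[OF i(2)] e0]
   let ?V = "space M e0"
   have xV: "x : carrier ?V" by (rule lsubD(5)[OF D(1)[OF U[OF Suc.prems] e0] x(1)])
   obtain ph m where c: "chart (?V\<lparr>carrier := U i e0\<rparr>) ph m" using ch[OF e0] by blast
   have ph: "inj_on ph (U i e0)" "!!u w. u : U i e0 ==> w : U i e0 ==> ph (u +[?V] w) = (%i. ph u i + ph w i)"
    "!!k u. u : U i e0 ==> ph (k *[?V] u) = (%i. k * ph u i)" "!!u j. u : U i e0 ==> m <= j ==> ph u j = 0" using c by (simp_all add: chart_def)
   have uniq: "u = w & k = l" if eq: "u +[?V] k *[?V] x = w +[?V] l *[?V] x" and u: "u : U i e0" and w: "w : U i e0" for u w k l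
   proof -
    note uV = lsubD(5)[OF L u] and wV = lsubD(5)[OF L w]
    have "(u +[?V] k *[?V] x) +[?V] (-l) *[?V] x = u +[?V] (k - l) *[?V] x"
     using vs_l_distr[OF V xV, of k "-l"] by (simp add: vs_assoc[OF V uV] vs_smult[OF V xV])
    moreover have "(w +[?V] l *[?V] x) +[?V] (-l) *[?V] x = w"
     using vs_l_distr[OF V xV, of l "-l", symmetric] by (simp add: vs_assoc[OF V wV] vs_smult[OF V xV] vs_smult_zero[OF V xV] vs_r_zero[OF V wV])
    ultimately have *: "u +[?V] (k - l) *[?V] x = w" using eq by simp
    have "k = l"
    proof (rule ccontr)
     assume ne: "k ~= l"
     have "(k - l) *[?V] x = (-1) *[?V] u +[?V] w"
     proof -
     have "(-1) *[?V] u +[?V] (u +[?V] (k - l) *[?V] x) = (u +[?V] (-1) *[?V] u) +[?V] (k - l) *[?V] x"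
     using vs_assoc[OF V vs_smult[OF V uV, of "-1"] uV vs_smult[OF V xV, of "k - l"]] vs_comm[OF V uV vs_smult[OF V uV, of "-1"]] by simp
     also have "\<dots> = (k - l) *[?V] x" using vs_neg[OF V uV] vs_l_zero[OF V vs_smult[OF V xV]] by simp
     finally show ?thesis using * by simp
     qed
     hence "(k - l) *[?V] x : U i e0" using lsubD(3,4)[OF L] u w by simp
     hence "inverse (k - l) *[?V] ((k - l) *[?V] x) : U i e0" by (rule lsubD(4)[OF L])
     hence "x : U i e0" using ne by (simp add: vs_smult_smult[OF V xV] vs_smult_one[OF V xV])
     thus False using x by blast
    qed
    thus ?thesis using * by (simp add: vs_smult_zero[OF V xV] vs_r_zero[OF V uV])
   qed
   define dec where "dec y = (SOME uc. fst uc : U i e0 & y = fst uc +[?V] snd uc *[?V] x)" for y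
   have dec: "dec (u +[?V] k *[?V] x) = (u, k)" if "u : U i e0" for u k
    unfolding dec_def by (rule some_equality) (use that uniq in \<open>auto simp: prod_eq_iff\<close>)
   define ps where "ps y = (ph (fst (dec y)))(m := snd (dec y))" for y
   have ps: "ps (u +[?V] k *[?V] x) = (ph u)(m := k)" if "u : U i e0" for u k by (simp add: ps_def dec[OF that])
   have S1: "U (Suc i) e0 = {u +[?V] k *[?V] x | u k. u : U i e0}" by (simp add: eq)
   have "chart (?V\<lparr>carrier := U (Suc i) e0\<rparr>) ps (Suc m)"
    unfolding chart_def
   proof (intro conjI ballI allI impI)
    show "inj_on ps (carrier (?V\<lparr>carrier := U (Suc i) e0\<rparr>))"
    proof (rule inj_onI)
     fix y z assume "y : carrier (?V\<lparr>carrier := U (Suc i) e0\<rparr>)" "z : carrier (?V\<lparr>carrier := U (Suc i) e0\<rparr>)" and e: "ps y = ps z"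
     then obtain u k w l where y: "y = u +[?V] k *[?V] x" "u : U i e0" and z: "z = w +[?V] l *[?V] x" "w : U i e0"
     unfolding S1 by auto
     have f: "(ph u)(m := k) = (ph w)(m := l)" using e ps y z by simp
     hence "k = l" by (metis fun_upd_same)
     moreover have "ph u j = ph w j" for j using fun_cong[OF f, of j] ph(4)[OF y(2), of m] ph(4)[OF z(2), of m] by (cases "j = m") auto
     hence "u = w" using inj_onD[OF ph(1) _ y(2) z(2)] by blast
     ultimately show "y = z" using y z by simp
    qed
   next
    fix y z assume "y : carrier (?V\<lparr>carrier := U (Suc i) e0\<rparr>)" "z : carrier (?V\<lparr>carrier := U (Suc i) e0\<rparr>)"
    then obtain u k w l where y: "y = u +[?V] k *[?V] x" "u : U i e0" and z: "z = w +[?V] l *[?V] x" "w : U i e0"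
     unfolding S1 by auto
    note uV = lsubD(5)[OF L y(2)] and wV = lsubD(5)[OF L z(2)]
    have "y +[?V] z = (u +[?V] w) +[?V] (k + l) *[?V] x"
     unfolding y z using uV wV xV by (simp add: vs_assoc[OF V] vs_l_distr[OF V] vs_add[OF V] vs_smult[OF V] vs_lcomm[OF V, of "k *[?V] x" w])
    thus "ps (y +[?V\<lparr>carrier := U (Suc i) e0\<rparr>] z) = (%i. ps y i + ps z i)"
     using ps[OF lsubD(3)[OF L y(2) z(2)]] ps[OF y(2)] ps[OF z(2)] ph(2)[OF y(2) z(2)] y(1) z(1) by (simp add: fun_eq_iff)
   next
    fix a y assume "y : carrier (?V\<lparr>carrier := U (Suc i) e0\<rparr>)"
    then obtain u k where y: "y = u +[?V] k *[?V] x" "u : U i e0"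
     unfolding S1 by auto
    note uV = lsubD(5)[OF L y(2)]
    have "a *[?V] y = (a *[?V] u) +[?V] (a * k) *[?V] x"
     unfolding y using uV xV by (simp add: vs_r_distr[OF V] vs_smult[OF V] vs_smult_smult[OF V])
    thus "ps (a *[?V\<lparr>carrier := U (Suc i) e0\<rparr>] y) = (%i. a * ps y i)"
     using ps[OF lsubD(4)[OF L y(2)]] ps[OF y(2)] ph(3)[OF y(2)] y(1) by (simp add: fun_eq_iff)
   next
    fix y j assume "y : carrier (?V\<lparr>carrier := U (Suc i) e0\<rparr>)" and j: "Suc m <= j"
    then obtain u k where y: "y = u +[?V] k *[?V] x" "u : U i e0"
     unfolding S1 by auto
    show "ps y j = 0" using ps[OF y(2)] ph(4)[OF y(2), of j] y(1) j by simp
   qed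
   thus ?thesis using True by blast
  qed
  ultimately show ?case by blast
 qed
 note top = this[OF order_refl]
 obtain S where S: "finite S" "\<forall>e\<in>Q0 - S. U n e = {(zero (space M e))}" using conjunct1[OF top] by (elim exE conjE)
 note ch = bspec[OF conjunct2[OF top]]
 have Un: "U n e = sp M e" if "e : Q0" for e using cs that by (simp add: composition_series_def)
 have "\<exists>ph m. chart (space M e) ph m" if "e : Q0" for e using ch[OF that] Un[OF that] by simp
 moreover have "sp M e = {(zero (space M e))}" if "e : Q0 - S" for e using bspec[OF S(2) that] Un that by simp
 ultimately show ?thesis unfolding fin_dim_def using S(1) by blast
qed

lemma FL_Obj_iff: "M : Obj FL \<longleftrightarrow> is_Lambda_module M & fin_dim M"
 using fin_dim_finite_length finite_length_fin_dim unfolding FL_simps by blast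

subsection \<open>Kernels and cokernels\<close>

lemma FL_zero_apply: "e : Q0 ==> x : sp M e ==> (zero (Hom FL M N)) e x = (zero (space N e))" by (simp add: FL_simps)

lemma FL_comp_apply: "e : Q0 ==> x : sp L e ==> Comp FL L M N g f e x = g e (f e x)" by (simp add: FL_simps)

definition ker_sub :: "('k, 'u) quiver_rep => ('k, 'u) quiver_rep => (qvertex => 'u => 'u) => qvertex => 'u set" where
 "ker_sub M N f e = (if e : Q0 then {x : sp M e. f e x = (zero (space N e))} else {})"

definition im_sub :: "('k, 'u) quiver_rep => (qvertex => 'u => 'u) => qvertex => 'u set" where
 "im_sub M f e = (if e : Q0 then f e ` sp M e else {})"

lemma ker_sub_submodule:
 assumes M: "is_Lambda_module M" and N: "is_Lambda_module N" and f: "f : mor FL M N"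
 shows "is_Lambda_submodule M (ker_sub M N f)"
 unfolding Lambda_submodule_iff[OF M]
proof (intro conjI ballI allI impI)
 fix e assume e: "e : Q0"
 note V = LmodD(1)[OF M e] and W = LmodD(1)[OF N e] and l = FL_lin[OF f e]
 show "linear_subset (space M e) (ker_sub M N f e)"
  unfolding linear_subset_def using e by (auto simp: ker_sub_def vs_zero[OF V] vs_add[OF V] vs_smult[OF V] lin_maps_zero[OF V W l]
    lin_maps_add[OF l] lin_maps_smult[OF l] vs_l_zero[OF W vs_zero[OF W]] vs_smult_null[OF W])
next
 fix e :: qvertex assume "e \<notin> Q0"
 thus "ker_sub M N f e = {}" by (simp add: ker_sub_def)
next
 fix a :: qarrow
 show "amap M a ` ker_sub M N f (src a) \<subseteq> ker_sub M N f (tgt a)"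
  using lin_maps_closed[OF LmodD(2)[OF M, of a]] FL_nat[OF f, of _ a] amap_zero[OF N, of a]
  by (auto simp: ker_sub_def simp del: src.simps tgt.simps)
qed

lemma im_sub_submodule:
 assumes M: "is_Lambda_module M" and N: "is_Lambda_module N" and f: "f : mor FL M N"
 shows "is_Lambda_submodule N (im_sub M f)"
 unfolding Lambda_submodule_iff[OF N]
proof (intro conjI ballI allI impI)
 fix e assume e: "e : Q0"
 note V = LmodD(1)[OF M e] and W = LmodD(1)[OF N e] and l = FL_lin[OF f e]
 show "linear_subset (space N e) (im_sub M f e)"
  unfolding linear_subset_def
 proof (intro conjI ballI allI)
  show "im_sub M f e \<subseteq> sp N e" using lin_maps_closed[OF l] e by (auto simp: im_sub_def)
  show "(zero (space N e)) : im_sub M f e" using lin_maps_zero[OF V W l] vs_zero[OF V] e unfolding im_sub_def by (metis imageI)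
  fix y assume "y : im_sub M f e"
  then obtain x where x: "x : sp M e" "y = f e x" using e by (auto simp: im_sub_def)
  show "c *[space N e] y : im_sub M f e" for c
   using lin_maps_smult[OF l x(1), of c, symmetric] vs_smult[OF V x(1), of c] e by (auto simp: im_sub_def x)
  fix z assume "z : im_sub M f e"
  then obtain w where w: "w : sp M e" "z = f e w" using e by (auto simp: im_sub_def)
  show "y +[space N e] z : im_sub M f e" using lin_maps_add[OF l x(1) w(1), symmetric] vs_add[OF V x(1) w(1)] e by (auto simp: im_sub_def x w)
 qed
next
 fix e :: qvertex assume "e \<notin> Q0"
 thus "im_sub M f e = {}" by (simp add: im_sub_def)
next
 fix a :: qarrow
 show "amap N a ` im_sub M f (src a) \<subseteq> im_sub M f (tgt a)" using lin_maps_closed[OF LmodD(2)[OF M, of a]] FL_nat[OF f, of _ a, symmetric]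
  by (auto simp: im_sub_def simp del: src.simps tgt.simps)
qed

lemma subrep_incl:
 assumes M: "is_Lambda_module M" and U: "is_Lambda_submodule M U"
 shows "family (subrep M U) (%e x. x) : mor FL (subrep M U) M" by (rule FL_morI[OF subrep_module[OF M U]])
  (use lsubD(5)[OF Lambda_submoduleD(1)[OF M U]] in \<open>auto intro: lin_mapsI\<close>)

lemma mor_into_subrep:
 assumes W: "is_Lambda_module W" and h: "h : mor FL W M"
  and into: "!!e x. e : Q0 ==> x : sp W e ==> h e x : U e"
 shows "h : mor FL W (subrep M U)"
proof -
 have "family W h : mor FL W (subrep M U)"
 proof (rule FL_morI[OF W])
  fix e assume e: "e : Q0"
  show "h e : lin_maps (space W e) (space (subrep M U) e)" using FL_lin[OF h e] into[OF e] by (auto simp: lin_maps_def)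
 next
  fix a x assume "x : sp W (src a)"
  thus "h (tgt a) (amap W a x) = amap (subrep M U) a (h (src a) x)" using FL_nat[OF h] by simp
 qed
 thus ?thesis using FL_eq[OF h] by simp
qed

lemma FL_kernel:
 fixes M N :: "('k::field, 'u) quiver_rep"
 assumes M: "M : Obj FL" and N: "N : Obj FL" and f: "f : mor FL M N"
 shows "is_kernel FL M N f (subrep M (ker_sub M N f)) (family (subrep M (ker_sub M N f)) (%e x. x))"
 unfolding is_kernel_def
proof (intro conjI ballI impI)
 have LM: "is_Lambda_module M" "fin_dim M" and LN: "is_Lambda_module N" using M N FL_Obj_iff by blast+
 note K = ker_sub_submodule[OF LM(1) LN f]
 let ?K = "subrep M (ker_sub M N f)"
 let ?i = "family ?K (%e x. x)"
 show "?K : Obj FL" using subrep_module[OF LM(1) K] subrep_fin_dim[OF LM(1) K LM(2)] FL_Obj_iff by blast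
 show i: "?i : mor FL ?K M" by (rule subrep_incl[OF LM(1) K])
 show "Comp FL ?K M N f ?i = (zero (Hom FL ?K N))"
  unfolding FL_simps by (rule family_cong) (simp add: ker_sub_def)
 fix W h assume W: "W : Obj FL" and h: "h : mor FL W M" "Comp FL W M N f h = (zero (Hom FL W N))"
 have LW: "is_Lambda_module W" using W FL_Obj_iff by blast
 have hK: "h e x : ker_sub M N f e" if e: "e : Q0" and x: "x : sp W e" for e x
  using FL_comp_apply[OF e x, of M N f h] FL_zero_apply[OF e x, of N] h(2) FL_closed[OF h(1) e x] e by (simp add: ker_sub_def)
 show "\<exists>!u. u : mor FL W ?K & Comp FL W ?K M ?i u = h"
 proof (intro ex1I conjI)
  show hm: "h : mor FL W ?K" by (rule mor_into_subrep[OF LW h(1) hK])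
  have "Comp FL W ?K M ?i h = family W h"
   unfolding FL_simps by (rule family_cong) (simp add: hK)
  thus "Comp FL W ?K M ?i h = h" using FL_eq[OF h(1)] by simp
  fix u assume u: "u : mor FL W ?K & Comp FL W ?K M ?i u = h"
  show "u = h"
  proof (rule FL_ext)
   show "u : mor FL W ?K" "h : mor FL W M" using u h by blast+
   fix e x assume e: "e : Q0" and x: "x : sp W e"
   have "u e x : sp ?K e" using FL_closed[OF _ e x] u by blast
   thus "u e x = h e x" using FL_comp_apply[OF e x, of ?K M ?i u] u e by simp
  qed
 qed
qed

text \<open>
 The cokernel is realised on a complement of the image, with the projection onto it, so that its
 elements are among those of the target.
\<close>

definition complement_rep :: "('k, 'u) quiver_rep => (qvertex => 'u => 'u) => ('k, 'u) quiver_rep" where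
 "complement_rep N prj = \<lparr>space = (%e. (space N e)\<lparr>carrier := prj e ` sp N e\<rparr>),
   amap = (%a x. prj (tgt a) (amap N a x))\<rparr>"

lemma complement_rep_simps [simp]:
 "space (complement_rep N prj) e = (space N e)\<lparr>carrier := prj e ` sp N e\<rparr>"
 "amap (complement_rep N prj) a x = prj (tgt a) (amap N a x)" by (simp_all add: complement_rep_def)

lemma FL_cokernel:
 fixes M N :: "('k::field, 'u) quiver_rep"
 assumes M: "M : Obj FL" and N: "N : Obj FL" and f: "f : mor FL M N"
 obtains B p where "is_cokernel FL M N f B p"
  "!!e x. e : Q0 ==> x : sp N e ==> p e x = (zero (space B e)) \<longleftrightarrow> x : f e ` sp M e"
proof -
 have LN: "is_Lambda_module N" "fin_dim N" and LM: "is_Lambda_module M" using M N FL_Obj_iff by blast+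
 note I = im_sub_submodule[OF LM LN(1) f]
 note ID = Lambda_submoduleD[OF LN(1) I]
 note V = LmodD(1)[OF LN(1)]
 have "\<exists>prj. prj : lin_maps (space N e) (space N e) & (\<forall>x\<in>sp N e. prj x = (zero (space N e)) \<longleftrightarrow> x : im_sub M f e) &
  (\<forall>x\<in>sp N e. prj (prj x) = prj x)" if e: "e : Q0" for e
 proof -
  obtain ph n where c: "chart (space N e) ph n" using LN(2) e unfolding fin_dim_def by blast
  show ?thesis by (rule chart_projection[OF V[OF e] c ID(1)[OF e]]) blast
 qed
 then obtain prj where prj: "!!e. e : Q0 ==> prj e : lin_maps (space N e) (space N e) & (\<forall>x\<in>sp N e. prj e x = (zero (space N e)) \<longleftrightarrow> x : im_sub M f e) &
  (\<forall>x\<in>sp N e. prj e (prj e x) = prj e x)" by metis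
 have lin: "prj e : lin_maps (space N e) (space N e)" if "e : Q0" for e using prj[OF that] by blast
 have ker: "prj e x = (zero (space N e)) \<longleftrightarrow> x : im_sub M f e" if "e : Q0" "x : sp N e" for e x using prj[OF that(1)] that by blast
 have idem: "prj e (prj e x) = prj e x" if "e : Q0" "x : sp N e" for e x using prj[OF that(1)] that by blast
 note cl = lin_maps_closed[OF lin]
 define B where "B = complement_rep N prj"
 have same: "prj e x = prj e y" if e: "e : Q0" and x: "x : sp N e" and y: "y : sp N e"
  and d: "x +[space N e] (-1) *[space N e] y : im_sub M f e" for e x y
 proof -
  have "prj e (x +[space N e] (-1) *[space N e] y) = (zero (space N e))" using ker[OF e vs_add[OF V[OF e] x vs_smult[OF V[OF e] y]]] d by blast
  hence "prj e x +[space N e] (-1) *[space N e] prj e y = (zero (space N e))"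
   by (simp add: lin_maps_add[OF lin[OF e] x vs_smult[OF V[OF e] y]] lin_maps_smult[OF lin[OF e] y])
  thus ?thesis using vs_eq_iff_diff[OF V[OF e] cl[OF e x] cl[OF e y]] by blast
 qed
 have diff: "x +[space N e] (-1) *[space N e] prj e x : im_sub M f e" if e: "e : Q0" and x: "x : sp N e" for e x
 proof -
  have "prj e (x +[space N e] (-1) *[space N e] prj e x) = prj e x +[space N e] (-1) *[space N e] prj e x"
   by (simp add: lin_maps_add[OF lin[OF e] x vs_smult[OF V[OF e] cl[OF e x]]] lin_maps_smult[OF lin[OF e] cl[OF e x]] idem[OF e x])
  thus ?thesis using ker[OF e vs_add[OF V[OF e] x vs_smult[OF V[OF e] cl[OF e x]]]] vs_neg[OF V[OF e] cl[OF e x]] by simp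
 qed
 have am: "prj (tgt a) (amap N a (prj (src a) x)) = prj (tgt a) (amap N a x)" if x: "x : sp N (src a)" for a x
 proof -
  note am = LmodD(2)[OF LN(1), of a]
  have px: "prj (src a) x : sp N (src a)" by (rule cl[OF _ x]) simp
  have "amap N a (x +[space N (src a)] (-1) *[space N (src a)] prj (src a) x) : im_sub M f (tgt a)" by (rule ID(3)[OF diff[OF _ x]]) simp
  hence "amap N a x +[space N (tgt a)] (-1) *[space N (tgt a)] amap N a (prj (src a) x) : im_sub M f (tgt a)"
   by (simp only: lin_maps_add[OF am x vs_smult[OF V[OF src_tgt_Q0(1)] px]] lin_maps_smult[OF am px])
  from same[OF _ lin_maps_closed[OF am x] lin_maps_closed[OF am px] this] show ?thesis by simp
 qed
 have LS: "linear_subset (space N e) (prj e ` sp N e)" if e: "e : Q0" for e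
  unfolding linear_subset_def
 proof (intro conjI ballI allI)
  show "prj e ` sp N e \<subseteq> sp N e" using cl[OF e] by blast
  show "(zero (space N e)) : prj e ` sp N e" using lin_maps_zero[OF V[OF e] V[OF e] lin[OF e]] vs_zero[OF V[OF e]] by (metis imageI)
  fix y assume "y : prj e ` sp N e"
  then obtain x where x: "x : sp N e" "y = prj e x" by blast
  show "c *[space N e] y : prj e ` sp N e" for c
   using lin_maps_smult[OF lin[OF e] x(1), of c, symmetric] vs_smult[OF V[OF e] x(1), of c] by (auto simp: x)
  fix z assume "z : prj e ` sp N e"
  then obtain w where w: "w : sp N e" "z = prj e w" by blast
  show "y +[space N e] z : prj e ` sp N e" using lin_maps_add[OF lin[OF e] x(1) w(1), symmetric] vs_add[OF V[OF e] x(1) w(1)] by (auto simp: x w)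
 qed
 have B: "is_Lambda_module B"
  unfolding is_Lambda_module_def
 proof (intro conjI ballI allI)
  show "Module.module class_ring (space B e)" if "e : Q0" for e using vs_linear_subset[OF V[OF that] LS[OF that]] by (simp add: B_def)
  fix a
  note amc = lin_maps_closed[OF LmodD(2)[OF LN(1), of a]]
  note L = lin_comp[OF LmodD(2)[OF LN(1), of a] lin[OF src_tgt_Q0(2)[of a]]]
  show "amap B a : lin_maps (space B (src a)) (space B (tgt a))"
  proof (rule lin_mapsI)
   fix x c assume x: "x : sp B (src a)"
   hence x': "x : sp N (src a)" using lsubD(5)[OF LS[of "src a"]] by (simp add: B_def)
   show "amap B a x : sp B (tgt a)" using amc[OF x'] by (simp add: B_def)
   show "amap B a (c *[space B (src a)] x) = c *[space B (tgt a)] amap B a x" using lin_maps_smult[OF L x'] by (simp add: B_def)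
   fix y assume y: "y : sp B (src a)"
   hence y': "y : sp N (src a)" using lsubD(5)[OF LS[of "src a"]] by (simp add: B_def)
   show "amap B a (x +[space B (src a)] y) = amap B a x +[space B (tgt a)] amap B a y" using lin_maps_add[OF L x' y'] by (simp add: B_def)
  qed
 next
  fix v d x assume "x : sp B (tedge v d)"
  hence x: "x : carrier (space N (src (v, d)))" using lsubD(5)[OF LS[of "tedge v d"]] by (simp add: B_def)
  have "amap N (v, d) x : carrier (space N (src (v, clockwise d)))" using lin_maps_closed[OF LmodD(2)[OF LN(1)] x] by simp
  from am[OF this] have "amap B (v, clockwise d) (amap B (v, d) x) = prj (tgt (v, clockwise d)) (amap N (v, clockwise d) (amap N (v, d) x))"
   by (simp add: B_def)
  also have "\<dots> = prj (tgt (v, clockwise d)) (zero (space N (tgt (v, clockwise d))))" by (simp only: LmodD(3)[OF LN(1) x])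
  also have "\<dots> = (zero (space N (tgt (v, clockwise d))))"
   using lin_maps_zero[OF V[OF src_tgt_Q0(2)] V[OF src_tgt_Q0(2)] lin[OF src_tgt_Q0(2)]] by blast
  finally show "amap B (v, clockwise d) (amap B (v, d) x) = (zero (space B (tedge v (clockwise (clockwise d)))))" by (simp add: B_def)
 qed
 have fdB: "fin_dim B"
 proof -
  obtain S where S: "finite S" "!!e. e : Q0 - S ==> sp N e = {(zero (space N e))}" using LN(2) unfolding fin_dim_def by blast
  have "sp B e = {(zero (space B e))}" if "e : Q0 - S" for e using S(2)[OF that] lsubD(1,2)[OF LS[of e]] that by (auto simp: B_def)
  moreover have "\<exists>ph n. chart (space B e) ph n" if e: "e : Q0" for e
   using LN(2) chart_linear_subset[OF _ LS[OF e]] e unfolding fin_dim_def B_def by fastforce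
  ultimately show ?thesis unfolding fin_dim_def using S(1) by blast
 qed
 define p where "p = family N prj"
 have p: "p : mor FL N B"
  unfolding p_def
 proof (rule FL_morI[OF LN(1)])
  fix e assume e: "e : Q0"
  show "prj e : lin_maps (space N e) (space B e)" using lin[OF e] by (auto simp: lin_maps_def B_def)
 next
  fix a x assume "x : sp N (src a)"
  from am[OF this] show "prj (tgt a) (amap N a x) = amap B a (prj (src a) x)" by (simp add: B_def)
 qed
 have "is_cokernel FL M N f B p"
  unfolding is_cokernel_def
 proof (intro conjI ballI impI p)
  show "B : Obj FL" using B fdB FL_Obj_iff by blast
  show "Comp FL M N B p f = (zero (Hom FL M B))"
   unfolding FL_simps
  proof (rule family_cong)
   fix e x assume e: "e : Q0" and x: "x : sp M e"
   have "f e x : im_sub M f e" using e x by (simp add: im_sub_def)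
   thus "p e (f e x) = (zero (space B e))" using ker[OF e FL_closed[OF f e x]] FL_closed[OF f e x] e by (simp add: p_def B_def)
  qed
  fix W h assume W: "W : Obj FL" and h: "h : mor FL N W" "Comp FL M N W h f = (zero (Hom FL M W))"
  have LW: "is_Lambda_module W" using W FL_Obj_iff by blast
  have h0: "h e y = (zero (space W e))" if e: "e : Q0" and y: "y : im_sub M f e" for e y
  proof -
   obtain x where x: "x : sp M e" "y = f e x" using e y by (auto simp: im_sub_def)
   show ?thesis using FL_comp_apply[OF e x(1), of N W h f] FL_zero_apply[OF e x(1), of W] h(2) x by simp
  qed
  have hprj: "h e (prj e x) = h e x" if e: "e : Q0" and x: "x : sp N e" for e x
  proof -
   note l = FL_lin[OF h(1) e] and VW = LmodD(1)[OF LW e]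
   have "h e x +[space W e] (-1) *[space W e] h e (prj e x) = (zero (space W e))"
    using h0[OF e diff[OF e x]] lin_maps_add[OF l x vs_smult[OF V[OF e] cl[OF e x]]] lin_maps_smult[OF l cl[OF e x]] by simp
   thus ?thesis using vs_eq_iff_diff[OF VW lin_maps_closed[OF l x] lin_maps_closed[OF l cl[OF e x]]] by simp
  qed
  have BN: "x : sp N e" "\<exists>y. y : sp N e & x = prj e y" if "e : Q0" "x : sp B e" for e x
   using that lsubD(5)[OF LS[of e]] by (auto simp: B_def)
  show "\<exists>!u. u : mor FL B W & Comp FL N B W u p = h"
  proof (intro ex1I conjI)
   show u: "family B h : mor FL B W"
   proof (rule FL_morI[OF B])
    fix e assume e: "e : Q0"
    show "h e : lin_maps (space B e) (space W e)" using FL_lin[OF h(1) e] BN(1)[OF e] by (auto simp: lin_maps_def B_def)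
   next
    fix a x assume "x : sp B (src a)"
    hence x: "x : sp N (src a)" using BN(1) by simp
    show "h (tgt a) (amap B a x) = amap W a (h (src a) x)"
     using hprj[OF _ lin_maps_closed[OF LmodD(2)[OF LN(1)] x]] FL_nat[OF h(1) x] by (simp add: B_def)
   qed
   have "Comp FL N B W (family B h) p = family N h"
    unfolding FL_simps
   proof (rule family_cong)
    fix e x assume e: "e : Q0" and x: "x : sp N e"
    have "p e x : sp B e" using FL_closed[OF p e x] .
    thus "family B h e (p e x) = h e x" using hprj[OF e x] e x by (simp add: p_def)
   qed
   thus "Comp FL N B W (family B h) p = h" using FL_eq[OF h(1)] by simp
   fix u assume u': "u : mor FL B W & Comp FL N B W u p = h"
   show "u = family B h"
   proof (rule FL_ext)
    show "u : mor FL B W" "family B h : mor FL B W" using u u' by blast+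
    fix e x assume e: "e : Q0" and x: "x : sp B e"
    obtain y where y: "y : sp N e" "x = prj e y" using BN(2)[OF e x] by blast
    have "u e (p e y) = h e y" using FL_comp_apply[OF e y(1), of B W u p] u' by simp
    thus "u e x = family B h e x" using hprj[OF e y(1)] e x y by (simp add: p_def)
   qed
  qed
 qed
 moreover have "p e x = (zero (space B e)) \<longleftrightarrow> x : f e ` sp M e" if e: "e : Q0" and x: "x : sp N e" for e x
  using ker[OF e x] e x by (simp add: p_def B_def im_sub_def)
 ultimately show thesis using that by blast
qed

lemma FL_mono_inj:
 fixes M N :: "('k::field, 'u) quiver_rep"
 assumes M: "M : Obj FL" and N: "N : Obj FL" and f: "is_mono FL M N f" and e: "e : Q0"
 shows "inj_on (f e) (sp M e)"
proof -
 interpret klin_category "FL :: ('k, ('k, 'u) quiver_rep, qvertex => 'u => 'u) klin_cat" by (rule klin_category_FL)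
 have fm: "f : mor FL M N" using f by (simp add: is_mono_def)
 let ?K = "subrep M (ker_sub M N f)"
 let ?i = "family ?K (%e x. x)"
 have K: "is_kernel FL M N f ?K ?i" by (rule FL_kernel[OF M N fm])
 hence KO: "?K : Obj FL" and i: "?i : mor FL ?K M" and fi: "Comp FL ?K M N f ?i = (zero (Hom FL ?K N))" by (simp_all add: is_kernel_def)
 have iz: "?i = (zero (Hom FL ?K M))" using f KO i fi comp_zero_right[OF KO M N fm] zero_mor[OF KO M] unfolding is_mono_def by metis
 have z: "x = (zero (space M e))" if "x : ker_sub M N f e" for x
 proof -
  have "x = ?i e x" using that e by simp
  also have "\<dots> = (zero (Hom FL ?K M)) e x" by (simp only: iz)
  also have "\<dots> = (zero (space M e))" using FL_zero_apply[OF e, of x ?K M] that by simp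
  finally show ?thesis .
 qed
 note VM = LmodD(1)[OF FL_Obj[OF M] e] and VN = LmodD(1)[OF FL_Obj[OF N] e] and l = FL_lin[OF fm e]
 show ?thesis
 proof (rule inj_onI)
  fix x y assume x: "x : sp M e" and y: "y : sp M e" and eq: "f e x = f e y"
  have "f e (x +[space M e] (-1) *[space M e] y) = (zero (space N e))"
   using lin_maps_add[OF l x vs_smult[OF VM y]] lin_maps_smult[OF l y] eq vs_neg[OF VN lin_maps_closed[OF l y]] by simp
  hence "x +[space M e] (-1) *[space M e] y = (zero (space M e))" using z vs_add[OF VM x vs_smult[OF VM y]] e by (simp add: ker_sub_def)
  thus "x = y" using vs_eq_iff_diff[OF VM x y] by blast
 qed
qed

lemma FL_epi_surj:
 fixes M N :: "('k::field, 'u) quiver_rep"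
 assumes M: "M : Obj FL" and N: "N : Obj FL" and f: "is_epi FL M N f" and e: "e : Q0"
 shows "f e ` sp M e = sp N e"
proof -
 interpret klin_category "FL :: ('k, ('k, 'u) quiver_rep, qvertex => 'u => 'u) klin_cat" by (rule klin_category_FL)
 have fm: "f : mor FL M N" using f by (simp add: is_epi_def)
 obtain B p where cok: "is_cokernel FL M N f B p"
  and ker: "!!e x. e : Q0 ==> x : sp N e ==> p e x = (zero (space B e)) \<longleftrightarrow> x : f e ` sp M e"
  using FL_cokernel[OF M N fm] by metis
 hence B: "B : Obj FL" and p: "p : mor FL N B" and pf: "Comp FL M N B p f = (zero (Hom FL M B))" by (simp_all add: is_cokernel_def)
 have "p = (zero (Hom FL N B))" using f B p pf comp_zero_left[OF M N B fm] zero_mor[OF N B] unfolding is_epi_def by metis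
 hence "x : f e ` sp M e" if "x : sp N e" for x using ker[OF e that] FL_zero_apply[OF e that] by simp
 thus ?thesis using FL_closed[OF fm e] by blast
qed

text \<open>
 A monomorphism is injective, hence an isomorphism onto the kernel of its cokernel.
\<close>

lemma FL_mono_normal:
 fixes M N :: "('k::field, 'u) quiver_rep"
 assumes M: "M : Obj FL" and N: "N : Obj FL" and f: "is_mono FL M N f"
 shows "\<exists>Z\<in>Obj FL. \<exists>g\<in>mor FL N Z. is_kernel FL N Z g M f"
proof -
 have fm: "f : mor FL M N" using f by (simp add: is_mono_def)
 note inj = FL_mono_inj[OF M N f] and LM = FL_Obj[OF M]
 obtain B p where cok: "is_cokernel FL M N f B p"
  and ker: "!!e x. e : Q0 ==> x : sp N e ==> p e x = (zero (space B e)) \<longleftrightarrow> x : f e ` sp M e"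
  using FL_cokernel[OF M N fm] by metis
 hence B: "B : Obj FL" and p: "p : mor FL N B" and pf: "Comp FL M N B p f = (zero (Hom FL M B))" by (simp_all add: is_cokernel_def)
 have "is_kernel FL N B p M f"
  unfolding is_kernel_def
 proof (intro conjI ballI impI M fm pf)
  fix W h assume W: "W : Obj FL" and h: "h : mor FL W N" "Comp FL W N B p h = (zero (Hom FL W B))"
  note LW = FL_Obj[OF W]
  define u where "u e w = inv_into (sp M e) (f e) (h e w)" for e w
  have im: "h e w : f e ` sp M e" if e: "e : Q0" and w: "w : sp W e" for e w
   using ker[OF e FL_closed[OF h(1) e w]] FL_comp_apply[OF e w, of N B p h] FL_zero_apply[OF e w, of B] h(2) by simp
  have uM: "u e w : sp M e" and fu: "f e (u e w) = h e w" if "e : Q0" "w : sp W e" for e w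
   using im[OF that] by (auto simp: u_def intro: inv_into_into f_inv_into_f)
  have eqI: "x = y" if "e : Q0" "f e x = f e y" "x : sp M e" "y : sp M e" for e x y using inj_onD[OF inj[OF that(1)] that(2,3,4)] .
  show "\<exists>!u. u : mor FL W M & Comp FL W M N f u = h"
  proof (intro ex1I conjI)
   show um: "family W u : mor FL W M"
   proof (rule FL_morI[OF LW])
    fix e assume e: "e : Q0"
    note VW = LmodD(1)[OF LW e] and VM = LmodD(1)[OF LM e]
    show "u e : lin_maps (space W e) (space M e)"
    proof (rule lin_mapsI)
     fix x y assume x: "x : sp W e" and y: "y : sp W e"
     show "u e (x +[space W e] y) = u e x +[space M e] u e y"
     by (rule eqI[OF e]) (simp_all add: fu[OF e] uM[OF e] x y vs_add[OF VW] vs_add[OF VM]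
     lin_maps_add[OF FL_lin[OF fm e]] lin_maps_add[OF FL_lin[OF h(1) e]])
    next
     fix c x assume x: "x : sp W e"
     show "u e (c *[space W e] x) = c *[space M e] u e x" by (rule eqI[OF e]) (simp_all add: fu[OF e] uM[OF e] x vs_smult[OF VW] vs_smult[OF VM]
     lin_maps_smult[OF FL_lin[OF fm e]] lin_maps_smult[OF FL_lin[OF h(1) e]])
    qed (rule uM[OF e])
   next
    fix a x assume x: "x : sp W (src a)"
    note ax = lin_maps_closed[OF LmodD(2)[OF LW] x]
    note ux = uM[OF src_tgt_Q0(1) x]
    show "u (tgt a) (amap W a x) = amap M a (u (src a) x)"
     by (rule eqI[OF src_tgt_Q0(2)[of a] _ uM[OF src_tgt_Q0(2) ax] lin_maps_closed[OF LmodD(2)[OF LM] ux]])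
     (simp only: fu[OF src_tgt_Q0(2) ax] FL_nat[OF fm ux] fu[OF src_tgt_Q0(1) x] FL_nat[OF h(1) x])
   qed
   have "Comp FL W M N f (family W u) = family W h"
    unfolding FL_simps by (rule family_cong) (simp add: fu)
   thus "Comp FL W M N f (family W u) = h" using FL_eq[OF h(1)] by simp
   fix v assume v: "v : mor FL W M & Comp FL W M N f v = h"
   show "v = family W u"
   proof (rule FL_ext)
    show "v : mor FL W M" "family W u : mor FL W M" using v um by blast+
    fix e x assume e: "e : Q0" and x: "x : sp W e"
    have "f e (v e x) = f e (u e x)" using FL_comp_apply[OF e x, of M N f v] v fu[OF e x] by simp
    hence "v e x = u e x" using eqI[OF e _ FL_closed[OF conjunct1[OF v] e x] uM[OF e x]] by blast
    thus "v e x = family W u e x" using e x by simp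
   qed
  qed
 qed
 thus ?thesis using B p by blast
qed

lemma FL_epi_normal:
 fixes M N :: "('k::field, 'u) quiver_rep"
 assumes M: "M : Obj FL" and N: "N : Obj FL" and f: "is_epi FL M N f"
 shows "\<exists>Z\<in>Obj FL. \<exists>g\<in>mor FL Z M. is_cokernel FL Z M g N f"
proof -
 have fm: "f : mor FL M N" using f by (simp add: is_epi_def)
 note surj = FL_epi_surj[OF M N f] and LM = FL_Obj[OF M] and LN = FL_Obj[OF N]
 let ?K = "subrep M (ker_sub M N f)"
 let ?i = "family ?K (%e x. x)"
 have K: "is_kernel FL M N f ?K ?i" by (rule FL_kernel[OF M N fm])
 hence KO: "?K : Obj FL" and i: "?i : mor FL ?K M" and fi: "Comp FL ?K M N f ?i = (zero (Hom FL ?K N))" by (simp_all add: is_kernel_def)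
 have "is_cokernel FL ?K M ?i N f"
  unfolding is_cokernel_def
 proof (intro conjI ballI impI N fm fi)
  fix W h assume W: "W : Obj FL" and h: "h : mor FL M W" "Comp FL ?K M W h ?i = (zero (Hom FL ?K W))"
  note LW = FL_Obj[OF W]
  have h0: "h e x = (zero (space W e))" if e: "e : Q0" and x: "x : ker_sub M N f e" for e x
   using FL_comp_apply[OF e, of x ?K M W h ?i] FL_zero_apply[OF e, of x ?K W] h(2) e x by simp
  define u where "u e y = h e (inv_into (sp M e) (f e) y)" for e y
  have uf: "u e (f e x) = h e x" if e: "e : Q0" and x: "x : sp M e" for e x
  proof -
   note l = FL_lin[OF fm e] and VM = LmodD(1)[OF LM e] and VN = LmodD(1)[OF LN e]
    and lh = FL_lin[OF h(1) e] and VW = LmodD(1)[OF LW e]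
   define y where "y = inv_into (sp M e) (f e) (f e x)"
   have y: "y : sp M e" "f e y = f e x" using x by (auto simp: y_def intro: inv_into_into f_inv_into_f)
   have "f e (y +[space M e] (-1) *[space M e] x) = (zero (space N e))"
    using lin_maps_add[OF l y(1) vs_smult[OF VM x]] lin_maps_smult[OF l x] y(2) vs_neg[OF VN lin_maps_closed[OF l x]] by simp
   hence "y +[space M e] (-1) *[space M e] x : ker_sub M N f e" using vs_add[OF VM y(1) vs_smult[OF VM x]] e by (simp add: ker_sub_def)
   from h0[OF e this] have "h e y +[space W e] (-1) *[space W e] h e x = (zero (space W e))"
    using lin_maps_add[OF lh y(1) vs_smult[OF VM x]] lin_maps_smult[OF lh x] by simp
   thus ?thesis using vs_eq_iff_diff[OF VW lin_maps_closed[OF lh y(1)] lin_maps_closed[OF lh x]] by (simp add: u_def y_def)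
  qed
  have pre: "\<exists>x. x : sp M e & y = f e x" if "e : Q0" "y : sp N e" for e y using surj[OF that(1)] that(2) by blast
  show "\<exists>!u. u : mor FL N W & Comp FL M N W u f = h"
  proof (intro ex1I conjI)
   show um: "family N u : mor FL N W"
   proof (rule FL_morI[OF LN])
    fix e assume e: "e : Q0"
    note l = FL_lin[OF fm e] and VM = LmodD(1)[OF LM e] and lh = FL_lin[OF h(1) e]
    show "u e : lin_maps (space N e) (space W e)"
    proof (rule lin_mapsI)
     fix c y assume "y : sp N e"
     then obtain x where x: "x : sp M e" "y = f e x" using pre[OF e] by blast
     show "u e y : sp W e" using uf[OF e x(1)] x lin_maps_closed[OF lh x(1)] by simp
     show "u e (c *[space N e] y) = c *[space W e] u e y"
     using uf[OF e vs_smult[OF VM x(1)]] uf[OF e x(1)] lin_maps_smult[OF l x(1)] lin_maps_smult[OF lh x(1)] x(2) by simp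
     fix z assume "z : sp N e"
     then obtain w where w: "w : sp M e" "z = f e w" using pre[OF e] by blast
     show "u e (y +[space N e] z) = u e y +[space W e] u e z"
     using uf[OF e vs_add[OF VM x(1) w(1)]] uf[OF e x(1)] uf[OF e w(1)] lin_maps_add[OF l x(1) w(1)]
     lin_maps_add[OF lh x(1) w(1)] x(2) w(2) by simp
    qed
   next
    fix a y assume "y : sp N (src a)"
    then obtain x where x: "x : sp M (src a)" "y = f (src a) x" using pre[OF src_tgt_Q0(1)] by blast
    show "u (tgt a) (amap N a y) = amap W a (u (src a) y)"
     unfolding x(2) uf[OF src_tgt_Q0(1) x(1)] FL_nat[OF fm x(1), symmetric] FL_nat[OF h(1) x(1), symmetric]
     by (rule uf[OF src_tgt_Q0(2) lin_maps_closed[OF LmodD(2)[OF LM] x(1)]])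
   qed
   have "Comp FL M N W (family N u) f = family M h"
    unfolding FL_simps by (rule family_cong) (simp add: uf FL_closed[OF fm])
   thus "Comp FL M N W (family N u) f = h" using FL_eq[OF h(1)] by simp
   fix v assume v: "v : mor FL N W & Comp FL M N W v f = h"
   show "v = family N u"
   proof (rule FL_ext)
    show "v : mor FL N W" "family N u : mor FL N W" using v um by blast+
    fix e y assume e: "e : Q0" and y: "y : sp N e"
    then obtain x where x: "x : sp M e" "y = f e x" using pre[OF e] by blast
    show "v e y = family N u e y" using FL_comp_apply[OF e x(1), of N W v f] v uf[OF e x(1)] e y x by simp
   qed
  qed
 qed
 thus ?thesis using KO i by blast
qed

section \<open>String modules\<close>

definition act :: "dpoint => dpoint => qvertex set" where
 "act p q = (if homC p q then common (lft p) (turn (deg p q) (lft q)) else {})"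

lemma act_refl: "chord (lft p) ==> act p p = cr (lft p)" using homC_refl[of p] deg_refl[of p] by (simp add: act_def common_def cr_def)

lemma act_subset: "e : act p q ==> e : cr (lft p) & e : cr (lft q) & homC p q"
 using common_subset[of "lft p" "turn (deg p q) (lft q)"] by (auto simp: act_def split: if_splits)

lemma act_arrow:
 assumes "homC p q" "src a : cr (lft p)"
 shows "src a : act p q & tgt a : cr (lft q) \<longleftrightarrow> tgt a : act p q"
 using common_arrow[OF homC_deg[OF assms(1)] assms(2)] assms(1) by (simp add: act_def del: src.simps tgt.simps)

text \<open>
 Sides crossed by the three chords \<open>p\<close>, \<open>q\<close>, \<open>r\<close> during a rotation are those crossed by \<open>p\<close> and \<open>r\<close>; if
 the composite of the basic morphisms is zero there are none.
\<close>

lemma act_comp: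
 assumes pq: "homC p q" and qr: "homC q r"
 shows "e : act p q & e : act q r \<longleftrightarrow> compC p q r & e : act p r"
proof -
 define x where "x = lft p"
 define y where "y = turn (deg p q) (lft q)"
 define z where "z = turn (deg p q + deg q r) (lft r)"
 have 1: "lift_hom x y" using homC_deg[OF pq] by (simp add: x_def y_def)
 have 2: "lift_hom y z" using homC_deg[OF qr] lift_hom_turn[of "deg p q" "lft q" "turn (deg q r) (lft r)"] by (simp add: y_def z_def)
 have a: "e : act p q \<longleftrightarrow> e : common x y" using pq by (simp add: act_def x_def y_def)
 have "common y z = common (lft q) (turn (deg q r) (lft r))"
  using common_turn[of "deg p q" "lft q" "turn (deg q r) (lft r)"] by (simp add: y_def z_def)
 hence b: "e : act q r \<longleftrightarrow> e : common y z" using qr by (simp add: act_def)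
 have c: "compC p q r \<longleftrightarrow> lift_hom x z" by (simp add: compC_def x_def z_def)
 have d: "e : act p r \<longleftrightarrow> e : common x z" if "lift_hom x z"
  using that homC_iff[of p "deg p q + deg q r" r] by (simp add: act_def x_def z_def)
 show ?thesis
 proof
  assume "e : act p q & e : act q r"
  hence e: "e : common x y" "e : common y z" using a b by auto
  then obtain l where l: "l : lifts e" "crosses x l" "crosses y l" unfolding common_def by blast
  hence "crosses z l" using common_iff[OF l(1,3)] e by blast
  moreover from this have "lift_hom x z" using 1 2 l unfolding lift_hom_def crosses_def by linarith
  ultimately show "compC p q r & e : act p r" using c d l commonI by blast
 next
  assume *: "compC p q r & e : act p r"
  hence xz: "lift_hom x z" "e : common x z" using c d by auto
  then obtain l where l: "l : lifts e" "crosses x l" "crosses z l" unfolding common_def by blast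
  hence "crosses y l" using 1 2 unfolding lift_hom_def crosses_def by linarith
  thus "e : act p q & e : act q r" using a b l commonI by blast
 qed
qed

locale list_encoding =
 fixes \<iota> :: "'k::field list => 'u"
 assumes inj: "inj \<iota>"
begin

definition vec :: "nat => (nat => 'k) => 'u" where
 "vec n f = \<iota> (map f (upt 0 n))"

definition coord :: "'u => nat => 'k" where
 "coord x i = (if i < length (inv_into UNIV \<iota> x) then inv_into UNIV \<iota> x ! i else 0)"

lemma coord_vec: "coord (vec n f) i = (if i < n then f i else 0)" by (simp add: coord_def vec_def inv_f_f[OF inj])

lemma vec_cong: "(!!i. i < n ==> f i = g i) ==> vec n f = vec n g" by (auto simp: vec_def intro!: arg_cong[of _ _ \<iota>])

definition coords_at :: "dpoint list => qvertex => (nat => 'k) set" where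
 "coords_at X e = {f. \<forall>i. f i ~= 0 --> i < length X & e : cr (lft (X ! i))}"

text \<open>
 The direct sum of the string modules of the chords in \<open>X\<close>: the space at \<open>e\<close> has one basis vector
 for each chord of \<open>X\<close> that crosses \<open>e\<close>, and an arrow keeps the basis vectors that survive.
\<close>

definition strep :: "dpoint list => ('k, 'u) quiver_rep" where
 "strep X = \<lparr>space = (%e. \<lparr>carrier = vec (length X) ` coords_at X e, mult = undefined, one = undefined,
   zero = vec (length X) (%i. 0), add = (%x y. vec (length X) (%i. coord x i + coord y i)),
   smult = (%c x. vec (length X) (%i. c * coord x i))\<rparr>),
  amap = (%a x. vec (length X) (%i. if tgt a : cr (lft (X ! i)) then coord x i else 0))\<rparr>"

lemma string_rep_simps [simp]:
 "sp (strep X) e = vec (length X) ` coords_at X e"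
 "(zero (space (strep X) e)) = vec (length X) (%i. 0)"
 "x +[space (strep X) e] y = vec (length X) (%i. coord x i + coord y i)"
 "c *[space (strep X) e] x = vec (length X) (%i. c * coord x i)"
 "amap (strep X) a x = vec (length X) (%i. if tgt a : cr (lft (X ! i)) then coord x i else 0)" by (simp_all add: strep_def)

lemma coords_atD: "f : coords_at X e ==> f i ~= 0 ==> i < length X & e : cr (lft (X ! i))" by (auto simp: coords_at_def)

lemma coord_vec_at: "f : coords_at X e ==> coord (vec (length X) f) = f" using coords_atD[of f X e] by (fastforce simp: coord_vec fun_eq_iff)

lemma carrier_string: "x : vec (length X) ` coords_at X e \<longleftrightarrow> coord x : coords_at X e & vec (length X) (coord x) = x"
 using coord_vec_at by (metis (no_types, lifting) image_iff)

lemma coords_at_closed: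
 "(%i. 0) : coords_at X e" "f : coords_at X e ==> g : coords_at X e ==> (%i. f i + g i) : coords_at X e"
 "f : coords_at X e ==> (%i. c * f i) : coords_at X e"
proof -
 show "(%i. 0) : coords_at X e" by (simp add: coords_at_def)
 show "(%i. c * f i) : coords_at X e" if "f : coords_at X e" using that by (auto simp: coords_at_def)
 show "(%i. f i + g i) : coords_at X e" if "f : coords_at X e" "g : coords_at X e"
 proof -
  have "f i ~= 0 | g i ~= 0" if "f i + g i ~= 0" for i using that by auto
  thus ?thesis using that unfolding coords_at_def by blast
 qed
qed

lemma mask_closed: "f : coords_at X e ==> (%i. if d : cr (lft (X ! i)) then f i else 0) : coords_at X d" by (auto simp: coords_at_def)

lemma string_chart: "chart (space (strep X) e) coord (length X)"
 unfolding chart_def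
proof (intro conjI ballI allI impI)
 show "inj_on coord (sp (strep X) e)" by (rule inj_onI) (metis carrier_string string_rep_simps(1))
 fix x assume "x : sp (strep X) e"
 hence x: "coord x : coords_at X e" by (simp add: carrier_string)
 show "coord (c *[space (strep X) e] x) = (%i. c * coord x i)" for c using coord_vec_at[OF coords_at_closed(3)[OF x]] by simp
 show "coord x i = 0" if "length X <= i" for i using coords_atD[OF x, of i] that by auto
 fix y assume "y : sp (strep X) e"
 hence y: "coord y : coords_at X e" by (simp add: carrier_string)
 show "coord (x +[space (strep X) e] y) = (%i. coord x i + coord y i)" using coord_vec_at[OF coords_at_closed(2)[OF x y]] by simp
qed

lemma string_vs: "Module.module class_ring (space (strep X) e)"
proof (rule vs_chart[where ph = coord])
 note c = string_chart[of X e, unfolded chart_def]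
 show "inj_on coord (sp (strep X) e)" using c by blast
 show "(zero (space (strep X) e)) : sp (strep X) e" using coords_at_closed(1) by simp
 show "coord (zero (space (strep X) e)) = (%i. 0)" using coord_vec_at[OF coords_at_closed(1)] by simp
 fix x assume x: "x : sp (strep X) e"
 show "coord (c *[space (strep X) e] x) = (%i. c * coord x i)" for c using c x by blast
 show "c *[space (strep X) e] x : sp (strep X) e" for c using x coords_at_closed(3) by (simp add: carrier_string[of x])
 fix y assume y: "y : sp (strep X) e"
 show "coord (x +[space (strep X) e] y) = (%i. coord x i + coord y i)" using c x y by blast
 show "x +[space (strep X) e] y : sp (strep X) e" using x y coords_at_closed(2) by (simp add: carrier_string[of x] carrier_string[of y])
qed

lemma string_Lambda_module: "is_Lambda_module (strep X)"
 unfolding is_Lambda_module_def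
proof (intro conjI ballI allI)
 show "Module.module class_ring (space (strep X) e)" for e by (rule string_vs)
 show "amap (strep X) a : lin_maps (space (strep X) (src a)) (space (strep X) (tgt a))" for a
 proof (rule lin_mapsI)
  fix x assume x: "x : sp (strep X) (src a)"
  hence cx: "coord x : coords_at X (src a)" by (simp add: carrier_string)
  show "amap (strep X) a x : sp (strep X) (tgt a)" using mask_closed[OF cx] by simp
  show "amap (strep X) a (c *[space (strep X) (src a)] x) = c *[space (strep X) (tgt a)] amap (strep X) a x" for c
   by (simp add: coord_vec, intro vec_cong) (simp add: coord_vec)
  fix y
  show "amap (strep X) a (x +[space (strep X) (src a)] y) =
   amap (strep X) a x +[space (strep X) (tgt a)] amap (strep X) a y" by (simp add: coord_vec, intro vec_cong) (simp add: coord_vec)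
 qed
 fix v d x assume "x : sp (strep X) (tedge v d)"
 hence x: "coord x : coords_at X (tedge v d)" by (simp add: carrier_string)
 have "tedge v (clockwise d) : cr (lft (X ! i)) --> tedge v (clockwise (clockwise d)) : cr (lft (X ! i)) --> coord x i = 0"
  if "i < length X" for i using not_three_sides[of "(v, d)" "lft (X ! i)"] coords_atD[OF x, of i] by auto
 thus "amap (strep X) (v, clockwise d) (amap (strep X) (v, d) x) =
   (zero (space (strep X) (tedge v (clockwise (clockwise d)))))" by (simp add: coord_vec, intro vec_cong) (simp add: coord_vec)
qed

lemma string_fin_dim:
 assumes "!!d. d : set X ==> dyadic_lift (lft d)"
 shows "fin_dim (strep X)"
 unfolding fin_dim_def
proof (intro conjI ballI)
 show "\<exists>ph n. chart (space (strep X) e) ph n" for e using string_chart by blast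
 let ?S = "\<Union>d\<in>set X. cr (lft d)"
 have "finite (cr (lft d))" if "d : set X" for d using finite_cr[of "fst (lft d)" "snd (lft d)"] assms[OF that] by (simp add: dyadic_lift_def)
 hence "finite ?S" by simp
 moreover have "sp (strep X) e = {(zero (space (strep X) e))}" if "e : Q0 - ?S" for e
 proof -
  have "coords_at X e = {%i. 0}" using that nth_mem by (fastforce simp: coords_at_def fun_eq_iff)
  thus ?thesis by simp
 qed
 ultimately show "\<exists>S. finite S & (\<forall>e\<in>Q0 - S. sp (strep X) e = {(zero (space (strep X) e))})" by blast
qed

definition string_map :: "dpoint list => dpoint list => (nat \<times> nat => 'k) => qvertex => 'u => 'u" where
 "string_map X Y c = family (strep X)
   (%e x. vec (length Y) (%j. \<Sum>i<length X. if e : act (X ! i) (Y ! j) then c (j, i) * coord x i else 0))"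

lemma string_map_coords:
 "f : coords_at X e ==> (%j. if j < length Y then \<Sum>i<length X. if e : act (X ! i) (Y ! j) then c (j, i) * f i else 0 else 0) : coords_at Y e"
 unfolding coords_at_def
proof (intro CollectI allI impI)
 fix j assume nz: "(if j < length Y then \<Sum>i<length X. if e : act (X ! i) (Y ! j) then c (j, i) * f i else 0 else 0) ~= 0"
 hence j: "j < length Y" by (auto split: if_splits)
 obtain i where "(if e : act (X ! i) (Y ! j) then c (j, i) * f i else 0) ~= 0"
  using nz j sum.not_neutral_contains_not_neutral[of _ "{..<length X}"] by auto
 hence "e : act (X ! i) (Y ! j)" by (auto split: if_splits)
 thus "j < length Y & e : cr (lft (Y ! j))" using act_subset j by blast
qed

lemma vec_restrict: "vec n (%i. if i < n then f i else 0) = vec n f" by (rule vec_cong) simp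

lemma string_map_mor:
 assumes c: "c : supp_mats homC X Y"
 shows "string_map X Y c : mor FL (strep X) (strep Y)"
 unfolding string_map_def
proof (rule FL_morI[OF string_Lambda_module])
 fix e assume e: "e : Q0"
 let ?h = "%x. vec (length Y) (%j. \<Sum>i<length X. if e : act (X ! i) (Y ! j) then c (j, i) * coord x i else 0)"
 show "?h : lin_maps (space (strep X) e) (space (strep Y) e)"
 proof (rule lin_mapsI)
  fix x assume x: "x : sp (strep X) e"
  hence cx: "coord x : coords_at X e" by (simp add: carrier_string)
  show "?h x : sp (strep Y) e" using imageI[OF string_map_coords[OF cx, of Y c], of "vec (length Y)"] by (simp add: vec_restrict)
  show "?h (k *[space (strep X) e] x) = k *[space (strep Y) e] ?h x" for k
   unfolding string_rep_simps by (rule vec_cong) (simp add: coord_vec sum_distrib_left, rule sum.cong, simp_all add: coord_vec)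
  fix y
  show "?h (x +[space (strep X) e] y) = ?h x +[space (strep Y) e] ?h y"
   unfolding string_rep_simps
   by (rule vec_cong, simp add: coord_vec, rule trans[OF sum.cong[OF refl] sum.distrib], simp add: coord_vec distrib_left)
 qed
next
 fix a x assume "x : sp (strep X) (src a)"
 hence x: "coord x : coords_at X (src a)" by (simp add: carrier_string)
 have t: "(if tgt a : act (X ! i) (Y ! j) then c (j, i) * (if tgt a : cr (lft (X ! i)) then coord x i else 0) else 0) =
  (if tgt a : cr (lft (Y ! j)) then if src a : act (X ! i) (Y ! j) then c (j, i) * coord x i else 0 else 0)" for i j
 proof (cases "c (j, i) = 0 | coord x i = 0")
  case False
  hence "homC (X ! i) (Y ! j)" "src a : cr (lft (X ! i))" using supp_matsD[OF c, of j i] coords_atD[OF x, of i] by auto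
  from act_arrow[OF this] show ?thesis using act_subset[of "tgt a" "X ! i" "Y ! j"] by (auto simp del: src.simps tgt.simps)
 next
  case True
  thus ?thesis by auto
 qed
 have "(\<Sum>i<length X. if tgt a : act (X ! i) (Y ! j) then c (j, i) * coord (amap (strep X) a x) i else 0) =
  (if tgt a : cr (lft (Y ! j)) then \<Sum>i<length X. if src a : act (X ! i) (Y ! j) then c (j, i) * coord x i else 0 else 0)" for j
 proof -
  have "(\<Sum>i<length X. if tgt a : act (X ! i) (Y ! j) then c (j, i) * coord (amap (strep X) a x) i else 0) =
   (\<Sum>i<length X. if tgt a : cr (lft (Y ! j)) then if src a : act (X ! i) (Y ! j) then c (j, i) * coord x i else 0 else 0)"
  proof (intro sum.cong refl)
   fix i assume "i : {..<length X}"
   hence "coord (amap (strep X) a x) i = (if tgt a : cr (lft (X ! i)) then coord x i else 0)" by (simp add: coord_vec)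
   thus "(if tgt a : act (X ! i) (Y ! j) then c (j, i) * coord (amap (strep X) a x) i else 0) =
    (if tgt a : cr (lft (Y ! j)) then if src a : act (X ! i) (Y ! j) then c (j, i) * coord x i else 0 else 0)" using t[of i j] by presburger
  qed
  also have "\<dots> = (if tgt a : cr (lft (Y ! j)) then \<Sum>i<length X. if src a : act (X ! i) (Y ! j) then c (j, i) * coord x i else 0 else 0)"
   by simp
  finally show ?thesis .
 qed
 thus "vec (length Y) (%j. \<Sum>i<length X. if tgt a : act (X ! i) (Y ! j) then c (j, i) * coord (amap (strep X) a x) i else 0) =
  amap (strep Y) a (vec (length Y) (%j. \<Sum>i<length X. if src a : act (X ! i) (Y ! j) then c (j, i) * coord x i else 0))"
  unfolding string_rep_simps(5)[of Y] by (intro vec_cong) (simp add: coord_vec)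
qed

lemma string_map_apply:
 "e : Q0 ==> x : sp (strep X) e ==> string_map X Y c e x =
  vec (length Y) (%j. \<Sum>i<length X. if e : act (X ! i) (Y ! j) then c (j, i) * coord x i else 0)" by (simp add: string_map_def)

lemma string_map_comp:
 assumes f: "f : supp_mats homC X Y" and g: "g : supp_mats homC Y Z"
 shows "string_map X Z (mat_comp compC X Y Z g f) = Comp FL (strep X) (strep Y) (strep Z) (string_map Y Z g) (string_map X Y f)"
proof -
 have c: "mat_comp compC X Y Z g f : supp_mats homC X Z" by (rule mat_relation.mat_comp_supp[OF mat_relation_C f g])
 show ?thesis
 proof (rule FL_ext[OF string_map_mor[OF c]])
  show "Comp FL (strep X) (strep Y) (strep Z) (string_map Y Z g) (string_map X Y f) : mor FL (strep X) (strep Z)"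
   unfolding FL_simps by (rule FL_comp_mor[OF string_Lambda_module string_map_mor[OF f] string_map_mor[OF g]])
  fix e x assume e: "e : Q0" and x: "x : sp (strep X) e"
  note fx = FL_closed[OF string_map_mor[OF f] e x]
  have "Comp FL (strep X) (strep Y) (strep Z) (string_map Y Z g) (string_map X Y f) e x =
   vec (length Z) (%l. \<Sum>j<length Y. if e : act (Y ! j) (Z ! l) then g (l, j) * coord (string_map X Y f e x) j else 0)"
   unfolding FL_simps using string_map_apply[OF e fx, of Z g] e x by simp
  also have "\<dots> = vec (length Z) (%l. \<Sum>i<length X. if e : act (X ! i) (Z ! l) then mat_comp compC X Y Z g f (l, i) * coord x i else 0)"
  proof (rule vec_cong)
   fix l assume l: "l < length Z"
   have "(\<Sum>j<length Y. if e : act (Y ! j) (Z ! l) then g (l, j) * coord (string_map X Y f e x) j else 0) =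
    (\<Sum>j<length Y. \<Sum>i<length X. if e : act (Y ! j) (Z ! l) & e : act (X ! i) (Y ! j) then g (l, j) * f (j, i) * coord x i else 0)"
    by (auto simp: string_map_apply[OF e x] coord_vec sum_distrib_left mult.assoc intro!: sum.cong)
   also have "\<dots> = (\<Sum>j<length Y. \<Sum>i<length X. if compC (X ! i) (Y ! j) (Z ! l) & e : act (X ! i) (Z ! l) then g (l, j) * f (j, i) * coord x i else 0)"
   proof (intro sum.cong refl)
    fix j i
    show "(if e : act (Y ! j) (Z ! l) & e : act (X ! i) (Y ! j) then g (l, j) * f (j, i) * coord x i else 0) =
     (if compC (X ! i) (Y ! j) (Z ! l) & e : act (X ! i) (Z ! l) then g (l, j) * f (j, i) * coord x i else 0)"
    proof (cases "g (l, j) * f (j, i) = 0")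
     case False
     hence "homC (X ! i) (Y ! j)" "homC (Y ! j) (Z ! l)" using supp_matsD[OF f, of j i] supp_matsD[OF g, of l j] by auto
     from act_comp[OF this, of e] show ?thesis by auto
    qed auto
   qed
   also have "\<dots> = (\<Sum>i<length X. \<Sum>j<length Y. if compC (X ! i) (Y ! j) (Z ! l) & e : act (X ! i) (Z ! l) then g (l, j) * f (j, i) * coord x i else 0)"
    by (rule sum.swap)
   also have "\<dots> = (\<Sum>i<length X. if e : act (X ! i) (Z ! l) then mat_comp compC X Y Z g f (l, i) * coord x i else 0)"
    using l by (auto simp: mat_comp_def sum_distrib_right intro!: sum.cong)
   finally show "(\<Sum>j<length Y. if e : act (Y ! j) (Z ! l) then g (l, j) * coord (string_map X Y f e x) j else 0) =
    (\<Sum>i<length X. if e : act (X ! i) (Z ! l) then mat_comp compC X Y Z g f (l, i) * coord x i else 0)" .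
  qed
  finally show "string_map X Z (mat_comp compC X Y Z g f) e x =
   Comp FL (strep X) (strep Y) (strep Z) (string_map Y Z g) (string_map X Y f) e x" using string_map_apply[OF e x] by simp
 qed
qed

definition basis_vec :: "dpoint list => nat => 'u" where
 "basis_vec X i = vec (length X) (%k. if k = i then 1 else 0)"

lemma basis_vec_carrier: "i < length X ==> e : cr (lft (X ! i)) ==> basis_vec X i : sp (strep X) e" by (auto simp: basis_vec_def coords_at_def)

lemma coord_basis_vec: "coord (basis_vec X i) k = (if k = i & i < length X then 1 else 0)" by (auto simp: basis_vec_def coord_vec)

lemma mor_expand:
 assumes h: "h : mor FL (strep X) (strep Y)" and e: "e : Q0" and x: "x : sp (strep X) e"
 shows "coord (h e x) j = (\<Sum>i<length X. if e : cr (lft (X ! i)) then coord x i * coord (h e (basis_vec X i)) j else 0)"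
proof -
 note l = FL_lin[OF h e] and c = string_chart[of Y e, unfolded chart_def]
 have cadd: "coord (h e (y +[space (strep X) e] z)) j = coord (h e y) j + coord (h e z) j"
  if "y : sp (strep X) e" "z : sp (strep X) e" for y z
  using lin_maps_add[OF l that] lin_maps_closed[OF l that(1)] lin_maps_closed[OF l that(2)] c by (metis (no_types, lifting))
 have csm: "coord (h e (k *[space (strep X) e] y)) j = k * coord (h e y) j"
  if "y : sp (strep X) e" for k y using lin_maps_smult[OF l that] lin_maps_closed[OF l that] c by (metis (no_types, lifting))
 have fx: "coord x : coords_at X e" "vec (length X) (coord x) = x" using x by (simp_all add: carrier_string)
 define p where "p m = vec (length X) (%i. if i < m then coord x i else 0)" for m
 have pc: "p m : sp (strep X) e" for m using coords_atD[OF fx(1)] by (auto simp: p_def coords_at_def)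
 have "coord (h e (p m)) j = (\<Sum>i<m. if e : cr (lft (X ! i)) then coord x i * coord (h e (basis_vec X i)) j else 0)" if "m <= length X" for m
  using that
 proof (induction m)
  case 0
  have "p 0 = 0 *[space (strep X) e] p 0" by (simp add: p_def coord_vec cong: if_cong)
  hence "coord (h e (p 0)) j = 0" using csm[OF pc, of 0 0] by simp
  thus ?case by simp
 next
  case (Suc m)
  show ?case
  proof (cases "coord x m = 0")
   case True
   hence "p (Suc m) = p m" by (auto simp: p_def less_Suc_eq intro!: vec_cong)
   thus ?thesis using Suc True by simp
  next
   case False
   hence em: "e : cr (lft (X ! m))" "m < length X" using coords_atD[OF fx(1)] by blast+
   note b = basis_vec_carrier[OF em(2,1)]
   have "p (Suc m) = p m +[space (strep X) e] (coord x m *[space (strep X) e] basis_vec X m)"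
    unfolding string_rep_simps p_def by (rule vec_cong) (auto simp: coord_vec coord_basis_vec less_Suc_eq em)
   hence "coord (h e (p (Suc m))) j = coord (h e (p m)) j + coord x m * coord (h e (basis_vec X m)) j"
    using cadd[OF pc[of m] vs_smult[OF string_vs b]] csm[OF b] by simp
   thus ?thesis using Suc em by simp
  qed
 qed
 from this[of "length X"] have "coord (h e (p (length X))) j = (\<Sum>i<length X. if e : cr (lft (X ! i)) then coord x i * coord (h e (basis_vec X i)) j else 0)" by simp
 moreover have "p (length X) = x" unfolding p_def vec_restrict fx(2) ..
 ultimately show ?thesis by simp
qed

text \<open>Each matrix entry of a homomorphism between sums of string modules is a single scalar.\<close>

lemma string_map_full:
 assumes h: "h : mor FL (strep X) (strep Y)" and dy: "!!d. d : set X ==> dyadic_lift (lft d)"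
 shows "\<exists>c \<in> supp_mats homC X Y. string_map X Y c = h"
proof -
 define ps where "ps j i e = (if e : cr (lft (X ! i)) then coord (h e (basis_vec X i)) j else 0)" for j i e
 have ex: "\<exists>c. (c ~= 0 --> homC (X ! i) (Y ! j)) & (\<forall>e. ps j i e = (if e : act (X ! i) (Y ! j) then c else 0))"
  if i: "i < length X" and j: "j < length Y" for i j
 proof -
  have sm: "string_entry (lft (X ! i)) (lft (Y ! j)) (ps j i)"
  proof
   show "finite (cr (lft (X ! i)))" using finite_cr[of "fst (lft (X ! i))" "snd (lft (X ! i))"] dy[of "X ! i"] i by (simp add: dyadic_lift_def)
   show "e : cr (lft (X ! i)) & e : cr (lft (Y ! j))" if "ps j i e ~= 0" for e
   proof -
    have ei: "e : cr (lft (X ! i))" and nz: "coord (h e (basis_vec X i)) j ~= 0" using that by (auto simp: ps_def split: if_splits)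
    hence e: "e : Q0" using cr_Q0 by blast
    have "h e (basis_vec X i) : sp (strep Y) e" by (rule FL_closed[OF h e basis_vec_carrier[OF i ei]])
    hence "coord (h e (basis_vec X i)) : coords_at Y e" by (simp add: carrier_string)
    from coords_atD[OF this, of j] show ?thesis using nz ei by simp
   qed
   fix a assume sa: "src a : cr (lft (X ! i))"
   note b = basis_vec_carrier[OF i sa]
   have nat: "h (tgt a) (amap (strep X) a (basis_vec X i)) = amap (strep Y) a (h (src a) (basis_vec X i))" by (rule FL_nat[OF h b])
   have r: "coord (amap (strep Y) a (h (src a) (basis_vec X i))) j = (if tgt a : cr (lft (Y ! j)) then ps j i (src a) else 0)"
    using j sa by (simp add: coord_vec ps_def)
   have l: "coord (h (tgt a) (amap (strep X) a (basis_vec X i))) j = (if tgt a : cr (lft (X ! i)) then ps j i (tgt a) else 0)"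
   proof (cases "tgt a : cr (lft (X ! i))")
    case True
    hence "amap (strep X) a (basis_vec X i) = basis_vec X i"
     unfolding string_rep_simps basis_vec_def by (intro vec_cong) (simp add: coord_vec)
    thus ?thesis using True by (simp add: ps_def)
   next
    case False
    have "amap (strep X) a (basis_vec X i) = (zero (space (strep X) (tgt a)))"
     unfolding string_rep_simps by (rule vec_cong) (use False in \<open>auto simp: coord_basis_vec\<close>)
    hence "h (tgt a) (amap (strep X) a (basis_vec X i)) = (zero (space (strep Y) (tgt a)))"
     using lin_maps_zero[OF string_vs string_vs FL_lin[OF h src_tgt_Q0(2)]] by simp
    thus ?thesis using False by (simp add: coord_vec)
   qed
   show "(if tgt a : cr (lft (Y ! j)) then ps j i (src a) else 0) = (if tgt a : cr (lft (X ! i)) then ps j i (tgt a) else 0)" using nat l r by simp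
  qed
  show ?thesis
  proof (cases "\<forall>e. ps j i e = 0")
   case True
   thus ?thesis by (intro exI[of _ 0]) simp
  next
   case False
   then obtain e where e: "ps j i e ~= 0" by blast
   obtain k where k: "lift_hom (lft (X ! i)) (turn k (lft (Y ! j))) &
    (\<forall>f. ps j i f = (if f : common (lft (X ! i)) (turn k (lft (Y ! j))) then ps j i e else 0))"
    using string_entry.classification[OF sm e] by (rule exE)
   hence "homC (X ! i) (Y ! j)" "act (X ! i) (Y ! j) = common (lft (X ! i)) (turn k (lft (Y ! j)))"
    using homC_iff[of "X ! i" k "Y ! j"] by (simp_all only: act_def if_True)
   thus ?thesis using conjunct2[OF k] by (metis (no_types))
  qed
 qed
 define c0 where "c0 j i = (SOME c. (c ~= 0 --> homC (X ! i) (Y ! j)) & (\<forall>e. ps j i e = (if e : act (X ! i) (Y ! j) then c else 0)))" for j i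
 have c0: "c0 j i ~= 0 --> homC (X ! i) (Y ! j)" "!!e. ps j i e = (if e : act (X ! i) (Y ! j) then c0 j i else 0)"
  if "i < length X" "j < length Y" for i j using someI_ex[OF ex[OF that]] unfolding c0_def by blast+
 define c where "c = (%(j, i). if j < length Y & i < length X then c0 j i else 0)"
 have c: "c : supp_mats homC X Y" using c0(1) by (auto simp: c_def supp_mats_def split: if_splits)
 have "string_map X Y c = h"
 proof (rule FL_ext[OF string_map_mor[OF c] h])
  fix e x assume e: "e : Q0" and x: "x : sp (strep X) e"
  have hx: "h e x = vec (length Y) (coord (h e x))" using FL_closed[OF h e x] by (simp add: carrier_string)
  have "string_map X Y c e x = vec (length Y) (coord (h e x))"
   unfolding string_map_apply[OF e x]
  proof (rule vec_cong)
   fix j assume j: "j < length Y"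
   have "(if e : act (X ! i) (Y ! j) then c (j, i) * coord x i else 0) =
    (if e : cr (lft (X ! i)) then coord x i * coord (h e (basis_vec X i)) j else 0)" if i: "i < length X" for i
    using c0(2)[OF i j, of e] i j by (auto simp: c_def ps_def split: if_splits)
   thus "(\<Sum>i<length X. if e : act (X ! i) (Y ! j) then c (j, i) * coord x i else 0) = coord (h e x) j"
    unfolding mor_expand[OF h e x] by (intro sum.cong) auto
  qed
  thus "string_map X Y c e x = h e x" by (rule trans[OF _ hx[symmetric]])
 qed
 thus ?thesis using c by blast
qed

lemma string_map_eq_zero:
 assumes c: "c : supp_mats homC X Y" and z: "string_map X Y c = (zero (Hom FL (strep X) (strep Y)))"
  and nz: "c (j, i) ~= 0"
 shows "act (X ! i) (Y ! j) = {}"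
proof (rule ccontr)
 assume "act (X ! i) (Y ! j) ~= {}"
 then obtain e where ea: "e : act (X ! i) (Y ! j)" by blast
 hence ei: "e : cr (lft (X ! i))" using act_subset by blast
 hence e: "e : Q0" using cr_Q0 by blast
 have ij: "j < length Y" "i < length X" using supp_matsD[OF c nz] by auto
 note b = basis_vec_carrier[OF ij(2) ei]
 have "string_map X Y c e (basis_vec X i) = vec (length Y) (%i. 0)" using z FL_zero_apply[OF e b, of "strep Y"] by simp
 hence "coord (string_map X Y c e (basis_vec X i)) j = 0" by (simp add: coord_vec)
 moreover have "coord (string_map X Y c e (basis_vec X i)) j = (\<Sum>k<length X. if k = i then c (j, i) else 0)"
 proof -
  have "(if e : act (X ! k) (Y ! j) then c (j, k) * coord (basis_vec X i) k else 0) = (if k = i then c (j, i) else 0)" for k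
   using ij ea by (simp add: coord_basis_vec)
  thus ?thesis unfolding string_map_apply[OF e b] using ij by (simp add: coord_vec)
 qed
 ultimately show False using nz ij by simp
qed

end

section \<open>The functor from rational objects to modules\<close>

lemma rational_pts_iff: "d : rational_pts \<longleftrightarrow> dyadic_lift (lft d) & chord (lft d)"
proof
 assume "d : rational_pts"
 then obtain a b :: int and n :: nat and s where
  d: "d = ((of_int a * pi / 2 ^ n, of_int b * pi / 2 ^ n), s)" and ab: "\<bar>a - b\<bar> < 2 ^ n" by (auto simp: rational_pts_def)
 have l: "lft d = (of_int a / 2 ^ n, of_int (b + 2 ^ n) / 2 ^ n)" by (simp add: d lft_def plift_def field_simps)
 have "of_int \<bar>a - b\<bar> < (of_int (2 ^ n) :: real)" using ab by (rule of_int_less_iff[THEN iffD2])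
 hence "real_of_int a < of_int (b + 2 ^ n)" "real_of_int (b + 2 ^ n) < of_int a + 2 * 2 ^ n" by auto
 moreover have "real_of_int a / 2 ^ n + 2 = (of_int a + 2 * 2 ^ n) / 2 ^ n" by (simp add: field_simps)
 ultimately have "chord (lft d)" by (simp only: l chord_def fst_conv snd_conv divide_strict_right_mono zero_less_power zero_less_numeral)
 moreover have "dyadic_lift (lft d)" unfolding dyadic_lift_def l dyadic_def fst_conv snd_conv by blast
 ultimately show "dyadic_lift (lft d) & chord (lft d)" by blast
next
 assume *: "dyadic_lift (lft d) & chord (lft d)"
 obtain x y s where d: "d = ((x, y), s)" by (metis surj_pair)
 have "dyadic (fst (lft d))" "dyadic (snd (lft d))" using * by (auto simp: dyadic_lift_def)
 from this[THEN dyadic_multiple] obtain m n where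
  "!!N. m <= N ==> \<exists>i::int. fst (lft d) = of_int i / 2 ^ N" "!!N. n <= N ==> \<exists>i::int. snd (lft d) = of_int i / 2 ^ N"
  by (metis (no_types))
 from this[of "max m n"] obtain a c :: int where
  "fst (lft d) = of_int a / 2 ^ max m n" "snd (lft d) = of_int c / 2 ^ max m n" by auto
 moreover define N where "N = max m n"
 ultimately have ac: "x / pi = of_int a / 2 ^ N" "y / pi + 1 = of_int c / 2 ^ N" by (simp_all add: d lft_def plift_def)
 define b where "b = c - 2 ^ N"
 have "y / pi = of_int b / 2 ^ N" using ac(2) by (simp add: b_def field_simps)
 hence xy: "x = of_int a * pi / 2 ^ N" "y = of_int b * pi / 2 ^ N" using ac(1) by (simp_all add: field_simps)
 have "real_of_int a / 2 ^ N < of_int c / 2 ^ N" "real_of_int c / 2 ^ N < of_int a / 2 ^ N + 2"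
  using * ac by (simp_all add: chord_def d lft_def plift_def)
 hence "real_of_int a < of_int c" "real_of_int c < of_int (a + 2 * 2 ^ N)" by (simp_all add: field_simps)
 hence "a < c" "c < a + 2 * 2 ^ N" by (simp_all only: of_int_less_iff)
 hence "\<bar>a - b\<bar> < 2 ^ N" by (simp add: b_def)
 thus "d : rational_pts" unfolding rational_pts_def d xy by blast
qed

lemma lft_std: "lft ((of_int m * pi / 2 ^ n, pi + (of_int m - 1) * pi / 2 ^ n), s) = (of_int m / 2 ^ n, (of_int m - 1) / 2 ^ n + 2)"
 by (simp add: lft_def plift_def add_divide_distrib)

lemma std_cluster_lift:
 assumes "d : std_cluster"
 shows "\<exists>e. lft d : lifts e"
proof -
 obtain m :: int and n :: nat where d: "d = ((of_int m * pi / 2 ^ n, pi + (of_int m - 1) * pi / 2 ^ n), False)"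
  using assms by (auto simp: std_cluster_def)
 obtain e where "(of_int (m - 1) / 2 ^ n, (of_int (m - 1) + 1) / 2 ^ n) : lifts e" using dyadic_interval_lift[of "m - 1" n] by blast
 from lifts_turn[OF this, of 1] have "lft d : lifts e" by (simp add: d lft_std turn_def add.commute)
 thus ?thesis by blast
qed

lemma lift_std_cluster:
 assumes "l : lifts e"
 obtains d k where "d : std_cluster" "l = turn k (lft d)"
proof -
 define ta :: "int => nat => dpoint" where
  "ta m n = ((of_int m * pi / 2 ^ n, pi + (of_int m - 1) * pi / 2 ^ n), False)" for m n
 have std: "ta m n : std_cluster" if "0 <= m" "m < 2 ^ (n + 1)" "n ~= 0 | m ~= 1" for m n
 proof -
  have "ta m n ~= ((pi, pi), False)"
  proof
   assume "ta m n = ((pi, pi), False)"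
   hence "real_of_int m = 2 ^ n" "real_of_int m = 1" by (auto simp: ta_def field_simps)
   thus False using that(3) one_less_power[of "2::real" n] by auto
  qed
  thus ?thesis using that unfolding std_cluster_def ta_def by blast
 qed
 have lft: "lft (ta m n) = (of_int m / 2 ^ n, (of_int m - 1) / 2 ^ n + 2)" for m n
  unfolding ta_def by (rule lft_std)
 obtain j v where l: "l = turn j (iv v)" using assms by (auto simp: lifts_def)
 obtain s p where v: "v = (s, p)" by (cases v)
 define n where "n = length p"
 obtain m :: int where m: "0 <= m" "m < 2 ^ Suc n" "iv v = (of_int m / 2 ^ n, (of_int m + 1) / 2 ^ n)" using iv_dyadic[of p s] v n_def by auto
 consider "n = 0" "m = 0" | "n = 0" "m = 1" | "n ~= 0" "m + 1 < 2 ^ Suc n" | "n ~= 0" "m + 1 = 2 ^ Suc n" using m(1,2) by force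
 thus thesis
 proof cases
  case 1
  hence "l = turn j (lft (ta 0 0))" by (simp add: l m lft)
  thus thesis using that[OF std[of 0 0]] by auto
 next
  case 2
  hence "l = turn (j + 1) (lft (ta 0 0))" unfolding l m turn_turn[symmetric] by (simp add: lft turn_def)
  thus thesis using that[OF std[of 0 0]] by auto
 next
  case 3
  have "l = turn (j - 1) (lft (ta (m + 1) n))"
   unfolding l m diff_conv_add_uminus turn_turn[symmetric] by (simp add: lft turn_def)
  thus thesis using that[OF std[of "m + 1" n]] 3 m(1) by auto
 next
  case 4
  hence "real_of_int (m + 1) = of_int (2 ^ Suc n)" by simp
  hence "l = turn (j + 1) (lft (ta 0 n))"
   unfolding l m turn_turn[symmetric] by (simp add: lft turn_def field_simps)
  thus thesis using that[OF std[of 0 n]] 4 by auto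
 qed
qed

lemma std_cluster_cr: "d : std_cluster ==> cr (lft d) = {}" using std_cluster_lift[of d] noncrossing[of "lft d"] by (auto simp: cr_def)

lemma std_cluster_rational: "std_cluster \<subseteq> rational_pts"
proof
 fix d assume "d : std_cluster"
 then obtain e where "lft d : lifts e" using std_cluster_lift by blast
 thus "d : rational_pts" using lifts_chord lifts_dyadic by (simp add: rational_pts_iff)
qed

text \<open>A basic morphism that acts as zero on every string module factors through the cluster.\<close>

lemma factor_through_cluster:
 assumes hom: "homC p q" and p: "dyadic_lift (lft p)" and q: "dyadic_lift (lft q)" and no: "act p q = {}"
 obtains d where "d : std_cluster" "homC p d" "homC d q" "compC p d q"
proof -
 define k where "k = deg p q"
 obtain a b where ab: "lft p = (a, b)" by (cases "lft p")
 obtain c d where cd: "turn k (lft q) = (c, d)" by (cases "turn k (lft q)")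
 have h: "lift_hom (a, b) (c, d)" using homC_deg[OF hom] by (simp add: ab cd[symmetric] k_def)
 have "dyadic_lift (c, d)" using q by (simp add: cd[symmetric])
 hence dy: "dyadic a" "dyadic b" "dyadic c" "dyadic d" using p by (auto simp: dyadic_lift_def ab)
 have "common (a, b) (c, d) = {}" using no hom by (simp add: act_def ab cd[symmetric] k_def)
 from lift_hom_factor_or_common[OF h dy this] obtain s t e where
  st: "(s, t) : lifts e" "a <= s" "s <= c" "b <= t" "t <= d" .
 from lift_std_cluster[OF st(1)] obtain ta m where ta: "ta : std_cluster" "(s, t) = turn m (lft ta)" .
 have "lift_hom (lft p) (turn m (lft ta))" "lift_hom (turn m (lft ta)) (turn k (lft q))"
  using h st unfolding ta(2)[symmetric] ab cd lift_hom_def by auto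
 hence 1: "homC p ta" "deg p ta = m" and "lift_hom (lft ta) (turn (k - m) (lft q))"
  using homC_iff[of p m ta] lift_hom_turn[of m "lft ta" "turn (k - m) (lft q)"] by simp_all
 hence 2: "homC ta q" "deg ta q = k - m" using homC_iff by blast+
 have "compC p ta q" unfolding compC_def 1 2 using homC_deg[OF hom] by (simp add: k_def)
 thus thesis using that ta(1) 1(1) 2(1) by blast
qed

lemma klin_category_full_subcat: "klin_category C ==> klin_category (full_subcat C S)"
 unfolding klin_category_def full_subcat_def by simp

lemma ff_functor_full_subcat: "ff_functor C D F ==> ff_functor (full_subcat C S) D F" using klin_category_full_subcat[of C S]
 by (simp add: ff_functor_def klin_functor_def klin_functor_axioms_def full_subcat_def)

lemma cat_X_simps: "Obj cat_X = {X. set X \<subseteq> rational_pts}" "Hom cat_X = Hom cat_C" "Comp cat_X = Comp cat_C"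
proof -
 have "X : Obj cat_C" if "set X \<subseteq> rational_pts" for X using that by (auto simp: rational_pts_iff cat_C_def orbit_cat_def cat_D2_simps)
 thus "Obj cat_X = {X. set X \<subseteq> rational_pts}" by (auto simp: cat_X_def full_subcat_def)
qed (simp_all add: cat_X_def full_subcat_def)

lemma ff_cat_X: "ff_functor (cat_X :: ('k::field, dpoint list, int => 'k mat set) klin_cat)
  (catC' chord_lists) \<lparr>FObj = (%X. X), FMap = oentries\<rparr>"
 unfolding cat_X_def by (rule ff_functor_full_subcat[OF ff_cat_C])

context list_encoding
begin

abbreviation X_cat :: "('k, dpoint list, int => 'k mat set) klin_cat" where
 "X_cat \<equiv> cat_X"

lemma ff_X: "ff_functor X_cat (catC' chord_lists) \<lparr>FObj = (%X. X), FMap = oentries\<rparr>" by (rule ff_cat_X)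

lemma entries_bij:
 "X : Obj X_cat ==> Y : Obj X_cat ==> bij_betw (oentries X Y) (mor X_cat X Y) (supp_mats homC X Y)" using ff_X by (simp add: ff_functor_def)

sublocale E: klin_functor X_cat "catC' chord_lists" "\<lparr>FObj = (%X. X), FMap = oentries\<rparr>" using ff_X by (simp add: ff_functor_def)

definition string_functor :: "(dpoint list, int => 'k mat set, ('k, 'u) quiver_rep, qvertex => 'u => 'u) cat_functor" where
 "string_functor = \<lparr>FObj = strep, FMap = (%X Y f. string_map X Y (oentries X Y f))\<rparr>"

lemma string_map_linear:
 "string_map X Y : lin_maps (fun_space (supp_mats homC X Y)) (Hom FL (strep X) (strep Y))"
proof (rule lin_mapsI)
 fix c d :: "nat \<times> nat => 'k" assume c: "c : carrier (fun_space (supp_mats homC X Y))"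
 show "string_map X Y c : mor FL (strep X) (strep Y)" using c by (simp add: string_map_mor)
 show "string_map X Y (c +[fun_space (supp_mats homC X Y)] d) = string_map X Y c +[Hom FL (strep X) (strep Y)] string_map X Y d"
  unfolding FL_simps string_map_def by (rule family_cong, simp, rule vec_cong, simp add: coord_vec,
   rule trans[OF sum.cong[OF refl] sum.distrib], simp add: distrib_right)
 show "string_map X Y (k *[fun_space (supp_mats homC X Y)] c) = k *[Hom FL (strep X) (strep Y)] string_map X Y c" for k
  unfolding FL_simps string_map_def by (rule family_cong, simp, rule vec_cong, simp add: coord_vec sum_distrib_left, rule sum.cong, simp_all)
qed

lemma string_rep_Obj: "set X \<subseteq> rational_pts ==> strep X : Obj FL"
 unfolding FL_Obj_iff by (intro conjI string_Lambda_module string_fin_dim) (use rational_pts_iff in blast)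

sublocale F: klin_functor X_cat FL string_functor
proof -
 note X = E.FMap_mor[simplified]
 show "klin_functor X_cat FL string_functor"
 proof (intro klin_functor.intro klin_functor_axioms.intro E.S.klin_category_axioms klin_category_FL)
  show "FObj string_functor X : Obj FL" if "X : Obj X_cat" for X using that by (simp add: string_functor_def string_rep_Obj cat_X_simps)
  show "FMap string_functor X Y : lin_maps (Hom X_cat X Y) (Hom FL (FObj string_functor X) (FObj string_functor Y))"
   if "X : Obj X_cat" "Y : Obj X_cat" for X Y
   using lin_comp[OF E.FMap_linear[OF that, simplified] string_map_linear] by (simp add: string_functor_def)
  show "FMap string_functor X X (Ident X_cat X) = Ident FL (FObj string_functor X)"
   if X: "X : Obj X_cat" for X
  proof -
   have *: "chord (lft (X ! i))" if "i < length X" for i using X that nth_mem by (fastforce simp: cat_X_simps rational_pts_iff)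
   have "string_map X X (Ident (catC' chord_lists) X) = Ident FL (strep X)"
    unfolding FL_simps string_map_def
   proof (rule family_cong)
    fix e x assume "x : sp (strep X) e"
    hence cx: "coord x : coords_at X e" "vec (length X) (coord x) = x" by (simp_all add: carrier_string)
    have "vec (length X) (%j. \<Sum>i<length X. if e : act (X ! i) (X ! j)
     then Ident (catC' chord_lists) X (j, i) * coord x i else 0) = vec (length X) (coord x)"
    proof (rule vec_cong)
     fix j assume j: "j < length X"
     have "(if e : act (X ! i) (X ! j) then Ident (catC' chord_lists) X (j, i) * coord x i else 0)
     = (if i = j then coord x j else 0)" if "i < length X" for i using * j that coords_atD[OF cx(1), of j] by (auto simp: act_refl homC_refl)
     hence "(\<Sum>i<length X. if e : act (X ! i) (X ! j)
     then Ident (catC' chord_lists) X (j, i) * coord x i else 0) = (\<Sum>i<length X. if i = j then coord x j else 0)" by (intro sum.cong) auto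
     also have "\<dots> = coord x j" using j by simp
     finally show "(\<Sum>i<length X. if e : act (X ! i) (X ! j)
     then Ident (catC' chord_lists) X (j, i) * coord x i else 0) = coord x j" .
    qed
    thus "vec (length X) (%j. \<Sum>i<length X. if e : act (X ! i) (X ! j)
     then Ident (catC' chord_lists) X (j, i) * coord x i else 0) = x" by (simp only: cx)
   qed
   thus ?thesis using E.FMap_Ident[OF X] by (simp add: string_functor_def)
  qed
  show "FMap string_functor X Z (Comp X_cat X Y Z g f) = Comp FL (FObj string_functor X) (FObj string_functor Y)
    (FObj string_functor Z) (FMap string_functor Y Z g) (FMap string_functor X Y f)"
   if "X : Obj X_cat" "Y : Obj X_cat" "Z : Obj X_cat" "f : mor X_cat X Y" "g : mor X_cat Y Z"
   for X Y Z f g using E.FMap_Comp[OF that, simplified] string_map_comp[OF X[OF that(1,2,4)] X[OF that(2,3,5)]] by (simp add: string_functor_def)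
 qed
qed

lemma string_functor_simps [simp]: "FObj string_functor = strep"
 "FMap string_functor X Y f = string_map X Y (oentries X Y f)" by (simp_all add: string_functor_def)

lemma string_functor_full:
 assumes "X : Obj X_cat"
  "Y : Obj X_cat"
 shows "mor FL (FObj string_functor X) (FObj string_functor Y) \<subseteq> FMap string_functor X Y ` mor X_cat X Y"
proof
 fix h assume "h : mor FL (FObj string_functor X) (FObj string_functor Y)"
 hence h: "h : mor FL (strep X) (strep Y)" by simp
 have "\<exists>c \<in> supp_mats homC X Y. string_map X Y c = h"
  by (rule string_map_full[OF h]) (use assms in \<open>auto simp: cat_X_simps rational_pts_iff\<close>)
 then obtain c where c: "c : supp_mats homC X Y" "string_map X Y c = h" by blast
 have "bij_betw (oentries X Y) (mor X_cat X Y) (supp_mats homC X Y)" using entries_bij assms by simp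
 hence "c : oentries X Y ` mor X_cat X Y" using c(1) by (simp add: bij_betw_def)
 thus "h : FMap string_functor X Y ` mor X_cat X Y" using c(2) by auto
qed

lemma string_rep_trivial:
 assumes "!!d. d : set X ==> cr (lft d) = {}"
 shows "sp (strep X) e = {(zero (space (strep X) e))}"
proof -
 have "f i = 0" if "f : coords_at X e" for f i
 proof (rule ccontr)
  assume "f i ~= 0"
  from coords_atD[OF that this] assms[of "X ! i"] show False by simp
 qed
 hence "coords_at X e = {%i. 0}" using coords_at_closed(1) by blast
 thus ?thesis by simp
qed

lemma cluster_factoring_zero:
 assumes X: "X : Obj X_cat" and Y: "Y : Obj X_cat"
  and f: "f : factoring X_cat (add_T TYPE('k)) X Y"
 shows "f : mor X_cat X Y & FMap string_functor X Y f = (zero (Hom FL (strep X) (strep Y)))"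
proof -
 obtain Z h g where Z: "Z : add_T TYPE('k)" and hg: "h : mor X_cat X Z" "g : mor X_cat Z Y" and fgh: "f = Comp X_cat X Z Y g h"
  using f unfolding factoring_def by blast
 obtain Z0 u where Zo: "Z : Obj X_cat" and Z0: "set Z0 \<subseteq> std_cluster"
  and u: "is_iso X_cat Z Z0 u" using Z unfolding add_T_def isomorphic_in_def by blast
 obtain w where w: "u : mor X_cat Z Z0" "w : mor X_cat Z0 Z" "Comp X_cat Z Z0 Z w u = Ident X_cat Z" using u unfolding is_iso_def by blast
 have Z0o: "Z0 : Obj X_cat" using Z0 std_cluster_rational by (auto simp: cat_X_simps)
 note m = F.FMap_mor[simplified]
 have t: "sp (strep Z0) e = {(zero (space (strep Z0) e))}" for e by (rule string_rep_trivial) (use Z0 std_cluster_cr in blast)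
 have "FMap string_functor Z Z0 u = (zero (Hom FL (strep Z) (strep Z0)))"
 proof (rule FL_ext)
  show *: "FMap string_functor Z Z0 u : mor FL (strep Z) (strep Z0)" using m[OF Zo Z0o w(1)] by simp
  show "(zero (Hom FL (strep Z) (strep Z0))) : mor FL (strep Z) (strep Z0)"
   unfolding FL_simps by (rule FL_zero_mor) (rule string_Lambda_module)+
  fix e x assume e: "e : Q0" and x: "x : sp (strep Z) e"
  show "FMap string_functor Z Z0 u e x = (zero (Hom FL (strep Z) (strep Z0))) e x"
   using FL_closed[OF * e x] unfolding FL_zero_apply[OF e x] t by blast
 qed
 moreover have "Ident FL (strep Z) = Comp FL (strep Z) (strep Z0) (strep Z) (FMap string_functor Z0 Z w) (FMap string_functor Z Z0 u)"
  using F.FMap_Ident[OF Zo] F.FMap_Comp[OF Zo Z0o Zo w(1,2)] by (simp add: w(3))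
 ultimately have "Ident FL (strep Z) = (zero (Hom FL (strep Z) (strep Z)))"
  using F.T.comp_zero_right[OF F.FObj_closed[OF Zo] F.FObj_closed[OF Z0o] F.FObj_closed[OF Zo] F.FMap_mor[OF Z0o Zo w(2)]] by simp
 moreover have "FMap string_functor X Z h = Comp FL (strep X) (strep Z) (strep Z) (Ident FL (strep Z)) (FMap string_functor X Z h)"
  using F.T.Ident_left[OF F.FObj_closed[OF X] F.FObj_closed[OF Zo] F.FMap_mor[OF X Zo hg(1)]] by simp
 ultimately have "FMap string_functor X Z h = (zero (Hom FL (strep X) (strep Z)))"
  using F.T.comp_zero_left[OF F.FObj_closed[OF X] F.FObj_closed[OF Zo] F.FObj_closed[OF Zo] F.FMap_mor[OF X Zo hg(1)]] by simp
 hence "FMap string_functor X Y f = (zero (Hom FL (strep X) (strep Y)))"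
  using F.FMap_Comp[OF X Zo Y hg] F.T.comp_zero_right[OF F.FObj_closed[OF X] F.FObj_closed[OF Zo] F.FObj_closed[OF Y] F.FMap_mor[OF Zo Y hg(2)]]
  by (simp add: fgh)
 thus ?thesis using E.S.comp_mor[OF X Zo Y hg] by (simp add: fgh)
qed

end

text \<open>
 A matrix all of whose entries factor through points of a set factors through a sum of such points:
 every entry gets a summand of its own.
\<close>

lemma entrywise_factoring:
 fixes c :: "nat \<times> nat => 'k::field"
 assumes c: "c : supp_mats R X Y" and ne: "P z0"
  and ex: "!!i j. c (j, i) ~= 0 ==> \<exists>z. P z & R (X ! i) z & R z (Y ! j) & E (X ! i) z (Y ! j)"
 shows "\<exists>Z f g. (\<forall>z \<in> set Z. P z) & f : supp_mats R X Z & g : supp_mats R Z Y & c = mat_comp E X Z Y g f"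
proof -
 have "\<exists>z. P z & (c (j, i) ~= 0 --> R (X ! i) z & R z (Y ! j) & E (X ! i) z (Y ! j))" for j i
  using ex[of j i] ne by (cases "c (j, i) = 0") auto
 then obtain z where z: "!!j i. P (z j i)"
  "!!j i. c (j, i) ~= 0 ==> R (X ! i) (z j i) & R (z j i) (Y ! j) & E (X ! i) (z j i) (Y ! j)" by metis
 define n where "n = length X"
 define L where "L = length Y * n"
 have kdec: "k div n < length Y" "k mod n < n" if "k < L" for k
 proof -
  have "n > 0" using that by (cases n) (auto simp: L_def)
  thus "k div n < length Y" "k mod n < n" using that less_mult_imp_div_less[of k "length Y" n] by (auto simp: L_def)
 qed
 have kenc: "j * n + i < L" "(j * n + i) div n = j" "(j * n + i) mod n = i" if "j < length Y" "i < n" for j i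
 proof -
  have "j * n + i < (j + 1) * n" using that by simp
  also have "\<dots> <= L" using that unfolding L_def by (intro mult_le_mono1) simp
  finally show "j * n + i < L" .
 qed (use that in simp_all)
 define Z where "Z = map (%k. z (k div n) (k mod n)) [0..<L]"
 define f where "f = (%(k, i). if k < L & k mod n = i & c (k div n, i) ~= 0 then 1 else 0 :: 'k)"
 define g where "g = (%(j, k). if k < L & k div n = j then c (j, k mod n) else 0)"
 have Zk: "length Z = L" "!!k. k < L ==> Z ! k = z (k div n) (k mod n)" by (simp_all add: Z_def)
 have "\<forall>z \<in> set Z. P z" using z(1) by (auto simp: Z_def)
 moreover have "f : supp_mats R X Z" "g : supp_mats R Z Y" using z(2) kdec by (auto simp: supp_mats_def f_def g_def Zk n_def split: if_splits)
 moreover have "c = mat_comp E X Z Y g f"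
 proof (rule ext)
  fix ji :: "nat \<times> nat"
  obtain j i where ji: "ji = (j, i)" by (cases ji)
  show "c ji = mat_comp E X Z Y g f ji"
  proof (cases "j < length Y & i < n")
   case False
   hence "c (j, i) = 0" using supp_matsD[OF c, of j i] by (auto simp: n_def)
   thus ?thesis using False by (auto simp: ji mat_comp_def n_def)
  next
   case True
   have "(if E (X ! i) (Z ! k) (Y ! j) then g (j, k) * f (k, i) else 0) = (if k = j * n + i then c (j, i) else 0)"
    if k: "k < L" for k
   proof (cases "k = j * n + i")
    case eq: True
    thus ?thesis using kenc[of j i] True k z(2)[of j i] by (auto simp: f_def g_def Zk)
   next
    case neq: False
    hence "\<not> (k div n = j & k mod n = i)" using div_mult_mod_eq[of k n] by auto
    thus ?thesis using neq by (auto simp: f_def g_def)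
   qed
   hence "(\<Sum>k<L. if E (X ! i) (Z ! k) (Y ! j) then g (j, k) * f (k, i) else 0) = (\<Sum>k<L. if k = j * n + i then c (j, i) else 0)"
    by (intro sum.cong) auto
   hence "(\<Sum>k<L. if E (X ! i) (Z ! k) (Y ! j) then g (j, k) * f (k, i) else 0) = c (j, i)" using kenc(1)[of j i] True by simp
   thus ?thesis using True by (simp add: ji mat_comp_def Zk n_def)
  qed
 qed
 ultimately show ?thesis by blast
qed

context list_encoding
begin

text \<open>
 Objects of the cluster cross no side, so morphisms through them act as zero. Conversely every
 nonzero entry of a matrix acting as zero factors through the cluster by itself.
\<close>

theorem cluster_factoring:
 assumes X: "X : Obj X_cat" and Y: "Y : Obj X_cat"
 shows "factoring X_cat (add_T TYPE('k)) X Y =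
  {f : mor X_cat X Y. FMap string_functor X Y f = (zero (Hom FL (FObj string_functor X) (FObj string_functor Y)))}"
proof (intro equalityI subsetI)
 fix f :: "int => 'k mat set" assume "f : factoring X_cat (add_T TYPE('k)) X Y"
 thus "f : {f : mor X_cat X Y. FMap string_functor X Y f = (zero (Hom FL (FObj string_functor X) (FObj string_functor Y)))}"
  using cluster_factoring_zero[OF X Y] by simp
next
 fix f :: "int => 'k mat set" assume "f : {f : mor X_cat X Y. FMap string_functor X Y f = (zero (Hom FL (FObj string_functor X) (FObj string_functor Y)))}"
 hence f: "f : mor X_cat X Y" and f0: "string_map X Y (oentries X Y f) = (zero (Hom FL (strep X) (strep Y)))" by simp_all
 note bij = entries_bij
 have c: "oentries X Y f : supp_mats homC X Y" using bij[OF X Y] f by (auto simp: bij_betw_def)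
 have dyX: "dyadic_lift (lft d)" if "d : set X \<union> set Y" for d using that X Y by (auto simp: cat_X_simps rational_pts_iff)
 have ex: "\<exists>z. z : std_cluster & homC (X ! i) z & homC z (Y ! j) & compC (X ! i) z (Y ! j)"
  if nz: "oentries X Y f (j, i) ~= 0" for i j
 proof -
  have ij: "j < length Y" "i < length X" "homC (X ! i) (Y ! j)" using supp_matsD[OF c nz] by auto
  have "dyadic_lift (lft (X ! i))" "dyadic_lift (lft (Y ! j))" using ij dyX by simp_all
  from factor_through_cluster[OF ij(3) this string_map_eq_zero[OF c f0 nz]] obtain z
   where "z : std_cluster" "homC (X ! i) z" "homC z (Y ! j)" "compC (X ! i) z (Y ! j)" .
  thus ?thesis by blast
 qed
 have "(0, 1) : lifts (tedge (False, []) Up)" using iv_lifts[of "(False, [])"] by simp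
 from lift_std_cluster[OF this] obtain z0 where z0: "z0 : std_cluster" .
 have "\<exists>Z f' g'. (\<forall>z \<in> set Z. z : std_cluster) & f' : supp_mats homC X Z & g' : supp_mats homC Z Y &
   oentries X Y f = mat_comp compC X Z Y g' f'" by (rule entrywise_factoring[where P = "%z. z : std_cluster", OF c z0]) (rule ex)
 then obtain Z f' g' where Z: "\<forall>z \<in> set Z. z : std_cluster" and f': "f' : supp_mats homC X Z" and g': "g' : supp_mats homC Z Y"
  and comp: "oentries X Y f = mat_comp compC X Z Y g' f'" by (elim exE conjE)
 have Zo: "Z : Obj X_cat" using Z std_cluster_rational by (auto simp: cat_X_simps)
 have "f' : oentries X Z ` mor X_cat X Z" using bij[OF X Zo] f' by (simp add: bij_betw_def)
 then obtain f'' where f'': "f' = oentries X Z f''" "f'' : mor X_cat X Z" by (rule imageE)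
 have "g' : oentries Z Y ` mor X_cat Z Y" using bij[OF Zo Y] g' by (simp add: bij_betw_def)
 then obtain g'' where g'': "g' = oentries Z Y g''" "g'' : mor X_cat Z Y" by (rule imageE)
 have "oentries X Y (Comp X_cat X Z Y g'' f'') = oentries X Y f" using E.FMap_Comp[OF X Zo Y f''(2) g''(2)] by (simp add: comp f''(1) g''(1))
 hence "f = Comp X_cat X Z Y g'' f''" using bij[OF X Y] f E.S.comp_mor[OF X Zo Y f''(2) g''(2)] by (metis bij_betw_def inj_onD)
 moreover have "Z : add_T TYPE('k)"
 proof -
  have "is_iso X_cat Z Z (Ident X_cat Z)"
   unfolding is_iso_def using E.S.Ident_mor[OF Zo] E.S.Ident_left[OF Zo Zo] by blast
  thus ?thesis using Zo Z unfolding add_T_def isomorphic_in_def by blast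
 qed
 ultimately show "f : factoring X_cat (add_T TYPE('k)) X Y" unfolding factoring_def using Zo f''(2) g''(2) by blast
qed

end

section \<open>Every module of finite length is a sum of string modules\<close>

lemma tedge_inj: "tedge v d = tedge v d' ==> d = d'"
proof -
 have "nbr v d ~= v" for d by (cases v; cases "snd v"; cases d) auto
 moreover have "nbr v d = nbr v d' ==> d = d'" by (cases v; cases "snd v"; cases d; cases d') (auto dest: arg_cong[of _ _ length])
 moreover assume "tedge v d = tedge v d'"
 ultimately show ?thesis by (auto simp: tedge_def doubleton_eq_iff)
qed

lemma src_neq_tgt: "src a ~= tgt a"
proof (cases a)
 case (Pair v d)
 have "clockwise d ~= d" by (cases d) auto
 thus ?thesis using tedge_inj[of v d "clockwise d"] by (auto simp: Pair)
qed

text \<open>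
 The edge above a vertex lies in one triangle on each side; its lift is chosen so that the triangle
 below has its apex outside the interval \<open>(s, t)\<close> and the other one has it inside.
\<close>

lemma two_triangles:
 obtains v d s t w w' f f' where "arrow_lift (v, d) s w t" "tedge v (clockwise d) = tedge v0 Up"
  "(t, w') : lifts f" "(w', s + 2) : lifts f'" "t < w'" "w' < s + 2"
  "{f, f'} = {tedge v0 Right_Child, tedge v0 Left_Child}"
  "!!a. src a = tedge v0 Up ==> a = (v, clockwise d) | tgt a : {f, f'}"
  "!!a. tgt a = tedge v0 Up ==> a = (v, d) | src a : {f, f'}"
proof -
 define p q m where "p = fst (iv v0)" and "q = snd (iv v0)" and "m = (p + q) / 2"
 have al: "arrow_lift (v0, Left_Child) p m q" using arrow_lift_Left[of v0] by (simp add: p_def q_def m_def)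
 define s where "s = q - 2"
 have o: "p < m" "m < q" "q < p + 2"
  and f': "(m, q) : lifts (tedge v0 Left_Child)" and e: "(p, q) : lifts (tedge v0 Up)" and f: "(p, m) : lifts (tedge v0 Right_Child)"
  using al by (simp_all add: arrow_lift_def)
 have "(s, p) : lifts (tedge v0 Up)" using lifts_turn[OF e, of "- 1"] by (simp add: turn_def s_def)
 from apex[OF this] obtain v d w where a: "arrow_lift (v, d) s w p" and ed: "tedge v0 Up = tgt (v, d)" .
 have ne: "v ~= v0"
 proof
  assume v: "v = v0"
  have "clockwise d = Up" using ed tedge_inj[of v0 Up "clockwise d"] by (simp add: v)
  hence d: "d = Left_Child" by (cases d) auto
  have so: "s < w" "w < p" "p < s + 2" and g: "(w, p) : lifts (tedge v0 Left_Child)" using a by (simp_all add: arrow_lift_def v d)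
  obtain k where "(m, q) = turn k (w, p)" using lifts_orbit[OF g f'] by blast
  hence k: "even k & q = p + of_int k | odd k & m = p + of_int k - 1 & q = w + of_int k + 1" by (auto simp: turn_def split: if_splits)
  thus False
  proof
   assume "even k & q = p + of_int k"
   hence "even k" "0 < real_of_int k" "real_of_int k < 2" using o by auto
   hence "k = 1" by simp
   thus False using \<open>even k\<close> by simp
  next
   assume "odd k & m = p + of_int k - 1 & q = w + of_int k + 1"
   hence "odd k" "1 < real_of_int k" "of_int k < (3::real)" using o so by (auto simp: s_def)
   hence "k = 2" by simp
   thus False using \<open>odd k\<close> by simp
  qed
 qed
 have v: "v = nbr v0 Up" using ed ne by (auto simp: tedge_def doubleton_eq_iff)
 have cl: "v' = v0 & d' = Up | v' = v & d' = clockwise d" if "tedge v' d' = tedge v0 Up" for v' d'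
 proof -
  have "v' = v0 | v' = v" using that unfolding v by (auto simp: tedge_def doubleton_eq_iff)
  thus ?thesis using that ed tedge_inj[of v0 d' Up] tedge_inj[of v d' "clockwise d"] by auto
 qed
 have out: "a' = (v, clockwise d) | tgt a' : {tedge v0 Right_Child, tedge v0 Left_Child}" if "src a' = tedge v0 Up" for a'
  using cl[of "fst a'" "snd a'"] that by (cases a') auto
 have inn: "a' = (v, d) | src a' : {tedge v0 Right_Child, tedge v0 Left_Child}" if t: "tgt a' = tedge v0 Up" for a'
 proof -
  obtain v' d' where a': "a' = (v', d')" by (cases a')
  have "v' = v0 & clockwise d' = Up | v' = v & clockwise d' = clockwise d" using cl t by (simp add: a')
  thus ?thesis by (cases d; cases d') (auto simp: a')
 qed
 show thesis by (rule that[OF a _ f _ _ _ refl out inn]) (use o ed f' in \<open>auto simp: s_def\<close>)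
qed

definition comb :: "nat => (nat => 'k::field) => (nat => nat => 'k) => nat => 'k" where
 "comb n f b = (%t. \<Sum>i<n. f i * b i t)"

lemma comb_closed:
 assumes W: "coord_space N W" and b: "!!i. i < n ==> f i ~= 0 ==> b i : W"
 shows "comb n f b : W" using b
proof (induction n)
 case 0
 show ?case using coord_spaceD(1)[OF W] by (simp add: comb_def)
next
 case (Suc n)
 have IH: "comb n f b : W" using Suc by simp
 show ?case
 proof (cases "f n = 0")
  case True
  thus ?thesis using IH by (simp add: comb_def)
 next
  case False
  hence "(%t. f n * b n t) : W" using Suc.prems coord_spaceD(3)[OF W] by simp
  thus ?thesis using coord_spaceD(2)[OF W IH] by (simp add: comb_def)
 qed
qed

lemma comb_linear:
 fixes T :: "(nat => 'k::field) => nat => 'k"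
 assumes W: "coord_space N W" and b: "!!i. i < n ==> f i ~= 0 ==> b i : W"
  and add: "!!x y. x : W ==> y : W ==> T (%t. x t + y t) = (%t. T x t + T y t)"
  and smult: "!!c x. x : W ==> T (%t. c * x t) = (%t. c * T x t)"
 shows "T (comb n f b) = comb n f (%i. T (b i))" using b
proof (induction n)
 case 0
 show ?case using smult[OF coord_spaceD(1)[OF W], of 0] by (simp add: comb_def)
next
 case (Suc n)
 have IH: "T (comb n f b) = comb n f (%i. T (b i))" using Suc by simp
 show ?case
 proof (cases "f n = 0")
  case True
  thus ?thesis using IH by (simp add: comb_def)
 next
  case False
  hence bn: "b n : W" using Suc.prems by simp
  have c: "comb n f b : W" by (rule comb_closed[OF W]) (use Suc.prems in simp)
  have "T (comb (Suc n) f b) = T (%t. comb n f b t + f n * b n t)" by (simp add: comb_def)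
  also have "\<dots> = (%t. T (comb n f b) t + f n * T (b n) t)"
   unfolding add[OF c coord_spaceD(3)[OF W bn]] smult[OF bn] ..
  finally show ?thesis unfolding IH by (simp add: comb_def)
 qed
qed

lemma comb_cong: "(!!i. i < n ==> f i ~= 0 | g i ~= 0 ==> f i = g i & b i = c i) ==> comb n f b = comb n g c"
 unfolding comb_def
proof (intro ext sum.cong refl)
 fix t i assume h: "!!i. i < n ==> f i ~= 0 | g i ~= 0 ==> f i = g i & b i = c i" and "i : {..<n}"
 thus "f i * b i t = g i * c i t" using h[of i] by (cases "f i = 0 & g i = 0") auto
qed

text \<open>
 A representation all of whose spaces are subspaces of coordinate spaces, and a basis of it that
 identifies it with a sum of string modules.
\<close>

definition coord_rep :: "(qvertex => nat) => (qvertex => (nat => 'k::field) set) =>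
  (qarrow => (nat => 'k) => nat => 'k) => bool" where
 "coord_rep N V A \<longleftrightarrow> (\<forall>e. coord_space (N e) (V e)) & (\<forall>a. \<forall>x\<in>V (src a). A a x : V (tgt a) &
   (\<forall>y\<in>V (src a). A a (%t. x t + y t) = (%t. A a x t + A a y t)) & (\<forall>c. A a (%t. c * x t) = (%t. c * A a x t))) &
   (\<forall>v d. \<forall>x\<in>V (tedge v d). A (v, clockwise d) (A (v, d) x) = (%t. 0))"

lemma coord_repD:
 assumes "coord_rep N V A"
 shows "coord_space (N e) (V e)" "x : V (src a) ==> A a x : V (tgt a)"
  "x : V (src a) ==> y : V (src a) ==> A a (%t. x t + y t) = (%t. A a x t + A a y t)"
  "x : V (src a) ==> A a (%t. c * x t) = (%t. c * A a x t)"
  "x : V (tedge v d) ==> A (v, clockwise d) (A (v, d) x) = (%t. 0)" using assms unfolding coord_rep_def by blast+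

lemma coord_rep_comb:
 assumes "coord_rep N V A" "!!i. i < n ==> f i ~= 0 ==> b i : V (src a)"
 shows "A a (comb n f b) = comb n f (%i. A a (b i))"
 by (rule comb_linear[OF coord_repD(1)[OF assms(1), of "src a"] assms(2) coord_repD(3,4)[OF assms(1)]])

context list_encoding
begin

definition string_basis :: "(qvertex => (nat => 'k) set) => (qarrow => (nat => 'k) => nat => 'k) =>
  dpoint list => (nat => qvertex => nat => 'k) => bool" where
 "string_basis V A Y b \<longleftrightarrow> set Y \<subseteq> rational_pts & (\<forall>i<length Y. \<forall>e\<in>cr (lft (Y ! i)). b i e : V e) &
   (\<forall>i<length Y. \<forall>a. src a : cr (lft (Y ! i)) -->
    A a (b i (src a)) = (if tgt a : cr (lft (Y ! i)) then b i (tgt a) else (%t. 0))) &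
   (\<forall>e\<in>Q0. bij_betw (%f. comb (length Y) f (%i. b i e)) (coords_at Y e) (V e))"

lemma string_basisD:
 assumes "string_basis V A Y b"
 shows "set Y \<subseteq> rational_pts" "i < length Y ==> e : cr (lft (Y ! i)) ==> b i e : V e"
  "i < length Y ==> src a : cr (lft (Y ! i)) ==>
   A a (b i (src a)) = (if tgt a : cr (lft (Y ! i)) then b i (tgt a) else (%t. 0))"
  "e : Q0 ==> bij_betw (%f. comb (length Y) f (%i. b i e)) (coords_at Y e) (V e)" using assms unfolding string_basis_def by blast+

lemma string_basis_zero_space:
 assumes B: "string_basis V A Y b" and i: "i < length Y" and e: "e : cr (lft (Y ! i))" and V: "V e = {x}"
 shows False
proof -
 have Q: "e : Q0" using e cr_Q0 by blast
 define u where "u = (%k. if k = i then 1 else 0 :: 'k)"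
 have "u : coords_at Y e" "(%k. 0) : coords_at Y e" using i e by (auto simp: coords_at_def u_def)
 hence "u = (%k. 0)"
  using bij_betwE[OF string_basisD(4)[OF B Q]] inj_onD[OF bij_betw_imp_inj_on[OF string_basisD(4)[OF B Q]], of u "%k. 0"] V by auto
 hence "u i = 0" by simp
 thus False by (simp add: u_def)
qed

text \<open>
 Replacing a basis string by its sum with images of other strings. Since no image is itself
 changed, the change of basis is unipotent with inverse given by \<open>- nu\<close>.
\<close>

lemma shear:
 assumes R: "coord_rep N V A" and B: "string_basis V A Y b"
  and nu: "!!i k. nu i k ~= 0 ==> i < length Y & k < length Y & homC (Y ! i) (Y ! k) & (\<forall>l. nu k l = 0)"
 shows "string_basis V A Y (%i e t. b i e t + comb (length Y) (%k. if e : act (Y ! i) (Y ! k) then nu i k else 0) (%k. b k e) t)"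
proof -
 let ?n = "length Y"
 define M where "M e i k = (if e : act (Y ! i) (Y ! k) then nu i k else 0)" for e i k
 have M: "M e i k ~= 0 ==> i < ?n & k < ?n & homC (Y ! i) (Y ! k) & e : cr (lft (Y ! i)) & e : cr (lft (Y ! k)) & (\<forall>l. M e k l = 0)" for e i k
  using nu[of i k] act_subset[of e "Y ! i" "Y ! k"] by (auto simp: M_def split: if_splits)
 define b' where "b' i e = (%t. b i e t + comb ?n (M e i) (%k. b k e) t)" for i e
 note D = string_basisD[OF B]
 have cl: "comb ?n (M e i) (%k. b k e) : V e" for e i by (rule comb_closed[OF coord_repD(1)[OF R]]) (use M D(2) in blast)
 have "string_basis V A Y b'"
  unfolding string_basis_def
 proof (intro conjI allI impI ballI D(1))
  fix i e assume i: "i < ?n" "e : cr (lft (Y ! i))"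
  show "b' i e : V e" unfolding b'_def by (rule coord_spaceD(2)[OF coord_repD(1)[OF R] D(2)[OF i] cl])
 next
  fix i a assume i: "i < ?n" and sa: "src a : cr (lft (Y ! i))"
  have "A a (b' i (src a)) = (%t. A a (b i (src a)) t + A a (comb ?n (M (src a) i) (%k. b k (src a))) t)"
   unfolding b'_def by (rule coord_repD(3)[OF R D(2)[OF i sa] cl])
  also have "A a (comb ?n (M (src a) i) (%k. b k (src a))) = comb ?n (M (src a) i) (%k. A a (b k (src a)))"
   by (rule coord_rep_comb[OF R]) (use M D(2) in blast)
  also have "\<dots> = comb ?n (M (tgt a) i) (%k. b k (tgt a))"
   unfolding comb_def
  proof (intro ext sum.cong refl)
   fix t k assume "k : {..<?n}"
   hence k: "k < ?n" by simp
   show "M (src a) i k * A a (b k (src a)) t = M (tgt a) i k * b k (tgt a) t"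
   proof (cases "nu i k = 0")
    case True
    thus ?thesis by (simp add: M_def)
   next
    case False
    hence h: "homC (Y ! i) (Y ! k)" using nu by blast
    show ?thesis using act_arrow[OF h sa] act_subset[of "src a" "Y ! i" "Y ! k"] D(3)[OF k, of a] by (auto simp: M_def)
   qed
  qed
  finally have *: "A a (b' i (src a)) = (%t. A a (b i (src a)) t + comb ?n (M (tgt a) i) (%k. b k (tgt a)) t)" .
  show "A a (b' i (src a)) = (if tgt a : cr (lft (Y ! i)) then b' i (tgt a) else (%t. 0))"
  proof (cases "tgt a : cr (lft (Y ! i))")
   case True
   thus ?thesis unfolding * D(3)[OF i sa] by (simp add: b'_def)
  next
   case False
   hence "M (tgt a) i k = 0" for k using M by blast
   thus ?thesis unfolding * D(3)[OF i sa] using False by (simp add: comb_def)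
  qed
 next
  fix e assume e: "e : Q0"
  define T where "T c f k = f k + c * (\<Sum>i<?n. f i * M e i k)" for c :: 'k and f k
  have Tc: "T c f : coords_at Y e" if f: "f : coords_at Y e" for c f
   unfolding coords_at_def
  proof (intro CollectI allI impI)
   fix k assume "T c f k ~= 0"
   hence "f k ~= 0 | (\<Sum>i<?n. f i * M e i k) ~= 0" by (auto simp: T_def)
   thus "k < ?n & e : cr (lft (Y ! k))"
   proof
    assume "(\<Sum>i<?n. f i * M e i k) ~= 0"
    then obtain i where "f i * M e i k ~= 0" using sum.not_neutral_contains_not_neutral by blast
    thus ?thesis using M[of e i k] by simp
   qed (rule coords_atD[OF f])
  qed
  have TT: "T c (T d f) = f" if "c + d = 0" for c d f
  proof
   fix k
   have "T d f i * M e i k = f i * M e i k" for i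
   proof (cases "M e i k = 0")
    case False
    hence "M e l i = 0" for l using M by blast
    thus ?thesis by (simp add: T_def)
   qed simp
   hence "(\<Sum>i<?n. T d f i * M e i k) = (\<Sum>i<?n. f i * M e i k)" by (intro sum.cong refl)
   hence "T c (T d f) k = T d f k + c * (\<Sum>i<?n. f i * M e i k)" unfolding T_def[of c] by (rule arg_cong)
   also have "\<dots> = f k + (c + d) * (\<Sum>i<?n. f i * M e i k)" by (simp add: T_def distrib_right)
   finally show "T c (T d f) k = f k" using that by simp
  qed
  have T: "bij_betw (T 1) (coords_at Y e) (coords_at Y e)" by (rule bij_betw_byWitness[where f' = "T (- 1)"]) (auto simp: TT Tc)
  have "comb ?n f (%i. b' i e) = comb ?n (T 1 f) (%i. b i e)" for f
  proof
   fix t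
   have "comb ?n f (%i. b' i e) t = (\<Sum>i<?n. f i * b i e t) + (\<Sum>i<?n. \<Sum>k<?n. f i * M e i k * b k e t)"
    by (simp add: comb_def b'_def distrib_left sum.distrib sum_distrib_left mult.assoc)
   also have "(\<Sum>i<?n. \<Sum>k<?n. f i * M e i k * b k e t) = (\<Sum>k<?n. (\<Sum>i<?n. f i * M e i k) * b k e t)"
    unfolding sum_distrib_right by (rule sum.swap)
   finally show "comb ?n f (%i. b' i e) t = comb ?n (T 1 f) (%i. b i e) t" by (simp add: comb_def T_def distrib_right sum.distrib)
  qed
  thus "bij_betw (%f. comb ?n f (%i. b' i e)) (coords_at Y e) (V e)" using bij_betw_trans[OF T D(4)[OF e]] by (simp add: comp_def)
 qed
 thus ?thesis unfolding b'_def M_def .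
qed

lemma append_trivial_string:
 assumes B: "string_basis V A Y b" and z: "z : std_cluster"
 shows "string_basis V A (Y @ [z]) b"
proof -
 note D = string_basisD[OF B]
 have cr: "cr (lft z) = {}" using std_cluster_cr[OF z] .
 have old: "e : cr (lft ((Y @ [z]) ! i)) \<longleftrightarrow> i < length Y & e : cr (lft (Y ! i))" if "i < length (Y @ [z])" for i e
  using that cr by (auto simp: nth_append less_Suc_eq)
 have c: "coords_at (Y @ [z]) e = coords_at Y e" for e
  unfolding coords_at_def using old by fastforce
 have k: "comb (length (Y @ [z])) f (%i. b i e) = comb (length Y) f (%i. b i e)" if "f : coords_at Y e" for f e
 proof -
  have "f (length Y) = 0" using coords_atD[OF that, of "length Y"] by blast
  thus ?thesis by (simp add: comb_def)
 qed
 show ?thesis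
  unfolding string_basis_def
 proof (intro conjI allI impI ballI)
  show "set (Y @ [z]) \<subseteq> rational_pts" using D(1) z std_cluster_rational by auto
  show "b i e : V e" if "i < length (Y @ [z])" "e : cr (lft ((Y @ [z]) ! i))" for i e using that old[OF that(1)] D(2) by blast
  show "A a (b i (src a)) = (if tgt a : cr (lft ((Y @ [z]) ! i)) then b i (tgt a) else (%t. 0))"
   if "i < length (Y @ [z])" "src a : cr (lft ((Y @ [z]) ! i))" for i a using that(2) D(3)[of i a] unfolding old[OF that(1)] by simp
  show "bij_betw (%f. comb (length (Y @ [z])) f (%i. b i e)) (coords_at (Y @ [z]) e) (V e)" if "e : Q0" for e
   unfolding c using D(4)[OF that] k bij_betw_cong[of "coords_at Y e"] by (metis (no_types, lifting))
 qed
qed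

end

lemma half_act:
 assumes "turn kp (lft p) = P" "turn kq (lft q) = Q" "lift_hom P Q"
 shows "homC p q & act p q = common P Q"
proof -
 have "lift_hom (lft p) (turn (kq - kp) (lft q))" using assms lift_hom_turn[of kp "lft p" "turn (kq - kp) (lft q)"] by simp
 hence "homC p q" "deg p q = kq - kp" by (simp_all add: homC_iff)
 moreover have "common (lft p) (turn (kq - kp) (lft q)) = common P Q" using assms common_turn[of kp "lft p" "turn (kq - kp) (lft q)"] by simp
 ultimately show ?thesis by (simp add: act_def)
qed

lemma point_with_lift:
 assumes "dyadic u" "dyadic v" "u < v" "v < u + 2"
 obtains z where "z : rational_pts" "lft z = (u, v)"
proof -
 have "lft ((u * pi, (v - 1) * pi), False) = (u, v)" by (simp add: lft_def plift_def)
 thus thesis using that assms by (simp add: rational_pts_iff dyadic_lift_def chord_def)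
qed

text \<open>
 A leaf \<open>e\<close> of the support of a representation, with a linear form \<open>\<lambda>\<close> on its space. In the
 triangle on the inner side, with arrows \<open>g \<rightarrow> e \<rightarrow> h \<rightarrow> g\<close>, the form either kills the image
 of the space at \<open>g\<close>, or the arrow to \<open>h\<close> is zero.
\<close>

locale leaf = list_encoding \<iota> for \<iota> :: "'k::field list => 'u" +
 fixes N and V :: "qvertex => (nat => 'k) set" and A v d and s t w w' :: real and f f' :: qvertex
  and lam :: "(nat => 'k) => 'k" and x1 :: "nat => 'k"
 assumes R: "coord_rep N V A"
  and al: "arrow_lift (v, d) s w t" and lf: "(t, w') : lifts f" and lf': "(w', s + 2) : lifts f'"
  and o1: "t < w'" and o2: "w' < s + 2"
  and out: "!!a. src a = tedge v (clockwise d) ==> a = (v, clockwise d) | tgt a : {f, f'}"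
  and inn: "!!a. tgt a = tedge v (clockwise d) ==> a = (v, d) | src a : {f, f'}"
  and zero: "!!c. c : {f, f'} ==> V c = {%t. 0}"
  and lam_add: "!!p q. lam (%t. p t + q t) = lam p + lam q" and lam_smult: "!!c p. lam (%t. c * p t) = c * lam p"
  and x1: "x1 : V (tedge v (clockwise d))" "lam x1 = 1"
  and dich: "(\<forall>z\<in>V (tedge v d). lam (A (v, d) z) = 0) | (\<forall>y\<in>V (tedge v (clockwise d)). A (v, clockwise d) y = (%t. 0))"
begin

abbreviation "e \<equiv> tedge v (clockwise d)"
abbreviation "g \<equiv> tedge v d"
abbreviation "h \<equiv> tedge v (clockwise (clockwise d))"

definition V' :: "qvertex => (nat => 'k) set" where
 "V' = V(e := {y : V e. lam y = 0})"

definition A' :: "qarrow => (nat => 'k) => nat => 'k" where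
 "A' a y = (if a = (v, d) then (%t. A a y t - lam (A a y) * x1 t) else A a y)"

lemma sides: "e ~= g" "h ~= e" "h ~= g" "e ~= h" using tedge_inj[of v d "clockwise d"] tedge_inj[of v "clockwise (clockwise d)" "clockwise d"]
  tedge_inj[of v "clockwise (clockwise d)" d] by (cases d; auto)+

lemma lam_zero: "lam (%t. 0) = 0" using lam_smult[of 0 x1] by simp

lemma leaf_neq: "c : {f, f'} ==> c ~= e" using zero[of c] x1 lam_zero by auto

lemma V'_simps: "c ~= e ==> V' c = V c" "V' e = {y : V e. lam y = 0}" "V' c \<subseteq> V c" by (auto simp: V'_def)

lemma A'_simps: "a ~= (v, d) ==> A' a = A a" "tgt a ~= e ==> A' a = A a" by (cases "a = (v, d)"; simp add: A'_def fun_eq_iff)+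

lemma order: "s < w" "w < t" "t < s + 2" and side_lifts: "(w, t) : lifts g" "(s, t) : lifts e" "(s, w) : lifts h"
 using al by (simp_all add: arrow_lift_def)

lemmas Vsp = coord_repD(1)[OF R]

lemma Vsub: "p : V c ==> q : V c ==> (%t. p t - k * q t) : V c" by (rule coord_space_diff[OF Vsp])

lemma lam_sub: "lam (%t. p t - k * q t) = lam p - k * lam q" using lam_add[of p "%t. (- k) * q t"] lam_smult[of "- k" q] by simp

lemma A_zero: "A a (%t. 0) = (%t. 0)" using coord_repD(4)[OF R coord_spaceD(1)[OF Vsp], of a 0] by simp

lemma A_sub: "p : V (src a) ==> q : V (src a) ==> A a (%t. p t - k * q t) = (%t. A a p t - k * A a q t)"
 using coord_repD(3)[OF R, of p a "%t. (- k) * q t"] coord_repD(4)[OF R, of q a "- k"] coord_spaceD(3)[OF Vsp, of q "src a" "- k"] by simp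

lemma rep': "coord_rep N V' A'"
 unfolding coord_rep_def
proof (intro conjI allI ballI)
 show "coord_space (N c) (V' c)" for c
 proof (cases "c = e")
  case True
  note W = Vsp[of e, unfolded coord_space_def]
  show ?thesis unfolding True V'_simps coord_space_def using W lam_zero lam_add lam_smult by auto
 qed (simp add: V'_simps Vsp)
next
 fix a x assume x': "x : V' (src a)"
 hence x: "x : V (src a)" using V'_simps(3) by blast
 note Ax = coord_repD(2)[OF R x]
 show "A' a x : V' (tgt a)"
 proof (cases "tgt a = e")
  case False
  thus ?thesis using Ax by (simp add: A'_simps V'_simps del: src.simps tgt.simps)
 next
  case True
  from inn[OF True] show ?thesis
  proof
   assume a: "a = (v, d)"
   show ?thesis using Ax Vsub[OF _ x1(1)] lam_sub x1(2) unfolding a by (simp add: A'_def V'_simps(2))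
  next
   assume a: "src a : {f, f'}"
   hence "x = (%t. 0)" using x zero by blast
   moreover have "A' a (%t. 0) = (%t. 0)" by (simp add: A'_def A_zero lam_zero)
   ultimately show ?thesis using Ax A_zero lam_zero unfolding True V'_simps(2) by simp
  qed
 qed
 show "A' a (%t. x t + y t) = (%t. A' a x t + A' a y t)" if "y : V' (src a)" for y
  unfolding A'_def coord_repD(3)[OF R x subsetD[OF V'_simps(3) that]] by (simp add: lam_add algebra_simps)
 show "A' a (%t. c * x t) = (%t. c * A' a x t)" for c
  unfolding A'_def coord_repD(4)[OF R x] by (simp add: lam_smult algebra_simps)
next
 fix u dl x assume "x : V' (tedge u dl)"
 hence x: "x : V (tedge u dl)" using V'_simps(3) by blast
 note rel = coord_repD(5)[OF R x]
 have cl: "clockwise dl ~= dl" by (cases dl) auto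
 show "A' (u, clockwise dl) (A' (u, dl) x) = (%t. 0)"
 proof (cases "(u, dl) = (v, d)")
  case True
  hence ud: "u = v" "dl = d" by auto
  have y: "A (v, d) x : V e" using coord_repD(2)[OF R, of x "(v, d)"] x ud by simp
  have "A' (u, clockwise dl) (A' (u, dl) x) = A (v, clockwise d) (%t. A (v, d) x t - lam (A (v, d) x) * x1 t)" using cl by (simp add: A'_def ud)
  also have "\<dots> = (%t. A (v, clockwise d) (A (v, d) x) t - lam (A (v, d) x) * A (v, clockwise d) x1 t)" by (rule A_sub) (use y x1 in simp_all)
  also have "\<dots> = (%t. 0)" using rel dich x x1 unfolding ud by auto
  finally show ?thesis .
 next
  case False
  show ?thesis unfolding A'_simps(1)[OF False] A'_def rel by (simp add: lam_zero)
 qed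
qed

lemma leaf_sides:
 assumes "string_basis V' A' Y b" "c : {f, f'}" "i < length Y"
 shows "c \<notin> cr (lft (Y ! i))" using string_basis_zero_space[OF assms(1,3)] zero[OF assms(2)] V'_simps(1)[OF leaf_neq[OF assms(2)]] by metis

text \<open>
 The basis is extended by lengthening the string \<open>j\<close>, which ends next to \<open>e\<close>, across \<open>e\<close>, with
 a multiple of \<open>x\<close> as the new basis vector.
\<close>

lemma lengthen:
 assumes B: "string_basis V' A' Y b" and j: "j < length Y" and ej: "e \<notin> cr (lft (Y ! j))"
  and z: "z : rational_pts" "cr (lft z) = insert e (cr (lft (Y ! j)))"
  and x: "x : V e" "lam x = 1" and kap: "kap ~= 0"
  and A'x: "!!y. y : V g ==> A' (v, d) y = (%t. A (v, d) y t - lam (A (v, d) y) * x t)"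
  and F1: "!!i. i < length Y ==> i ~= j ==> g : cr (lft (Y ! i)) ==> e \<notin> cr (lft (Y ! i)) ==> lam (A (v, d) (b i g)) = 0"
  and F2: "g : cr (lft (Y ! j)) ==> A (v, d) (b j g) = (%t. kap * x t)"
  and F3: "A (v, clockwise d) (%t. kap * x t) = (if h : cr (lft (Y ! j)) then b j h else (%t. 0))"
 shows "\<exists>Y b. string_basis V A Y b"
proof -
 let ?n = "length Y"
 let ?Y = "Y[j := z]"
 note D = string_basisD[OF B]
 define m where "m i = (if i = j then kap else if g : cr (lft (Y ! i)) then lam (A (v, d) (b i g)) else 0)" for i
 define p where "p i = (%t. if i = j then 0 else b i e t)" for i
 define b' where "b' i c = (if c = e then (%t. p i t + m i * x t) else b i c)" for i c
 have cr': "c : cr (lft (?Y ! i)) \<longleftrightarrow> c : cr (lft (Y ! i)) | i = j & c = e" if "i < ?n" for i c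
  using that z by (cases "i = j") auto
 have bV: "b i c : V c" if "i < ?n" "c : cr (lft (Y ! i))" for i c using D(2)[OF that] V'_simps(3) by blast
 have pV: "p i : V e" if "i < ?n" "e : cr (lft (?Y ! i))" for i
  using that bV[of i e] coord_spaceD(1)[OF Vsp] unfolding cr'[OF that(1)] p_def by (cases "i = j") auto
 have b'e: "b' i e : V e" if "i < ?n" "e : cr (lft (?Y ! i))" for i
  unfolding b'_def using coord_spaceD(2)[OF Vsp pV[OF that] coord_spaceD(3)[OF Vsp x(1)]] by simp
 have "string_basis V A ?Y b'"
  unfolding string_basis_def length_list_update
 proof (intro conjI allI impI ballI)
  show "set ?Y \<subseteq> rational_pts" using D(1) z(1) set_update_subset_insert[of Y j z] by blast
  fix i assume i: "i < ?n"
  show "b' i c : V c" if "c : cr (lft (?Y ! i))" for c using that b'e[OF i] bV[OF i, of c] cr'[OF i, of c] by (cases "c = e") (auto simp: b'_def)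
  fix a assume sa: "src a : cr (lft (?Y ! i))"
  show "A a (b' i (src a)) = (if tgt a : cr (lft (?Y ! i)) then b' i (tgt a) else (%t. 0))"
  proof (cases "src a = e")
   case True
   hence te: "tgt a ~= e" using src_neq_tgt[of a] by simp
   from out[OF True] show ?thesis
   proof
    assume tf: "tgt a : {f, f'}"
    have "A a (b' i (src a)) : V (tgt a)" using coord_repD(2)[OF R, of "b' i e" a] b'e[OF i] sa True by simp
    hence "A a (b' i (src a)) = (%t. 0)" using zero[OF tf] by simp
    thus ?thesis using cr'[OF i] te leaf_sides[OF B tf i] by simp
   next
    assume a: "a = (v, clockwise d)"
    show ?thesis
    proof (cases "i = j")
     case ij: True
     show ?thesis using F3 cr'[OF i] sides by (simp add: a ij b'_def p_def m_def)
    next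
     case ij: False
     hence ei: "e : cr (lft (Y ! i))" using sa cr'[OF i] True by simp
     have b'i: "b' i e = (%t. b i e t + m i * x t)" using ij by (simp add: b'_def p_def)
     have "A a (b' i e) = (%t. A a (b i e) t + m i * A a x t)"
     unfolding b'i using coord_repD(3)[OF R, of "b i e" a "%t. m i * x t"] coord_repD(4)[OF R, of x a "m i"]
     bV[OF i ei] x(1) coord_spaceD(3)[OF Vsp x(1), of "m i"] by (simp add: a)
     moreover have "(%t. A a (b i e) t + m i * A a x t) = A a (b i e)" using dich x(1) bV[OF i, of g] ij by (auto simp: m_def a)
     moreover have "A a (b i e) = (if h : cr (lft (Y ! i)) then b i h else (%t. 0))"
     using D(3)[OF i, of a] A'_simps(2)[of a] ei sides by (simp add: a)
     ultimately have "A a (b' i e) = (if h : cr (lft (Y ! i)) then b i h else (%t. 0))" by simp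
     thus ?thesis using cr'[OF i, of h] ij sides(2) by (simp add: a b'_def)
    qed
   qed
  next
   case ne: False
   hence si: "src a : cr (lft (Y ! i))" and bi: "b' i (src a) = b i (src a)" using sa cr'[OF i] by (simp_all add: b'_def)
   note old = D(3)[OF i si]
   show ?thesis
   proof (cases "tgt a = e")
    case True
    hence a: "a = (v, d)" using inn[OF True] leaf_sides[OF B _ i, of "src a"] si by blast
    have gi: "g : cr (lft (Y ! i))" using si by (simp add: a)
    show ?thesis
    proof (cases "i = j")
     case ij: True
     thus ?thesis using F2 gi cr'[OF i, of e] by (simp add: a b'_def p_def m_def sides sides[symmetric])
    next
     case ij: False
     have mi: "m i = lam (A (v, d) (b i g))" using ij gi by (simp add: m_def)
     have "A' (v, d) (b i g) = (%t. A (v, d) (b i g) t - m i * x t)" unfolding mi by (rule A'x[OF bV[OF i gi]])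
     hence "(%t. A (v, d) (b i g) t - m i * x t) = (if e : cr (lft (Y ! i)) then b i e else (%t. 0))" using old by (simp add: a)
     hence "A (v, d) (b i g) = (%t. (if e : cr (lft (Y ! i)) then b i e t else 0) + m i * x t)"
     by (auto simp: fun_eq_iff diff_eq_eq split: if_splits)
     thus ?thesis using cr'[OF i, of e] ij F1[OF i ij gi] mi by (auto simp: a b'_def p_def sides sides[symmetric])
    qed
   next
    case False
    thus ?thesis using old A'_simps(2)[OF False] cr'[OF i] unfolding bi by (simp add: b'_def del: src.simps tgt.simps)
   qed
  qed
 next
  fix c assume c: "c : Q0"
  have cat: "coords_at ?Y c = {f. \<forall>i. f i ~= 0 --> i < ?n & (c : cr (lft (Y ! i)) | i = j & c = e)}"
   unfolding coords_at_def length_list_update using cr' by blast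
  show "bij_betw (%f. comb ?n f (%i. b' i c)) (coords_at ?Y c) (V c)"
  proof (cases "c = e")
   case False
   hence "coords_at ?Y c = coords_at Y c" unfolding cat by (simp add: coords_at_def)
   thus ?thesis using D(4)[OF c] False by (simp add: b'_def V'_simps)
  next
   case c: True
   have 1: "bij_betw (%f. (f(j := 0), \<Sum>i<?n. f i * m i)) (coords_at ?Y e) (coords_at Y e \<times> UNIV)"
   proof (rule bij_betw_byWitness[where f' = "%(q, k). q(j := (k - (\<Sum>i<?n. q i * m i)) / kap)"])
    have sp: "(\<Sum>i<?n. q i * m i) = (\<Sum>i<?n. (q(j := 0)) i * m i) + q j * kap" for q
    proof -
     have "(\<Sum>i<?n. q i * m i) = (\<Sum>i<?n. (q(j := 0)) i * m i + (if i = j then q j * kap else 0))" by (rule sum.cong) (auto simp: m_def)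
     thus ?thesis using j by (simp add: sum.distrib)
    qed
    show "\<forall>f\<in>coords_at ?Y e. (%(q, k). q(j := (k - (\<Sum>i<?n. q i * m i)) / kap)) (f(j := 0), \<Sum>i<?n. f i * m i) = f"
    proof
     fix q
     have "((\<Sum>i<?n. q i * m i) - (\<Sum>i<?n. (q(j := 0)) i * m i)) / kap = q j"
     unfolding sp[of q] using kap by simp
     thus "(%(q, k). q(j := (k - (\<Sum>i<?n. q i * m i)) / kap)) (q(j := 0), \<Sum>i<?n. q i * m i) = q" by (simp del: fun_upd_apply)
    qed
    have q0: "q j = 0" if "q : coords_at Y e" for q using coords_atD[OF that, of j] ej by blast
    show "\<forall>a'\<in>coords_at Y e \<times> UNIV. (%f. (f(j := 0), \<Sum>i<?n. f i * m i)) ((%(q, k). q(j := (k - (\<Sum>i<?n. q i * m i)) / kap)) a') = a'"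
    proof
     fix a' assume "a' : coords_at Y e \<times> (UNIV :: 'k set)"
     then obtain q k where a': "a' = (q, k)" and q: "q : coords_at Y e" by blast
     have "q(j := 0) = q" using q0[OF q] by auto
     thus "(%f. (f(j := 0), \<Sum>i<?n. f i * m i)) ((%(q, k). q(j := (k - (\<Sum>i<?n. q i * m i)) / kap)) a') = a'"
     unfolding a' case_prod_conv sp[of "q(j := (k - (\<Sum>i<?n. q i * m i)) / kap)"] fun_upd_upd using kap by simp
    qed
    show "(%f. (f(j := 0), \<Sum>i<?n. f i * m i)) ` coords_at ?Y e \<subseteq> coords_at Y e \<times> UNIV"
     unfolding cat[unfolded c] by (auto simp: coords_at_def split: if_splits)
    show "(%(q, k). q(j := (k - (\<Sum>i<?n. q i * m i)) / kap)) ` (coords_at Y e \<times> UNIV) \<subseteq> coords_at ?Y e"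
     unfolding cat[unfolded c] using j by (auto simp: coords_at_def split: if_splits)
   qed
   note be = D(4)[OF tedge_Q0[of v "clockwise d"]]
   have cV: "comb ?n q (%i. b i e) : V' e" if "q : coords_at Y e" for q using bij_betwE[OF be] that by blast
   have 2: "bij_betw (%(q, k) t. comb ?n q (%i. b i e) t + k * x t) (coords_at Y e \<times> UNIV) (V e)"
   proof (rule bij_betw_imageI)
    show "inj_on (%(q, k) t. comb ?n q (%i. b i e) t + k * x t) (coords_at Y e \<times> UNIV)"
    proof (rule inj_onI, clarify)
     fix q k q' k' assume q: "q : coords_at Y e" "q' : coords_at Y e"
     and eq: "(%t. comb ?n q (%i. b i e) t + k * x t) = (%t. comb ?n q' (%i. b i e) t + k' * x t)"
     have "lam (%t. comb ?n q (%i. b i e) t + k * x t) = k" if "q : coords_at Y e" for q k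
     using lam_add lam_smult cV[OF that] x(2) V'_simps(2) by simp
     hence k: "k = k'" using q eq by metis
     hence "comb ?n q (%i. b i e) = comb ?n q' (%i. b i e)" using eq by (auto simp: fun_eq_iff)
     thus "q = q' & k = k'" using k inj_onD[OF bij_betw_imp_inj_on[OF be] _ q] by blast
    qed
    show "(%(q, k) t. comb ?n q (%i. b i e) t + k * x t) ` (coords_at Y e \<times> UNIV) = V e"
    proof (intro equalityI subsetI)
     fix y assume "y : (%(q, k) t. comb ?n q (%i. b i e) t + k * x t) ` (coords_at Y e \<times> UNIV)"
     then obtain q k where q: "q : coords_at Y e" and y: "y = (%t. comb ?n q (%i. b i e) t + k * x t)" by auto
     have "comb ?n q (%i. b i e) : V e" using cV[OF q] V'_simps(3) by blast
     thus "y : V e" unfolding y by (rule coord_spaceD(2)[OF Vsp _ coord_spaceD(3)[OF Vsp x(1)]])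
    next
     fix y assume y: "y : V e"
     have "(%t. y t - lam y * x t) : V' e" using Vsub[OF y x(1)] x(2) by (simp add: V'_simps(2) lam_sub)
     hence "(%t. y t - lam y * x t) : (%q. comb ?n q (%i. b i e)) ` coords_at Y e" using bij_betw_imp_surj_on[OF be] by simp
     then obtain q where q: "(%t. y t - lam y * x t) = comb ?n q (%i. b i e)" "q : coords_at Y e" by (rule imageE)
     have "y = (%t. comb ?n q (%i. b i e) t + lam y * x t)" unfolding q(1)[symmetric] by simp
     thus "y : (%(q, k) t. comb ?n q (%i. b i e) t + k * x t) ` (coords_at Y e \<times> UNIV)"
     using q(2) by (intro image_eqI[of _ _ "(q, lam y)"]) auto
    qed
   qed
   have "comb ?n q (%i. b' i e) = (%t. comb ?n (q(j := 0)) (%i. b i e) t + (\<Sum>i<?n. q i * m i) * x t)" for q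
   proof
    fix t
    have "comb ?n q (%i. b' i e) t = (\<Sum>i<?n. (q(j := 0)) i * b i e t + q i * m i * x t)"
     unfolding comb_def by (rule sum.cong) (auto simp: b'_def p_def algebra_simps)
    thus "comb ?n q (%i. b' i e) t = comb ?n (q(j := 0)) (%i. b i e) t + (\<Sum>i<?n. q i * m i) * x t"
     by (simp only: comb_def sum.distrib sum_distrib_right)
   qed
   thus ?thesis using bij_betw_trans[OF 1 2] unfolding c by (simp add: comp_def)
  qed
 qed
 thus ?thesis by blast
qed

end

context leaf
begin

lemma crosses_half: "s < u ==> u < w ==> crosses (u, t) (w, s + 2)" "w < u ==> u < t ==> crosses (u, s + 2) (t, w + 2)"
 using order by (simp_all add: crosses_def)

lemma single_string:
 obtains z where "z : rational_pts" "cr (lft z) = {e}"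
proof -
 have "dyadic w" "dyadic w'" using lifts_dyadic[OF side_lifts(1)] lifts_dyadic[OF lf'] by (simp_all add: dyadic_lift_def)
 then obtain z where z: "z : rational_pts" "lft z = (w, w')" using point_with_lift[of w w'] order o1 o2 by auto
 have "cr (lft z) = {e}"
  unfolding z(2) by (rule cr_single[OF side_lifts(2,1,3) lf lf']) (use order o1 o2 in auto)
 thus thesis using that z(1) by blast
qed

lemma new_string:
 assumes B: "string_basis V' A' Y b" and x: "x : V e" "lam x = 1"
  and A'x: "!!y. y : V g ==> A' (v, d) y = (%t. A (v, d) y t - lam (A (v, d) y) * x t)"
  and F1: "!!i. i < length Y ==> g : cr (lft (Y ! i)) ==> e \<notin> cr (lft (Y ! i)) ==> lam (A (v, d) (b i g)) = 0"
  and F3: "A (v, clockwise d) x = (%t. 0)"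
 shows "\<exists>Y b. string_basis V A Y b"
proof -
 obtain z where z: "z : rational_pts" "cr (lft z) = {e}" by (rule single_string)
 from lift_std_cluster[OF iv_lifts[of "(False, [])"]] obtain z0 where z0: "z0 : std_cluster" by metis
 have c0: "cr (lft ((Y @ [z0]) ! length Y)) = {}" using std_cluster_cr[OF z0] by simp
 show ?thesis
 proof (rule lengthen[OF append_trivial_string[OF B z0], of "length Y" z x 1])
  fix i assume "i < length (Y @ [z0])" "i ~= length Y" "g : cr (lft ((Y @ [z0]) ! i))" "e \<notin> cr (lft ((Y @ [z0]) ! i))"
  thus "lam (A (v, d) (b i g)) = 0" using F1[of i] by (simp add: nth_append)
 qed (use c0 z x A'x F3 in simp_all)
qed

text \<open>
 The form \<open>\<lambda>\<close> kills the image of the space at \<open>g\<close>. The image of the new vector in the space at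
 \<open>h\<close> involves only strings ending in the triangle that cross \<open>h\<close>; among these the one that maps
 to all others is replaced by this image and lengthened.
\<close>

lemma lengthen_source:
 assumes dA: "!!y. y : V g ==> lam (A (v, d) y) = 0" and B: "string_basis V' A' Y b"
 shows "\<exists>Y b. string_basis V A Y b"
proof -
 let ?n = "length Y"
 note D = string_basisD[OF B]
 let ?a2 = "(v, clockwise d)" and ?a3 = "(v, clockwise (clockwise d))"
 have a23: "?a2 ~= (v, d)" "?a3 ~= (v, d)" by (cases d; simp)+
 have bV: "b i c : V c" if "i < ?n" "c : cr (lft (Y ! i))" for i c using D(2)[OF that] V'_simps(3) by blast
 have "A ?a2 x1 : V h" using coord_repD(2)[OF R, of x1 ?a2] x1 by simp
 hence "A ?a2 x1 : (%f. comb ?n f (%i. b i h)) ` coords_at Y h" using bij_betw_imp_surj_on[OF D(4)[of h]] V'_simps(1)[OF sides(2)] by simp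
 then obtain c where c: "A ?a2 x1 = comb ?n c (%i. b i h)" "c : coords_at Y h" by (rule imageE)
 define c1 where "c1 i = (if e : cr (lft (Y ! i)) then c i else 0)" for i
 define c2 where "c2 i = (if e : cr (lft (Y ! i)) then 0 else c i)" for i
 have ci: "i < ?n & h : cr (lft (Y ! i))" if "c i ~= 0" for i using coords_atD[OF c(2) that] .
 define y where "y = comb ?n c1 (%i. b i e)"
 have y: "y : V' e"
  unfolding y_def by (rule comb_closed[OF coord_repD(1)[OF rep']]) (use D(2) in \<open>auto simp: c1_def split: if_splits\<close>)
 define x where "x = (%t. x1 t - 1 * y t)"
 have x: "x : V e" "lam x = 1"
  unfolding x_def lam_sub using Vsub[OF x1(1), of y 1] y x1 by (simp_all add: V'_simps(2))
 have A'x: "A' (v, d) z = (%t. A (v, d) z t - lam (A (v, d) z) * x t)" if "z : V g" for z using dA[OF that] by (simp add: A'_def)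
 have "A ?a2 y = comb ?n c1 (%i. A ?a2 (b i e))"
  unfolding y_def by (rule coord_rep_comb[OF R]) (use bV in \<open>auto simp: c1_def split: if_splits\<close>)
 also have "\<dots> = comb ?n c1 (%i. b i h)"
 proof (rule comb_cong)
  fix i assume i: "i < ?n" "c1 i ~= 0 | c1 i ~= 0"
  hence "e : cr (lft (Y ! i))" "h : cr (lft (Y ! i))" using ci by (auto simp: c1_def split: if_splits)
  thus "c1 i = c1 i & A ?a2 (b i e) = b i h" using D(3)[OF i(1), of ?a2] A'_simps(1)[OF a23(1)] by simp
 qed
 finally have "A ?a2 x = (%t. comb ?n c (%i. b i h) t - comb ?n c1 (%i. b i h) t)"
  using A_sub[of x1 ?a2 y 1] x1 y V'_simps(3) unfolding x_def c(1)[symmetric] by auto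
 also have "\<dots> = comb ?n c2 (%i. b i h)"
  unfolding comb_def sum_subtractf[symmetric] by (intro ext sum.cong) (auto simp: c1_def c2_def)
 finally have A2x: "A ?a2 x = comb ?n c2 (%i. b i h)" .
 define c3 where "c3 i = (if g : cr (lft (Y ! i)) then c2 i else 0)" for i
 have c2: "c2 i ~= 0 ==> i < ?n & h : cr (lft (Y ! i)) & e \<notin> cr (lft (Y ! i))" for i using ci by (auto simp: c2_def split: if_splits)
 have "A ?a3 (comb ?n c2 (%i. b i h)) = comb ?n c2 (%i. A ?a3 (b i h))" by (rule coord_rep_comb[OF R]) (use bV c2 in auto)
 also have "\<dots> = comb ?n c3 (%i. b i g)"
  unfolding comb_def
 proof (intro ext sum.cong refl)
  fix t' i assume "i : {..<?n}"
  thus "c2 i * A ?a3 (b i h) t' = c3 i * b i g t'" using D(3)[of i ?a3] A'_simps(1)[OF a23(2)] c2[of i] by (cases "c2 i = 0") (auto simp: c3_def)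
 qed
 finally have "comb ?n c3 (%i. b i g) = (%t. 0)" using coord_repD(5)[OF R x(1)] A2x by simp
 hence "comb ?n c3 (%i. b i g) = comb ?n (%i. 0) (%i. b i g)" by (simp add: comb_def)
 moreover have "c3 : coords_at Y g" "(%i. 0) : coords_at Y g" using c2 by (auto simp: coords_at_def c3_def split: if_splits)
 ultimately have c30: "c3 = (%i. 0)" using inj_onD[OF bij_betw_imp_inj_on[OF D(4)[of g]]] by simp
 have g2: "g \<notin> cr (lft (Y ! i))" if "c2 i ~= 0" for i using fun_cong[OF c30, of i] that by (auto simp: c3_def)
 show ?thesis
 proof (cases "\<forall>i. c2 i = 0")
  case True
  hence "A ?a2 x = (%t. 0)" using A2x by (simp add: comb_def)
  thus ?thesis using new_string[OF B x A'x] dA bV by blast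
 next
  case False
  have "\<exists>k u. turn k (lft (Y ! i)) = (u, t) & s < u & u < w" if "c2 i ~= 0" for i
  proof -
   show ?thesis by (rule half_string[OF al, of "lft (Y ! i)"]) (use c2[OF that] g2[OF that] in auto)
  qed
  then obtain k u where ku: "!!i. c2 i ~= 0 ==> turn (k i) (lft (Y ! i)) = (u i, t) & s < u i & u i < w" by metis
  have fin: "finite {i. c2 i ~= 0}" by (rule finite_subset[of _ "{..<?n}"]) (use c2 in auto)
  have "\<exists>j. c2 j ~= 0 & (\<forall>i. c2 i ~= 0 --> u j <= u i)"
   using arg_min_if_finite[OF fin, of u] False by (metis (mono_tags, lifting) empty_iff mem_Collect_eq not_le_imp_less subsetI subset_empty)
  then obtain j where j: "c2 j ~= 0" "!!i. c2 i ~= 0 ==> u j <= u i" by blast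
  have act: "homC (Y ! j) (Y ! i) & h : act (Y ! j) (Y ! i)" if i: "c2 i ~= 0" for i
  proof -
   have hm: "lift_hom (u j, t) (u i, t)" using ku[OF j(1)] ku[OF i] j(2)[OF i] order by (simp add: lift_hom_def)
   have "(w, s + 2) : lifts h" using lifts_turn[OF side_lifts(3), of 1] by (simp add: turn_1)
   hence "h : common (u j, t) (u i, t)" using crosses_half(1) ku[OF j(1)] ku[OF i] commonI by blast
   thus ?thesis using half_act[of "k j" "Y ! j" _ "k i" "Y ! i", OF _ _ hm] ku[OF j(1)] ku[OF i] by simp
  qed
  define nu where "nu i l = (if i = j & l ~= j then c2 l / c2 j else 0)" for i l
  define b' where "b' i c' t' = b i c' t' + comb ?n (%l. if c' : act (Y ! i) (Y ! l) then nu i l else 0) (%l. b l c') t'" for i c' t'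
  have B': "string_basis V' A' Y b'"
   unfolding b'_def by (rule shear[OF rep' B]) (use c2 j act in \<open>auto simp: nu_def split: if_splits\<close>)
  have jn: "j < ?n" using c2[OF j(1)] by blast
  have dy: "dyadic (u j)" "dyadic w'"
  proof -
   have "dyadic_lift (lft (Y ! j))" using D(1) jn nth_mem rational_pts_iff by blast
   hence "dyadic_lift (turn (k j) (lft (Y ! j)))" by simp
   thus "dyadic (u j)" using ku[OF j(1)] by (simp add: dyadic_lift_def del: dyadic_lift_turn)
   show "dyadic w'" using lifts_dyadic[OF lf] by (simp add: dyadic_lift_def)
  qed
  obtain z where z: "z : rational_pts" "lft z = (u j, w')" using point_with_lift[OF dy] ku[OF j(1)] order o1 o2 by auto
  have crj: "cr (lft (Y ! j)) = cr (u j, t)" using ku[OF j(1)] cr_turn[of "k j" "lft (Y ! j)"] by simp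
  have crz: "cr (lft z) = insert e (cr (lft (Y ! j)))"
   unfolding z(2) crj by (rule cr_extend_upper(1)[OF side_lifts(2,1,3) lf lf']) (use ku[OF j(1)] order o1 o2 in auto)
  have F3: "A ?a2 (%t. 1 / c2 j * x t) = b' j h"
  proof
   fix t'
   have "A ?a2 (%t. 1 / c2 j * x t) = (%t. 1 / c2 j * A ?a2 x t)" by (rule coord_repD(4)[OF R]) (use x in simp)
   hence "A ?a2 (%t. 1 / c2 j * x t) t' = 1 / c2 j * (\<Sum>l<?n. c2 l * b l h t')" by (simp only: A2x comb_def)
   also have "\<dots> = (\<Sum>l<?n. (if l = j then b j h t' else 0) + (if h : act (Y ! j) (Y ! l) then nu j l else 0) * b l h t')"
    unfolding sum_distrib_left by (rule sum.cong) (use act j in \<open>auto simp: nu_def\<close>)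
   also have "\<dots> = b' j h t'" using jn by (simp add: sum.distrib b'_def comb_def)
   finally show "A ?a2 (%t. 1 / c2 j * x t) t' = b' j h t'" .
  qed
  show ?thesis
  proof (rule lengthen[where kap = "1 / c2 j", OF B' jn _ z(1) crz x _ A'x])
   show "lam (A (v, d) (b' i g)) = 0" if "i < ?n" "g : cr (lft (Y ! i))" for i using dA string_basisD(2)[OF B' that] V'_simps(3) by blast
  qed (use c2[OF j(1)] g2[OF j(1)] j F3 in simp_all)
 qed
qed

text \<open>
 The arrow to \<open>h\<close> is zero. The form \<open>\<lambda>\<close>, composed with the arrow from \<open>g\<close>, is a form on the
 space at \<open>g\<close>; among the strings ending in the triangle on which it does not vanish, multiples
 of the one to which all others map are subtracted from the others, and this one is lengthened.
\<close>

lemma lengthen_target: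
 assumes dB: "!!y. y : V e ==> A (v, clockwise d) y = (%t. 0)" and B: "string_basis V' A' Y b"
 shows "\<exists>Y b. string_basis V A Y b"
proof -
 let ?n = "length Y"
 note D = string_basisD[OF B]
 let ?a3 = "(v, clockwise (clockwise d))"
 have a3: "?a3 ~= (v, d)" by (cases d; simp)
 have bV: "b i c : V c" if "i < ?n" "c : cr (lft (Y ! i))" for i c using D(2)[OF that] V'_simps(3) by blast
 define L where "L i = (if i < ?n & g : cr (lft (Y ! i)) & e \<notin> cr (lft (Y ! i)) then lam (A (v, d) (b i g)) else 0)" for i
 have L: "i < ?n & g : cr (lft (Y ! i)) & e \<notin> cr (lft (Y ! i)) & h \<notin> cr (lft (Y ! i))" if nz: "L i ~= 0" for i
 proof -
  have i: "i < ?n" "g : cr (lft (Y ! i))" "e \<notin> cr (lft (Y ! i))" and l: "lam (A (v, d) (b i g)) ~= 0"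
   using nz by (auto simp: L_def split: if_splits)
  have "h \<notin> cr (lft (Y ! i))"
  proof
   assume hi: "h : cr (lft (Y ! i))"
   hence "A ?a3 (b i h) = b i g" using D(3)[OF i(1), of ?a3] A'_simps(1)[OF a3] i by simp
   hence "A (v, d) (b i g) = (%t. 0)" using coord_repD(5)[OF R bV[OF i(1) hi]] by simp
   thus False using l lam_zero by simp
  qed
  thus ?thesis using i by blast
 qed
 have A'x: "A' (v, d) y = (%t. A (v, d) y t - lam (A (v, d) y) * x1 t)" for y by (simp add: A'_def)
 show ?thesis
 proof (cases "\<forall>i. L i = 0")
  case True
  have "lam (A (v, d) (b i g)) = 0" if "i < ?n" "g : cr (lft (Y ! i))" "e \<notin> cr (lft (Y ! i))" for i using True that unfolding L_def by metis
  thus ?thesis using new_string[OF B x1 A'x _ dB[OF x1(1)]] by blast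
 next
  case False
  have "\<exists>k u. turn k (lft (Y ! i)) = (u, s + 2) & w < u & u < t" if "L i ~= 0" for i
  proof -
   have "arrow_lift (v, clockwise d) w t (s + 2)" using arrow_lift_next[OF al] by simp
   from half_string[OF this, of "lft (Y ! i)"] show ?thesis using L[OF that] by simp blast
  qed
  then obtain k u where ku: "!!i. L i ~= 0 ==> turn (k i) (lft (Y ! i)) = (u i, s + 2) & w < u i & u i < t" by metis
  have fin: "finite {i. L i ~= 0}" by (rule finite_subset[of _ "{..<?n}"]) (use L in auto)
  have "\<exists>j. L j ~= 0 & (\<forall>i. L i ~= 0 --> u i <= u j)"
   using arg_min_if_finite[OF fin, of "%i. - u i"] False by (metis (mono_tags, lifting) empty_iff mem_Collect_eq neg_less_iff_less not_le_imp_less subsetI subset_empty)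
  then obtain j where j: "L j ~= 0" "!!i. L i ~= 0 ==> u i <= u j" by blast
  have act: "homC (Y ! i) (Y ! j) & g : act (Y ! i) (Y ! j)" if i: "L i ~= 0" for i
  proof -
   have hm: "lift_hom (u i, s + 2) (u j, s + 2)" using ku[OF j(1)] ku[OF i] j(2)[OF i] order by (simp add: lift_hom_def)
   have "(t, w + 2) : lifts g" using lifts_turn[OF side_lifts(1), of 1] by (simp add: turn_1)
   hence "g : common (u i, s + 2) (u j, s + 2)" using crosses_half(2) ku[OF j(1)] ku[OF i] commonI by blast
   thus ?thesis using half_act[of "k i" "Y ! i" _ "k j" "Y ! j", OF _ _ hm] ku[OF j(1)] ku[OF i] by simp
  qed
  define nu where "nu i l = (if l = j & i ~= j then - L i / L j else 0)" for i l
  define b' where "b' i c' t' = b i c' t' + comb ?n (%l. if c' : act (Y ! i) (Y ! l) then nu i l else 0) (%l. b l c') t'" for i c' t'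
  have B': "string_basis V' A' Y b'"
   unfolding b'_def by (rule shear[OF rep' B]) (use L j act in \<open>auto simp: nu_def split: if_splits\<close>)
  have jn: "j < ?n" using L[OF j(1)] by blast
  have b'g: "b' i g = (%t. b i g t - (- nu i j) * b j g t)" for i
  proof
   fix t'
   have "comb ?n (%l. if g : act (Y ! i) (Y ! l) then nu i l else 0) (%l. b l g) t' = (\<Sum>l<?n. if l = j then nu i j * b j g t' else 0)"
    unfolding comb_def by (rule sum.cong) (use act in \<open>auto simp: nu_def\<close>)
   thus "b' i g t' = b i g t' - (- nu i j) * b j g t'" using jn by (simp add: b'_def)
  qed
  have dy: "dyadic (u j)" "dyadic w'"
  proof -
   have "dyadic_lift (lft (Y ! j))" using D(1) jn nth_mem rational_pts_iff by blast
   hence "dyadic_lift (turn (k j) (lft (Y ! j)))" by simp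
   thus "dyadic (u j)" using ku[OF j(1)] by (simp add: dyadic_lift_def del: dyadic_lift_turn)
   show "dyadic w'" using lifts_dyadic[OF lf] by (simp add: dyadic_lift_def)
  qed
  obtain z where z: "z : rational_pts" "lft z = (u j, w')" using point_with_lift[OF dy] ku[OF j(1)] order o1 o2 by auto
  have crj: "cr (lft (Y ! j)) = cr (u j, s + 2)" using ku[OF j(1)] cr_turn[of "k j" "lft (Y ! j)"] by simp
  have crz: "cr (lft z) = insert e (cr (lft (Y ! j)))"
   unfolding z(2) crj by (rule cr_extend_lower(1)[OF side_lifts(2,1,3) lf lf']) (use ku[OF j(1)] order o1 o2 in auto)
  have gj: "g : cr (lft (Y ! j))" and ej: "e \<notin> cr (lft (Y ! j))" and hj: "h \<notin> cr (lft (Y ! j))" using L[OF j(1)] by blast+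
  show ?thesis
  proof (rule lengthen[OF B' jn ej z(1) crz x1 j(1) A'x])
   fix i assume i: "i < ?n" "i ~= j" "g : cr (lft (Y ! i))" "e \<notin> cr (lft (Y ! i))"
   have "A (v, d) (b' i g) = (%t. A (v, d) (b i g) t - (- nu i j) * A (v, d) (b j g) t)"
    unfolding b'g by (rule A_sub) (use bV[OF i(1,3)] bV[OF jn gj] in simp_all)
   hence "lam (A (v, d) (b' i g)) = lam (A (v, d) (b i g)) - (- nu i j) * lam (A (v, d) (b j g))" by (simp only: lam_sub)
   hence "lam (A (v, d) (b' i g)) = L i - (- nu i j) * L j" using i gj ej jn by (simp add: L_def)
   thus "lam (A (v, d) (b' i g)) = 0" using i(2) j(1) by (simp add: nu_def)
  next
   have "A' (v, d) (b j g) = (%t. 0)" using D(3)[OF jn, of "(v, d)"] gj ej by simp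
   hence "A (v, d) (b j g) = (%t. lam (A (v, d) (b j g)) * x1 t)" by (simp add: A'_def fun_eq_iff)
   moreover have "lam (A (v, d) (b j g)) = L j" using jn gj ej by (simp add: L_def)
   moreover have "b' j g = b j g" unfolding b'g by (simp add: nu_def)
   ultimately show "A (v, d) (b' j g) = (%t. L j * x1 t)" by metis
  next
   show "A (v, clockwise d) (%t. L j * x1 t) = (if h : cr (lft (Y ! j)) then b' j h else (%t. 0))"
    using dB[OF coord_spaceD(3)[OF Vsp x1(1)]] hj by simp
  qed
 qed
qed

theorem leaf_step: "string_basis V' A' Y b ==> \<exists>Y b. string_basis V A Y b" using dich lengthen_source[of Y b] lengthen_target[of Y b] by blast

end

lemma ex_linear_form:
 fixes W :: "(nat => 'k::field) set"
 assumes W: "coord_space n W" and x: "x \<notin> W"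
 obtains lam where "!!p q. lam (%t. p t + q t) = lam p + lam q" "!!c p. lam (%t. c * p t) = c * lam p"
  "!!y. y : W ==> lam y = 0" "lam x = (1::'k)"
proof -
 obtain prj :: "(nat => 'k) => nat => 'k" where
  prj: "!!v w. prj (%i. v i + w i) = (%i. prj v i + prj w i)" "!!c v. prj (%i. c * v i) = (%i. c * prj v i)"
   "!!v. prj v = (%i. 0) \<longleftrightarrow> v : W" using ex_projection[OF W] by (elim exE conjE) metis
 have "prj x ~= (%i. 0)" using prj(3) x by simp
 then obtain i where i: "prj x i ~= 0" by blast
 show thesis
 proof (rule that[of "%v. prj v i / prj x i"])
  show "prj y i / prj x i = 0" if "y : W" for y using prj(3)[of y] that by simp
 qed (use i in \<open>simp_all add: prj(1,2) add_divide_distrib\<close>)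
qed

context list_encoding
begin

text \<open>
 Induction on the total dimension. The leaf is an edge of the support above a vertex of maximal
 depth; the linear form is chosen to vanish on the image of the incoming arrow or, if this arrow is onto,
 so that the outgoing arrow is zero.
\<close>

theorem ex_string_basis:
 fixes V :: "qvertex => (nat => 'k) set"
 assumes S: "finite S" "S \<subseteq> Q0"
 shows "coord_rep N V A ==> (!!e. e \<notin> S ==> V e = {%t. 0}) ==> \<exists>Y b. string_basis V A Y b"
proof (induction "\<Sum>e\<in>S. card (lead_pos (V e))" arbitrary: V A rule: less_induct)
 case less
 note R = less.prems(1)
 show ?case
 proof (cases "\<forall>e. V e = {%t. 0}")
  case True
  have "coords_at [] e = {%i. 0 :: 'k}" for e by (auto simp: coords_at_def)
  hence "string_basis V A [] (%i e t. 0)" using True by (simp add: string_basis_def comb_def bij_betw_def)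
  thus ?thesis by blast
 next
  case False
  define up where "up e = (SOME v. tedge v Up = e)" for e
  have up: "tedge (up e) Up = e" if "e : Q0" for e
   unfolding up_def using Q0_Up[OF that] by (metis (mono_tags, lifting) someI_ex)
  define P where "P = {e : S. V e ~= {%t. 0}}"
  have P: "finite P" "P ~= {}" using S(1) False less.prems(2) by (auto simp: P_def)
  define dep where "dep e = length (snd (up e))" for e
  have "Max (dep ` P) : dep ` P" using P by (intro Max_in) auto
  then obtain e0 where e0: "e0 : P" "dep e0 = Max (dep ` P)" by auto
  have max: "dep c <= dep e0" if "c : P" for c using that P e0(2) by simp
  define v0 where "v0 = up e0"
  have ev0: "tedge v0 Up = e0" using up e0(1) S(2) by (auto simp: v0_def P_def)
  have child: "V c = {%t. 0}" if "c = tedge (fst v0, b # snd v0) Up" for c b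
  proof (rule ccontr)
   assume "V c ~= {%t. 0}"
   hence c: "c : P" using less.prems(2)[of c] by (auto simp: P_def)
   have "tedge (up c) Up = tedge (fst v0, b # snd v0) Up" using up[of c] c S(2) that by (auto simp: P_def)
   hence "up c = (fst v0, b # snd v0)" unfolding tedge_Up_eq by auto
   thus False using max[OF c] by (simp add: dep_def v0_def)
  qed
  have children: "V c = {%t. 0}" if "c : {tedge v0 Right_Child, tedge v0 Left_Child}" for c
   using that child tedge_child[of "fst v0" "snd v0"] by auto
  obtain v d s t w w' f f' where al: "arrow_lift (v, d) s w t" and e: "tedge v (clockwise d) = tedge v0 Up"
   and lf: "(t, w') : lifts f" "(w', s + 2) : lifts f'" "t < w'" "w' < s + 2"
   and ff: "{f, f'} = {tedge v0 Right_Child, tedge v0 Left_Child}"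
   and arr: "!!a. src a = tedge v0 Up ==> a = (v, clockwise d) | tgt a : {f, f'}"
    "!!a. tgt a = tedge v0 Up ==> a = (v, d) | src a : {f, f'}" by (rule two_triangles[of v0], rule that)
  let ?e = "tedge v (clockwise d)" and ?g = "tedge v d"
  have Ve: "V ?e ~= {%t. 0}" using e0(1) unfolding e ev0 by (simp add: P_def)
  note Rd = coord_repD[OF R]
  have Ag: "A (v, d) z : V ?e" if "z : V ?g" for z using Rd(2)[of z "(v, d)"] that by simp
  have "\<exists>W. coord_space (N ?e) W & W \<subset> V ?e &
   ((\<forall>z\<in>V ?g. A (v, d) z : W) | (\<forall>y\<in>V ?e. A (v, clockwise d) y = (%t. 0)))"
  proof (cases "A (v, d) ` V ?g = V ?e")
   case True
   hence "\<forall>y\<in>V ?e. A (v, clockwise d) y = (%t. 0)" using Rd(5)[of _ v d] by (metis imageE)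
   moreover have "coord_space (N ?e) {%t. 0 :: 'k}" by (simp add: coord_space_def)
   moreover have "{%t. 0} \<subset> V ?e" using Ve coord_spaceD(1)[OF Rd(1)[of ?e]] by blast
   ultimately show ?thesis by blast
  next
   case False
   note G = coord_spaceD[OF Rd(1)[of ?g]]
   have "coord_space (N ?e) (A (v, d) ` V ?g)"
    unfolding coord_space_def
   proof (intro conjI ballI allI impI)
    have "A (v, d) (%t. 0 * 0) = (%t. 0 * A (v, d) (%t. 0) t)" by (rule Rd(4)) (use G(1) in simp)
    thus "(%i. 0) : A (v, d) ` V ?g" using G(1) by (intro image_eqI[of _ _ "%t. 0"]) simp_all
    fix y assume "y : A (v, d) ` V ?g"
    then obtain p where p: "y = A (v, d) p" "p : V ?g" by (rule imageE)
    show "(%i. c * y i) : A (v, d) ` V ?g" for c using Rd(4)[of p "(v, d)" c] p G(3)[of p c] by (intro image_eqI[of _ _ "%t. c * p t"]) simp_all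
    show "y i = 0" if "N ?e <= i" for i using coord_spaceD(4)[OF Rd(1) Ag[OF p(2)] that] p by simp
    fix y' assume "y' : A (v, d) ` V ?g"
    then obtain q where q: "y' = A (v, d) q" "q : V ?g" by (rule imageE)
    show "(%i. y i + y' i) : A (v, d) ` V ?g" using Rd(3)[of p "(v, d)" q] p q G(2)[of p q] by (intro image_eqI[of _ _ "%t. p t + q t"]) simp_all
   qed
   thus ?thesis using False Ag by blast
  qed
  then obtain W where W: "coord_space (N ?e) W" "W \<subset> V ?e"
   "(\<forall>z\<in>V ?g. A (v, d) z : W) | (\<forall>y\<in>V ?e. A (v, clockwise d) y = (%t. 0))" by (elim exE conjE)
  obtain x1 where x1: "x1 : V ?e" "x1 \<notin> W" using W(2) by blast
  obtain lam where lam: "!!p q. lam (%t. p t + q t) = lam p + lam q" "!!c p. lam (%t. c * p t) = c * lam p"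
   "!!y. y : W ==> lam y = 0" "lam x1 = 1" using ex_linear_form[OF W(1) x1(2)] by blast
  interpret leaf \<iota> N V A v d s t w w' f f' lam x1
  proof unfold_locales
   show "V c = {%t. 0}" if "c : {f, f'}" for c using children that unfolding ff by blast
   show "(\<forall>z\<in>V ?g. lam (A (v, d) z) = 0) | (\<forall>y\<in>V ?e. A (v, clockwise d) y = (%t. 0))" using W(3) lam(3) by blast
  qed (use R al lf arr e lam x1 in auto)
  have "(\<Sum>c\<in>S. card (lead_pos (V' c))) < (\<Sum>c\<in>S. card (lead_pos (V c)))"
  proof (rule sum_strict_mono_ex1[OF S(1)])
   have "x1 \<notin> V' ?e" using lam(4) by (simp add: V'_simps)
   hence "V' ?e \<subset> V ?e" using x1(1) V'_simps(3) by blast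
   hence lt: "card (lead_pos (V' ?e)) < card (lead_pos (V ?e))" using lead_pos_strict coord_repD(1)[OF rep'] Rd(1) by blast
   moreover have "?e : S" using e0(1) unfolding e ev0 by (simp add: P_def)
   ultimately show "\<exists>c\<in>S. card (lead_pos (V' c)) < card (lead_pos (V c))" by blast
   show "\<forall>c\<in>S. card (lead_pos (V' c)) <= card (lead_pos (V c))" using lt V'_simps(1) by (metis less_imp_le order_refl)
  qed
  moreover have "V' c = {%t. 0}" if "c \<notin> S" for c
   using V'_simps(3)[of c] less.prems(2)[OF that] coord_spaceD(1)[OF coord_repD(1)[OF rep', of c]] by blast
  ultimately have "\<exists>Y b. string_basis V' A' Y b" using less.hyps[OF _ rep'] by blast
  thus ?thesis using leaf_step by blast
 qed
qed

end

lemma FL_iso: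
 assumes M: "M : Obj FL" and N: "N : Obj FL" and f: "f : mor FL M N"
  and bij: "!!e. e : Q0 ==> bij_betw (f e) (sp M e) (sp N e)"
 shows "is_iso FL M N f"
proof -
 let ?i = "%e. inv_into (sp M e) (f e)"
 define k where "k = family N ?i"
 note LM = FL_Obj[OF M] and LN = FL_Obj[OF N]
 have i: "?i e y : sp M e" "f e (?i e y) = y" if "e : Q0" "y : sp N e" for e y
  using bij[OF that(1)] that(2) by (auto simp: bij_betw_def inv_into_into f_inv_into_f)
 have if': "?i e (f e x) = x" if "e : Q0" "x : sp M e" for e x using bij[OF that(1)] that(2) by (auto simp: bij_betw_def inv_into_f_f)
 have eq: "?i e y = x" if "e : Q0" "x : sp M e" "f e x = y" for e x y using if'[OF that(1,2)] that(3) by simp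
 have k: "k : mor FL N M"
  unfolding k_def
 proof (rule FL_morI[OF LN])
  fix e assume e: "e : Q0"
  note l = FL_lin[OF f e]
  show "?i e : lin_maps (space N e) (space M e)"
  proof (rule lin_mapsI)
   fix x assume x: "x : sp N e"
   show "?i e x : sp M e" by (rule i[OF e x])
   show "?i e (c *[space N e] x) = c *[space M e] ?i e x" for c
    by (rule eq[OF e vs_smult[OF LmodD(1)[OF LM e] i(1)[OF e x]]]) (simp add: lin_maps_smult[OF l i(1)[OF e x]] i[OF e x])
   fix y assume y: "y : sp N e"
   show "?i e (x +[space N e] y) = ?i e x +[space M e] ?i e y" by (rule eq[OF e vs_add[OF LmodD(1)[OF LM e] i(1)[OF e x] i(1)[OF e y]]])
     (simp add: lin_maps_add[OF l i(1)[OF e x] i(1)[OF e y]] i[OF e x] i[OF e y])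
  qed
 next
  fix a y assume y: "y : sp N (src a)"
  note iy = i[OF src_tgt_Q0(1) y]
  show "?i (tgt a) (amap N a y) = amap M a (?i (src a) y)"
   by (rule eq[OF src_tgt_Q0(2) lin_maps_closed[OF LmodD(2)[OF LM] iy(1)]]) (simp add: FL_nat[OF f iy(1)] iy)
 qed
 note C = klin_category.comp_mor[OF klin_category_FL] and I = klin_category.Ident_mor[OF klin_category_FL]
 have "Comp FL M N M k f = Ident FL M" by (rule FL_ext[OF C[OF M N M f k] I[OF M]])
   (simp add: FL_comp_apply FL_simps(4) k_def FL_closed[OF f] if')
 moreover have "Comp FL N M N f k = Ident FL N" by (rule FL_ext[OF C[OF N M N k f] I[OF N]])
   (simp add: FL_comp_apply FL_simps(4) k_def i)
 ultimately show ?thesis unfolding is_iso_def using f k by blast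
qed

context list_encoding
begin

theorem string_rep_dense:
 fixes M :: "('k, 'u) quiver_rep"
 assumes M: "M : Obj FL"
 shows "\<exists>Y. set Y \<subseteq> rational_pts & isomorphic_in FL (strep Y) M"
proof -
 have LM: "is_Lambda_module M" and fd: "fin_dim M" using M FL_Obj_iff by blast+
 let ?C = "%e. sp M e"
 have "\<forall>e. \<exists>ph n. e : Q0 --> chart (space M e) ph n" using fd unfolding fin_dim_def by blast
 then obtain ph N where ch: "!!e. e : Q0 ==> chart (space M e) (ph e) (N e)" by metis
 obtain S0 where S0: "finite S0" "!!e. e : Q0 - S0 ==> ?C e = {(zero (space M e))}" using fd unfolding fin_dim_def by blast
 define S where "S = S0 \<inter> Q0"
 note vs = LmodD(1)[OF LM]
 have inj: "inj_on (ph e) (?C e)" and ad: "!!x y. x : ?C e ==> y : ?C e ==> ph e (x +[space M e] y) = (%i. ph e x i + ph e y i)"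
  and sm: "!!c x. x : ?C e ==> ph e (c *[space M e] x) = (%i. c * ph e x i)" if "e : Q0" for e using ch[OF that] unfolding chart_def by blast+
 define ps where "ps e = inv_into (?C e) (ph e)" for e
 have ps: "ps e (ph e x) = x" if "e : Q0" "x : ?C e" for e x unfolding ps_def by (rule inv_into_f_f[OF inj[OF that(1)] that(2)])
 define V where "V e = (if e : Q0 then ph e ` ?C e else {%t. 0})" for e
 define A where "A a y = ph (tgt a) (amap M a (ps (src a) y))" for a y
 have V: "V e = ph e ` ?C e" if "e : Q0" for e using that by (simp add: V_def)
 have psV: "ps e y : ?C e" "ph e (ps e y) = y" if "e : Q0" "y : V e" for e y
  using that(2) unfolding V[OF that(1)] ps_def by (auto intro: inv_into_into f_inv_into_f)
 have A: "A a (ph (src a) x) = ph (tgt a) (amap M a x)" if "x : ?C (src a)" for a x using ps[OF src_tgt_Q0(1) that] by (simp add: A_def)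
 have am: "amap M a x : ?C (tgt a)" if "x : ?C (src a)" for a x by (rule lin_maps_closed[OF LmodD(2)[OF LM] that])
 have R: "coord_rep N V A"
  unfolding coord_rep_def
 proof (intro conjI allI ballI)
  show "coord_space (N e) (V e)" for e
  proof (cases "e : Q0")
   case True
   show ?thesis unfolding V[OF True] by (rule chart_coord_space[OF vs[OF True] ch[OF True] carrier_linear_subset(1)[OF vs[OF True]]])
  qed (simp add: V_def coord_space_def)
  fix a y assume "y : V (src a)"
  then obtain x where x: "y = ph (src a) x" "x : ?C (src a)" unfolding V[OF src_tgt_Q0(1)] by (rule imageE)
  show "A a y : V (tgt a)" unfolding x(1) A[OF x(2)] V[OF src_tgt_Q0(2)] by (rule imageI[OF am[OF x(2)]])
  show "A a (%t. c * y t) = (%t. c * A a y t)" for c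
   unfolding x(1) sm[OF src_tgt_Q0(1) x(2), symmetric] A[OF x(2)] A[OF vs_smult[OF vs[OF src_tgt_Q0(1)] x(2)]]
    lin_maps_smult[OF LmodD(2)[OF LM] x(2)] sm[OF src_tgt_Q0(2) am[OF x(2)]] ..
  fix y' assume "y' : V (src a)"
  then obtain x' where x': "y' = ph (src a) x'" "x' : ?C (src a)" unfolding V[OF src_tgt_Q0(1)] by (rule imageE)
  show "A a (%t. y t + y' t) = (%t. A a y t + A a y' t)"
   unfolding x(1) x'(1) ad[OF src_tgt_Q0(1) x(2) x'(2), symmetric] A[OF x(2)] A[OF x'(2)] A[OF vs_add[OF vs[OF src_tgt_Q0(1)] x(2) x'(2)]]
    lin_maps_add[OF LmodD(2)[OF LM] x(2) x'(2)] ad[OF src_tgt_Q0(2) am[OF x(2)] am[OF x'(2)]] ..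
 next
  fix v d y assume "y : V (tedge v d)"
  then obtain x where x: "y = ph (tedge v d) x" "x : ?C (tedge v d)" unfolding V[OF tedge_Q0] by (rule imageE)
  have 1: "A (v, d) y = ph (tgt (v, d)) (amap M (v, d) x)" using A[of x "(v, d)"] x by simp
  have 2: "amap M (v, d) x : ?C (src (v, clockwise d))" using am[of x "(v, d)"] x by simp
  have "A (v, clockwise d) (A (v, d) y) = ph (tgt (v, clockwise d)) (amap M (v, clockwise d) (amap M (v, d) x))" using A[OF 2] unfolding 1 by simp
  also have "\<dots> = (%t. 0)"
   using LmodD(3)[OF LM, of x v d] x(2) chart_zero[OF vs ch, OF src_tgt_Q0(2) src_tgt_Q0(2), of "(v, clockwise d)"] by simp
  finally show "A (v, clockwise d) (A (v, d) y) = (%t. 0)" .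
 qed
 have Sz: "V e = {%t. 0}" if "e \<notin> S" for e
 proof (cases "e : Q0")
  case True
  thus ?thesis using S0(2)[of e] that chart_zero[OF vs ch, OF True True] by (simp add: V_def S_def)
 qed (simp add: V_def)
 have "\<exists>Y b. string_basis V A Y b" by (rule ex_string_basis[of S, OF _ _ R Sz]) (use S0(1) in \<open>auto simp: S_def\<close>)
 then obtain Y b where B: "string_basis V A Y b" by blast
 note D = string_basisD[OF B]
 let ?n = "length Y"
 let ?C' = "%e. sp (strep Y) e"
 define Ph where "Ph e x = comb ?n (coord x) (%i. b i e)" for e x
 define H where "H = family (strep Y) (%e x. ps e (Ph e x))"
 have cc: "bij_betw coord (?C' e) (coords_at Y e)" for e by (rule bij_betw_byWitness[where f' = "vec ?n"]) (auto simp: coord_vec_at)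
 have Ph: "bij_betw (Ph e) (?C' e) (V e)" if "e : Q0" for e using bij_betw_trans[OF cc D(4)[OF that]] by (simp add: Ph_def[abs_def] comp_def)
 have PhV: "Ph e x : V e" if "e : Q0" "x : ?C' e" for e x using bij_betwE[OF Ph[OF that(1)]] that(2) by blast
 have H: "H : mor FL (strep Y) M"
  unfolding H_def
 proof (rule FL_morI[OF string_Lambda_module])
  fix e assume e: "e : Q0"
  show "(%x. ps e (Ph e x)) : lin_maps (space (strep Y) e) (space M e)"
  proof (rule lin_mapsI)
   fix x assume x: "x : ?C' e"
   note px = psV[OF e PhV[OF e x]]
   show "ps e (Ph e x) : ?C e" by (rule px)
   show "ps e (Ph e (c *[space (strep Y) e] x)) = c *[space M e] ps e (Ph e x)" for c
   proof -
    have "Ph e (c *[space (strep Y) e] x) = (%t. c * Ph e x t)"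
     unfolding Ph_def comb_def string_rep_simps sum_distrib_left by (intro ext sum.cong) (auto simp: coord_vec)
    also have "\<dots> = ph e (c *[space M e] ps e (Ph e x))" unfolding sm[OF e px(1)] px(2) ..
    finally show ?thesis using ps[OF e vs_smult[OF vs[OF e] px(1)]] by simp
   qed
   fix y assume y: "y : ?C' e"
   note py = psV[OF e PhV[OF e y]]
   have "Ph e (x +[space (strep Y) e] y) = (%t. Ph e x t + Ph e y t)"
    unfolding Ph_def comb_def string_rep_simps sum.distrib[symmetric] by (intro ext sum.cong) (auto simp: coord_vec distrib_right)
   also have "\<dots> = ph e (ps e (Ph e x) +[space M e] ps e (Ph e y))" unfolding ad[OF e px(1) py(1)] px(2) py(2) ..
   finally show "ps e (Ph e (x +[space (strep Y) e] y)) = ps e (Ph e x) +[space M e] ps e (Ph e y)"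
    using ps[OF e vs_add[OF vs[OF e] px(1) py(1)]] by simp
  qed
 next
  fix a x assume x: "x : ?C' (src a)"
  note px = psV[OF src_tgt_Q0(1) PhV[OF src_tgt_Q0(1) x]]
  have cx: "coord x : coords_at Y (src a)" using x by (simp add: carrier_string)
  have "ph (tgt a) (amap M a (ps (src a) (Ph (src a) x))) = A a (comb ?n (coord x) (%i. b i (src a)))" by (simp add: A_def Ph_def)
  also have "\<dots> = comb ?n (coord x) (%i. A a (b i (src a)))" by (rule coord_rep_comb[OF R]) (use coords_atD[OF cx] D(2) in blast)
  also have "\<dots> = Ph (tgt a) (amap (strep Y) a x)"
   unfolding Ph_def comb_def
  proof (intro ext sum.cong refl)
   fix t i assume "i : {..<?n}"
   thus "coord x i * A a (b i (src a)) t = coord (amap (strep Y) a x) i * b i (tgt a) t"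
    using coords_atD[OF cx, of i] D(3)[of i a] by (cases "coord x i = 0") (auto simp: coord_vec)
  qed
  finally show "ps (tgt a) (Ph (tgt a) (amap (strep Y) a x)) = amap M a (ps (src a) (Ph (src a) x))" using ps[OF src_tgt_Q0(2) am[OF px(1)]] by simp
 qed
 have "is_iso FL (strep Y) M H"
 proof (rule FL_iso[OF string_rep_Obj[OF D(1)] M H])
  fix e assume e: "e : Q0"
  have "bij_betw (ps e) (V e) (?C e)"
   unfolding V[OF e] ps_def by (rule bij_betw_inv_into[OF inj_on_imp_bij_betw[OF inj[OF e]]])
  from bij_betw_trans[OF Ph[OF e] this] show "bij_betw (H e) (?C' e) (?C e)"
   by (rule bij_betw_cong[THEN iffD1, rotated]) (simp add: H_def e del: string_rep_simps)
 qed
 thus ?thesis unfolding isomorphic_in_def using D(1) by blast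
qed

end

section \<open>The equivalence\<close>

context list_encoding
begin

lemma string_rep_zero: "is_zero_obj FL (strep [] :: ('k, 'u) quiver_rep)"
 unfolding is_zero_obj_def
proof (intro conjI ballI)
 note Z = string_rep_Obj[of "[]", simplified]
 show "(strep [] :: ('k, 'u) quiver_rep) : Obj FL" by (rule Z)
 have t: "sp (strep []) e = {(zero (space (strep []) e))}" for e by (rule string_rep_trivial) simp
 fix M :: "('k, 'u) quiver_rep" assume M: "M : Obj FL"
 note LM = FL_Obj[OF M] and LZ = FL_Obj[OF Z]
 show "\<exists>!f. f : mor FL M (strep [])"
 proof (rule ex_ex1I)
  show "\<exists>f. f : mor FL M (strep [])" using FL_zero_mor[OF LM LZ] by blast
  fix f f' assume f: "f : mor FL M (strep [])" and f': "f' : mor FL M (strep [])"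
  show "f = f'"
  proof (rule FL_ext[OF f f'])
   fix e x assume "e : Q0" "x : sp M e"
   thus "f e x = f' e x" using FL_closed[OF f, of e x] FL_closed[OF f', of e x] unfolding t by simp
  qed
 qed
 show "\<exists>!f. f : mor FL (strep []) M"
 proof (rule ex_ex1I)
  show "\<exists>f. f : mor FL (strep []) M" using FL_zero_mor[OF LZ LM] by blast
  fix f f' assume f: "f : mor FL (strep []) M" and f': "f' : mor FL (strep []) M"
  show "f = f'"
  proof (rule FL_ext[OF f f'])
   fix e x assume e: "e : Q0" and "x : sp (strep []) e"
   hence x: "x = (zero (space (strep []) e))" using t by blast
   show "f e x = f' e x" unfolding x
    using lin_maps_zero[OF string_vs LmodD(1)[OF LM e] FL_lin[OF f e]] lin_maps_zero[OF string_vs LmodD(1)[OF LM e] FL_lin[OF f' e]] by simp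
  qed
 qed
qed

lemma string_rep_biproduct:
 assumes X: "set X \<subseteq> rational_pts" and Y: "set Y \<subseteq> rational_pts"
 shows "\<exists>i j p q. is_biproduct FL (strep X) (strep Y) (strep (X @ Y)) i j p q"
proof -
 let ?m = "length X" and ?n = "length Y" and ?S = "strep (X @ Y)"
 have XY: "set (X @ Y) \<subseteq> rational_pts" using X Y by simp
 define i where "i = family (strep X) (%e x. vec (?m + ?n) (%k. if k < ?m then coord x k else 0))"
 define j where "j = family (strep Y) (%e x. vec (?m + ?n) (%k. if k < ?m then 0 else coord x (k - ?m)))"
 define p where "p = family ?S (%e x. vec ?m (coord x))"
 define q where "q = family ?S (%e x. vec ?n (%k. coord x (?m + k)))"
 have im: "x : sp (strep Z) e" if "x = vec (length Z) f" "!!k. k < length Z ==> f k ~= 0 ==> e : cr (lft (Z ! k))" for x Z f e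
 proof -
  have "(%k. if k < length Z then f k else 0) : coords_at Z e" using that(2) by (auto simp: coords_at_def)
  hence "vec (length Z) (%k. if k < length Z then f k else 0) : sp (strep Z) e" by simp
  thus ?thesis unfolding vec_restrict that(1) .
 qed
 have cr: "coord x k ~= 0 ==> k < length Z & e : cr (lft (Z ! k))" if "x : sp (strep Z) e" for x k Z e
  using that coords_atD[of "coord x" Z e k] carrier_string[of x Z e] by simp
 have i: "i : mor FL (strep X) ?S"
  unfolding i_def
 proof (rule FL_morI[OF string_Lambda_module])
  show "(%x. vec (?m + ?n) (%k. if k < ?m then coord x k else 0)) : lin_maps (space (strep X) e) (space ?S e)" for e
  proof (rule lin_mapsI)
   show "vec (?m + ?n) (%k. if k < ?m then coord x k else 0) : sp ?S e" if "x : sp (strep X) e" for x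
    by (rule im) (use cr[OF that] in \<open>auto simp: nth_append split: if_splits\<close>)
  qed (unfold string_rep_simps length_append, (rule vec_cong, simp add: coord_vec)+)
 qed (unfold string_rep_simps length_append, rule vec_cong, simp add: coord_vec nth_append)
 have j: "j : mor FL (strep Y) ?S"
  unfolding j_def
 proof (rule FL_morI[OF string_Lambda_module])
  show "(%x. vec (?m + ?n) (%k. if k < ?m then 0 else coord x (k - ?m))) : lin_maps (space (strep Y) e) (space ?S e)" for e
  proof (rule lin_mapsI)
   show "vec (?m + ?n) (%k. if k < ?m then 0 else coord x (k - ?m)) : sp ?S e" if "x : sp (strep Y) e" for x
    by (rule im) (use cr[OF that] in \<open>auto simp: nth_append split: if_splits\<close>)
  qed (unfold string_rep_simps length_append, (rule vec_cong, simp add: coord_vec, linarith?)+)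
 qed (unfold string_rep_simps length_append, rule vec_cong, auto simp: coord_vec nth_append)
 have p: "p : mor FL ?S (strep X)"
  unfolding p_def
 proof (rule FL_morI[OF string_Lambda_module])
  show "(%x. vec ?m (coord x)) : lin_maps (space ?S e) (space (strep X) e)" for e
  proof (rule lin_mapsI)
   show "vec ?m (coord x) : sp (strep X) e" if "x : sp ?S e" for x
    by (rule im[OF refl]) (use cr[OF that] in \<open>fastforce simp: nth_append\<close>)
  qed (unfold string_rep_simps length_append, (rule vec_cong, simp add: coord_vec)+)
 qed (unfold string_rep_simps length_append, rule vec_cong, simp add: coord_vec nth_append)
 have q: "q : mor FL ?S (strep Y)"
  unfolding q_def
 proof (rule FL_morI[OF string_Lambda_module])
  show "(%x. vec ?n (%k. coord x (?m + k))) : lin_maps (space ?S e) (space (strep Y) e)" for e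
  proof (rule lin_mapsI)
   show "vec ?n (%k. coord x (?m + k)) : sp (strep Y) e" if "x : sp ?S e" for x
    by (rule im[OF refl]) (use cr[OF that, of "?m + _"] in \<open>force simp: nth_append\<close>)
  qed (unfold string_rep_simps length_append, (rule vec_cong, simp add: coord_vec)+)
 qed (unfold string_rep_simps length_append, rule vec_cong, simp add: coord_vec nth_append)
 have app: "i e x = vec (?m + ?n) (%k. if k < ?m then coord x k else 0)" if "e : Q0" "x : sp (strep X) e" for e x
  unfolding i_def by (rule family_apply[OF that])
 have bpp: "j e x = vec (?m + ?n) (%k. if k < ?m then 0 else coord x (k - ?m))" if "e : Q0" "x : sp (strep Y) e" for e x
  unfolding j_def by (rule family_apply[OF that])
 have cpp: "p e x = vec ?m (coord x)" "q e x = vec ?n (%k. coord x (?m + k))" if "e : Q0" "x : sp ?S e" for e x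
  unfolding p_def q_def by (rule family_apply[OF that])+
 note OX = string_rep_Obj[OF X] and OY = string_rep_Obj[OF Y] and OS = string_rep_Obj[OF XY]
 note C = F.T.comp_mor and I = F.T.Ident_mor
 have v: "vec (length Z) (coord x) = x" if "x : sp (strep Z) e" for x Z e using that carrier_string[of x Z e] by simp
 have id: "Ident FL (strep Z) e x = x" if "e : Q0" "x : sp (strep Z) e" for Z e x
  unfolding FL_simps(4) by (rule family_apply[OF that])
 have pi: "Comp FL (strep X) ?S (strep X) p i = Ident FL (strep X)"
 proof (rule FL_ext[OF C[OF OX OS OX i p] I[OF OX]])
  fix e x assume e: "e : Q0" and x: "x : sp (strep X) e"
  have "p e (i e x) = vec ?m (coord x)" unfolding cpp(1)[OF e FL_closed[OF i e x]] unfolding app[OF e x] by (rule vec_cong) (simp add: coord_vec)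
  thus "Comp FL (strep X) ?S (strep X) p i e x = Ident FL (strep X) e x"
   unfolding FL_comp_apply[OF e x] id[OF e x] v[OF x] .
 qed
 have qj: "Comp FL (strep Y) ?S (strep Y) q j = Ident FL (strep Y)"
 proof (rule FL_ext[OF C[OF OY OS OY j q] I[OF OY]])
  fix e x assume e: "e : Q0" and x: "x : sp (strep Y) e"
  have "q e (j e x) = vec ?n (coord x)" unfolding cpp(2)[OF e FL_closed[OF j e x]] unfolding bpp[OF e x] by (rule vec_cong) (simp add: coord_vec)
  thus "Comp FL (strep Y) ?S (strep Y) q j e x = Ident FL (strep Y) e x"
   unfolding FL_comp_apply[OF e x] id[OF e x] v[OF x] .
 qed
 have qi: "Comp FL (strep X) ?S (strep Y) q i = (zero (Hom FL (strep X) (strep Y)))"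
 proof (rule FL_ext[OF C[OF OX OS OY i q] F.T.zero_mor[OF OX OY]])
  fix e x assume e: "e : Q0" and x: "x : sp (strep X) e"
  have "q e (i e x) = vec ?n (%k. 0)" unfolding cpp(2)[OF e FL_closed[OF i e x]] unfolding app[OF e x] by (rule vec_cong) (simp add: coord_vec)
  thus "Comp FL (strep X) ?S (strep Y) q i e x = (zero (Hom FL (strep X) (strep Y))) e x"
   unfolding FL_comp_apply[OF e x] FL_zero_apply[OF e x] string_rep_simps .
 qed
 have pj: "Comp FL (strep Y) ?S (strep X) p j = (zero (Hom FL (strep Y) (strep X)))"
 proof (rule FL_ext[OF C[OF OY OS OX j p] F.T.zero_mor[OF OY OX]])
  fix e x assume e: "e : Q0" and x: "x : sp (strep Y) e"
  have "p e (j e x) = vec ?m (%k. 0)" unfolding cpp(1)[OF e FL_closed[OF j e x]] unfolding bpp[OF e x] by (rule vec_cong) (simp add: coord_vec)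
  thus "Comp FL (strep Y) ?S (strep X) p j e x = (zero (Hom FL (strep Y) (strep X))) e x"
   unfolding FL_comp_apply[OF e x] FL_zero_apply[OF e x] string_rep_simps .
 qed
 have sum: "Comp FL ?S (strep X) ?S i p +[Hom FL ?S ?S] Comp FL ?S (strep Y) ?S j q = Ident FL ?S"
 proof (rule FL_ext[OF vs_add[OF F.T.Hom_module[OF OS OS] C[OF OS OX OS p i] C[OF OS OY OS q j]] I[OF OS]])
  fix e x assume e: "e : Q0" and x: "x : sp ?S e"
  have "i e (p e x) +[space ?S e] j e (q e x) = vec (length (X @ Y)) (coord x)"
   unfolding app[OF e FL_closed[OF p e x]] bpp[OF e FL_closed[OF q e x]] unfolding cpp[OF e x] string_rep_simps length_append
   by (rule vec_cong) (auto simp: coord_vec)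
  thus "(Comp FL ?S (strep X) ?S i p +[Hom FL ?S ?S] Comp FL ?S (strep Y) ?S j q) e x = Ident FL ?S e x"
   unfolding FL_simps(2) family_apply[OF e x] FL_comp_apply[OF e x] id[OF e x] v[OF x] .
 qed
 show ?thesis unfolding is_biproduct_def using OS i j p q pi qj qi pj sum by blast
qed

end

theorem theorem3p1p4:
  fixes \<iota> :: "'k::field list \<Rightarrow> 'u"
  assumes "inj \<iota>"
  shows "abelian_category (cat_X_mod_T :: ('k, dpoint list, (int \<Rightarrow> 'k mat set) set) klin_cat) \<and>
    klin_equivalent
      (cat_X_mod_T :: ('k, dpoint list, (int \<Rightarrow> 'k mat set) set) klin_cat)
      (fl_mod_Lambda :: ('k, ('k, 'u) quiver_rep, qvertex \<Rightarrow> 'u \<Rightarrow> 'u) klin_cat)"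
proof -
 interpret list_encoding \<iota> by unfold_locales (rule assms)
 let ?G = "\<lparr>FObj = FObj string_functor, FMap = (%X Y A. FMap string_functor X Y (SOME f. f : A))\<rparr>"
 have ff: "ff_functor cat_X_mod_T FL ?G"
  unfolding cat_X_mod_T_def by (rule ff_functor_quotient(2)[OF F.klin_functor_axioms string_functor_full cluster_factoring])
 have "ess_surj cat_X_mod_T FL ?G"
  unfolding ess_surj_def
 proof
  fix M :: "('k, 'u) quiver_rep" assume "M : Obj FL"
  from string_rep_dense[OF this] obtain Y where "set Y \<subseteq> rational_pts" "isomorphic_in FL (strep Y) M" by blast
  thus "\<exists>X\<in>Obj (cat_X_mod_T :: ('k, dpoint list, (int => 'k mat set) set) klin_cat). isomorphic_in FL (FObj ?G X) M"
   by (intro bexI[of _ Y]) (simp_all add: cat_X_mod_T_def quotient_cat_def cat_X_simps)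
 qed
 from equivalence_functorI[OF ff this] interpret G: equivalence_functor cat_X_mod_T FL ?G .
 have "abelian_category (cat_X_mod_T :: ('k, dpoint list, (int => 'k mat set) set) klin_cat)"
 proof (rule G.abelian_transport[of "[]"])
  have obj: "Obj cat_X_mod_T = {X. set X \<subseteq> rational_pts}" by (simp add: cat_X_mod_T_def quotient_cat_def cat_X_simps)
  show "[] : Obj cat_X_mod_T" by (simp add: obj)
  show "is_zero_obj FL (FObj ?G [])" using string_rep_zero by simp
  show "\<exists>V\<in>Obj cat_X_mod_T. \<exists>i j p q. is_biproduct FL (FObj ?G X) (FObj ?G Y) (FObj ?G V) i j p q"
   if "X : Obj cat_X_mod_T" "Y : Obj cat_X_mod_T" for X Y
   using that string_rep_biproduct[of X Y] unfolding obj by (intro bexI[of _ "X @ Y"]) simp_all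
  fix M N :: "('k, 'u) quiver_rep" and f assume M: "M : Obj FL" and N: "N : Obj FL"
  show "\<exists>A i. is_kernel FL M N f A i" if "f : mor FL M N" using FL_kernel[OF M N that] by blast
  show "\<exists>B p. is_cokernel FL M N f B p" if "f : mor FL M N" by (rule FL_cokernel[OF M N that]) blast
  show "\<exists>Z\<in>Obj FL. \<exists>g\<in>mor FL N Z. is_kernel FL N Z g M f" if "is_mono FL M N f" by (rule FL_mono_normal[OF M N that])
  show "\<exists>Z\<in>Obj FL. \<exists>g\<in>mor FL Z M. is_cokernel FL Z M g N f" if "is_epi FL M N f" by (rule FL_epi_normal[OF M N that])
 qed
 thus ?thesis using G.equivalence by blast
qed

end
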